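(* Let $R$ be a Gorenstein ring. If $M=0\to M_n\to M_{n-1}\to\cdots\to M_1\to M_0\to 0$ is a bounded complex of $R$-modules (with $M_i$ in degree $i$), then $\overline{\mathrm{Ext}}^{\,j}(M,N)\simeq\widehat{\mathrm{Ext}}^{\,j}(M,N)$ for all $j>n$ and every $R$-module $N$ (regarded as a complex concentrated in degree $0$).
   Context: A ring is Gorenstein if it is left and right noetherian and has finite self-injective dimension on both sides. "$R$-module" means left $R$-module. Complexes are chain complexes. For complexes $X,Y$, $\mathcal{H}om(X,Y)$ is the complex with $\mathcal{H}om(X,Y)_n=\prod_{q=p+n}\mathrm{Hom}_R(X_p,Y_q)$ and $\partial(f)=\partial^Y f-(-1)^n f\partial^X$ for $f$ of degree $n$; $H^n\mathcal{H}om(X,Y)=H_{-n}\mathcal{H}om(X,Y)$. $\mathrm{Hom}(X,Y)$ is the group of maps of complexes from $X$ to $Y$. A complex $P$ is DG-projective if each $P_n$ is projective and $\mathcal{H}om(P,E)$ is exact for every exact complex $E$; a DG-projective resolution of $M$ is a quasi-isomorphism $P\to M$ with $P$ DG-projective. A complex is projective if it is exact with all terms and all kernels of differentials projective modules. A complex has finite projective dimension if it has a finite resolution (exact sequence of complexes) by projective complexes. A complex $G$ is Gorenstein projective if there is an exact sequence of complexes $\cdots\to Q_1\to Q_0\to Q_{-1}\to\cdots$ with each $Q_i$ a projective complex, which stays exact under $\mathrm{Hom}(-,Q)$ for every projective complex $Q$, with $G=\mathrm{Ker}(Q_0\to Q_{-1})$. A Gorenstein projective precover of $M$ is a map of complexes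 $\phi: G\to M$ with $G$ Gorenstein projective such that $\mathrm{Hom}(G',G)\to\mathrm{Hom}(G',M)$ is surjective for every Gorenstein projective complex $G'$; it is special if $\mathrm{Ker}\,\phi$ has finite projective dimension. Over a Gorenstein ring every complex has a special Gorenstein projective precover. Generalized Tate cohomology: let $P\to M$ be a surjective DG-projective resolution, $G\to M$ a special Gorenstein projective precover, and $u:P\to G$ a map of complexes over $M$ (induced by $1_M$). Let $M(u)$ be the mapping cone, $M(u)_n=G_n\oplus P_{n-1}$ with differential $(x,y)\mapsto(\partial^G x+u(y),-\partial^P y)$. Then $\overline{\mathrm{Ext}}^{\,j}(M,N)=H^{j+1}\mathcal{H}om(M(u),N)$; this is independent of choices up to isomorphism. Tate cohomology (Veliche): a complete resolution of $M$ is a diagram $T\xrightarrow{v}P\to M$ with $P\to M$ a DG-projective resolution, $T$ an exact complex of projective modules that stays exact under $\mathrm{Hom}_R(-,Q)$ for every projective module $Q$, and $v$ a map of complexes with $v_i$ bijective for $i\gg0$. For $M$ admitting a complete resolution, $\widehat{\mathrm{Ext}}^{\,j}(M,N)=H^j\mathcal{H}om(T,N)$, which is independent of the chosen complete resolution. *)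

theory Defs
  imports "HOL-Algebra.Module" "HOL-Algebra.AbelCoset" "HOL-Library.Equipollence"
begin

section \<open>Left modules over a not necessarily commutative ring\<close>

text \<open>
  The record of HOL-Algebra modules is reused; only the locale there requires the
  base ring to be commutative.  The fields for multiplication and unit of a module
  record carry no information.

  All modules that are quantified over inside a definition below live on one type
  \<open>'m\<close>, which serves as the universe.  If \<open>'m\<close> is infinite and the
  ring embeds into it, the modules on \<open>'m\<close> are, up to isomorphism, exactly those
  of cardinality at most that of \<open>'m\<close>; they are closed under submodules, quotients
  and direct sums of at most that many summands.  Over a Gorenstein ring testing the notions below
  against these modules (resp. complexes of them) is the same as testing against all
  modules (resp. complexes).
\<close>

locale left_module = R?: ring + M?: abelian_group M for M (structure) +
  assumes smult_closed [simp, intro]: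
      "\<lbrakk>a \<in> carrier R; x \<in> carrier M\<rbrakk> \<Longrightarrow> a \<odot>\<^bsub>M\<^esub> x \<in> carrier M"
    and smult_add_left:
      "\<lbrakk>a \<in> carrier R; b \<in> carrier R; x \<in> carrier M\<rbrakk> \<Longrightarrow>
        (a \<oplus> b) \<odot>\<^bsub>M\<^esub> x = a \<odot>\<^bsub>M\<^esub> x \<oplus>\<^bsub>M\<^esub> b \<odot>\<^bsub>M\<^esub> x"
    and smult_add_right:
      "\<lbrakk>a \<in> carrier R; x \<in> carrier M; y \<in> carrier M\<rbrakk> \<Longrightarrow>
        a \<odot>\<^bsub>M\<^esub> (x \<oplus>\<^bsub>M\<^esub> y) = a \<odot>\<^bsub>M\<^esub> x \<oplus>\<^bsub>M\<^esub> a \<odot>\<^bsub>M\<^esub> y"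
    and smult_mult:
      "\<lbrakk>a \<in> carrier R; b \<in> carrier R; x \<in> carrier M\<rbrakk> \<Longrightarrow>
        (a \<otimes> b) \<odot>\<^bsub>M\<^esub> x = a \<odot>\<^bsub>M\<^esub> (b \<odot>\<^bsub>M\<^esub> x)"
    and smult_unit [simp]:
      "x \<in> carrier M \<Longrightarrow> \<one> \<odot>\<^bsub>M\<^esub> x = x"

text \<open>
  Homomorphisms are extensional (undefined outside the carrier), so that equality of
  functions is equality of homomorphisms.
\<close>

definition lmod_hom ::
  "('r, 'x) ring_scheme \<Rightarrow> ('r, 'a) module \<Rightarrow> ('r, 'b) module \<Rightarrow> ('a \<Rightarrow> 'b) set" where
  "lmod_hom R A B =
    {f \<in> hom (add_monoid A) (add_monoid B) \<inter> extensional (carrier A).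
      \<forall>a\<in>carrier R. \<forall>x\<in>carrier A. f (a \<odot>\<^bsub>A\<^esub> x) = a \<odot>\<^bsub>B\<^esub> f x}"

definition zero_hom :: "('r, 'a) module \<Rightarrow> ('r, 'b) module \<Rightarrow> 'a \<Rightarrow> 'b" where
  "zero_hom A B = (\<lambda>x\<in>carrier A. \<zero>\<^bsub>B\<^esub>)"

definition zero_lmodule :: "('r, 'm) module \<Rightarrow> bool" where
  "zero_lmodule A \<longleftrightarrow> carrier A = {\<zero>\<^bsub>A\<^esub>}"

definition direct_sum :: "('r, 'a) module \<Rightarrow> ('r, 'b) module \<Rightarrow> ('r, 'a \<times> 'b) module" where
  "direct_sum A B =
    \<lparr>carrier = carrier A \<times> carrier B,
     mult = (\<lambda>x y. (fst x \<otimes>\<^bsub>A\<^esub> fst y, snd x \<otimes>\<^bsub>B\<^esub> snd y)),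
     one = (\<one>\<^bsub>A\<^esub>, \<one>\<^bsub>B\<^esub>),
     zero = (\<zero>\<^bsub>A\<^esub>, \<zero>\<^bsub>B\<^esub>),
     add = (\<lambda>x y. (fst x \<oplus>\<^bsub>A\<^esub> fst y, snd x \<oplus>\<^bsub>B\<^esub> snd y)),
     smult = (\<lambda>a x. (a \<odot>\<^bsub>A\<^esub> fst x, a \<odot>\<^bsub>B\<^esub> snd x))\<rparr>"

definition projective_lmodule ::
  "('r, 'x) ring_scheme \<Rightarrow> ('r, 'm) module \<Rightarrow> bool" where
  "projective_lmodule R P \<longleftrightarrow> left_module R P \<and>
    (\<forall>(A :: ('r, 'm) module) (B :: ('r, 'm) module) g f.
      left_module R A \<and> left_module R B \<and>
      g \<in> lmod_hom R A B \<and> g ` carrier A = carrier B \<and> f \<in> lmod_hom R P B \<longrightarrow>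
      (\<exists>h\<in>lmod_hom R P A. compose (carrier P) g h = f))"

definition injective_lmodule ::
  "('r, 'x) ring_scheme \<Rightarrow> ('r, 'm) module \<Rightarrow> bool" where
  "injective_lmodule R I \<longleftrightarrow> left_module R I \<and>
    (\<forall>(A :: ('r, 'm) module) (B :: ('r, 'm) module) g f.
      left_module R A \<and> left_module R B \<and>
      g \<in> lmod_hom R A B \<and> inj_on g (carrier A) \<and> f \<in> lmod_hom R A I \<longrightarrow>
      (\<exists>h\<in>lmod_hom R B I. compose (carrier A) h g = f))"

text \<open>A finite injective resolution \<open>0 \<rightarrow> A \<rightarrow> I 0 \<rightarrow> \<dots> \<rightarrow> I d \<rightarrow> 0\<close> by modules on the type
  \<open>'m\<close>; the module \<open>A\<close> itself may live on another type.\<close>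

definition finite_injective_dimension ::
  "'m itself \<Rightarrow> ('r, 'x) ring_scheme \<Rightarrow> ('r, 'a) module \<Rightarrow> bool" where
  "finite_injective_dimension U R A \<longleftrightarrow>
    (\<exists>(I :: nat \<Rightarrow> ('r, 'm) module) \<delta> \<epsilon> d.
      (\<forall>k. injective_lmodule R (I k)) \<and>
      (\<forall>k>d. zero_lmodule (I k)) \<and>
      \<epsilon> \<in> lmod_hom R A (I 0) \<and>
      (\<forall>k. \<delta> k \<in> lmod_hom R (I k) (I (Suc k))) \<and>
      inj_on \<epsilon> (carrier A) \<and>
      \<epsilon> ` carrier A = a_kernel (I 0) (I (Suc 0)) (\<delta> 0) \<and>
      (\<forall>k. \<delta> k ` carrier (I k) = a_kernel (I (Suc k)) (I (Suc (Suc k))) (\<delta> (Suc k))))"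


section \<open>Gorenstein rings\<close>

definition regular_lmodule :: "('r, 'x) ring_scheme \<Rightarrow> ('r, 'r) module" where
  "regular_lmodule R =
    \<lparr>carrier = carrier R, mult = mult R, one = one R, zero = zero R, add = add R,
     smult = mult R\<rparr>"

definition opposite_ring :: "('r, 'x) ring_scheme \<Rightarrow> ('r, 'x) ring_scheme" where
  "opposite_ring R = R\<lparr>mult := (\<lambda>x y. y \<otimes>\<^bsub>R\<^esub> x)\<rparr>"

text \<open>Every left ideal is finitely generated.\<close>

definition left_noetherian :: "('r, 'x) ring_scheme \<Rightarrow> bool" where
  "left_noetherian R \<longleftrightarrow>
    (\<forall>I. submodule I R (regular_lmodule R) \<longrightarrow>
      (\<exists>A. finite A \<and> A \<subseteq> I \<and> I = \<Inter>{J. submodule J R (regular_lmodule R) \<and> A \<subseteq> J}))"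

definition gorenstein_ring :: "'m itself \<Rightarrow> ('r, 'x) ring_scheme \<Rightarrow> bool" where
  "gorenstein_ring U R \<longleftrightarrow> ring R \<and>
    left_noetherian R \<and> left_noetherian (opposite_ring R) \<and>
    finite_injective_dimension U R (regular_lmodule R) \<and>
    finite_injective_dimension U (opposite_ring R) (regular_lmodule (opposite_ring R))"


section \<open>Homology of complexes of abelian groups\<close>

text \<open>Complexes are graded homologically: \<open>d n\<close> maps \<open>G n\<close> to \<open>G (n - 1)\<close>.\<close>

definition cycles ::
  "(int \<Rightarrow> ('a, 'b) monoid_scheme) \<Rightarrow> (int \<Rightarrow> 'a \<Rightarrow> 'a) \<Rightarrow> int \<Rightarrow> 'a set" where
  "cycles G d n = kernel (G n) (G (n - 1)) (d n)"

definition boundaries ::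
  "(int \<Rightarrow> ('a, 'b) monoid_scheme) \<Rightarrow> (int \<Rightarrow> 'a \<Rightarrow> 'a) \<Rightarrow> int \<Rightarrow> 'a set" where
  "boundaries G d n = d (n + 1) ` carrier (G (n + 1))"

definition homology ::
  "(int \<Rightarrow> ('a, 'b) monoid_scheme) \<Rightarrow> (int \<Rightarrow> 'a \<Rightarrow> 'a) \<Rightarrow> int \<Rightarrow> 'a set monoid" where
  "homology G d n = (G n)\<lparr>carrier := cycles G d n\<rparr> Mod boundaries G d n"

definition acyclic_complex ::
  "(int \<Rightarrow> ('a, 'b) monoid_scheme) \<Rightarrow> (int \<Rightarrow> 'a \<Rightarrow> 'a) \<Rightarrow> bool" where
  "acyclic_complex G d \<longleftrightarrow> (\<forall>n. boundaries G d n = cycles G d n)"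

text \<open>The map \<open>[x] \<mapsto> [f x]\<close> from degree \<open>n\<close> homology into that of the complex \<open>(H, e)\<close>.\<close>

definition homology_map ::
  "(int \<Rightarrow> ('b, 'c) monoid_scheme) \<Rightarrow> (int \<Rightarrow> 'b \<Rightarrow> 'b) \<Rightarrow> int \<Rightarrow> ('a \<Rightarrow> 'b) \<Rightarrow> 'a set \<Rightarrow> 'b set" where
  "homology_map H e n f = (\<lambda>C. the_elem ((\<lambda>x. boundaries H e n #>\<^bsub>H n\<^esub> f x) ` C))"


section \<open>Complexes of modules\<close>

record ('r, 'm) cplx =
  obj :: "int \<Rightarrow> ('r, 'm) module"
  diff :: "int \<Rightarrow> 'm \<Rightarrow> 'm"

abbreviation obj_groups where
  "obj_groups X \<equiv> (\<lambda>n. add_monoid (obj X n))"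

definition chain_complex :: "('r, 'x) ring_scheme \<Rightarrow> ('r, 'm) cplx \<Rightarrow> bool" where
  "chain_complex R X \<longleftrightarrow>
    (\<forall>n. left_module R (obj X n)) \<and>
    (\<forall>n. diff X n \<in> lmod_hom R (obj X n) (obj X (n - 1))) \<and>
    (\<forall>n. \<forall>x\<in>carrier (obj X n). diff X (n - 1) (diff X n x) = \<zero>\<^bsub>obj X (n - 2)\<^esub>)"

definition exact_complex :: "('r, 'x) ring_scheme \<Rightarrow> ('r, 'm) cplx \<Rightarrow> bool" where
  "exact_complex R X \<longleftrightarrow> chain_complex R X \<and> acyclic_complex (obj_groups X) (diff X)"

definition zero_cplx :: "('r, 'm) cplx \<Rightarrow> bool" where
  "zero_cplx X \<longleftrightarrow> (\<forall>n. zero_lmodule (obj X n))"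

text \<open>A module as a complex concentrated in degree 0.\<close>

definition concentrated :: "('r, 'm) module \<Rightarrow> ('r, 'm) cplx" where
  "concentrated N =
    (let X = (\<lambda>n. if n = 0 then N else N\<lparr>carrier := {\<zero>\<^bsub>N\<^esub>}\<rparr>)
     in \<lparr>obj = X, diff = (\<lambda>n. zero_hom (X n) (X (n - 1)))\<rparr>)"

definition chain_maps ::
  "('r, 'x) ring_scheme \<Rightarrow> ('r, 'a) cplx \<Rightarrow> ('r, 'b) cplx \<Rightarrow> (int \<Rightarrow> 'a \<Rightarrow> 'b) set" where
  "chain_maps R X Y =
    {f. (\<forall>n. f n \<in> lmod_hom R (obj X n) (obj Y n)) \<and>
        (\<forall>n. \<forall>x\<in>carrier (obj X n). diff Y n (f n x) = f (n - 1) (diff X n x))}"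

definition comp_map ::
  "('r, 'a) cplx \<Rightarrow> (int \<Rightarrow> 'b \<Rightarrow> 'c) \<Rightarrow> (int \<Rightarrow> 'a \<Rightarrow> 'b) \<Rightarrow> int \<Rightarrow> 'a \<Rightarrow> 'c" where
  "comp_map X g f = (\<lambda>n. compose (carrier (obj X n)) (g n) (f n))"

definition zero_map :: "('r, 'a) cplx \<Rightarrow> ('r, 'b) cplx \<Rightarrow> int \<Rightarrow> 'a \<Rightarrow> 'b" where
  "zero_map X Y = (\<lambda>n. zero_hom (obj X n) (obj Y n))"

definition surjective_map ::
  "('r, 'a) cplx \<Rightarrow> ('r, 'b) cplx \<Rightarrow> (int \<Rightarrow> 'a \<Rightarrow> 'b) \<Rightarrow> bool" where
  "surjective_map X Y f \<longleftrightarrow> (\<forall>n. f n ` carrier (obj X n) = carrier (obj Y n))"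

definition injective_map :: "('r, 'a) cplx \<Rightarrow> (int \<Rightarrow> 'a \<Rightarrow> 'b) \<Rightarrow> bool" where
  "injective_map X f \<longleftrightarrow> (\<forall>n. inj_on (f n) (carrier (obj X n)))"

text \<open>Exactness at \<open>Y\<close> of \<open>X \<rightarrow> Y \<rightarrow> Z\<close>.\<close>

definition exact_maps ::
  "('r, 'a) cplx \<Rightarrow> (int \<Rightarrow> 'a \<Rightarrow> 'b) \<Rightarrow> ('r, 'b) cplx \<Rightarrow> (int \<Rightarrow> 'b \<Rightarrow> 'c) \<Rightarrow> ('r, 'c) cplx \<Rightarrow> bool" where
  "exact_maps X f Y g Z \<longleftrightarrow>
    (\<forall>n. f n ` carrier (obj X n) = a_kernel (obj Y n) (obj Z n) (g n))"

definition ker_cplx ::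
  "('r, 'a) cplx \<Rightarrow> ('r, 'b) cplx \<Rightarrow> (int \<Rightarrow> 'a \<Rightarrow> 'b) \<Rightarrow> ('r, 'a) cplx" where
  "ker_cplx X Y f =
    (let K = (\<lambda>n. a_kernel (obj X n) (obj Y n) (f n))
     in \<lparr>obj = (\<lambda>n. (obj X n)\<lparr>carrier := K n\<rparr>), diff = (\<lambda>n. restrict (diff X n) (K n))\<rparr>)"

definition quasi_iso ::
  "('r, 'x) ring_scheme \<Rightarrow> ('r, 'a) cplx \<Rightarrow> ('r, 'b) cplx \<Rightarrow> (int \<Rightarrow> 'a \<Rightarrow> 'b) \<Rightarrow> bool" where
  "quasi_iso R X Y f \<longleftrightarrow> f \<in> chain_maps R X Y \<and>
    (\<forall>n. homology_map (obj_groups Y) (diff Y) n (f n)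
        \<in> iso (homology (obj_groups X) (diff X) n) (homology (obj_groups Y) (diff Y) n))"

text \<open>
  The differential of the mapping cone of \<open>u : P \<rightarrow> G\<close> is
  \<open>(x, y) \<mapsto> (\<partial> x + u y, - \<partial> y)\<close> on \<open>G n \<oplus> P (n - 1)\<close>.
\<close>

definition cone ::
  "('r, 'a) cplx \<Rightarrow> ('r, 'b) cplx \<Rightarrow> (int \<Rightarrow> 'a \<Rightarrow> 'b) \<Rightarrow> ('r, 'b \<times> 'a) cplx" where
  "cone P G u =
    \<lparr>obj = (\<lambda>n. direct_sum (obj G n) (obj P (n - 1))),
     diff = (\<lambda>n. \<lambda>(x, y)\<in>carrier (direct_sum (obj G n) (obj P (n - 1))).
       (diff G n x \<oplus>\<^bsub>obj G (n - 1)\<^esub> u (n - 1) y,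
        \<ominus>\<^bsub>obj P (n - 2)\<^esub> diff P (n - 1) y))\<rparr>"


section \<open>The Hom complex\<close>

text \<open>
  A homomorphism of degree \<open>n\<close> is a family of maps \<open>f p : X p \<rightarrow> Y (p + n)\<close>.
  The groups are written multiplicatively, as HOL-Algebra groups, but the operation
  is pointwise addition.
\<close>

definition hom_cplx ::
  "('r, 'x) ring_scheme \<Rightarrow> ('r, 'a) cplx \<Rightarrow> ('r, 'b) cplx \<Rightarrow> int \<Rightarrow> (int \<Rightarrow> 'a \<Rightarrow> 'b) monoid" where
  "hom_cplx R X Y n =
    \<lparr>carrier = {f. \<forall>p. f p \<in> lmod_hom R (obj X p) (obj Y (p + n))},
     mult = (\<lambda>f g p. \<lambda>x\<in>carrier (obj X p). f p x \<oplus>\<^bsub>obj Y (p + n)\<^esub> g p x),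
     one = (\<lambda>p. zero_hom (obj X p) (obj Y (p + n)))\<rparr>"

text \<open>\<open>\<partial> f = \<partial> \<circ> f - (-1)\<^sup>n f \<circ> \<partial>\<close>\<close>

definition hom_diff ::
  "('r, 'a) cplx \<Rightarrow> ('r, 'b) cplx \<Rightarrow> int \<Rightarrow> (int \<Rightarrow> 'a \<Rightarrow> 'b) \<Rightarrow> int \<Rightarrow> 'a \<Rightarrow> 'b" where
  "hom_diff X Y n f = (\<lambda>p. \<lambda>x\<in>carrier (obj X p).
    if even n
    then diff Y (p + n) (f p x) \<ominus>\<^bsub>obj Y (p + n - 1)\<^esub> f (p - 1) (diff X p x)
    else diff Y (p + n) (f p x) \<oplus>\<^bsub>obj Y (p + n - 1)\<^esub> f (p - 1) (diff X p x))"

definition hom_cohomology ::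
  "('r, 'x) ring_scheme \<Rightarrow> ('r, 'a) cplx \<Rightarrow> ('r, 'b) cplx \<Rightarrow> int \<Rightarrow> (int \<Rightarrow> 'a \<Rightarrow> 'b) set monoid" where
  "hom_cohomology R X Y n = homology (hom_cplx R X Y) (hom_diff X Y) (- n)"


section \<open>DG-projective and Gorenstein projective complexes\<close>

definition dg_projective :: "('r, 'x) ring_scheme \<Rightarrow> ('r, 'm) cplx \<Rightarrow> bool" where
  "dg_projective R P \<longleftrightarrow> chain_complex R P \<and> (\<forall>n. projective_lmodule R (obj P n)) \<and>
    (\<forall>E :: ('r, 'm) cplx. exact_complex R E \<longrightarrow>
      acyclic_complex (hom_cplx R P E) (hom_diff P E))"

definition dg_projective_resolution ::
  "('r, 'x) ring_scheme \<Rightarrow> ('r, 'm) cplx \<Rightarrow> ('r, 'm) cplx \<Rightarrow> (int \<Rightarrow> 'm \<Rightarrow> 'm) \<Rightarrow> bool" where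
  "dg_projective_resolution R P M \<pi> \<longleftrightarrow> dg_projective R P \<and> quasi_iso R P M \<pi>"

definition projective_cplx :: "('r, 'x) ring_scheme \<Rightarrow> ('r, 'm) cplx \<Rightarrow> bool" where
  "projective_cplx R X \<longleftrightarrow> exact_complex R X \<and>
    (\<forall>n. projective_lmodule R (obj X n)) \<and>
    (\<forall>n. projective_lmodule R
      ((obj X n)\<lparr>carrier := a_kernel (obj X n) (obj X (n - 1)) (diff X n)\<rparr>))"

text \<open>A finite resolution \<open>0 \<rightarrow> Q d \<rightarrow> \<dots> \<rightarrow> Q 0 \<rightarrow> L \<rightarrow> 0\<close> by projective complexes.\<close>

definition finite_projective_dimension :: "('r, 'x) ring_scheme \<Rightarrow> ('r, 'm) cplx \<Rightarrow> bool" where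
  "finite_projective_dimension R L \<longleftrightarrow> chain_complex R L \<and>
    (\<exists>(Q :: nat \<Rightarrow> ('r, 'm) cplx) \<delta> \<epsilon> d.
      (\<forall>k. projective_cplx R (Q k)) \<and>
      (\<forall>k>d. zero_cplx (Q k)) \<and>
      \<epsilon> \<in> chain_maps R (Q 0) L \<and>
      (\<forall>k. \<delta> k \<in> chain_maps R (Q (Suc k)) (Q k)) \<and>
      surjective_map (Q 0) L \<epsilon> \<and>
      exact_maps (Q (Suc 0)) (\<delta> 0) (Q 0) \<epsilon> L \<and>
      (\<forall>k. exact_maps (Q (Suc (Suc k))) (\<delta> (Suc k)) (Q (Suc k)) (\<delta> k) (Q k)))"

text \<open>
  The complex \<open>G\<close> is identified with the kernel of \<open>Q 0 \<rightarrow> Q (-1)\<close> along an injective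
  map \<open>\<iota>\<close>, because the carriers of \<open>G\<close> need not be subsets of those of \<open>Q 0\<close>.
\<close>

definition gorenstein_projective :: "('r, 'x) ring_scheme \<Rightarrow> ('r, 'm) cplx \<Rightarrow> bool" where
  "gorenstein_projective R G \<longleftrightarrow> chain_complex R G \<and>
    (\<exists>(Q :: int \<Rightarrow> ('r, 'm) cplx) \<delta> \<iota>.
      (\<forall>i. projective_cplx R (Q i)) \<and>
      (\<forall>i. \<delta> i \<in> chain_maps R (Q i) (Q (i - 1))) \<and>
      (\<forall>i. exact_maps (Q (i + 1)) (\<delta> (i + 1)) (Q i) (\<delta> i) (Q (i - 1))) \<and>
      (\<forall>W :: ('r, 'm) cplx. projective_cplx R W \<longrightarrow>
        (\<forall>i. (\<lambda>g. comp_map (Q i) g (\<delta> i)) ` chain_maps R (Q (i - 1)) W =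
          {f \<in> chain_maps R (Q i) W.
            comp_map (Q (i + 1)) f (\<delta> (i + 1)) = zero_map (Q (i + 1)) W})) \<and>
      \<iota> \<in> chain_maps R G (Q 0) \<and> injective_map G \<iota> \<and>
      exact_maps G \<iota> (Q 0) (\<delta> 0) (Q (- 1)))"

definition gorenstein_projective_precover ::
  "('r, 'x) ring_scheme \<Rightarrow> ('r, 'm) cplx \<Rightarrow> ('r, 'm) cplx \<Rightarrow> (int \<Rightarrow> 'm \<Rightarrow> 'm) \<Rightarrow> bool" where
  "gorenstein_projective_precover R G M \<phi> \<longleftrightarrow>
    gorenstein_projective R G \<and> \<phi> \<in> chain_maps R G M \<and>
    (\<forall>G' :: ('r, 'm) cplx. gorenstein_projective R G' \<longrightarrow>
      (\<lambda>h. comp_map G' \<phi> h) ` chain_maps R G' G = chain_maps R G' M)"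

definition special_gorenstein_projective_precover ::
  "('r, 'x) ring_scheme \<Rightarrow> ('r, 'm) cplx \<Rightarrow> ('r, 'm) cplx \<Rightarrow> (int \<Rightarrow> 'm \<Rightarrow> 'm) \<Rightarrow> bool" where
  "special_gorenstein_projective_precover R G M \<phi> \<longleftrightarrow>
    gorenstein_projective_precover R G M \<phi> \<and> finite_projective_dimension R (ker_cplx G M \<phi>)"


section \<open>Generalized Tate cohomology and Tate cohomology\<close>

definition generalized_tate_data ::
  "('r, 'x) ring_scheme \<Rightarrow> ('r, 'm) cplx \<Rightarrow>
    ('r, 'm) cplx \<Rightarrow> (int \<Rightarrow> 'm \<Rightarrow> 'm) \<Rightarrow> ('r, 'm) cplx \<Rightarrow> (int \<Rightarrow> 'm \<Rightarrow> 'm) \<Rightarrow>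
    (int \<Rightarrow> 'm \<Rightarrow> 'm) \<Rightarrow> bool" where
  "generalized_tate_data R M P \<pi> G \<phi> u \<longleftrightarrow>
    dg_projective_resolution R P M \<pi> \<and> surjective_map P M \<pi> \<and>
    special_gorenstein_projective_precover R G M \<phi> \<and>
    u \<in> chain_maps R P G \<and> comp_map P \<phi> u = \<pi>"

definition generalized_tate_ext ::
  "('r, 'x) ring_scheme \<Rightarrow> ('r, 'm) cplx \<Rightarrow> ('r, 'm) cplx \<Rightarrow> (int \<Rightarrow> 'm \<Rightarrow> 'm) \<Rightarrow>
    ('r, 'm) module \<Rightarrow> int \<Rightarrow> (int \<Rightarrow> 'm \<times> 'm \<Rightarrow> 'm) set monoid" where
  "generalized_tate_ext R P G u N j = hom_cohomology R (cone P G u) (concentrated N) (j + 1)"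

definition totally_acyclic :: "('r, 'x) ring_scheme \<Rightarrow> ('r, 'm) cplx \<Rightarrow> bool" where
  "totally_acyclic R T \<longleftrightarrow> exact_complex R T \<and> (\<forall>n. projective_lmodule R (obj T n)) \<and>
    (\<forall>Q :: ('r, 'm) module. projective_lmodule R Q \<longrightarrow>
      (\<forall>n. (\<lambda>g. compose (carrier (obj T n)) g (diff T n)) ` lmod_hom R (obj T (n - 1)) Q =
        {f \<in> lmod_hom R (obj T n) Q.
          compose (carrier (obj T (n + 1))) f (diff T (n + 1)) = zero_hom (obj T (n + 1)) Q}))"

definition complete_resolution ::
  "('r, 'x) ring_scheme \<Rightarrow> ('r, 'm) cplx \<Rightarrow>
    ('r, 'm) cplx \<Rightarrow> (int \<Rightarrow> 'm \<Rightarrow> 'm) \<Rightarrow> ('r, 'm) cplx \<Rightarrow> (int \<Rightarrow> 'm \<Rightarrow> 'm) \<Rightarrow> bool" where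
  "complete_resolution R M T v P \<pi> \<longleftrightarrow>
    dg_projective_resolution R P M \<pi> \<and> totally_acyclic R T \<and> v \<in> chain_maps R T P \<and>
    (\<exists>k. \<forall>i\<ge>k. bij_betw (v i) (carrier (obj T i)) (carrier (obj P i)))"

definition tate_ext ::
  "('r, 'x) ring_scheme \<Rightarrow> ('r, 'm) cplx \<Rightarrow> ('r, 'm) module \<Rightarrow> int \<Rightarrow>
    (int \<Rightarrow> 'm \<Rightarrow> 'm) set monoid" where
  "tate_ext R T N j = hom_cohomology R T (concentrated N) j"

end

theory Submission
  imports Defs "HOL-Library.Product_Plus"
begin

text \<open>
  Let \<open>C\<close> be the mapping cone of \<open>u\<close>.  In degrees above \<open>n\<close> the complex \<open>G\<close> agrees with the kernel
  of \<open>G \<rightarrow> M\<close>, so \<open>G i\<close> is a Gorenstein projective module with a finite projective resolution, hence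
  projective; in low and high degrees the cycles of \<open>G\<close> even split off.  Resolving \<open>C\<close> by complexes
  with split cycles and shifting dimensions down to a degree where the cycles of \<open>C\<close> split shows that
  \<open>Hom(C, Q)\<close> is exact there for every projective module \<open>Q\<close>.

  A comparison map \<open>w : P' \<rightarrow> P\<close> over \<open>M\<close> and the splitting of \<open>G\<close> in high degrees give maps
  \<open>T i \<rightarrow> C (i + 1)\<close> in high degrees which anticommute with the differentials.  As \<open>C (i + 1)\<close> is
  projective for \<open>i \<ge> n\<close>, total acyclicity of \<open>T\<close> extends them down to degree \<open>n\<close>.  The cone \<open>E\<close> of this
  map splits in high degrees; since \<open>Hom(E, Q)\<close> is exact for projective \<open>Q\<close>, in particular for the
  terms of \<open>E\<close>, the splitting descends to degree \<open>n\<close>.  Hence \<open>Hom(E, N)\<close> is exact above degree \<open>n\<close> for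
  every module \<open>N\<close>, and composition with \<open>T \<rightarrow> C\<close> is an isomorphism on cohomology there.
\<close>

section \<open>Summands of abelian groups with operators\<close>

text \<open>The obstacle is that \<open>G 0\<close>, ..., \<open>G n\<close> are only Gorenstein
  projective: the mapping cone is no complex of projectives, so neither a map into it nor a
  contraction can be obtained by lifting in all degrees. This is where the bound on \<open>j\<close>
  comes from: an isomorphism in degree \<open>j\<close> needs the comparison on \<open>T j\<close>
  and on \<open>T (j - 1)\<close>, and the latter ends in \<open>G j\<close>, which is known to be
  projective for \<open>j > n\<close>. The vanishing of Ext from Gorenstein projectives into objects
  of finite projective dimension takes the form of explicit lifts along finite resolutions. Each
  term of such a resolution costs one degree when a splitting is carried to the resolved complex, so
  its length decides from which degree on \<open>G\<close> splits. Projectivity speaks about modules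
  on one type \<open>'m\<close>, while cones and their resolutions live on products of it. Hence
  modules are realised as summands of one abelian group, where maps are total, kernels and cycles
  need not become objects, and lifting is stated by comparing images.\<close>

text \<open>
  An object is a summand of an abelian group with operators, given by the action of the operators and
  the idempotent projecting onto it.  Homomorphisms are total functions that absorb the idempotents,
  so that maps agree as soon as they agree on elements and no carrier sets are needed.
\<close>

type_synonym ('r, 'v) object = "('r \<Rightarrow> 'v \<Rightarrow> 'v) \<times> ('v \<Rightarrow> 'v)"

definition hm :: "('r, 'v::ab_group_add) object \<Rightarrow> ('r, 'w::ab_group_add) object \<Rightarrow> ('v \<Rightarrow> 'w) set" where
  "hm A B = {f. (\<forall>x y. f (x + y) = f x + f y) \<and> (\<forall>r x. f (fst A r x) = fst B r (f x)) \<and>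
    (\<forall>x. snd B (f x) = f x) \<and> (\<forall>x. f (snd A x) = f x)}"

definition el :: "('r, 'v) object \<Rightarrow> 'v \<Rightarrow> bool" where
  "el A x \<longleftrightarrow> snd A x = x"

text \<open>Membership of \<open>snd A\<close> in \<open>hm A A\<close> bundles idempotency,
  additivity and compatibility with the operators.\<close>

definition obj_ok :: "('r, 'v::ab_group_add) object \<Rightarrow> bool" where
  "obj_ok A \<longleftrightarrow> snd A \<in> hm A A \<and> (\<forall>r x y. fst A r (x + y) = fst A r x + fst A r y)"

definition osum :: "('r, 'v) object \<Rightarrow> ('r, 'w) object \<Rightarrow> ('r, 'v \<times> 'w) object" where
  "osum A B = ((\<lambda>r. map_prod (fst A r) (fst B r)), map_prod (snd A) (snd B))"

text \<open>Projectivity of \<open>A\<close> against the surjection of \<open>X\<close> onto the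
  image of \<open>g\<close>. Comparing images instead of asking for a surjective \<open>g\<close>
  allows lifts through maps onto cycles or kernels without forming these as objects.
  \<open>X\<close> and \<open>Y\<close> are parameters because a definition cannot quantify over
  their types.\<close>

definition lifts :: "('r, 'u::ab_group_add) object \<Rightarrow> ('r, 'v::ab_group_add) object \<Rightarrow>
    ('r, 'w::ab_group_add) object \<Rightarrow> bool" where
  "lifts A X Y \<longleftrightarrow> (\<forall>f\<in>hm A Y. \<forall>g\<in>hm X Y. (\<forall>x. \<exists>y. f x = g y) \<longrightarrow>
    (\<exists>h\<in>hm A X. \<forall>x. g (h x) = f x))"

section \<open>Elements, homomorphisms and lifting\<close>

lemma hm_add: "f \<in> hm A B \<Longrightarrow> f (x + y) = f x + f y"
  by (simp add: hm_def)

lemma hm_zero: "f \<in> hm A B \<Longrightarrow> f 0 = 0"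
  using hm_add[of f A B 0 0] by simp

lemma hm_minus: "f \<in> hm A B \<Longrightarrow> f (- x) = - f x"
  using hm_add[of f A B x "- x"] hm_zero[of f A B] by (simp add: eq_neg_iff_add_eq_0 add.commute)

lemma hm_diff: "f \<in> hm A B \<Longrightarrow> f (x - y) = f x - f y"
  using hm_add[of f A B x "- y"] hm_minus[of f A B y] by simp

lemmas hm_lin = hm_add hm_zero hm_minus hm_diff

lemma hm_el: "f \<in> hm A B \<Longrightarrow> el B (f x)"
  by (simp add: hm_def el_def)

lemma hm_src: "f \<in> hm A B \<Longrightarrow> f (snd A x) = f x"
  by (simp add: hm_def)

lemma hm_tgt: "f \<in> hm A B \<Longrightarrow> snd B (f x) = f x"
  by (simp add: hm_def)

lemma obj_okI: "obj_ok A \<Longrightarrow> snd A \<in> hm A A"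
  by (simp add: obj_ok_def)

lemma el_snd: "obj_ok A \<Longrightarrow> el A (snd A x)"
  unfolding obj_ok_def by (blast intro: hm_el)

lemma el_add: "obj_ok A \<Longrightarrow> el A x \<Longrightarrow> el A y \<Longrightarrow> el A (x + y)"
  by (simp add: el_def hm_lin[OF obj_okI])

lemma el_diff: "obj_ok A \<Longrightarrow> el A x \<Longrightarrow> el A y \<Longrightarrow> el A (x - y)"
  by (simp add: el_def hm_lin[OF obj_okI])

lemma el_minus: "obj_ok A \<Longrightarrow> el A x \<Longrightarrow> el A (- x)"
  by (simp add: el_def hm_lin[OF obj_okI])

lemma el_zero: "obj_ok A \<Longrightarrow> el A 0"
  by (simp add: el_def hm_lin[OF obj_okI])

lemma act_zero: "obj_ok A \<Longrightarrow> fst A r 0 = 0"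
  by (metis add_cancel_right_right obj_ok_def)

lemma act_minus: "obj_ok A \<Longrightarrow> fst A r (- x) = - fst A r x"
  by (metis act_zero add.right_inverse eq_neg_iff_add_eq_0 obj_ok_def add.commute)

lemma hm_comp: "f \<in> hm A B \<Longrightarrow> g \<in> hm B C \<Longrightarrow> (\<lambda>x. g (f x)) \<in> hm A C"
  by (simp add: hm_def)

lemma hm_plus: "f \<in> hm A B \<Longrightarrow> g \<in> hm A B \<Longrightarrow> obj_ok B \<Longrightarrow> (\<lambda>x. f x + g x) \<in> hm A B"
  by (auto simp: hm_def obj_ok_def algebra_simps)

lemma hm_uminus: "f \<in> hm A B \<Longrightarrow> obj_ok B \<Longrightarrow> (\<lambda>x. - f x) \<in> hm A B"
  using hm_minus[OF obj_okI, of B] act_minus[of B] by (auto simp: hm_def)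

lemma hm_sub: "f \<in> hm A B \<Longrightarrow> g \<in> hm A B \<Longrightarrow> obj_ok B \<Longrightarrow> (\<lambda>x. f x - g x) \<in> hm A B"
  using hm_plus[OF _ hm_uminus, of f A B g] by simp

lemma hm_0: "obj_ok B \<Longrightarrow> (\<lambda>x. 0) \<in> hm A B"
  using hm_zero[OF obj_okI, of B] act_zero[of B] by (auto simp: hm_def)

lemma hm_ext: "f \<in> hm A B \<Longrightarrow> g \<in> hm A B \<Longrightarrow> obj_ok A \<Longrightarrow> (\<And>x. el A x \<Longrightarrow> f x = g x) \<Longrightarrow> f x = g x"
  by (metis el_snd hm_src)

lemma obj_ok_osum: "obj_ok A \<Longrightarrow> obj_ok B \<Longrightarrow> obj_ok (osum A B)"
  by (auto simp: obj_ok_def hm_def osum_def)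

lemma el_osum: "el (osum A B) z \<longleftrightarrow> el A (fst z) \<and> el B (snd z)"
  by (cases z) (auto simp: el_def osum_def)

lemma hm_pair: "f \<in> hm A B \<Longrightarrow> g \<in> hm A C \<Longrightarrow> (\<lambda>x. (f x, g x)) \<in> hm A (osum B C)"
  by (auto simp: hm_def osum_def)

lemma hm_fst: "f \<in> hm A C \<Longrightarrow> (\<lambda>z. f (fst z)) \<in> hm (osum A B) C"
  by (auto simp: hm_def osum_def)

lemma hm_snd: "f \<in> hm B C \<Longrightarrow> (\<lambda>z. f (snd z)) \<in> hm (osum A B) C"
  by (auto simp: hm_def osum_def)

lemma hm_in1:
  assumes "f \<in> hm (osum A B) C" "obj_ok A" "obj_ok B"
  shows "(\<lambda>x. f (x, 0)) \<in> hm A C"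
proof -
  have *: "f (snd A x, snd B y) = f (x, y)" for x y
    using hm_src[OF assms(1), of "(x, y)"] by (simp add: osum_def)
  have "f (x + y, 0) = f (x, 0) + f (y, 0)" for x y
    using hm_add[OF assms(1), of "(x, 0)" "(y, 0)"] by simp
  moreover have "f (fst A r x, 0) = fst C r (f (x, 0))" for r x
    using assms(1) act_zero[OF assms(3), of r] unfolding hm_def osum_def
    by simp (metis map_prod_simp)
  moreover have "f (snd A x, 0) = f (x, 0)" for x
    using *[of x 0] hm_zero[OF obj_okI[OF assms(3)]] by simp
  ultimately show ?thesis using hm_tgt[OF assms(1)] by (simp add: hm_def)
qed

lemma hm_in2:
  assumes "f \<in> hm (osum A B) C" "obj_ok A" "obj_ok B"
  shows "(\<lambda>x. f (0, x)) \<in> hm B C"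
proof -
  have *: "f (snd A x, snd B y) = f (x, y)" for x y
    using hm_src[OF assms(1), of "(x, y)"] by (simp add: osum_def)
  have "f (0, x + y) = f (0, x) + f (0, y)" for x y
    using hm_add[OF assms(1), of "(0, x)" "(0, y)"] by simp
  moreover have "f (0, fst B r x) = fst C r (f (0, x))" for r x
    using assms(1) act_zero[OF assms(2), of r] unfolding hm_def osum_def
    by simp (metis map_prod_simp)
  moreover have "f (0, snd B x) = f (0, x)" for x
    using *[of 0 x] hm_zero[OF obj_okI[OF assms(2)]] by simp
  ultimately show ?thesis using hm_tgt[OF assms(1)] by (simp add: hm_def)
qed

lemma hm_osum_split: "f \<in> hm (osum A B) C \<Longrightarrow> f (x, y) = f (x, 0) + f (0, y)"
  using hm_add[of f "osum A B" C "(x, 0)" "(0, y)"] by simp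

lemma liftsD:
  "lifts A X Y \<Longrightarrow> f \<in> hm A Y \<Longrightarrow> g \<in> hm X Y \<Longrightarrow> (\<And>x. \<exists>y. f x = g y) \<Longrightarrow>
    \<exists>h\<in>hm A X. \<forall>x. g (h x) = f x"
  by (simp add: lifts_def)

lemma lifts_osum:
  assumes A: "lifts A X Y" "obj_ok A" and B: "lifts B X Y" "obj_ok B" and X: "obj_ok X"
  shows "lifts (osum A B) X Y"
  unfolding lifts_def
proof (intro ballI impI)
  fix f g assume f: "f \<in> hm (osum A B) Y" and g: "g \<in> hm X Y" and r: "\<forall>x. \<exists>y. f x = g y"
  obtain h1 where h1: "h1 \<in> hm A X" "\<And>x. g (h1 x) = f (x, 0)"
    using liftsD[OF A(1) hm_in1[OF f A(2) B(2)] g] r by blast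
  obtain h2 where h2: "h2 \<in> hm B X" "\<And>x. g (h2 x) = f (0, x)"
    using liftsD[OF B(1) hm_in2[OF f A(2) B(2)] g] r by blast
  have "(\<lambda>z. h1 (fst z) + h2 (snd z)) \<in> hm (osum A B) X"
    using h1 h2 by (intro hm_plus hm_fst hm_snd X)
  moreover have "g (h1 (fst z) + h2 (snd z)) = f z" for z
    using hm_osum_split[OF f, of "fst z" "snd z"] by (simp add: hm_add[OF g] h1 h2)
  ultimately show "\<exists>h\<in>hm (osum A B) X. \<forall>x. g (h x) = f x" by (intro bexI) auto
qed

lemma lifts_retract:
  assumes "lifts A X Y" "s \<in> hm B A" "r \<in> hm A B" "\<And>x. el B x \<Longrightarrow> r (s x) = x" "obj_ok B"
  shows "lifts B X Y"
  unfolding lifts_def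
proof (intro ballI impI)
  fix f g assume f: "f \<in> hm B Y" and g: "g \<in> hm X Y" and e: "\<forall>x. \<exists>y. f x = g y"
  obtain h where h: "h \<in> hm A X" "\<And>x. g (h x) = f (r x)"
    using liftsD[OF assms(1) hm_comp[OF assms(3) f] g] e by blast
  have "g (h (s x)) = f x" for x
    using assms(4)[OF el_snd[OF assms(5)], of x] h(2)
    by (metis assms(2) f hm_src)
  then show "\<exists>h\<in>hm B X. \<forall>x. g (h x) = f x" by (intro bexI[OF _ hm_comp[OF assms(2) h(1)]]) simp
qed

section \<open>Complexes\<close>

definition cpx :: "(int \<Rightarrow> ('r, 'v::ab_group_add) object) \<Rightarrow> (int \<Rightarrow> 'v \<Rightarrow> 'v) \<Rightarrow> bool" where
  "cpx X d \<longleftrightarrow> (\<forall>i. obj_ok (X i)) \<and> (\<forall>i. d i \<in> hm (X i) (X (i - 1))) \<and> (\<forall>i x. d (i - 1) (d i x) = 0)"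

definition exact_at :: "(int \<Rightarrow> ('r, 'v::ab_group_add) object) \<Rightarrow> (int \<Rightarrow> 'v \<Rightarrow> 'v) \<Rightarrow> int \<Rightarrow> bool" where
  "exact_at X d i \<longleftrightarrow> (\<forall>x. el (X i) x \<longrightarrow> d i x = 0 \<longrightarrow> (\<exists>y. el (X (i + 1)) y \<and> d (i + 1) y = x))"

text \<open>In a complex, \<open>d (i + 1)\<close> after \<open>h\<close> retracts
  \<open>X i\<close> onto its cycles. So \<open>h\<close> splits both the inclusion of the cycles
  into \<open>X i\<close> and the surjection of \<open>X (i + 1)\<close> onto them, and since it is
  defined on all of \<open>X i\<close> the cycles themselves never appear as an object.\<close>

definition cycle_section ::
    "(int \<Rightarrow> ('r, 'v::ab_group_add) object) \<Rightarrow> (int \<Rightarrow> 'v \<Rightarrow> 'v) \<Rightarrow> int \<Rightarrow> ('v \<Rightarrow> 'v) \<Rightarrow> bool" where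
  "cycle_section X d i h \<longleftrightarrow> h \<in> hm (X i) (X (i + 1)) \<and>
    (\<forall>x. el (X i) x \<longrightarrow> d i x = 0 \<longrightarrow> d (i + 1) (h x) = x)"

lemma cpxD:
  assumes "cpx X d"
  shows cpx_ok: "obj_ok (X i)" and cpx_d: "d i \<in> hm (X i) (X (i - 1))"
    and cpx_dd: "d (i - 1) (d i x) = 0"
  using assms by (auto simp: cpx_def)

lemma cpx_d': "cpx X d \<Longrightarrow> d (i + 1) \<in> hm (X (i + 1)) (X i)"
  using cpx_d[of X d "i + 1"] by simp

lemma cpx_dd': "cpx X d \<Longrightarrow> d i (d (i + 1) x) = 0"
  using cpx_dd[of X d "i + 1"] by simp

text \<open>The element \<open>x - h (d i x)\<close> is a cycle, hence a boundary, hence killed by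
  \<open>a\<close>; so \<open>a\<close> after \<open>h\<close> is the factorization, for an
  arbitrary target \<open>Q\<close>.\<close>

lemma hom_exact_of_section:
  assumes X: "cpx X d" and h: "cycle_section X d (i - 1) h" and ex: "exact_at X d i"
    and a: "a \<in> hm (X i) Q" "\<And>x. a (d (i + 1) x) = 0"
  shows "\<exists>c\<in>hm (X (i - 1)) Q. \<forall>x. a x = c (d i x)"
proof -
  have h1: "h \<in> hm (X (i - 1)) (X i)"
    using h by (simp add: cycle_section_def)
  have h2: "el (X (i - 1)) x \<Longrightarrow> d (i - 1) x = 0 \<Longrightarrow> d i (h x) = x" for x
    using h by (simp add: cycle_section_def)
  have c: "(\<lambda>x. a (h x)) \<in> hm (X (i - 1)) Q"
    using hm_comp[OF h1 a(1)] .
  have "a x = a (h (d i x))" for x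
  proof (rule hm_ext[OF a(1) _ cpx_ok[OF X]])
    show "(\<lambda>x. a (h (d i x))) \<in> hm (X i) Q" using hm_comp[OF cpx_d[OF X] c] .
  next
    fix x assume x: "el (X i) x"
    have "d i (x - h (d i x)) = 0"
      using h2[OF hm_el[OF cpx_d[OF X]] cpx_dd[OF X], of x] by (simp add: hm_lin[OF cpx_d[OF X]])
    moreover have "el (X i) (x - h (d i x))"
      using x hm_el[OF h1] by (simp add: el_diff cpx_ok[OF X])
    ultimately obtain y where "d (i + 1) y = x - h (d i x)"
      using ex unfolding exact_at_def by blast
    then have "a (x - h (d i x)) = 0" using a(2)[of y] by simp
    then show "a x = a (h (d i x))" by (simp add: hm_lin[OF a(1)])
  qed
  then show ?thesis by (intro bexI[OF _ c]) simp
qed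

text \<open>One upward step of a contracting homotopy: \<open>id - h d\<close> takes values in the
  cycles, which are the image of \<open>d (i + 1)\<close>, and a lift \<open>h'\<close> satisfies
  \<open>d h' = id - h d\<close>. On cycles the last term vanishes.\<close>

lemma cycle_section_up:
  assumes X: "cpx X d" and h: "cycle_section X d (i - 1) h" and ex: "exact_at X d i"
    and l: "lifts (X i) (X (i + 1)) (X i)"
  shows "\<exists>h'. cycle_section X d i h'"
proof -
  have h1: "h \<in> hm (X (i - 1)) (X i)"
    using h by (simp add: cycle_section_def)
  have h2: "el (X (i - 1)) x \<Longrightarrow> d (i - 1) x = 0 \<Longrightarrow> d i (h x) = x" for x
    using h by (simp add: cycle_section_def)
  note ok = cpx_ok[OF X]
  let ?f = "\<lambda>x. snd (X i) x - h (d i x)"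
  have f: "?f \<in> hm (X i) (X i)"
    by (intro hm_sub obj_okI ok hm_comp[OF cpx_d[OF X] h1])
  have "\<exists>y. ?f x = d (i + 1) y" for x
  proof -
    have "d i (?f x) = 0"
      using h2[OF hm_el[OF cpx_d[OF X]] cpx_dd[OF X], of x]
      by (simp add: hm_lin[OF cpx_d[OF X]] hm_src[OF cpx_d[OF X]])
    then show ?thesis using ex hm_el[OF f, of x] unfolding exact_at_def by metis
  qed
  from liftsD[OF l f cpx_d'[OF X] this] obtain h' where
    h': "h' \<in> hm (X i) (X (i + 1))" "\<And>x. d (i + 1) (h' x) = ?f x" by blast
  then have "cycle_section X d i h'"
    by (auto simp: cycle_section_def el_def hm_zero[OF h1])
  then show ?thesis by blast
qed

text \<open>
  Dimension shifting: exactness of \<open>Hom(_, Q)\<close> for the \<open>m\<close>-th syzygy complex in degree \<open>i\<close> follows from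
  that for the \<open>(m + 1)\<close>-st one in degree \<open>i - 1\<close>, until degree \<open>k + 2\<close> is reached, where the cycles of
  all syzygy complexes in degree \<open>k\<close> split.
\<close>

locale resolved_complex =
  fixes X :: "nat \<Rightarrow> int \<Rightarrow> ('r, 'v::ab_group_add) object" and d N :: "nat \<Rightarrow> int \<Rightarrow> 'v \<Rightarrow> 'v"
    and Q :: "('r, 'q::ab_group_add) object" and s :: "nat \<Rightarrow> int \<Rightarrow> 'v \<Rightarrow> 'v" and s0 :: "'v \<Rightarrow> 'v"
    and k :: int
  assumes col: "cpx (X m) (d m)"
    and N: "N m i \<in> hm (X (Suc m) i) (X m i)"
    and NN: "N m i (N (Suc m) i x) = 0"
    and dN: "d m i (N m i x) = N m (i - 1) (d (Suc m) i x)"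
    and aug: "el (X 0 i) x \<Longrightarrow> \<exists>y. N 0 i y = x"
    and row: "el (X (Suc m) i) x \<Longrightarrow> N m i x = 0 \<Longrightarrow> \<exists>y. N (Suc m) i y = x"
    and ex: "exact_at (X m) (d m) i"
    and sec: "cycle_section (X (Suc m)) (d (Suc m)) i (s m i)"
    and sec0: "cycle_section (X 0) (d 0) k s0"
    and lft0: "lifts (X 0 k) (X (Suc 0) (k + 1)) (X 0 (k + 1))"
    and lft: "lifts (X (Suc m) i) (X m' i') (X m'' i'')"
    and Q: "obj_ok Q"
    and rowQ: "f \<in> hm (X (Suc m) i) Q \<Longrightarrow> (\<And>x. f (N (Suc m) i x) = 0) \<Longrightarrow>
      \<exists>g\<in>hm (X m i) Q. \<forall>x. f x = g (N m i x)"
begin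

lemma ok: "obj_ok (X m i)" using cpx_ok[OF col] .
lemma dh: "d m i \<in> hm (X m i) (X m (i - 1))" using cpx_d[OF col] .
lemma dh': "d m (i + 1) \<in> hm (X m (i + 1)) (X m i)" using cpx_d'[OF col] .
lemma dd': "d m i (d m (i + 1) x) = 0" using cpx_dd'[OF col] .
lemma dN': "d m (i + 1) (N m (i + 1) x) = N m i (d (Suc m) (i + 1) x)"
  using dN[of m "i + 1" x] by simp

lemmas Nl = hm_lin[OF N] and dl = hm_lin[OF dh]

text \<open>The cycles of the \<open>m\<close>-th syzygy complex of \<open>X 0\<close>.\<close>

definition cyc :: "nat \<Rightarrow> int \<Rightarrow> 'v \<Rightarrow> bool" where
  "cyc m i x \<longleftrightarrow> el (X m i) x \<and> d m i x = 0 \<and> (\<forall>m'. m = Suc m' \<longrightarrow> N m' i x = 0)"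

lemma rowE:
  assumes "el (X (Suc m) i) x" "N m i x = 0"
  obtains y where "el (X (Suc (Suc m)) i) y" "N (Suc m) i y = x"
  using row[OF assms] el_snd[OF ok] hm_src[OF N] by metis

text \<open>If a complex and the terms of its resolution are exact, so are the syzygy complexes.
  Write \<open>x = d y\<close>; then \<open>N m y\<close> is a cycle one syzygy lower and one degree
  higher, by induction it is \<open>N m (d w)\<close>, and \<open>y - d w\<close> lies in the syzygy
  and still has boundary \<open>x\<close>. The form of the conclusion exhibits \<open>N m\<close>
  after \<open>d\<close> as a map onto the cycles of the syzygy, ready for
  \<open>lifts\<close>.\<close>

lemma syzygy_exact:
  assumes "cyc m i x"
  obtains w where "el (X (Suc m) (i + 1)) w" "N m i (d (Suc m) (i + 1) w) = x"
  using assms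
proof (induction m arbitrary: i x thesis)
  case 0
  from ex[of 0 i] "0.prems"(2) obtain y where y: "el (X 0 (i + 1)) y" "d 0 (i + 1) y = x"
    unfolding exact_at_def cyc_def by blast
  obtain w where w: "N 0 (i + 1) w = y" using aug[OF y(1)] by blast
  show ?case
  proof (rule "0.prems"(1))
    show "el (X (Suc 0) (i + 1)) (snd (X (Suc 0) (i + 1)) w)" by (rule el_snd[OF ok])
    show "N 0 i (d (Suc 0) (i + 1) (snd (X (Suc 0) (i + 1)) w)) = x"
      using dN'[of 0 i w] w y(2) by (simp add: hm_src[OF dh])
  qed
next
  case (Suc m)
  from Suc.prems(2) have x: "el (X (Suc m) i) x" "d (Suc m) i x = 0" "N m i x = 0"
    by (auto simp: cyc_def)
  from ex[of "Suc m" i] x obtain y where y: "el (X (Suc m) (i + 1)) y" "d (Suc m) (i + 1) y = x"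
    unfolding exact_at_def by blast
  have "cyc m (i + 1) (N m (i + 1) y)"
    using hm_el[OF N] NN x(3) y(2) dN'[of m i y] by (auto simp: cyc_def)
  from Suc.IH[OF _ this] obtain w where
    w: "el (X (Suc m) (i + 1 + 1)) w" "N m (i + 1) (d (Suc m) (i + 1 + 1) w) = N m (i + 1) y" by blast
  have "el (X (Suc m) (i + 1)) (y - d (Suc m) (i + 1 + 1) w)"
    by (rule el_diff[OF ok y(1) hm_el[OF dh']])
  moreover have "N m (i + 1) (y - d (Suc m) (i + 1 + 1) w) = 0"
    using w(2) by (simp add: Nl)
  ultimately obtain w' where w': "el (X (Suc (Suc m)) (i + 1)) w'"
    "N (Suc m) (i + 1) w' = y - d (Suc m) (i + 1 + 1) w" by (rule rowE)
  have "N (Suc m) i (d (Suc (Suc m)) (i + 1) w') = d (Suc m) (i + 1) (y - d (Suc m) (i + 1 + 1) w)"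
    using dN'[of "Suc m" i w'] w'(2) by simp
  also have "\<dots> = x" using y(2) dd'[of "Suc m" "i + 1" w] by (simp add: dl)
  finally show ?case using Suc.prems(1) w'(1) by blast
qed

text \<open>In degree \<open>k\<close> the cycles of two consecutive syzygies form a short exact
  sequence with the cycles of \<open>X (m + 1)\<close> in the middle. The middle ones are a summand
  by \<open>sec\<close>, so a splitting on the right end passes to the left end.\<close>

lemma syzygy_section:
  "\<exists>H\<in>hm (X m k) (X (Suc m) (k + 1)). \<forall>x. cyc m k x \<longrightarrow> N m k (d (Suc m) (k + 1) (H x)) = x"
proof (induction m)
  case 0
  have s0: "s0 \<in> hm (X 0 k) (X 0 (k + 1))" using sec0 by (simp add: cycle_section_def)
  have "\<exists>y. s0 x = N 0 (k + 1) y" for x using aug[OF hm_el[OF s0, of x]] by metis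
  from liftsD[OF lft0 s0 N this] obtain H where
    H: "H \<in> hm (X 0 k) (X (Suc 0) (k + 1))" "\<And>x. N 0 (k + 1) (H x) = s0 x" by blast
  show ?case
  proof (intro bexI[OF _ H(1)] allI impI)
    fix x assume "cyc 0 k x"
    then show "N 0 k (d (Suc 0) (k + 1) (H x)) = x"
      using sec0 by (simp add: dN'[symmetric] H(2) cycle_section_def cyc_def)
  qed
next
  case (Suc m)
  then obtain H where H: "H \<in> hm (X m k) (X (Suc m) (k + 1))"
    "\<And>x. cyc m k x \<Longrightarrow> N m k (d (Suc m) (k + 1) (H x)) = x" by blast
  let ?s = "s m k"
  have s: "?s \<in> hm (X (Suc m) k) (X (Suc m) (k + 1))"
    "\<And>x. el (X (Suc m) k) x \<Longrightarrow> d (Suc m) k x = 0 \<Longrightarrow> d (Suc m) (k + 1) (?s x) = x"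
    using sec[of m k] by (auto simp: cycle_section_def)
  define z where "z x = d (Suc m) (k + 1) (?s x)" for x
  have z: "z \<in> hm (X (Suc m) k) (X (Suc m) k)"
    unfolding z_def using hm_comp[OF s(1) dh'] .
  have zc: "d (Suc m) k (z x) = 0" for x by (simp add: z_def dd')
  \<comment> \<open>\<open>z\<close> retracts \<open>X (m + 1)\<close> onto its cycles. Subtracting
    the boundary of the lift \<open>H\<close> of \<open>N m (z x)\<close> moves \<open>z x\<close>
    into the kernel of \<open>N m\<close> and leaves cycles that already lie there
    unchanged.\<close>
  define \<Phi> where "\<Phi> x = z x - d (Suc m) (k + 1) (H (N m k (z x)))" for x
  have \<Phi>: "\<Phi> \<in> hm (X (Suc m) k) (X (Suc m) k)"
    unfolding \<Phi>_def by (intro hm_sub z ok hm_comp[OF z] hm_comp[OF N] hm_comp[OF H(1)] dh')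
  have c: "cyc m k (N m k (z x))" for x
    using hm_el[OF N] zc by (auto simp: cyc_def NN dN Nl)
  have "cyc (Suc m) k (\<Phi> x)" for x
    using hm_el[OF \<Phi>] H(2)[OF c, of x] by (simp add: cyc_def \<Phi>_def dl dd' zc Nl)
  then have "\<exists>y. \<Phi> x = N (Suc m) k (d (Suc (Suc m)) (k + 1) y)" for x
    by (metis syzygy_exact)
  from liftsD[OF lft[of m k] \<Phi> hm_comp[OF dh' N] this] obtain H' where
    H': "H' \<in> hm (X (Suc m) k) (X (Suc (Suc m)) (k + 1))"
      "\<And>x. N (Suc m) k (d (Suc (Suc m)) (k + 1) (H' x)) = \<Phi> x" by blast
  have "\<Phi> x = x" if "cyc (Suc m) k x" for x
    using that s(2)[of x] by (simp add: \<Phi>_def z_def cyc_def hm_zero[OF H(1)] dl)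
  then show ?case by (intro bexI[OF _ H'(1)]) (simp add: H'(2))
qed

text \<open>Homomorphisms from the \<open>m\<close>-th syzygy complex are encoded as homomorphisms \<open>a\<close> from \<open>X (m + 1)\<close>
  with \<open>a \<circ> N = 0\<close>.\<close>

lemma syzygy_hom_exact_bottom:
  assumes a: "a \<in> hm (X (Suc m) (k + 2)) Q" "\<And>x. a (N (Suc m) (k + 2) x) = 0"
    "\<And>x. a (d (Suc m) (k + 3) x) = 0"
  shows "\<exists>a'\<in>hm (X (Suc m) (k + 1)) Q. (\<forall>x. a' (N (Suc m) (k + 1) x) = 0) \<and>
    (\<forall>x. a x = a' (d (Suc m) (k + 2) x))"
proof -
  obtain H where H: "H \<in> hm (X m k) (X (Suc m) (k + 1))"
    "\<And>x. cyc m k x \<Longrightarrow> N m k (d (Suc m) (k + 1) (H x)) = x" using syzygy_section by blast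
  have e2: "k + 1 + 1 = k + 2" "k + 2 + 1 = k + 3" by simp_all
  note d2 = dh'[of _ "k + 1", unfolded e2] dd'[of _ "k + 1", unfolded e2] dN'[of _ "k + 1", unfolded e2]
    syzygy_exact[of _ "k + 1", unfolded e2] syzygy_exact[of _ "k + 2", unfolded e2]
    dh'[of _ "k + 2", unfolded e2] dd'[of _ "k + 2", unfolded e2] dN'[of _ "k + 2", unfolded e2]
  \<comment> \<open>\<open>a\<close> lives on the syzygy complex and vanishes on its boundaries; by
    exactness these are all of its cycles.\<close>
  have kill: "a x = 0" if x: "el (X (Suc m) (k + 2)) x" "cyc m (k + 2) (N m (k + 2) x)" for x
  proof -
    obtain w where w: "el (X (Suc m) (k + 3)) w" "N m (k + 2) (d (Suc m) (k + 3) w) = N m (k + 2) x"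
      using d2(5)[OF x(2)] by blast
    have "el (X (Suc m) (k + 2)) (x - d (Suc m) (k + 3) w)"
      by (rule el_diff[OF ok x(1) hm_el[OF d2(6)]])
    moreover have "N m (k + 2) (x - d (Suc m) (k + 3) w) = 0" using w(2) by (simp add: Nl)
    ultimately obtain y where "N (Suc m) (k + 2) y = x - d (Suc m) (k + 3) w" by (rule rowE)
    then have "a (x - d (Suc m) (k + 3) w) = 0" using a(2)[of y] by simp
    then show ?thesis by (simp add: hm_lin[OF a(1)] a(3))
  qed
  \<comment> \<open>With the section in degree \<open>k\<close>, this map projects the syzygy in
    degree \<open>k + 1\<close> onto its cycles. Its lift \<open>\<Lambda>\<close> goes up to degree
    \<open>k + 2\<close>, which is why the shifting of dimensions can stop there.\<close>
  let ?f = "\<lambda>x. N m (k + 1) x - N m (k + 1) (H (d m (k + 1) (N m (k + 1) x)))"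
  have f: "?f \<in> hm (X (Suc m) (k + 1)) (X m (k + 1))"
    by (intro hm_sub N ok hm_comp[OF N] hm_comp[OF dh'] hm_comp[OF H(1)])
  have c0: "cyc m k (d m (k + 1) (N m (k + 1) x))" for x
    unfolding cyc_def by (intro conjI allI impI hm_el[OF dh'] dd') (simp add: dN' NN)
  have "cyc m (k + 1) (?f x)" for x
    using hm_el[OF f, of x] H(2)[OF c0, of x] by (auto simp: cyc_def Nl NN dl dN')
  then have "\<exists>y. ?f x = N m (k + 1) (d (Suc m) (k + 2) y)" for x
    using d2(4)[of m "?f x"] by metis
  from liftsD[OF lft f hm_comp[OF d2(1) N] this] obtain \<Lambda> where
    \<Lambda>: "\<Lambda> \<in> hm (X (Suc m) (k + 1)) (X (Suc m) (k + 2))"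
      "\<And>x. N m (k + 1) (d (Suc m) (k + 2) (\<Lambda> x)) = ?f x" by blast
  have dL: "d m (k + 2) (N m (k + 2) (\<Lambda> x)) = ?f x" for x by (simp add: d2(3) \<Lambda>(2))
  have "a (\<Lambda> (N (Suc m) (k + 1) x)) = 0" for x
    using hm_el[OF N] by (intro kill hm_el[OF \<Lambda>(1)])
      (auto simp: cyc_def dL NN dl hm_zero[OF H(1)] Nl)
  moreover have "a x = a (\<Lambda> (d (Suc m) (k + 2) x))" for x
  proof (rule hm_ext[OF a(1) hm_comp[OF d2(1) hm_comp[OF \<Lambda>(1) a(1)]] ok])
    fix x assume x: "el (X (Suc m) (k + 2)) x"
    have Ny: "N m (k + 1) (d (Suc m) (k + 2) x) = d m (k + 2) (N m (k + 2) x)" by (simp add: d2(3))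
    have "a (x - \<Lambda> (d (Suc m) (k + 2) x)) = 0"
    proof (rule kill[OF el_diff[OF ok x hm_el[OF \<Lambda>(1)]]])
      show "cyc m (k + 2) (N m (k + 2) (x - \<Lambda> (d (Suc m) (k + 2) x)))"
        unfolding cyc_def by (intro conjI allI impI hm_el[OF N]) (auto simp: Nl NN dl dL Ny d2(2) hm_zero[OF H(1)])
    qed
    then show "a x = a (\<Lambda> (d (Suc m) (k + 2) x))" by (simp add: hm_lin[OF a(1)])
  qed
  ultimately show ?thesis by (intro bexI[OF _ hm_comp[OF \<Lambda>(1) a(1)]]) simp
qed

text \<open>Since \<open>X (m + 1)\<close> splits, \<open>a = c d\<close> at once, but
  \<open>c\<close> need not factor through the syzygy. Its defect \<open>c N\<close> is a cocycle on
  the next syzygy in a degree lower by one; the induction hypothesis and \<open>rowQ\<close> give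
  \<open>c N = g d N\<close>, and \<open>c - g d\<close> is a solution which vanishes on the image
  of \<open>N\<close>.\<close>

lemma syzygy_hom_exact:
  assumes a: "a \<in> hm (X (Suc m) i) Q" "\<And>x. a (N (Suc m) i x) = 0"
    "\<And>x. a (d (Suc m) (i + 1) x) = 0" and i: "k + 2 \<le> i"
  shows "\<exists>a'\<in>hm (X (Suc m) (i - 1)) Q. (\<forall>x. a' (N (Suc m) (i - 1) x) = 0) \<and>
    (\<forall>x. a x = a' (d (Suc m) i x))"
  using i a
proof (induction i arbitrary: m a rule: int_ge_induct)
  case base
  have e: "k + 2 + 1 = k + 3" "k + 2 - 1 = k + 1" by simp_all
  show ?case using syzygy_hom_exact_bottom[of a m] base unfolding e by blast
next
  case (step i)
  have e: "i + 1 - 1 = i" by simp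
  note dh2 = dh'[of _ "i - 1", simplified] and dd2 = dd'[of _ "i - 1", simplified]
  from hom_exact_of_section[OF col _ ex, of "Suc m" "i + 1" "s m i" a Q] sec step.prems
  obtain c where c: "c \<in> hm (X (Suc m) i) Q" "\<And>x. a x = c (d (Suc m) (i + 1) x)"
    unfolding e by blast
  have c1: "(\<lambda>x. c (N (Suc m) i x)) \<in> hm (X (Suc (Suc m)) i) Q"
    by (rule hm_comp[OF N c(1)])
  have "\<exists>a'\<in>hm (X (Suc (Suc m)) (i - 1)) Q. (\<forall>x. a' (N (Suc (Suc m)) (i - 1) x) = 0) \<and>
    (\<forall>x. c (N (Suc m) i x) = a' (d (Suc (Suc m)) i x))"
  proof (rule step.IH[OF c1])
    show "c (N (Suc m) i (N (Suc (Suc m)) i x)) = 0" for x by (simp add: NN hm_zero[OF c(1)])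
    show "c (N (Suc m) i (d (Suc (Suc m)) (i + 1) x)) = 0" for x
      using c(2)[of "N (Suc m) (i + 1) x"] step.prems(2)[of x] by (simp add: dN')
  qed
  then obtain a1 where a1: "a1 \<in> hm (X (Suc (Suc m)) (i - 1)) Q" "\<And>x. a1 (N (Suc (Suc m)) (i - 1) x) = 0"
    "\<And>x. c (N (Suc m) i x) = a1 (d (Suc (Suc m)) i x)" by blast
  from rowQ[OF a1(1,2)] obtain g where
    g: "g \<in> hm (X (Suc m) (i - 1)) Q" "\<And>x. a1 x = g (N (Suc m) (i - 1) x)" by blast
  have dh3: "d (Suc m) i \<in> hm (X (Suc m) i) (X (Suc m) (i - 1))" by (rule dh)
  have "(\<lambda>x. c x - g (d (Suc m) i x)) \<in> hm (X (Suc m) i) Q"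
    by (intro hm_sub c Q hm_comp[OF dh g(1)])
  moreover have "c (N (Suc m) i x) - g (d (Suc m) i (N (Suc m) i x)) = 0" for x
    by (simp add: dN g(2)[symmetric] a1(3))
  moreover have "a x = c (d (Suc m) (i + 1) x) - g (d (Suc m) i (d (Suc m) (i + 1) x))" for x
    by (simp add: dd' c(2) hm_zero[OF g(1)])
  ultimately show ?case unfolding e by (intro bexI) auto
qed

text \<open>The case \<open>m = 0\<close>, decoded: \<open>a\<close> is encoded as \<open>a\<close>
  after \<open>N 0\<close>, and \<open>rowQ\<close> together with the surjectivity of
  \<open>N 0\<close> turns the answer into a map on \<open>X 0\<close>.\<close>

theorem hom_exact:
  assumes a: "a \<in> hm (X 0 i) Q" "\<And>x. a (d 0 (i + 1) x) = 0" and i: "k + 2 \<le> i"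
  shows "\<exists>c\<in>hm (X 0 (i - 1)) Q. \<forall>x. a x = c (d 0 i x)"
proof -
  have "\<exists>a'\<in>hm (X (Suc 0) (i - 1)) Q. (\<forall>x. a' (N (Suc 0) (i - 1) x) = 0) \<and>
    (\<forall>x. a (N 0 i x) = a' (d (Suc 0) i x))"
    by (rule syzygy_hom_exact[OF hm_comp[OF N a(1)] _ _ i]) (simp_all add: NN hm_zero[OF a(1)] dN'[symmetric] a(2))
  then obtain a' where a': "a' \<in> hm (X (Suc 0) (i - 1)) Q" "\<And>x. a' (N (Suc 0) (i - 1) x) = 0"
    "\<And>x. a (N 0 i x) = a' (d (Suc 0) i x)" by blast
  from rowQ[OF a'(1,2)] obtain g where
    g: "g \<in> hm (X 0 (i - 1)) Q" "\<And>x. a' x = g (N 0 (i - 1) x)" by blast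
  have "a x = g (d 0 i x)" for x
  proof (rule hm_ext[OF a(1) hm_comp[OF dh g(1)] ok])
    fix x assume "el (X 0 i) x"
    then obtain y where "N 0 i y = x" using aug by blast
    then show "a x = g (d 0 i x)" using a'(3)[of y] g(2) by (auto simp: dN)
  qed
  then show ?thesis using g(1) by blast
qed

end

text \<open>A Gorenstein projective object with a finite projective resolution is a summand of the
  first term of that resolution. \<open>A 0\<close> sits between \<open>B 1\<close> and
  \<open>B 0\<close> through \<open>p\<close> and \<open>\<iota>\<close>, as in a complete
  resolution. A lift of \<open>p\<close> through \<open>\<delta> 0\<close> that kills the image of
  \<open>\<beta> 1\<close> extends to \<open>B 0\<close>, and the restriction of this extension
  along \<open>\<iota>\<close> is the section.\<close>

lemma resolution_section:
  fixes A :: "nat \<Rightarrow> ('r, 'v::ab_group_add) object" and B :: "nat \<Rightarrow> ('r, 'w::ab_group_add) object"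
  assumes okA: "\<And>k. obj_ok (A k)" and okB: "\<And>m. obj_ok (B m)"
    and \<delta>: "\<And>k. \<delta> k \<in> hm (A (Suc k)) (A k)" and \<delta>\<delta>: "\<And>k x. \<delta> k (\<delta> (Suc k) x) = 0"
    and exA: "\<And>k x. el (A (Suc k)) x \<Longrightarrow> \<delta> k x = 0 \<Longrightarrow> \<exists>y. \<delta> (Suc k) y = x"
    and augA: "\<And>x. el (A 0) x \<Longrightarrow> \<exists>y. \<delta> 0 y = x"
    and fin: "\<And>k x. D < k \<Longrightarrow> el (A k) x \<Longrightarrow> x = 0"
    and \<beta>: "\<And>m. \<beta> m \<in> hm (B (Suc m)) (B m)" and \<beta>\<beta>: "\<And>m x. \<beta> m (\<beta> (Suc m) x) = 0"
    and BA: "\<And>m k f. f \<in> hm (B (Suc m)) (A (Suc k)) \<Longrightarrow> (\<And>x. f (\<beta> (Suc m) x) = 0) \<Longrightarrow>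
      \<exists>g\<in>hm (B m) (A (Suc k)). \<forall>x. f x = g (\<beta> m x)"
    and lB: "\<And>m k. lifts (B (Suc m)) (A (Suc k)) (A k)"
    and p: "p \<in> hm (B (Suc 0)) (A 0)" "\<And>x. p (\<beta> (Suc 0) x) = 0" "\<And>x. el (A 0) x \<Longrightarrow> \<exists>y. p y = x"
    and \<iota>: "\<iota> \<in> hm (A 0) (B 0)" "\<And>x. \<iota> (p x) = \<beta> 0 x"
  shows "\<exists>\<sigma>\<in>hm (A 0) (A (Suc 0)). \<forall>x. el (A 0) x \<longrightarrow> \<delta> 0 (\<sigma> x) = x"
proof -
  \<comment> \<open>This is the vanishing of Ext between the syzygies of \<open>B\<close> and those
    of \<open>A\<close>, by descending induction from the zero terms. If \<open>e\<close> is any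
    lift of \<open>g\<close>, its defect \<open>e \<beta>\<close> satisfies the hypotheses with
    \<open>k\<close> and \<open>m\<close> raised by one; a lift of the defect, extended along
    \<open>\<beta>\<close>, corrects \<open>e\<close>.\<close>
  have claim: "\<exists>g'\<in>hm (B (Suc m)) (A (Suc k)). (\<forall>x. \<delta> k (g' x) = g x) \<and> (\<forall>x. g' (\<beta> (Suc m) x) = 0)"
    if "g \<in> hm (B (Suc m)) (A k)" "\<And>x. g (\<beta> (Suc m) x) = 0" "\<And>k' x. k = Suc k' \<Longrightarrow> \<delta> k' (g x) = 0"
    for g m k
    using that
  proof (induction "Suc D - k" arbitrary: k m g)
    case 0
    then have "g x = 0" for x using fin[of k] hm_el[OF 0(2)] by simp
    then show ?case by (intro bexI[OF _ hm_0[OF okA]]) (simp add: hm_zero[OF \<delta>])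
  next
    case (Suc n)
    have "\<exists>y. g x = \<delta> k y" for x
      using augA[of "g x"] exA[of "k - 1" "g x"] hm_el[OF Suc(3), of x] Suc(5)[of "k - 1" x]
      by (cases k) (metis, auto, metis)
    from liftsD[OF lB Suc(3) \<delta> this] obtain e where
      e: "e \<in> hm (B (Suc m)) (A (Suc k))" "\<And>x. \<delta> k (e x) = g x" by blast
    have "\<exists>g'\<in>hm (B (Suc (Suc m))) (A (Suc (Suc k))). (\<forall>x. \<delta> (Suc k) (g' x) = e (\<beta> (Suc m) x)) \<and>
      (\<forall>x. g' (\<beta> (Suc (Suc m)) x) = 0)"
      using Suc by (intro Suc(1) hm_comp[OF \<beta> e(1)]) (auto simp: \<beta>\<beta> hm_zero[OF e(1)] e(2))
    then obtain e' where e': "e' \<in> hm (B (Suc (Suc m))) (A (Suc (Suc k)))"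
      "\<And>x. \<delta> (Suc k) (e' x) = e (\<beta> (Suc m) x)" "\<And>x. e' (\<beta> (Suc (Suc m)) x) = 0" by blast
    from BA[OF e'(1,3)] obtain e'' where
      e'': "e'' \<in> hm (B (Suc m)) (A (Suc (Suc k)))" "\<And>x. e' x = e'' (\<beta> (Suc m) x)" by blast
    have "(\<lambda>x. e x - \<delta> (Suc k) (e'' x)) \<in> hm (B (Suc m)) (A (Suc k))"
      by (intro hm_sub e okA hm_comp[OF e''(1) \<delta>])
    then show ?case
      by (intro bexI) (auto simp: hm_lin[OF \<delta>] e(2) \<delta>\<delta> e''(2)[symmetric] e'(2))
  qed
  from claim[OF p(1,2)] obtain g where g: "g \<in> hm (B (Suc 0)) (A (Suc 0))"
    "\<And>x. \<delta> 0 (g x) = p x" "\<And>x. g (\<beta> (Suc 0) x) = 0" by blast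
  from BA[OF g(1,3)] obtain g' where g': "g' \<in> hm (B 0) (A (Suc 0))" "\<And>x. g x = g' (\<beta> 0 x)" by blast
  have "\<delta> 0 (g' (\<iota> x)) = x" if "el (A 0) x" for x
    using p(3)[OF that] \<iota>(2) g(2) g'(2) by metis
  then show ?thesis by (intro bexI[OF _ hm_comp[OF \<iota>(1) g'(1)]]) simp
qed

text \<open>Splitting of cycles is carried from the zero end of the resolution back to
  \<open>A 0\<close>. The step from the \<open>(k + 1)\<close>-st to the \<open>k\<close>-th syzygy
  complex goes through the connecting map \<open>x \<mapsto> d (\<sigma> x)\<close> and so needs the
  splitting one degree lower. At most \<open>D + 1\<close> such steps occur, which is the width of
  the window in the last hypothesis.\<close>

lemma cycle_section_of_resolution:
  fixes A :: "nat \<Rightarrow> int \<Rightarrow> ('r, 'v::ab_group_add) object"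
  assumes col: "\<And>k. cpx (A k) (d k)"
    and \<delta>: "\<And>k i. \<delta> k i \<in> hm (A (Suc k) i) (A k i)" and \<delta>\<delta>: "\<And>k i x. \<delta> k i (\<delta> (Suc k) i x) = 0"
    and d\<delta>: "\<And>k i x. d k i (\<delta> k i x) = \<delta> k (i - 1) (d (Suc k) i x)"
    and row: "\<And>k i x. el (A (Suc k) i) x \<Longrightarrow> \<delta> k i x = 0 \<Longrightarrow> \<exists>y. \<delta> (Suc k) i y = x"
    and fin: "\<And>k i x. D < k \<Longrightarrow> el (A k i) x \<Longrightarrow> x = 0"
    and sec: "\<And>k i. cycle_section (A (Suc k)) (d (Suc k)) i (t k i)"
    and l: "\<And>k i. lifts (A (Suc k) i) (A (Suc (Suc k)) i) (A (Suc k) i)"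
    and \<sigma>0: "\<And>j. i - int (Suc D) \<le> j \<Longrightarrow> j \<le> i \<Longrightarrow>
      \<exists>\<sigma>\<in>hm (A 0 j) (A (Suc 0) j). \<forall>x. el (A 0 j) x \<longrightarrow> \<delta> 0 j (\<sigma> x) = x"
  shows "\<exists>h. cycle_section (A 0) (d 0) i h"
proof -
  note ok = cpx_ok[OF col]
  note dh = cpx_d[OF col] and dd = cpx_dd[OF col]
  \<comment> \<open>All syzygies split degreewise once the augmentation does:
    \<open>id - \<sigma> \<delta>\<close> projects onto the kernel of \<open>\<delta> k\<close>,
    that is, onto the image of the next \<open>\<delta>\<close>, and lifts.\<close>
  have split: "\<exists>\<sigma>\<in>hm (A k j) (A (Suc k) j). \<forall>x. el (A k j) x \<longrightarrow>
      (\<forall>k'. k = Suc k' \<longrightarrow> \<delta> k' j x = 0) \<longrightarrow> \<delta> k j (\<sigma> x) = x"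
    if "i - int (Suc D) \<le> j" "j \<le> i" for j k
  proof (induction k)
    case 0
    then show ?case using \<sigma>0[OF that] by simp
  next
    case (Suc k)
    then obtain \<sigma> where \<sigma>: "\<sigma> \<in> hm (A k j) (A (Suc k) j)"
      "\<And>x. el (A k j) x \<Longrightarrow> (\<And>k'. k = Suc k' \<Longrightarrow> \<delta> k' j x = 0) \<Longrightarrow> \<delta> k j (\<sigma> x) = x" by blast
    let ?f = "\<lambda>x. snd (A (Suc k) j) x - \<sigma> (\<delta> k j x)"
    have f: "?f \<in> hm (A (Suc k) j) (A (Suc k) j)"
      by (intro hm_sub obj_okI ok hm_comp[OF \<delta> \<sigma>(1)])
    have "\<delta> k j (\<sigma> (\<delta> k j x)) = \<delta> k j x" for x
      by (rule \<sigma>(2)[OF hm_el[OF \<delta>]]) (simp add: \<delta>\<delta>)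
    then have "\<delta> k j (?f x) = 0" for x by (simp add: hm_lin[OF \<delta>] hm_src[OF \<delta>])
    then have "\<exists>y. ?f x = \<delta> (Suc k) j y" for x
      using row[OF hm_el[OF f], of x] by metis
    from liftsD[OF l f \<delta> this] obtain h where
      h: "h \<in> hm (A (Suc k) j) (A (Suc (Suc k)) j)" "\<And>x. \<delta> (Suc k) j (h x) = ?f x" by blast
    then show ?case by (intro bexI[OF _ h(1)]) (simp add: el_def hm_zero[OF \<sigma>(1)])
  qed
  have "\<exists>\<theta>\<in>hm (A k i') (A k (i' + 1)). \<forall>x. el (A k i') x \<longrightarrow> d k i' x = 0 \<longrightarrow>
      (\<forall>k'. k = Suc k' \<longrightarrow> \<delta> k' i' x = 0) \<longrightarrow>
      d k (i' + 1) (\<theta> x) = x \<and> (\<forall>k'. k = Suc k' \<longrightarrow> \<delta> k' (i' + 1) (\<theta> x) = 0)"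
    if "k \<le> Suc D" "i - int k \<le> i'" "i' \<le> i" for k i'
    using that
  proof (induction "Suc D - k" arbitrary: k i')
    case 0
    then have "el (A k i') x \<Longrightarrow> x = 0" for x using fin[of k i'] by simp
    then show ?case
      by (intro bexI[OF _ hm_0[OF ok]]) (auto simp: hm_zero[OF \<delta>] hm_zero[OF cpx_d'[OF col]])
  next
    case (Suc n)
    have w: "n = Suc D - Suc k" "Suc k \<le> Suc D" "i - int (Suc k) \<le> i' - 1" "i' - 1 \<le> i" using Suc by auto
    from Suc(1)[OF w] obtain \<theta> where \<theta>: "\<theta> \<in> hm (A (Suc k) (i' - 1)) (A (Suc k) i')"
      "\<And>x. el (A (Suc k) (i' - 1)) x \<Longrightarrow> d (Suc k) (i' - 1) x = 0 \<Longrightarrow> \<delta> k (i' - 1) x = 0 \<Longrightarrow>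
        d (Suc k) i' (\<theta> x) = x"
      "\<And>x. el (A (Suc k) (i' - 1)) x \<Longrightarrow> d (Suc k) (i' - 1) x = 0 \<Longrightarrow> \<delta> k (i' - 1) x = 0 \<Longrightarrow>
        \<delta> k i' (\<theta> x) = 0"
      by auto
    have "i - int (Suc D) \<le> i'" "i' \<le> i" using Suc by auto
    from split[OF this] obtain \<sigma> where \<sigma>: "\<sigma> \<in> hm (A k i') (A (Suc k) i')"
      "\<And>x. el (A k i') x \<Longrightarrow> (\<And>k'. k = Suc k' \<Longrightarrow> \<delta> k' i' x = 0) \<Longrightarrow> \<delta> k i' (\<sigma> x) = x" by blast
    let ?t = "t k i'"
    have t: "?t \<in> hm (A (Suc k) i') (A (Suc k) (i' + 1))"
      "\<And>x. el (A (Suc k) i') x \<Longrightarrow> d (Suc k) i' x = 0 \<Longrightarrow> d (Suc k) (i' + 1) (?t x) = x"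
      using sec[of k i'] by (auto simp: cycle_section_def)
    \<comment> \<open>The correction by \<open>\<theta>\<close> turns the lift
      \<open>\<sigma> x\<close> into a cycle over \<open>x\<close>, to which the section
      \<open>?t\<close> of the split complex \<open>A (k + 1)\<close> applies.\<close>
    let ?z = "\<lambda>x. \<sigma> x - \<theta> (d (Suc k) i' (\<sigma> x))"
    have z: "?z \<in> hm (A k i') (A (Suc k) i')"
      by (intro hm_sub \<sigma> ok hm_comp[OF hm_comp[OF \<sigma>(1) dh] \<theta>(1)])
    show ?case
    proof (intro bexI[of _ "\<lambda>x. \<delta> k (i' + 1) (?t (?z x))"] allI impI)
      show "(\<lambda>x. \<delta> k (i' + 1) (?t (?z x))) \<in> hm (A k i') (A k (i' + 1))"
        by (rule hm_comp[OF hm_comp[OF z t(1)] \<delta>])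
      fix x assume x: "el (A k i') x" "d k i' x = 0" "\<forall>k'. k = Suc k' \<longrightarrow> \<delta> k' i' x = 0"
      have s: "\<delta> k i' (\<sigma> x) = x" using \<sigma>(2)[OF x(1)] x(3) by blast
      let ?y = "d (Suc k) i' (\<sigma> x)"
      have y: "el (A (Suc k) (i' - 1)) ?y" "d (Suc k) (i' - 1) ?y = 0" "\<delta> k (i' - 1) ?y = 0"
        using hm_el[OF dh] by (auto simp: dd d\<delta>[symmetric] s x(2))
      have "d (Suc k) i' (?z x) = 0" using \<theta>(2)[OF y] by (simp add: hm_lin[OF dh])
      then have "d (Suc k) (i' + 1) (?t (?z x)) = ?z x" using t(2) hm_el[OF z] by blast
      then have "d k (i' + 1) (\<delta> k (i' + 1) (?t (?z x))) = \<delta> k i' (?z x)"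
        using d\<delta>[of k "i' + 1" "?t (?z x)"] by simp
      also have "\<dots> = x" using \<theta>(3)[OF y] by (simp add: hm_lin[OF \<delta>] s)
      finally show "d k (i' + 1) (\<delta> k (i' + 1) (?t (?z x))) = x \<and>
        (\<forall>k'. k = Suc k' \<longrightarrow> \<delta> k' (i' + 1) (\<delta> k (i' + 1) (?t (?z x))) = 0)" by (auto simp: \<delta>\<delta>)
    qed
  qed
  from this[of 0 i] show ?thesis unfolding cycle_section_def by auto
qed

section \<open>Realising modules as direct summands of one abelian group\<close>

text \<open>
  The product of all abelian groups on the type \<open>'m\<close>.  Every module on \<open>'m\<close> is a summand of it, which
  turns the record-based modules into objects over a single type of class \<open>ab_group_add\<close>.
\<close>

typedef ('r, 'm) amb = "{\<phi> :: ('r, 'm) module \<Rightarrow> 'm.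
    \<forall>A. if abelian_group A then \<phi> A \<in> carrier A else \<phi> A = undefined}"
  by (intro exI[of _ "\<lambda>A. if abelian_group A then \<zero>\<^bsub>A\<^esub> else undefined"])
    (auto simp: abelian_group_def abelian_monoid.zero_closed)

text \<open>Coordinates at records that are no abelian groups are frozen, so that equality can be
  tested on the remaining ones.\<close>

definition mk_amb :: "(('r, 'm) module \<Rightarrow> 'm) \<Rightarrow> ('r, 'm) amb" where
  "mk_amb \<phi> = Abs_amb (\<lambda>A. if abelian_group A then \<phi> A else undefined)"

definition prj :: "('r, 'm) module \<Rightarrow> ('r, 'm) amb \<Rightarrow> 'm" where
  "prj A x = Rep_amb x A"

lemma prj_mk: "(\<And>B. abelian_group B \<Longrightarrow> \<phi> B \<in> carrier B) \<Longrightarrow> abelian_group A \<Longrightarrow> prj A (mk_amb \<phi>) = \<phi> A"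
  unfolding prj_def mk_amb_def by (subst Abs_amb_inverse) auto

lemma prj_closed: "abelian_group A \<Longrightarrow> prj A x \<in> carrier A"
  using Rep_amb[of x] by (auto simp: prj_def split: if_splits)

lemma amb_eqI: "(\<And>A. abelian_group A \<Longrightarrow> prj A x = prj A y) \<Longrightarrow> x = y"
  using Rep_amb[of x] Rep_amb[of y] unfolding prj_def
  by (intro Rep_amb_inject[THEN iffD1] ext) (simp split: if_splits, metis)

instantiation amb :: (type, type) ab_group_add
begin
definition "0 = mk_amb (\<lambda>A. \<zero>\<^bsub>A\<^esub>)"
definition "x + y = mk_amb (\<lambda>A. prj A x \<oplus>\<^bsub>A\<^esub> prj A y)"
definition "- x = mk_amb (\<lambda>A. \<ominus>\<^bsub>A\<^esub> prj A x)"
definition "x - y = mk_amb (\<lambda>A. prj A x \<ominus>\<^bsub>A\<^esub> prj A y)" for x :: "('a, 'b) amb"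

lemma prj_zero: "abelian_group A \<Longrightarrow> prj A (0 :: ('a, 'b) amb) = \<zero>\<^bsub>A\<^esub>"
  unfolding zero_amb_def by (subst prj_mk) (auto intro: abelian_group.axioms(1) abelian_monoid.zero_closed)

lemma prj_add: "abelian_group A \<Longrightarrow> prj A (x + y :: ('a, 'b) amb) = prj A x \<oplus>\<^bsub>A\<^esub> prj A y"
  unfolding plus_amb_def
  by (subst prj_mk) (auto intro: abelian_group.axioms(1) abelian_monoid.a_closed prj_closed)

lemma prj_uminus: "abelian_group A \<Longrightarrow> prj A (- x :: ('a, 'b) amb) = \<ominus>\<^bsub>A\<^esub> prj A x"
  unfolding uminus_amb_def by (subst prj_mk) (auto intro: abelian_group.a_inv_closed prj_closed)

lemma prj_minus: "abelian_group A \<Longrightarrow> prj A (x - y :: ('a, 'b) amb) = prj A x \<ominus>\<^bsub>A\<^esub> prj A y"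
  unfolding minus_amb_def by (subst prj_mk) (auto intro: abelian_group.minus_closed prj_closed)

instance
proof
  fix a b c :: "('a, 'b) amb"
  note p = prj_add prj_zero prj_uminus prj_minus
  show "a + b + c = a + (b + c)"
    by (rule amb_eqI) (simp add: p prj_closed abelian_monoid.a_assoc abelian_group.axioms(1))
  show "a + b = b + a"
    by (rule amb_eqI) (simp add: p prj_closed abelian_monoid.a_comm abelian_group.axioms(1))
  show "0 + a = a"
    by (rule amb_eqI) (simp add: p prj_closed abelian_monoid.l_zero abelian_group.axioms(1))
  show "- a + a = 0"
    by (rule amb_eqI) (simp add: p prj_closed abelian_group.l_neg)
  show "a - b = a + - b"
    by (rule amb_eqI) (simp add: p prj_closed a_minus_def)
qed
end

definition emb :: "('r, 'm) module \<Rightarrow> 'm \<Rightarrow> ('r, 'm) amb" where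
  "emb A x = mk_amb (\<lambda>B. if B = A \<and> x \<in> carrier A then x else \<zero>\<^bsub>B\<^esub>)"

text \<open>One action serves all objects: scalars outside the ring and coordinates that are no
  \<open>R\<close>-modules give zero. It is therefore additive everywhere, and homomorphisms can be
  required to commute with every element of the scalar type.\<close>

definition scl :: "('r, 'x) ring_scheme \<Rightarrow> 'r \<Rightarrow> ('r, 'm) amb \<Rightarrow> ('r, 'm) amb" where
  "scl R r x = mk_amb (\<lambda>B. if left_module R B \<and> r \<in> carrier R then r \<odot>\<^bsub>B\<^esub> prj B x else \<zero>\<^bsub>B\<^esub>)"

definition mobj :: "('r, 'x) ring_scheme \<Rightarrow> ('r, 'm) module \<Rightarrow> ('r, ('r, 'm) amb) object" where
  "mobj R A = (scl R, \<lambda>x. emb A (prj A x))"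

definition mmap :: "('r, 'm) module \<Rightarrow> ('r, 'm) module \<Rightarrow> ('m \<Rightarrow> 'm) \<Rightarrow> ('r, 'm) amb \<Rightarrow> ('r, 'm) amb" where
  "mmap A B f = (\<lambda>x. emb B (f (prj A x)))"

lemma lm_ag: "left_module R A \<Longrightarrow> abelian_group A"
  by (simp add: left_module_def)

lemma lm_ring: "left_module R A \<Longrightarrow> ring R"
  by (simp add: left_module_def)

lemmas ag_zero = abelian_monoid.zero_closed[OF abelian_group.axioms(1)]

lemma prj_emb: "abelian_group B \<Longrightarrow> prj B (emb A x) = (if B = A \<and> x \<in> carrier A then x else \<zero>\<^bsub>B\<^esub>)"
  unfolding emb_def by (subst prj_mk) (auto intro: ag_zero)

lemma prj_scl: "abelian_group B \<Longrightarrow>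
    prj B (scl R r x) = (if left_module R B \<and> r \<in> carrier R then r \<odot>\<^bsub>B\<^esub> prj B x else \<zero>\<^bsub>B\<^esub>)"
  unfolding scl_def
  by (subst prj_mk) (auto intro: ag_zero left_module.smult_closed prj_closed)

lemma emb_prj_emb: "abelian_group A \<Longrightarrow> x \<in> carrier A \<Longrightarrow> prj A (emb A x) = x"
  by (simp add: prj_emb)

lemma emb_add: "abelian_group A \<Longrightarrow> x \<in> carrier A \<Longrightarrow> y \<in> carrier A \<Longrightarrow>
    emb A (x \<oplus>\<^bsub>A\<^esub> y) = emb A x + emb A y"
  by (rule amb_eqI)
    (auto simp: prj_emb prj_add abelian_monoid.a_closed[OF abelian_group.axioms(1)]
      abelian_monoid.l_zero[OF abelian_group.axioms(1)] ag_zero)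

lemma emb_zero: "abelian_group A \<Longrightarrow> emb A \<zero>\<^bsub>A\<^esub> = 0"
  by (rule amb_eqI) (auto simp: prj_emb prj_zero)

lemma emb_uminus: "abelian_group A \<Longrightarrow> x \<in> carrier A \<Longrightarrow> emb A (\<ominus>\<^bsub>A\<^esub> x) = - emb A x"
  using emb_add[of A x "\<ominus>\<^bsub>A\<^esub> x"]
  by (simp add: abelian_group.r_neg abelian_group.a_inv_closed emb_zero eq_neg_iff_add_eq_0 add.commute)

lemma emb_inj: "abelian_group A \<Longrightarrow> x \<in> carrier A \<Longrightarrow> y \<in> carrier A \<Longrightarrow> emb A x = emb A y \<longleftrightarrow> x = y"
  by (metis emb_prj_emb)

lemma emb_eq_zero: "abelian_group A \<Longrightarrow> x \<in> carrier A \<Longrightarrow> emb A x = 0 \<longleftrightarrow> x = \<zero>\<^bsub>A\<^esub>"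
  by (metis emb_inj emb_zero ag_zero)

lemma lm_smult_zero: "left_module R A \<Longrightarrow> r \<in> carrier R \<Longrightarrow> r \<odot>\<^bsub>A\<^esub> \<zero>\<^bsub>A\<^esub> = \<zero>\<^bsub>A\<^esub>"
proof -
  assume A: "left_module R A" and r: "r \<in> carrier R"
  interpret left_module R A by fact
  have "r \<odot>\<^bsub>A\<^esub> \<zero>\<^bsub>A\<^esub> \<oplus>\<^bsub>A\<^esub> r \<odot>\<^bsub>A\<^esub> \<zero>\<^bsub>A\<^esub> = r \<odot>\<^bsub>A\<^esub> \<zero>\<^bsub>A\<^esub>"
    using smult_add_right[OF r M.zero_closed M.zero_closed] by simp
  then show ?thesis using r
    by (metis M.add.l_cancel_one' M.zero_closed smult_closed)
qed

lemma scl_emb: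
  assumes "left_module R A" "r \<in> carrier R" "x \<in> carrier A"
  shows "scl R r (emb A x) = emb A (r \<odot>\<^bsub>A\<^esub> x)"
  using assms by (intro amb_eqI) (auto simp: prj_scl prj_emb left_module.smult_closed lm_smult_zero)

lemma scl_add: "scl R r (x + y) = scl R r x + scl R r y"
  by (rule amb_eqI)
    (auto simp: prj_scl prj_add left_module.smult_add_right prj_closed
      abelian_monoid.l_zero[OF abelian_group.axioms(1)] ag_zero)

lemma el_mobj: "el (mobj R A) x \<longleftrightarrow> emb A (prj A x) = x"
  by (simp add: el_def mobj_def)

lemma el_emb: "abelian_group A \<Longrightarrow> x \<in> carrier A \<Longrightarrow> el (mobj R A) (emb A x)"
  by (simp add: el_mobj prj_emb)

lemma elE:
  assumes "el (mobj R A) x" "abelian_group A"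
  obtains y where "y \<in> carrier A" "x = emb A y"
  using assms prj_closed[of A x] by (metis el_mobj)

lemma obj_ok_mobj:
  assumes A: "left_module R A"
  shows "obj_ok (mobj R A)"
proof -
  note a = lm_ag[OF A]
  have "emb A (prj A (scl R r x)) = scl R r (emb A (prj A x))" for r x
  proof (cases "r \<in> carrier R")
    case True
    then show ?thesis by (simp add: scl_emb A prj_closed a prj_scl)
  next
    case False
    then have "scl R r y = 0" for y :: "('a, 'c) amb"
      by (intro amb_eqI) (simp add: prj_scl prj_zero)
    then show ?thesis by (simp add: prj_zero a emb_zero)
  qed
  then show ?thesis
    by (simp add: obj_ok_def hm_def mobj_def scl_add prj_add a emb_add prj_closed emb_prj_emb)
qed

lemma lmod_homD:
  assumes "f \<in> lmod_hom R A B"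
  shows lh_closed: "x \<in> carrier A \<Longrightarrow> f x \<in> carrier B"
    and lh_add: "x \<in> carrier A \<Longrightarrow> y \<in> carrier A \<Longrightarrow> f (x \<oplus>\<^bsub>A\<^esub> y) = f x \<oplus>\<^bsub>B\<^esub> f y"
    and lh_smult: "r \<in> carrier R \<Longrightarrow> x \<in> carrier A \<Longrightarrow> f (r \<odot>\<^bsub>A\<^esub> x) = r \<odot>\<^bsub>B\<^esub> f x"
    and lh_ext: "f \<in> extensional (carrier A)"
  using assms unfolding lmod_hom_def hom_def by auto

lemma lmod_homI:
  assumes "\<And>x. x \<in> carrier A \<Longrightarrow> f x \<in> carrier B"
    and "\<And>x y. x \<in> carrier A \<Longrightarrow> y \<in> carrier A \<Longrightarrow> f (x \<oplus>\<^bsub>A\<^esub> y) = f x \<oplus>\<^bsub>B\<^esub> f y"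
    and "\<And>r x. r \<in> carrier R \<Longrightarrow> x \<in> carrier A \<Longrightarrow> f (r \<odot>\<^bsub>A\<^esub> x) = r \<odot>\<^bsub>B\<^esub> f x"
    and "f \<in> extensional (carrier A)"
  shows "f \<in> lmod_hom R A B"
  using assms unfolding lmod_hom_def hom_def by auto

lemma scl_outside: "r \<notin> carrier R \<Longrightarrow> scl R r x = 0"
  by (intro amb_eqI) (simp add: prj_scl prj_zero)

lemma lh_zero:
  assumes "f \<in> lmod_hom R A B" "abelian_group A" "abelian_group B"
  shows "f \<zero>\<^bsub>A\<^esub> = \<zero>\<^bsub>B\<^esub>"
proof -
  interpret A: abelian_group A by fact
  interpret B: abelian_group B by fact
  have "f \<zero>\<^bsub>A\<^esub> \<oplus>\<^bsub>B\<^esub> f \<zero>\<^bsub>A\<^esub> = f \<zero>\<^bsub>A\<^esub>"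
    using lh_add[OF assms(1), of "\<zero>\<^bsub>A\<^esub>" "\<zero>\<^bsub>A\<^esub>"] by simp
  then show ?thesis using lh_closed[OF assms(1), of "\<zero>\<^bsub>A\<^esub>"]
    by (metis A.zero_closed B.add.l_cancel_one')
qed

lemma mmap_hm:
  assumes A: "left_module R A" and B: "left_module R B" and f: "f \<in> lmod_hom R A B"
  shows "mmap A B f \<in> hm (mobj R A) (mobj R B)"
proof -
  note a = lm_ag[OF A] and b = lm_ag[OF B]
  have "emb B (f (prj A (scl R r x))) = scl R r (emb B (f (prj A x)))" for r x
    by (cases "r \<in> carrier R")
      (simp_all add: A B a b prj_closed scl_emb lh_closed[OF f] prj_scl lh_smult[OF f] scl_outside
        lh_zero[OF f a b] emb_zero prj_zero)
  then show ?thesis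
    by (simp add: hm_def mmap_def mobj_def prj_add a b emb_add prj_closed emb_prj_emb
        lh_closed[OF f] lh_add[OF f])
qed

lemma mmap_emb: "abelian_group A \<Longrightarrow> x \<in> carrier A \<Longrightarrow> mmap A B f (emb A x) = emb B (f x)"
  by (simp add: mmap_def emb_prj_emb)

text \<open>The passage from modules to objects is full, so maps constructed in \<open>hm\<close>
  can be read back as module homomorphisms.\<close>

lemma hm_mmap:
  assumes A: "left_module R A" and B: "left_module R B" and F: "F \<in> hm (mobj R A) (mobj R B)"
  obtains f where "f \<in> lmod_hom R A B" "F = mmap A B f"
proof
  note a = lm_ag[OF A] and b = lm_ag[OF B]
  let ?f = "\<lambda>x\<in>carrier A. prj B (F (emb A x))"
  have s: "F (scl R r x) = scl R r (F x)" for r x using F by (simp add: hm_def mobj_def)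
  have t: "emb B (prj B (F x)) = F x" and t': "F (emb A (prj A x)) = F x" for x
    using hm_tgt[OF F] hm_src[OF F] by (simp_all add: mobj_def)
  show "?f \<in> lmod_hom R A B"
    by (rule lmod_homI)
      (simp_all add: a b A B prj_closed abelian_monoid.a_closed[OF abelian_group.axioms(1)] emb_add
        hm_add[OF F] prj_add left_module.smult_closed[OF A] scl_emb[OF A, symmetric] s prj_scl)
  show "F = mmap A B ?f"
    by (rule ext) (simp add: mmap_def prj_closed a t t')
qed

section \<open>Lifting along surjections of small objects\<close>

text \<open>
  The objects that are isomorphic to a module on the type \<open>'m\<close>; projectivity can only be tested
  against these.
\<close>

definition good :: "'m itself \<Rightarrow> ('r, 'x) ring_scheme \<Rightarrow> ('r, 'v::ab_group_add) object \<Rightarrow> bool" where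
  "good U R X \<longleftrightarrow> obj_ok X \<and> (\<forall>x. el X x \<longrightarrow> fst X \<one>\<^bsub>R\<^esub> x = x) \<and>
    (\<forall>r\<in>carrier R. \<forall>s\<in>carrier R. \<forall>x. fst X (r \<oplus>\<^bsub>R\<^esub> s) x = fst X r x + fst X s x \<and>
      fst X (r \<otimes>\<^bsub>R\<^esub> s) x = fst X r (fst X s x)) \<and>
    (\<forall>r x. r \<notin> carrier R \<longrightarrow> fst X r x = 0) \<and> {x. el X x} \<lesssim> (UNIV :: 'm set)"

lemma good_mobj:
  fixes A :: "('r, 'm) module"
  assumes A: "left_module R A"
  shows "good TYPE('m) R (mobj R A)"
proof -
  note a = lm_ag[OF A]
  interpret R: ring R using lm_ring[OF A] .
  have "scl R (r \<oplus>\<^bsub>R\<^esub> s) x = scl R r x + scl R s x \<and> scl R (r \<otimes>\<^bsub>R\<^esub> s) x = scl R r (scl R s x)"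
    if "r \<in> carrier R" "s \<in> carrier R" for r s and x :: "('r, 'm) amb"
    using that
    by (intro conjI amb_eqI) (simp_all add: prj_scl prj_add left_module.smult_add_left left_module.smult_mult
        prj_closed abelian_monoid.l_zero[OF abelian_group.axioms(1)] ag_zero)
  moreover have "scl R \<one>\<^bsub>R\<^esub> (emb A y) = emb A y" if "y \<in> carrier A" for y
    using that by (simp add: scl_emb A left_module.smult_unit)
  moreover have "inj_on (prj A) {x. el (mobj R A) x}"
    by (rule inj_onI) (metis el_mobj mem_Collect_eq)
  then have "{x. el (mobj R A) x} \<lesssim> (UNIV :: 'm set)"
    unfolding lepoll_def by auto
  moreover have "scl R \<one>\<^bsub>R\<^esub> x = x" if "el (mobj R A) x" for x
    using that by (rule elE[OF _ a]) (use calculation in auto)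
  ultimately show ?thesis
    using obj_ok_mobj[OF A] unfolding good_def by (simp add: mobj_def scl_outside)
qed

text \<open>Here the infinity of \<open>'m\<close> enters: a sum of two objects that are no larger
  than \<open>'m\<close> is again no larger than \<open>'m\<close>.\<close>

lemma good_osum:
  assumes inf: "infinite (UNIV :: 'm set)" and A: "good TYPE('m) R A" and B: "good TYPE('m) R B"
  shows "good TYPE('m) R (osum A B)"
proof -
  have "{x. el (osum A B) x} = {x. el A x} \<times> {x. el B x}" by (auto simp: el_osum)
  also have "\<dots> \<lesssim> (UNIV :: 'm set) \<times> (UNIV :: 'm set)"
    using A B by (intro times_lepoll_mono) (auto simp: good_def)
  also have "\<dots> \<lesssim> (UNIV :: 'm set)"
  proof -
    have "(card_of ((UNIV :: 'm set) \<times> (UNIV :: 'm set)), card_of (UNIV :: 'm set)) \<in> ordIso"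
      using inf by (rule card_of_Times_same_infinite)
    then obtain f where "bij_betw f ((UNIV :: 'm set) \<times> (UNIV :: 'm set)) (UNIV :: 'm set)"
      using card_of_ordIso by blast
    then show ?thesis unfolding lepoll_def bij_betw_def by blast
  qed
  finally have "Collect (el (osum A B)) \<lesssim> (UNIV :: 'm set)" .
  moreover have "fst (osum A B) r x = (fst A r (fst x), fst B r (snd x))" for r x
    by (simp add: osum_def map_prod_def split_beta)
  ultimately show ?thesis using A B unfolding good_def
    by (simp add: obj_ok_osum el_osum zero_prod_def)
qed

text \<open>Renaming the elements of \<open>S\<close> along \<open>e\<close> produces a module
  record on \<open>'m\<close>, to which the definition of projectivity applies.\<close>

lemma transport_left_module:
  fixes S :: "'w::ab_group_add set" and b :: "'r \<Rightarrow> 'w \<Rightarrow> 'w" and e :: "'w \<Rightarrow> 'm"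
  assumes R: "ring R" and S: "0 \<in> S" "\<And>x y. x \<in> S \<Longrightarrow> y \<in> S \<Longrightarrow> x + y \<in> S" "\<And>x. x \<in> S \<Longrightarrow> - x \<in> S"
    and b: "\<And>r x. r \<in> carrier R \<Longrightarrow> x \<in> S \<Longrightarrow> b r x \<in> S"
      "\<And>r x y. r \<in> carrier R \<Longrightarrow> x \<in> S \<Longrightarrow> y \<in> S \<Longrightarrow> b r (x + y) = b r x + b r y"
      "\<And>r s x. r \<in> carrier R \<Longrightarrow> s \<in> carrier R \<Longrightarrow> x \<in> S \<Longrightarrow> b (r \<oplus>\<^bsub>R\<^esub> s) x = b r x + b s x"
      "\<And>r s x. r \<in> carrier R \<Longrightarrow> s \<in> carrier R \<Longrightarrow> x \<in> S \<Longrightarrow> b (r \<otimes>\<^bsub>R\<^esub> s) x = b r (b s x)"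
      "\<And>x. x \<in> S \<Longrightarrow> b \<one>\<^bsub>R\<^esub> x = x"
    and e: "inj_on e S"
  obtains B :: "('r, 'm) module" where "left_module R B" "carrier B = e ` S"
    "\<And>x y. x \<in> S \<Longrightarrow> y \<in> S \<Longrightarrow> e x \<oplus>\<^bsub>B\<^esub> e y = e (x + y)"
    "\<And>r x. x \<in> S \<Longrightarrow> r \<odot>\<^bsub>B\<^esub> e x = e (b r x)"
proof -
  define \<rho> where "\<rho> = inv_into S e"
  have \<rho>: "\<rho> (e x) = x" if "x \<in> S" for x using that e by (simp add: \<rho>_def)
  define B :: "('r, 'm) module" where
    "B = \<lparr>carrier = e ` S, mult = (\<lambda>x y. x), one = e 0, zero = e 0, add = (\<lambda>x y. e (\<rho> x + \<rho> y)),
      smult = (\<lambda>r x. e (b r (\<rho> x)))\<rparr>"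
  have "abelian_group B"
  proof (rule abelian_groupI)
    fix x assume "x \<in> carrier B"
    then obtain y where "y \<in> S" "x = e y" by (auto simp: B_def)
    then show "\<exists>y\<in>carrier B. y \<oplus>\<^bsub>B\<^esub> x = \<zero>\<^bsub>B\<^esub>"
      using S by (intro bexI[of _ "e (- y)"]) (auto simp: B_def \<rho>)
  qed (use S in \<open>auto simp: B_def \<rho> algebra_simps\<close>)
  then have "left_module R B"
    by (intro left_module.intro R left_module_axioms.intro) (use S b in \<open>auto simp: B_def \<rho>\<close>)
  then show ?thesis by (rule that) (auto simp: B_def \<rho>)
qed

text \<open>The lifting problem is moved to modules on \<open>'m\<close>: \<open>BX\<close> is a
  copy of \<open>X\<close>, and \<open>BY\<close> is a copy of the image of \<open>g\<close> rather
  than of \<open>Y\<close>, so that \<open>Y\<close> may have any size.\<close>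

lemma projective_lifts:
  fixes A :: "('r, 'm) module" and X :: "('r, 'v::ab_group_add) object"
    and Y :: "('r, 'w::ab_group_add) object"
  assumes P: "projective_lmodule R A" and X: "good TYPE('m) R X"
  shows "lifts (mobj R A) X Y"
  unfolding lifts_def
proof (intro ballI impI)
  fix f g assume f: "f \<in> hm (mobj R A) Y" and g: "g \<in> hm X Y" and fg: "\<forall>x. \<exists>y. f x = g y"
  have A: "left_module R A" using P by (simp add: projective_lmodule_def)
  note a = lm_ag[OF A]
  have R: "ring R" using lm_ring[OF A] .
  have okX: "obj_ok X" using X by (simp add: good_def)
  let ?S = "{x. el X x}"
  obtain e :: "'v \<Rightarrow> 'm" where e: "inj_on e ?S"
    using X unfolding good_def lepoll_def by auto
  have eact: "el X (fst X r x)" if "el X x" for r x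
    using that obj_okI[OF okX] by (simp add: el_def hm_def)
  have S: "0 \<in> ?S" "\<And>x y. x \<in> ?S \<Longrightarrow> y \<in> ?S \<Longrightarrow> x + y \<in> ?S" "\<And>x. x \<in> ?S \<Longrightarrow> - x \<in> ?S"
    using el_zero[OF okX] el_add[OF okX] el_minus[OF okX] by auto
  obtain BX :: "('r, 'm) module" where BX: "left_module R BX" "carrier BX = e ` ?S"
    "\<And>x y. x \<in> ?S \<Longrightarrow> y \<in> ?S \<Longrightarrow> e x \<oplus>\<^bsub>BX\<^esub> e y = e (x + y)"
    "\<And>r x. x \<in> ?S \<Longrightarrow> r \<odot>\<^bsub>BX\<^esub> e x = e (fst X r x)"
    by (rule transport_left_module[OF R S, of "fst X" e])
      (use X e eact in \<open>auto simp: good_def obj_ok_def\<close>)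
  let ?T = "g ` ?S"
  have gact: "fst Y r (g x) = g (fst X r x)" for r x using g by (simp add: hm_def)
  \<comment> \<open>A choice of preimages embeds the image of \<open>g\<close> into \<open>X\<close>
    and thereby into \<open>'m\<close>.\<close>
  define c where "c = inv_into ?S g"
  have c: "c y \<in> ?S" "g (c y) = y" if "y \<in> ?T" for y
    using inv_into_into[OF that] f_inv_into_f[OF that] by (simp_all add: c_def)
  have ec: "inj_on (\<lambda>y. e (c y)) ?T"
  proof (rule inj_onI)
    fix y z assume yz: "y \<in> ?T" "z \<in> ?T" "e (c y) = e (c z)"
    then have "c y = c z" using e c(1) unfolding inj_on_def by blast
    then show "y = z" using c(2) yz by metis
  qed
  have T: "0 \<in> ?T" "\<And>x y. x \<in> ?T \<Longrightarrow> y \<in> ?T \<Longrightarrow> x + y \<in> ?T" "\<And>x. x \<in> ?T \<Longrightarrow> - x \<in> ?T"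
  proof -
    show "0 \<in> ?T" using S(1) hm_zero[OF g] by (metis imageI)
    show "x + y \<in> ?T" if "x \<in> ?T" "y \<in> ?T" for x y
      using that S(2) by (auto simp: hm_add[OF g, symmetric])
    show "- x \<in> ?T" if "x \<in> ?T" for x
      using that S(3) by (auto simp del: hm_minus[OF g] simp: hm_minus[OF g, symmetric])
  qed
  obtain BY :: "('r, 'm) module" where BY: "left_module R BY" "carrier BY = (\<lambda>y. e (c y)) ` ?T"
    "\<And>x y. x \<in> ?T \<Longrightarrow> y \<in> ?T \<Longrightarrow> e (c x) \<oplus>\<^bsub>BY\<^esub> e (c y) = e (c (x + y))"
    "\<And>r x. x \<in> ?T \<Longrightarrow> r \<odot>\<^bsub>BY\<^esub> e (c x) = e (c (fst Y r x))"
    by (rule transport_left_module[OF R T, of "fst Y" "\<lambda>y. e (c y)"])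
      (use X ec in \<open>auto simp: good_def obj_ok_def gact hm_add[OF g, symmetric] intro!: imageI eact\<close>)
  define \<rho> where "\<rho> = inv_into ?S e"
  have \<rho>: "\<rho> (e x) = x" if "x \<in> ?S" for x using that e by (simp add: \<rho>_def)
  let ?g = "\<lambda>t\<in>carrier BX. e (c (g (\<rho> t)))"
  let ?f = "\<lambda>t\<in>carrier A. e (c (f (emb A t)))"
  have fT: "f x \<in> ?T" for x
    using fg el_snd[OF okX] hm_src[OF g] by (metis imageI mem_Collect_eq)
  have fact: "f (scl R r x) = fst Y r (f x)" for r x using f by (simp add: hm_def mobj_def)
  have ei: "e x = e y \<longleftrightarrow> x = y" if "el X x" "el X y" for x y
    using e that unfolding inj_on_def by blast
  have "?g \<in> lmod_hom R BX BY"
    by (rule lmod_homI) (auto simp: BX BY \<rho> S eact hm_add[OF g] gact el_add[OF okX] ei)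
  moreover have "?g ` carrier BX = carrier BY"
    by (auto simp: BX(2) BY(2) \<rho> image_image)
  moreover have "?f \<in> lmod_hom R A BY"
    by (rule lmod_homI)
      (simp_all add: BY fT a A emb_add hm_add[OF f] scl_emb[OF A, symmetric] fact left_module.smult_closed[OF A]
        abelian_monoid.a_closed[OF abelian_group.axioms(1)])
  ultimately obtain h where h: "h \<in> lmod_hom R A BX" "compose (carrier A) ?g h = ?f"
    using P BX(1) BY(1) unfolding projective_lmodule_def by blast
  have hX: "h t \<in> e ` ?S" if "t \<in> carrier A" for t using lh_closed[OF h(1) that] BX(2) by simp
  have gh: "g (\<rho> (h t)) = f (emb A t)" if t: "t \<in> carrier A" for t
  proof -
    have "e (c (g (\<rho> (h t)))) = e (c (f (emb A t)))"
      using fun_cong[OF h(2), of t] t hX[OF t] BX(2) by (simp add: compose_def)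
    moreover have "g (\<rho> (h t)) \<in> ?T" using hX[OF t] \<rho> by auto
    ultimately show ?thesis using ec fT unfolding inj_on_def by blast
  qed
  let ?h = "\<lambda>x. \<rho> (h (prj A x))"
  have \<rho>add: "\<rho> (s \<oplus>\<^bsub>BX\<^esub> t) = \<rho> s + \<rho> t" if "s \<in> e ` ?S" "t \<in> e ` ?S" for s t
    using that S by (auto simp: BX(3) \<rho>)
  have \<rho>act: "\<rho> (r \<odot>\<^bsub>BX\<^esub> s) = fst X r (\<rho> s)" if "s \<in> e ` ?S" for r s
    using that by (auto simp: BX(4) \<rho> eact)
  have "?h (x + y) = ?h x + ?h y" for x y
    by (simp add: prj_add a prj_closed lh_add[OF h(1)] \<rho>add hX)
  moreover from this have "?h 0 = 0" by (metis add_cancel_right_right)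
  then have "?h (scl R r x) = fst X r (?h x)" for r x
    using X by (cases "r \<in> carrier R")
      (simp_all add: prj_scl a A prj_closed lh_smult[OF h(1)] \<rho>act hX scl_outside good_def)
  moreover have "snd X (?h x) = ?h x" for x
    using hX[OF prj_closed[OF a], of x] \<rho> by (auto simp: el_def)
  moreover have "?h (emb A (prj A x)) = ?h x" for x
    by (simp add: emb_prj_emb a prj_closed)
  ultimately have "?h \<in> hm (mobj R A) X" by (simp add: hm_def mobj_def)
  moreover have "g (?h x) = f x" for x
    using gh[OF prj_closed[OF a], of x] hm_src[OF f, of x] by (simp add: mobj_def)
  ultimately show "\<exists>h\<in>hm (mobj R A) X. \<forall>x. g (h x) = f x" by (intro bexI) auto
qed

section \<open>Exactness and projectivity carried over from modules to summands\<close>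

lemmas lm_zero = ag_zero[OF lm_ag]
lemmas lm_add = abelian_monoid.a_closed[OF abelian_group.axioms(1), OF lm_ag]
lemmas lm_uminus = abelian_group.a_inv_closed[OF lm_ag]

lemma exact_atD:
  "exact_at X d i \<Longrightarrow> el (X i) x \<Longrightarrow> d i x = 0 \<Longrightarrow> \<exists>y. el (X (i + 1)) y \<and> d (i + 1) y = x"
  unfolding exact_at_def by blast

lemma exact_atD':
  "exact_at X d (i - 1) \<Longrightarrow> el (X (i - 1)) x \<Longrightarrow> d (i - 1) x = 0 \<Longrightarrow> \<exists>y. el (X i) y \<and> d i y = x"
  using exact_atD[of X d "i - 1" x] by simp

lemma mmap_zero: "abelian_group A \<Longrightarrow> abelian_group B \<Longrightarrow> (\<And>x. x \<in> carrier A \<Longrightarrow> f x = \<zero>\<^bsub>B\<^esub>) \<Longrightarrow> mmap A B f y = 0"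
  by (simp add: mmap_def prj_closed emb_zero)

lemma mmap_eq_zeroD: "abelian_group A \<Longrightarrow> abelian_group B \<Longrightarrow> x \<in> carrier A \<Longrightarrow> f x \<in> carrier B \<Longrightarrow>
    mmap A B f (emb A x) = 0 \<Longrightarrow> f x = \<zero>\<^bsub>B\<^esub>"
  by (simp add: mmap_emb emb_eq_zero)

lemma mmap_mmap: "abelian_group B \<Longrightarrow> (\<And>x. x \<in> carrier A \<Longrightarrow> f x \<in> carrier B) \<Longrightarrow> abelian_group A \<Longrightarrow>
    mmap B C g (mmap A B f x) = mmap A C (\<lambda>x. g (f x)) x"
  by (simp add: mmap_def emb_prj_emb prj_closed)

lemma mmap_cong: "abelian_group A \<Longrightarrow> (\<And>x. x \<in> carrier A \<Longrightarrow> f x = g x) \<Longrightarrow> mmap A B f = mmap A B g"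
  by (auto simp: mmap_def prj_closed)

lemma mmap_exact:
  assumes A: "left_module R A" and B: "left_module R B" and C: "left_module R C"
    and e: "f ` carrier A = a_kernel B C g"
    and x: "el (mobj R B) x" "mmap B C g x = 0" and g: "g \<in> lmod_hom R B C"
  shows "\<exists>y. el (mobj R A) y \<and> mmap A B f y = x"
proof -
  note a = lm_ag[OF A] lm_ag[OF B] lm_ag[OF C]
  obtain b where b: "b \<in> carrier B" "x = emb B b" using elE[OF x(1) a(2)] .
  have "g b = \<zero>\<^bsub>C\<^esub>" using mmap_eq_zeroD[where f=g, OF a(2,3) b(1) lh_closed[OF g b(1)]] x(2) b(2) by simp
  then have "b \<in> f ` carrier A" using b(1) by (simp add: e a_kernel_def')
  then obtain c where "c \<in> carrier A" "b = f c" by blast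
  then show ?thesis using b a by (intro exI[of _ "emb A c"]) (simp add: el_emb mmap_emb)
qed

lemma mmap_exact':
  assumes A: "left_module R A" and B: "left_module R B" and C: "left_module R C"
    and e: "f ` carrier A = a_kernel B C g"
  shows "mmap B C g (mmap A B f x) = 0"
proof -
  have "f y \<in> carrier B \<and> g (f y) = \<zero>\<^bsub>C\<^esub>" if "y \<in> carrier A" for y
    using that e by (auto simp: a_kernel_def')
  then show ?thesis
    by (subst mmap_mmap) (auto intro!: mmap_zero simp: lm_ag[OF A] lm_ag[OF B] lm_ag[OF C])
qed

lemma zero_hom_lmod: "left_module R A \<Longrightarrow> left_module R B \<Longrightarrow> zero_hom A B \<in> lmod_hom R A B"
  by (rule lmod_homI)
    (auto simp: zero_hom_def lm_zero lm_add left_module.smult_closed lm_smult_zero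
      abelian_monoid.l_zero[OF abelian_group.axioms(1), OF lm_ag])

lemma hom_exact_transfer:
  fixes A B C Q :: "('r, 'm) module"
  assumes A: "left_module R A" and B: "left_module R B" and C: "left_module R C" and Q: "left_module R Q"
    and a: "a \<in> lmod_hom R A B" and b: "b \<in> lmod_hom R B C"
    and h: "\<And>f. f \<in> lmod_hom R B Q \<Longrightarrow> (\<And>x. x \<in> carrier A \<Longrightarrow> f (a x) = \<zero>\<^bsub>Q\<^esub>) \<Longrightarrow>
      \<exists>g\<in>lmod_hom R C Q. \<forall>x\<in>carrier B. f x = g (b x)"
    and F: "F \<in> hm (mobj R B) (mobj R Q)" "\<And>x. F (mmap A B a x) = 0"
  shows "\<exists>G\<in>hm (mobj R C) (mobj R Q). \<forall>x. F x = G (mmap B C b x)"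
proof -
  note ag = lm_ag[OF A] lm_ag[OF B] lm_ag[OF C] lm_ag[OF Q]
  obtain f where f: "f \<in> lmod_hom R B Q" "F = mmap B Q f" using hm_mmap[OF B Q F(1)] .
  have "f (a x) = \<zero>\<^bsub>Q\<^esub>" if x: "x \<in> carrier A" for x
    using F(2)[of "emb A x"] x
    by (simp add: f(2) mmap_emb ag lh_closed[OF a x] emb_eq_zero lh_closed[OF f(1)])
  from h[OF f(1) this] obtain g where g: "g \<in> lmod_hom R C Q" "\<And>x. x \<in> carrier B \<Longrightarrow> f x = g (b x)" by blast
  have "F x = mmap C Q g (mmap B C b x)" for x
    by (simp add: f(2) mmap_mmap ag lh_closed[OF b]) (simp add: mmap_def prj_closed ag g(2))
  then show ?thesis using mmap_hm[OF C Q g(1)] by blast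
qed

lemma projective_lm: "projective_lmodule R A \<Longrightarrow> left_module R A"
  by (simp add: projective_lmodule_def)

text \<open>The retraction and its section are maps of objects, so the lifting property is
  transferred there and then read back for modules.\<close>

lemma projective_retract:
  fixes A B :: "('r, 'm) module"
  assumes A: "projective_lmodule R A" and B: "left_module R B"
    and s: "s \<in> hm (mobj R B) (mobj R A)" and r: "r \<in> hm (mobj R A) (mobj R B)"
    and rs: "\<And>x. el (mobj R B) x \<Longrightarrow> r (s x) = x"
  shows "projective_lmodule R B"
  unfolding projective_lmodule_def
proof (intro conjI allI impI, rule B, elim conjE)
  fix C D :: "('r, 'm) module" and g f
  assume C: "left_module R C" and D: "left_module R D" and g: "g \<in> lmod_hom R C D"
    and gs: "g ` carrier C = carrier D" and f: "f \<in> lmod_hom R B D"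
  have l: "lifts (mobj R A) (mobj R C) (mobj R D)"
    by (rule projective_lifts[OF A good_mobj[OF C]])
  have l: "lifts (mobj R B) (mobj R C) (mobj R D)"
    by (rule lifts_retract[OF l s r rs obj_ok_mobj[OF B]])
  note ag = lm_ag[OF B] lm_ag[OF C] lm_ag[OF D]
  have "\<exists>y. mmap B D f x = mmap C D g y" for x
  proof -
    have "f (prj B x) \<in> g ` carrier C" using gs lh_closed[OF f] prj_closed[OF ag(1)] by simp
    then obtain c where "c \<in> carrier C" "f (prj B x) = g c" by blast
    then show ?thesis by (intro exI[of _ "emb C c"]) (simp add: mmap_def emb_prj_emb ag)
  qed
  from liftsD[OF l mmap_hm[OF B D f] mmap_hm[OF C D g] this]
  obtain H where H: "H \<in> hm (mobj R B) (mobj R C)" "\<And>x. mmap C D g (H x) = mmap B D f x" by blast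
  obtain h where h: "h \<in> lmod_hom R B C" "H = mmap B C h" using hm_mmap[OF B C H(1)] .
  have "g (h x) = f x" if "x \<in> carrier B" for x
    using H(2)[of "emb B x"] that
    by (simp add: h(2) mmap_emb ag lh_closed[OF h(1)] emb_inj lh_closed[OF g] lh_closed[OF f])
  then have "compose (carrier B) g h = f"
    using lh_ext[OF f] by (auto simp: compose_def extensional_def)
  then show "\<exists>h\<in>lmod_hom R B C. compose (carrier B) g h = f" using h(1) by blast
qed

lemma zero_projective:
  fixes Z :: "('r, 'm) module"
  assumes Z: "left_module R Z" "carrier Z = {\<zero>\<^bsub>Z\<^esub>}"
  shows "projective_lmodule R Z"
  unfolding projective_lmodule_def
proof (intro conjI allI impI, rule Z, elim conjE)
  fix C D :: "('r, 'm) module" and g f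
  assume C: "left_module R C" and D: "left_module R D" and g: "g \<in> lmod_hom R C D"
    and f: "f \<in> lmod_hom R Z D"
  have "compose (carrier Z) g (zero_hom Z C) = f"
    using lh_zero[OF g] lh_zero[OF f] lh_ext[OF f] Z lm_ag[OF C] lm_ag[OF D] lm_ag[OF Z(1)]
    by (auto simp: compose_def zero_hom_def extensional_def)
  then show "\<exists>h\<in>lmod_hom R Z C. compose (carrier Z) g h = f"
    using zero_hom_lmod[OF Z(1) C] by blast
qed

lemma sub_left_module:
  assumes A: "left_module R A" and S: "S \<subseteq> carrier A" "\<zero>\<^bsub>A\<^esub> \<in> S"
    "\<And>x y. x \<in> S \<Longrightarrow> y \<in> S \<Longrightarrow> x \<oplus>\<^bsub>A\<^esub> y \<in> S" "\<And>x. x \<in> S \<Longrightarrow> \<ominus>\<^bsub>A\<^esub> x \<in> S"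
    "\<And>r x. r \<in> carrier R \<Longrightarrow> x \<in> S \<Longrightarrow> r \<odot>\<^bsub>A\<^esub> x \<in> S"
  shows "left_module R (A\<lparr>carrier := S\<rparr>)"
proof -
  interpret left_module R A by fact
  have c: "x \<in> S \<Longrightarrow> x \<in> carrier A" for x using S by auto
  have "abelian_group (A\<lparr>carrier := S\<rparr>)"
  proof (rule abelian_groupI)
    fix x assume "x \<in> carrier (A\<lparr>carrier := S\<rparr>)"
    then show "\<exists>y\<in>carrier (A\<lparr>carrier := S\<rparr>). y \<oplus>\<^bsub>A\<lparr>carrier := S\<rparr>\<^esub> x = \<zero>\<^bsub>A\<lparr>carrier := S\<rparr>\<^esub>"
      using S c by (intro bexI[of _ "\<ominus>\<^bsub>A\<^esub> x"]) (auto simp: M.l_neg)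
  qed (use S c in \<open>auto simp: M.a_assoc intro: M.a_comm\<close>)
  then show ?thesis
    by (intro left_module.intro left_module_axioms.intro R.ring_axioms)
      (use S c in \<open>auto simp: smult_add_left smult_add_right smult_mult\<close>)
qed

lemma kernel_left_module:
  assumes A: "left_module R A" and B: "left_module R B" and f: "f \<in> lmod_hom R A B"
  shows "left_module R (A\<lparr>carrier := a_kernel A B f\<rparr>)"
proof (rule sub_left_module[OF A])
  interpret A: left_module R A by fact
  interpret B: left_module R B by fact
  note z = lh_zero[OF f lm_ag[OF A] lm_ag[OF B]]
  show "\<ominus>\<^bsub>A\<^esub> x \<in> a_kernel A B f" if "x \<in> a_kernel A B f" for x
  proof -
    have x: "x \<in> carrier A" "f x = \<zero>\<^bsub>B\<^esub>" using that by (auto simp: a_kernel_def')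
    have "f (\<ominus>\<^bsub>A\<^esub> x \<oplus>\<^bsub>A\<^esub> x) = f (\<ominus>\<^bsub>A\<^esub> x) \<oplus>\<^bsub>B\<^esub> f x" using x by (intro lh_add[OF f]) auto
    then show ?thesis using x z lh_closed[OF f, of "\<ominus>\<^bsub>A\<^esub> x"]
      by (simp add: a_kernel_def' A.M.l_neg)
  qed
qed (auto simp: a_kernel_def' lh_zero[OF f lm_ag[OF A] lm_ag[OF B]] lh_add[OF f] lh_smult[OF f]
    lm_zero[OF A] lm_add[OF A] left_module.smult_closed[OF A] lm_zero[OF B] lm_smult_zero[OF B]
    abelian_monoid.l_zero[OF abelian_group.axioms(1), OF lm_ag[OF B]])

lemma zero_left_module:
  assumes A: "left_module R A"
  shows "left_module R (A\<lparr>carrier := {\<zero>\<^bsub>A\<^esub>}\<rparr>)"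
proof -
  interpret left_module R A by fact
  show ?thesis by (rule sub_left_module[OF A]) (auto simp: lm_smult_zero[OF A])
qed

section \<open>Complexes of modules\<close>

definition ob :: "('r, 'x) ring_scheme \<Rightarrow> ('r, 'm) cplx \<Rightarrow> int \<Rightarrow> ('r, ('r, 'm) amb) object" where
  "ob R X i = mobj R (obj X i)"

definition dm :: "('r, 'm) cplx \<Rightarrow> int \<Rightarrow> ('r, 'm) amb \<Rightarrow> ('r, 'm) amb" where
  "dm X i = mmap (obj X i) (obj X (i - 1)) (diff X i)"

definition cm :: "('r, 'm) cplx \<Rightarrow> ('r, 'm) cplx \<Rightarrow> (int \<Rightarrow> 'm \<Rightarrow> 'm) \<Rightarrow> int \<Rightarrow> ('r, 'm) amb \<Rightarrow> ('r, 'm) amb" where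
  "cm X Y f i = mmap (obj X i) (obj Y i) (f i)"

lemma ccD:
  assumes "chain_complex R X"
  shows cc_lm: "left_module R (obj X i)" and cc_d: "diff X i \<in> lmod_hom R (obj X i) (obj X (i - 1))"
    and cc_dd: "x \<in> carrier (obj X i) \<Longrightarrow> diff X (i - 1) (diff X i x) = \<zero>\<^bsub>obj X (i - 2)\<^esub>"
  using assms by (auto simp: chain_complex_def)

lemmas cc_ag = lm_ag[OF cc_lm]

lemma cc_d': "chain_complex R X \<Longrightarrow> diff X (i + 1) \<in> lmod_hom R (obj X (i + 1)) (obj X i)"
  using cc_d[of R X "i + 1"] by simp

lemma cc_dd': "chain_complex R X \<Longrightarrow> x \<in> carrier (obj X (i + 1)) \<Longrightarrow>
    diff X i (diff X (i + 1) x) = \<zero>\<^bsub>obj X (i - 1)\<^esub>"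
  using cc_dd[of R X x "i + 1"] by simp

lemma cpx_ob:
  assumes X: "chain_complex R X"
  shows "cpx (ob R X) (dm X)"
  unfolding cpx_def ob_def dm_def
proof (intro conjI allI obj_ok_mobj cc_lm[OF X] mmap_hm cc_d[OF X])
  fix i x
  show "mmap (obj X (i - 1)) (obj X (i - 1 - 1)) (diff X (i - 1)) (mmap (obj X i) (obj X (i - 1)) (diff X i) x) = 0"
    by (subst mmap_mmap)
      (auto intro!: mmap_zero simp: cc_ag[OF X] lh_closed[OF cc_d[OF X]] cc_dd[OF X])
qed

lemma chain_mapsD:
  assumes "f \<in> chain_maps R X Y"
  shows cm_hom: "f i \<in> lmod_hom R (obj X i) (obj Y i)"
    and cm_comm: "x \<in> carrier (obj X i) \<Longrightarrow> diff Y i (f i x) = f (i - 1) (diff X i x)"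
  using assms by (auto simp: chain_maps_def)

lemma cm_hm:
  "chain_complex R X \<Longrightarrow> chain_complex R Y \<Longrightarrow> f \<in> chain_maps R X Y \<Longrightarrow> cm X Y f i \<in> hm (ob R X i) (ob R Y i)"
  unfolding cm_def ob_def by (intro mmap_hm cc_lm cm_hom)

lemma cm_dm:
  assumes X: "chain_complex R X" and Y: "chain_complex R Y" and f: "f \<in> chain_maps R X Y"
  shows "dm Y i (cm X Y f i x) = cm X Y f (i - 1) (dm X i x)"
  unfolding cm_def dm_def
  by (simp add: mmap_mmap cc_ag[OF X] cc_ag[OF Y] lh_closed[OF cc_d[OF X]] lh_closed[OF cm_hom[OF f]])
    (rule arg_cong[where f="\<lambda>h. h x"], rule mmap_cong, auto simp: cc_ag[OF X] cm_comm[OF f])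

lemma exact_ob:
  assumes X: "chain_complex R X" and e: "boundaries (obj_groups X) (diff X) i = cycles (obj_groups X) (diff X) i"
  shows "exact_at (ob R X) (dm X) i"
proof -
  have e': "diff X (i + 1) ` carrier (obj X (i + 1)) = a_kernel (obj X i) (obj X (i - 1)) (diff X i)"
    using e by (simp add: boundaries_def cycles_def a_kernel_def)
  show ?thesis
    unfolding exact_at_def ob_def dm_def
    using mmap_exact[OF cc_lm[OF X] cc_lm[OF X] cc_lm[OF X] e' _ _ cc_d[OF X]] by simp
qed

lemma exact_cplx_ob: "exact_complex R X \<Longrightarrow> exact_at (ob R X) (dm X) i"
  by (auto simp: exact_complex_def acyclic_complex_def intro: exact_ob)

lemma totally_acyclic_hom_exact:
  fixes T :: "('r, 'm) cplx" and Q :: "('r, 'm) module"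
  assumes T: "totally_acyclic R T" and Q: "projective_lmodule R Q"
    and F: "F \<in> hm (ob R T i) (mobj R Q)" "\<And>x. F (dm T (i + 1) x) = 0"
  shows "\<exists>G\<in>hm (ob R T (i - 1)) (mobj R Q). \<forall>x. F x = G (dm T i x)"
proof -
  have cc: "chain_complex R T" using T by (simp add: totally_acyclic_def exact_complex_def)
  have eq: "(\<lambda>g. compose (carrier (obj T i)) g (diff T i)) ` lmod_hom R (obj T (i - 1)) Q =
        {f \<in> lmod_hom R (obj T i) Q.
          compose (carrier (obj T (i + 1))) f (diff T (i + 1)) = zero_hom (obj T (i + 1)) Q}"
    using T Q by (simp add: totally_acyclic_def)
  have F2: "F (mmap (obj T (i + 1)) (obj T i) (diff T (i + 1)) x) = 0" for x
    using F(2)[of x] by (simp add: dm_def)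
  show ?thesis unfolding ob_def dm_def
  proof (rule hom_exact_transfer[OF cc_lm[OF cc] cc_lm[OF cc] cc_lm[OF cc] projective_lm[OF Q]
        cc_d'[OF cc] cc_d[OF cc] _ F(1)[unfolded ob_def] F2])
    fix f assume f: "f \<in> lmod_hom R (obj T i) Q"
      and 0: "\<And>x. x \<in> carrier (obj T (i + 1)) \<Longrightarrow> f (diff T (i + 1) x) = \<zero>\<^bsub>Q\<^esub>"
    have "compose (carrier (obj T (i + 1))) f (diff T (i + 1)) = zero_hom (obj T (i + 1)) Q"
      using 0 by (auto simp: compose_def zero_hom_def)
    with f have "f \<in> (\<lambda>g. compose (carrier (obj T i)) g (diff T i)) ` lmod_hom R (obj T (i - 1)) Q"
      unfolding eq by blast
    then show "\<exists>g\<in>lmod_hom R (obj T (i - 1)) Q. \<forall>x\<in>carrier (obj T i). f x = g (diff T i x)"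
      by (auto simp: compose_def)
  qed
qed

section \<open>Projective complexes\<close>

lemma projective_cplxD:
  assumes "projective_cplx R X"
  shows "chain_complex R X" "exact_at (ob R X) (dm X) i" "projective_lmodule R (obj X i)"
  using assms by (auto simp: projective_cplx_def exact_complex_def intro: exact_cplx_ob)

text \<open>Projectivity of the cycles in degree \<open>i - 1\<close> yields a section
  \<open>s\<close> of the differential onto them. Then \<open>id - s d\<close> projects
  \<open>X i\<close> onto the cycles in degree \<open>i\<close>, and projectivity of
  \<open>X i\<close> lifts this projection to \<open>X (i + 1)\<close>.\<close>

lemma projective_cplx_section:
  fixes X :: "('r, 'm) cplx"
  assumes X: "projective_cplx R X"
  shows "\<exists>h. cycle_section (ob R X) (dm X) i h"
proof -
  note cc = projective_cplxD(1)[OF X]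
  note C = cpx_ob[OF cc]
  define Z where "Z = (obj X (i - 1))\<lparr>carrier := a_kernel (obj X (i - 1)) (obj X (i - 1 - 1)) (diff X (i - 1))\<rparr>"
  have Z: "projective_lmodule R Z" using X unfolding projective_cplx_def Z_def by blast
  note lZ = projective_lm[OF Z]
  have Zc: "x \<in> carrier Z \<longleftrightarrow> x \<in> carrier (obj X (i - 1)) \<and> diff X (i - 1) x = \<zero>\<^bsub>obj X (i - 2)\<^esub>" for x
    by (simp add: Z_def a_kernel_def')
  have Zo: "x \<oplus>\<^bsub>Z\<^esub> y = x \<oplus>\<^bsub>obj X (i - 1)\<^esub> y" "r \<odot>\<^bsub>Z\<^esub> x = r \<odot>\<^bsub>obj X (i - 1)\<^esub> x"
    "\<zero>\<^bsub>Z\<^esub> = \<zero>\<^bsub>obj X (i - 1)\<^esub>" for x y r by (simp_all add: Z_def)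
  have sub: "x \<in> carrier Z \<Longrightarrow> x \<in> carrier (obj X (i - 1))" for x by (simp add: Zc)
  let ?inc = "\<lambda>x\<in>carrier Z. x"
  have inc: "?inc \<in> lmod_hom R Z (obj X (i - 1))"
    using lm_add[OF lZ] left_module.smult_closed[OF lZ] by (intro lmod_homI) (auto simp: sub Zo)
  have dZ: "diff X i x \<in> carrier Z" if "x \<in> carrier (obj X i)" for x
    using that lh_closed[OF cc_d[OF cc] that] cc_dd[OF cc that] by (simp add: Zc)
  then have d': "diff X i \<in> lmod_hom R (obj X i) Z"
    using cc_d[OF cc, of i] by (intro lmod_homI) (auto simp: lh_add lh_smult lh_ext Zo)
  note hZ = mmap_hm[OF lZ cc_lm[OF cc] inc] and hd = mmap_hm[OF cc_lm[OF cc] lZ d']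
  let ?I = "mmap Z (obj X (i - 1)) ?inc" and ?D = "mmap (obj X i) Z (diff X i)"
  have ID: "?I (?D x) = dm X i x" for x
    using dZ[OF prj_closed[OF cc_ag[OF cc]]] by (simp add: dm_def mmap_def emb_prj_emb lm_ag[OF lZ])
  have "\<exists>y. ?I x = dm X i y" for x
  proof -
    have "dm X (i - 1) (?I x) = 0"
      unfolding dm_def
      by (subst mmap_mmap) (auto intro!: mmap_zero simp: lm_ag[OF lZ] cc_ag[OF cc] Zc)
    moreover have "el (ob R X (i - 1)) (?I x)" using hm_el[OF hZ] by (simp add: ob_def)
    ultimately show ?thesis using exact_atD'[OF projective_cplxD(2)[OF X]] by metis
  qed
  moreover have "dm X i \<in> hm (ob R X i) (mobj R (obj X (i - 1)))" using cpx_d[OF C] by (simp add: ob_def)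
  moreover have "lifts (mobj R Z) (ob R X i) (mobj R (obj X (i - 1)))"
    unfolding ob_def by (intro projective_lifts[OF Z] good_mobj cc_lm[OF cc])
  ultimately obtain s where s: "s \<in> hm (mobj R Z) (ob R X i)" "\<And>x. dm X i (s x) = ?I x"
    using liftsD[of "mobj R Z" "ob R X i" "mobj R (obj X (i - 1))" ?I "dm X i"] hZ by blast
  let ?r = "\<lambda>x. snd (ob R X i) x - s (?D x)"
  have hd: "?D \<in> hm (ob R X i) (mobj R Z)" using hd by (simp add: ob_def)
  have r: "?r \<in> hm (ob R X i) (ob R X i)"
    by (intro hm_sub obj_okI cpx_ok[OF C] hm_comp[OF hd s(1)])
  have "dm X i (?r x) = 0" for x
    by (simp add: hm_lin[OF cpx_d[OF C]] hm_src[OF cpx_d[OF C]] s(2) ID)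
  then have "\<exists>y. ?r x = dm X (i + 1) y" for x
    using projective_cplxD(2)[OF X, of i] hm_el[OF r, of x] unfolding exact_at_def by metis
  moreover have "lifts (ob R X i) (ob R X (i + 1)) (ob R X i)"
    unfolding ob_def by (intro projective_lifts good_mobj cc_lm[OF cc] projective_cplxD(3)[OF X])
  ultimately obtain h where h: "h \<in> hm (ob R X i) (ob R X (i + 1))" "\<And>x. dm X (i + 1) (h x) = ?r x"
    using liftsD[OF _ r cpx_d'[OF C]] by blast
  \<comment> \<open>\<open>?D\<close> is the differential with the cycle module \<open>Z\<close> as
    target. \<open>Z\<close> and \<open>obj X (i - 1)\<close> may be different coordinates of the
    ambient group, so the vanishing of \<open>dm X i\<close> is carried over through the
    carriers.\<close>
  have "?D x = 0" if z: "el (ob R X i) x" "dm X i x = 0" for x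
  proof -
    obtain y where y: "y \<in> carrier (obj X i)" "x = emb (obj X i) y"
      using elE[OF z(1)[unfolded ob_def] cc_ag[OF cc]] .
    have "diff X i y = \<zero>\<^bsub>obj X (i - 1)\<^esub>"
      using mmap_eq_zeroD[where f="diff X i", OF cc_ag[OF cc] cc_ag[OF cc] y(1) lh_closed[OF cc_d[OF cc] y(1)]] z(2) y(2)
      by (simp add: dm_def)
    then show ?thesis using y emb_zero[OF lm_ag[OF lZ]] by (simp add: mmap_emb cc_ag[OF cc] Zo)
  qed
  then have "cycle_section (ob R X) (dm X) i h"
    using h by (auto simp: cycle_section_def hm_zero[OF s(1)] el_def)
  then show ?thesis by blast
qed

text \<open>
  The projective complex \<open>A = A\<close> in degrees \<open>i + 1\<close> and \<open>i\<close>: maps of complexes into it are module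
  homomorphisms in degree \<open>i\<close>, which makes exactness under maps into projective complexes degreewise.
\<close>

definition disc :: "('r, 'm) module \<Rightarrow> int \<Rightarrow> ('r, 'm) cplx" where
  "disc A i = (let X = (\<lambda>n. if n = i \<or> n = i + 1 then A else A\<lparr>carrier := {\<zero>\<^bsub>A\<^esub>}\<rparr>)
     in \<lparr>obj = X, diff = (\<lambda>n. if n = i + 1 then (\<lambda>x\<in>carrier A. x) else zero_hom (X n) (X (n - 1)))\<rparr>)"

lemma disc_obj: "obj (disc A i) n = (if n = i \<or> n = i + 1 then A else A\<lparr>carrier := {\<zero>\<^bsub>A\<^esub>}\<rparr>)"
  and disc_diff: "diff (disc A i) n = (if n = i + 1 then (\<lambda>x\<in>carrier A. x)
    else zero_hom (obj (disc A i) n) (obj (disc A i) (n - 1)))"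
  by (simp_all add: disc_def Let_def)

lemma disc_zero: "\<zero>\<^bsub>obj (disc A i) n\<^esub> = \<zero>\<^bsub>A\<^esub>"
  by (simp add: disc_obj)

lemma disc_kernel:
  assumes "\<zero>\<^bsub>A\<^esub> \<in> carrier A"
  shows "a_kernel (obj (disc A i) n) (obj (disc A i) (n - 1)) (diff (disc A i) n) =
    (if n = i then carrier A else {\<zero>\<^bsub>A\<^esub>})"
proof -
  have "n \<noteq> i \<Longrightarrow> n \<noteq> i + 1 \<Longrightarrow> carrier (obj (disc A i) n) = {\<zero>\<^bsub>A\<^esub>}" by (simp add: disc_obj)
  moreover have "carrier (obj (disc A i) i) = carrier A" "carrier (obj (disc A i) (i + 1)) = carrier A"
    by (simp_all add: disc_obj)
  ultimately show ?thesis
    using assms by (auto simp: a_kernel_def' disc_zero disc_diff zero_hom_def)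
qed

lemma disc_image:
  assumes "\<zero>\<^bsub>A\<^esub> \<in> carrier A"
  shows "diff (disc A i) (n + 1) ` carrier (obj (disc A i) (n + 1)) = (if n = i then carrier A else {\<zero>\<^bsub>A\<^esub>})"
proof -
  have "carrier (obj (disc A i) (n + 1)) \<noteq> {}" using assms by (auto simp: disc_obj)
  then show ?thesis by (auto simp: disc_diff zero_hom_def disc_zero) (auto simp: disc_obj)
qed

lemma disc_projective:
  fixes A :: "('r, 'm) module"
  assumes A: "projective_lmodule R A"
  shows "projective_cplx R (disc A i)"
proof -
  note lA = projective_lm[OF A] and zA = lm_zero[OF projective_lm[OF A]]
  note Z = zero_left_module[OF lA]
  have lm: "left_module R (obj (disc A i) n)" for n using lA Z by (simp add: disc_obj)
  have "(\<lambda>x\<in>carrier A. x) \<in> lmod_hom R A A"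
    using lm_add[OF lA] left_module.smult_closed[OF lA] by (intro lmod_homI) auto
  then have "diff (disc A i) n \<in> lmod_hom R (obj (disc A i) n) (obj (disc A i) (n - 1))" for n
    using zero_hom_lmod[OF lm lm] by (auto simp: disc_diff disc_obj[of A i "i + 1"] disc_obj[of A i i])
  moreover have "diff (disc A i) (n - 1) (diff (disc A i) n x) = \<zero>\<^bsub>A\<^esub>"
    if "x \<in> carrier (obj (disc A i) n)" for n x
  proof -
    have "diff (disc A i) n x \<in> (if n - 1 = i then carrier A else {\<zero>\<^bsub>A\<^esub>})"
      using disc_image[OF zA, of i "n - 1"] that by (metis diff_add_cancel imageI)
    then have "diff (disc A i) n x \<in> a_kernel (obj (disc A i) (n - 1)) (obj (disc A i) (n - 1 - 1)) (diff (disc A i) (n - 1))"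
      by (simp only: disc_kernel[OF zA])
    then show ?thesis by (simp add: a_kernel_def' disc_zero)
  qed
  ultimately have cc: "chain_complex R (disc A i)"
    using lm by (simp add: chain_complex_def disc_zero)
  moreover have "boundaries (obj_groups (disc A i)) (diff (disc A i)) n = cycles (obj_groups (disc A i)) (diff (disc A i)) n" for n
    using disc_kernel[OF zA, of i n] disc_image[OF zA, of i n]
    by (simp add: boundaries_def cycles_def a_kernel_def)
  moreover have "projective_lmodule R (obj (disc A i) n)" for n
    using A zero_projective[OF Z] by (simp add: disc_obj)
  moreover have "projective_lmodule R ((obj (disc A i) n)\<lparr>carrier := (if n = i then carrier A else {\<zero>\<^bsub>A\<^esub>})\<rparr>)" for n
    using A zero_projective[OF Z] by (simp add: disc_obj)
  ultimately show ?thesis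
    by (simp only: projective_cplx_def exact_complex_def acyclic_complex_def disc_kernel[OF zA]) simp
qed

lemma degreewise_hom_exact:
  fixes X Y Z :: "('r, 'm) cplx" and Q :: "('r, 'm) module"
  assumes X: "chain_complex R X" and Y: "chain_complex R Y" and Z: "chain_complex R Z"
    and a: "a \<in> chain_maps R Y X" and b: "b \<in> chain_maps R X Z"
    and h: "\<And>W :: ('r, 'm) cplx. projective_cplx R W \<Longrightarrow> (\<lambda>g. comp_map X g b) ` chain_maps R Z W =
      {f \<in> chain_maps R X W. comp_map Y f a = zero_map Y W}"
    and Q: "projective_lmodule R Q"
    and F: "F \<in> hm (ob R X i) (mobj R Q)" "\<And>x. F (cm Y X a i x) = 0"
  shows "\<exists>G\<in>hm (ob R Z i) (mobj R Q). \<forall>x. F x = G (cm X Z b i x)"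
  unfolding ob_def cm_def
proof (rule hom_exact_transfer[OF cc_lm[OF Y] cc_lm[OF X] cc_lm[OF Z] projective_lm[OF Q] cm_hom[OF a] cm_hom[OF b]
      _ F(1)[unfolded ob_def] F(2)[unfolded cm_def]])
  fix f assume f: "f \<in> lmod_hom R (obj X i) Q"
    and 0: "\<And>x. x \<in> carrier (obj Y i) \<Longrightarrow> f (a i x) = \<zero>\<^bsub>Q\<^esub>"
  let ?W = "disc Q i"
  note W = disc_projective[OF Q, of i]
  note WC = projective_cplxD(1)[OF W]
  note lQ = projective_lm[OF Q]
  \<comment> \<open>The map of complexes into \<open>disc Q i\<close> that corresponds to
    \<open>f\<close>: its component in degree \<open>i + 1\<close> is forced, because the
    differential of the disc is the identity there.\<close>
  define F where "F n = (if n = i then f else if n = i + 1 then compose (carrier (obj X (i + 1))) f (diff X (i + 1))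
    else zero_hom (obj X n) (obj ?W n))" for n
  have Fv: "F n x = (if n = i then f x else if n = i + 1 then f (diff X (i + 1) x) else \<zero>\<^bsub>Q\<^esub>)"
    if "x \<in> carrier (obj X n)" for n x
    using that by (auto simp: F_def compose_def zero_hom_def disc_zero)
  have fd: "compose (carrier (obj X (i + 1))) f (diff X (i + 1)) \<in> lmod_hom R (obj X (i + 1)) Q"
    using lh_closed[OF cc_d'[OF X, of i]]
    by (intro lmod_homI) (auto simp: compose_def lh_closed[OF f] lh_add[OF f] lh_add[OF cc_d'[OF X]]
        lh_smult[OF f] lh_smult[OF cc_d'[OF X]] lm_add[OF cc_lm[OF X]] left_module.smult_closed[OF cc_lm[OF X]])
  have Fh: "F n \<in> lmod_hom R (obj X n) (obj ?W n)" for n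
    using f fd zero_hom_lmod[OF cc_lm[OF X] cc_lm[OF WC]] by (auto simp: F_def disc_obj[of Q i i] disc_obj[of Q i "i + 1"])
  have f0: "f \<zero>\<^bsub>obj X i\<^esub> = \<zero>\<^bsub>Q\<^esub>" by (rule lh_zero[OF f cc_ag[OF X] lm_ag[OF lQ]])
  have Fc: "F \<in> chain_maps R X ?W"
  proof -
    have "diff ?W n (F n x) = F (n - 1) (diff X n x)" if x: "x \<in> carrier (obj X n)" for n x
    proof -
      have dx: "diff X n x \<in> carrier (obj X (n - 1))" by (rule lh_closed[OF cc_d[OF X] x])
      have "n = i + 1 + 1 \<Longrightarrow> f (diff X (i + 1) (diff X n x)) = \<zero>\<^bsub>Q\<^esub>"
        using cc_dd'[OF X, of x "i + 1"] x f0 by (metis add_diff_cancel_right')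
      moreover have "F n x \<in> carrier (obj ?W n)" by (rule lh_closed[OF Fh x])
      ultimately show ?thesis
        using x by (auto simp: Fv[OF dx] disc_diff zero_hom_def disc_zero) (auto simp: F_def compose_def disc_obj lh_closed[OF f])
    qed
    then show ?thesis using Fh by (simp add: chain_maps_def)
  qed
  have "comp_map Y F a = zero_map Y ?W"
  proof (intro ext)
    fix n x
    show "comp_map Y F a n x = zero_map Y ?W n x"
    proof (cases "x \<in> carrier (obj Y n)")
      case True
      then have "a n x \<in> carrier (obj X n)" by (rule lh_closed[OF cm_hom[OF a]])
      moreover have "n = i + 1 \<Longrightarrow> f (diff X (i + 1) (a n x)) = \<zero>\<^bsub>Q\<^esub>"
        using cm_comm[OF a True] lh_closed[OF cc_d[OF Y] True] 0 by simp
      ultimately show ?thesis using True 0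
        by (auto simp: comp_map_def zero_map_def compose_def zero_hom_def Fv disc_zero)
    qed (auto simp: comp_map_def zero_map_def compose_def zero_hom_def)
  qed
  with Fc h[OF W] have "F \<in> (\<lambda>g. comp_map X g b) ` chain_maps R Z ?W" by blast
  then obtain G where G: "G \<in> chain_maps R Z ?W" "F = comp_map X G b" by blast
  have "G i \<in> lmod_hom R (obj Z i) Q" using cm_hom[OF G(1), of i] by (simp add: disc_obj)
  moreover have "f x = G i (b i x)" if "x \<in> carrier (obj X i)" for x
    using fun_cong[OF fun_cong[OF G(2)], of i x] that by (simp add: F_def comp_map_def compose_def)
  ultimately show "\<exists>g\<in>lmod_hom R (obj Z i) Q. \<forall>x\<in>carrier (obj X i). f x = g (b i x)" by blast
qed

section \<open>DG-projective complexes\<close>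

text \<open>Truncate \<open>P\<close> to the exact complex \<open>E\<close> which has the cycles of
  degree \<open>-1\<close> in degree \<open>0\<close> and zero above. The canonical map from
  \<open>P\<close> to \<open>E\<close> is a cycle of an acyclic Hom complex, hence null-homotopic.
  In degrees at most \<open>-2\<close> this map is the identity and \<open>E (i + 1)\<close> is
  \<open>P (i + 1)\<close>, so the homotopy contracts \<open>P\<close>; from degree
  \<open>-1\<close> it would end in the cycles instead of \<open>P 0\<close>.\<close>

lemma dg_projective_section:
  fixes P :: "('r, 'm) cplx"
  assumes P: "dg_projective R P" and i: "i \<le> - 2"
    and ex: "\<And>i. i < 0 \<Longrightarrow> boundaries (obj_groups P) (diff P) i = cycles (obj_groups P) (diff P) i"
  shows "\<exists>h. cycle_section (ob R P) (dm P) i h"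
proof -
  have cc: "chain_complex R P" using P by (simp add: dg_projective_def)
  have ex': "diff P (i + 1) ` carrier (obj P (i + 1)) = a_kernel (obj P i) (obj P (i - 1)) (diff P i)"
    if "i < 0" for i
    using ex[OF that] by (simp add: boundaries_def cycles_def a_kernel_def)
  define K where "K = a_kernel (obj P (- 1)) (obj P (- 1 - 1)) (diff P (- 1))"
  define Z where "Z = (obj P (- 1))\<lparr>carrier := K\<rparr>"
  define Zo where "Zo = (obj P (- 1))\<lparr>carrier := {\<zero>\<^bsub>obj P (- 1)\<^esub>}\<rparr>"
  have lZo: "left_module R Zo" unfolding Zo_def by (rule zero_left_module[OF cc_lm[OF cc]])
  have lZ: "left_module R Z" unfolding Z_def K_def by (rule kernel_left_module[OF cc_lm[OF cc] cc_lm[OF cc] cc_d[OF cc]])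
  have Kc: "x \<in> K \<longleftrightarrow> x \<in> carrier (obj P (- 1)) \<and> diff P (- 1) x = \<zero>\<^bsub>obj P (- 2)\<^esub>" for x
    by (simp add: K_def a_kernel_def')
  have Kim: "diff P 0 ` carrier (obj P 0) = K" using ex'[of "- 1"] by (simp add: K_def)
  have zK: "\<zero>\<^bsub>obj P (- 1)\<^esub> \<in> K" using lm_zero[OF lZ] by (simp add: Z_def)
  define X where "X n = (if n < 0 then obj P n else if n = 0 then Z else Zo)" for n :: int
  define D where "D n = (if n < 0 then diff P n else if n = 0 then (\<lambda>x\<in>K. x) else zero_hom (X n) (X (n - 1)))" for n
  define E where "E = \<lparr>obj = X, diff = D\<rparr>"
  have lX: "left_module R (X n)" for n using cc_lm[OF cc] lZ lZo by (simp add: X_def)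
  have "(\<lambda>x\<in>K. x) \<in> lmod_hom R Z (obj P (- 1))"
    using lm_add[OF lZ] left_module.smult_closed[OF lZ]
    by (intro lmod_homI) (auto simp: Z_def Kc)
  then have Dh: "D n \<in> lmod_hom R (X n) (X (n - 1))" for n
    using cc_d[OF cc, of n] zero_hom_lmod[OF lX lX, of n "n - 1"]
    by (cases n "0 :: int" rule: linorder_cases) (simp_all add: D_def, simp_all add: X_def)
  have ker: "a_kernel (X n) (X (n - 1)) (D n) = (if n < 0 then a_kernel (obj P n) (obj P (n - 1)) (diff P n)
      else {\<zero>\<^bsub>obj P (- 1)\<^esub>})" for n
  proof -
    consider "n < 0" | "n = 0" | "n = 1" | "n > 1" by linarith
    then show ?thesis
    proof cases
      case 3
      then show ?thesis by (auto simp: a_kernel_def' D_def X_def zero_hom_def Zo_def Z_def)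
    next
      case 4
      then show ?thesis by (auto simp: a_kernel_def' D_def X_def zero_hom_def Zo_def Z_def)
    qed (use zK in \<open>auto simp: a_kernel_def' D_def X_def zero_hom_def Zo_def Z_def Kc\<close>)
  qed
  have im: "D (n + 1) ` carrier (X (n + 1)) = (if n < 0 then a_kernel (obj P n) (obj P (n - 1)) (diff P n)
      else {\<zero>\<^bsub>obj P (- 1)\<^esub>})" for n
  proof -
    consider "n < - 1" | "n = - 1" | "n = 0" | "n > 0" by linarith
    then show ?thesis
    proof cases
      case 1
      then show ?thesis using ex'[of n] by (simp add: D_def X_def)
    next
      case 2
      then show ?thesis by (auto simp: D_def X_def Z_def K_def)
    qed (auto simp: D_def X_def Z_def Zo_def zero_hom_def)
  qed
  have "D (n - 1) (D n x) = \<zero>\<^bsub>X (n - 2)\<^esub>" if "x \<in> carrier (X n)" for n x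
  proof -
    have "D n x \<in> a_kernel (X (n - 1)) (X (n - 1 - 1)) (D (n - 1))"
      unfolding ker using im[of "n - 1"] that by (metis diff_add_cancel imageI)
    then show ?thesis by (simp add: a_kernel_def')
  qed
  then have "chain_complex R E" using lX Dh by (simp add: chain_complex_def E_def)
  moreover have "boundaries (obj_groups E) (diff E) n = cycles (obj_groups E) (diff E) n" for n
    using ker[of n] im[of n] by (simp add: boundaries_def cycles_def a_kernel_def E_def)
  ultimately have "exact_complex R E" by (simp add: exact_complex_def acyclic_complex_def)
  then have ac: "boundaries (hom_cplx R P E) (hom_diff P E) 0 = cycles (hom_cplx R P E) (hom_diff P E) 0"
    using P by (simp add: dg_projective_def acyclic_complex_def)
  define f where "f p = (if p < 0 then (\<lambda>x\<in>carrier (obj P p). x) else if p = 0 then diff P 0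
    else zero_hom (obj P p) (X p))" for p
  have fh: "f p \<in> lmod_hom R (obj P p) (X p)" for p
  proof -
    have "(\<lambda>x\<in>carrier (obj P p). x) \<in> lmod_hom R (obj P p) (obj P p)"
      by (intro lmod_homI) (auto simp: lm_add[OF cc_lm[OF cc]] left_module.smult_closed[OF cc_lm[OF cc]])
    moreover have "diff P 0 \<in> lmod_hom R (obj P 0) Z"
      using cc_d[OF cc, of 0] Kim by (intro lmod_homI) (auto simp: Z_def lh_add lh_smult lh_ext)
    ultimately show ?thesis using zero_hom_lmod[OF cc_lm[OF cc] lX, of p p]
      by (cases p "0 :: int" rule: linorder_cases) (simp_all add: f_def, simp_all add: X_def)
  qed
  have comm: "D p (f p x) = f (p - 1) (diff P p x)" if x: "x \<in> carrier (obj P p)" for p x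
  proof -
    note dx = lh_closed[OF cc_d[OF cc] x]
    consider "p < 0" | "p = 0" | "p = 1" | "p > 1" by linarith
    then show ?thesis
    proof cases
      case 2
      then have "diff P 0 x \<in> K" using Kim x by auto
      then show ?thesis using 2 dx x by (simp add: D_def f_def)
    next
      case 3
      then show ?thesis using cc_dd[OF cc x] x by (simp add: D_def f_def X_def zero_hom_def Zo_def Z_def)
    qed (use x dx in \<open>auto simp: D_def f_def X_def zero_hom_def Zo_def\<close>)
  qed
  have "f \<in> cycles (hom_cplx R P E) (hom_diff P E) 0"
  proof -
    have "D p (f p x) \<ominus>\<^bsub>X (p - 1)\<^esub> f (p - 1) (diff P p x) = \<zero>\<^bsub>X (p - 1)\<^esub>"
      if "x \<in> carrier (obj P p)" for p x
      using that lm_ag[OF lX] lh_closed[OF fh lh_closed[OF cc_d[OF cc] that]]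
      by (simp add: comm a_minus_def abelian_group.r_neg)
    then show ?thesis using fh
      by (auto simp: cycles_def kernel_def hom_cplx_def hom_diff_def E_def zero_hom_def fun_eq_iff)
  qed
  then obtain g where g: "g \<in> carrier (hom_cplx R P E 1)" "f = hom_diff P E 1 g"
    using ac by (auto simp: boundaries_def)
  have gh: "g p \<in> lmod_hom R (obj P p) (X (p + 1))" for p using g(1) by (simp add: hom_cplx_def E_def)
  have gi: "g i \<in> lmod_hom R (obj P i) (obj P (i + 1))" using gh[of i] i by (simp add: X_def)
  have gx: "diff P (i + 1) (g i x) = x" if x: "x \<in> carrier (obj P i)" "diff P i x = \<zero>\<^bsub>obj P (i - 1)\<^esub>" for x
  proof -
    have "x = f i x" using i x by (simp add: f_def)
    \<comment> \<open>The homotopy \<open>g\<close> has odd degree, so its boundary is the sum of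
      \<open>D g\<close> and \<open>g d\<close>; the second summand vanishes on cycles.\<close>
    also have "\<dots> = D (i + 1) (g i x) \<oplus>\<^bsub>X i\<^esub> g (i - 1) (diff P i x)"
      using x by (simp add: g(2) hom_diff_def E_def)
    also have "g (i - 1) (diff P i x) = \<zero>\<^bsub>X i\<^esub>"
      using lh_zero[OF gh cc_ag[OF cc] lm_ag[OF lX], of "i - 1"] x(2) by simp
    also have "D (i + 1) (g i x) \<oplus>\<^bsub>X i\<^esub> \<zero>\<^bsub>X i\<^esub> = D (i + 1) (g i x)"
      using lh_closed[OF Dh[of "i + 1"] lh_closed[OF gh x(1)]]
      by (simp add: abelian_monoid.r_zero abelian_group.axioms(1) lm_ag[OF lX])
    also have "\<dots> = diff P (i + 1) (g i x)" using i by (simp add: D_def)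
    finally show ?thesis by simp
  qed
  have "dm P (i + 1) (mmap (obj P i) (obj P (i + 1)) (g i) x) = x" if x: "el (ob R P i) x" "dm P i x = 0" for x
  proof -
    obtain y where y: "y \<in> carrier (obj P i)" "x = emb (obj P i) y"
      using elE[OF x(1)[unfolded ob_def] cc_ag[OF cc]] .
    have "diff P i y = \<zero>\<^bsub>obj P (i - 1)\<^esub>"
      using mmap_eq_zeroD[where f="diff P i", OF cc_ag[OF cc] cc_ag[OF cc] y(1) lh_closed[OF cc_d[OF cc] y(1)]] x(2) y(2)
      by (simp add: dm_def)
    then show ?thesis using gx[OF y(1)] lh_closed[OF gi y(1)] y by (simp add: dm_def mmap_emb cc_ag[OF cc])
  qed
  moreover have "mmap (obj P i) (obj P (i + 1)) (g i) \<in> hm (ob R P i) (ob R P (i + 1))"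
    unfolding ob_def by (rule mmap_hm[OF cc_lm[OF cc] cc_lm[OF cc] gi])
  ultimately show ?thesis unfolding cycle_section_def by blast
qed

section \<open>Quasi-isomorphisms\<close>

lemma in_boundaries: "b \<in> boundaries (obj_groups X) (diff X) n \<longleftrightarrow>
    (\<exists>y\<in>carrier (obj X (n + 1)). b = diff X (n + 1) y)"
  by (auto simp: boundaries_def)

lemma in_cycles: "x \<in> cycles (obj_groups X) (diff X) n \<longleftrightarrow>
    x \<in> carrier (obj X n) \<and> diff X n x = \<zero>\<^bsub>obj X (n - 1)\<^esub>"
  by (auto simp: cycles_def kernel_def)

lemma boundaries_subgroup:
  assumes X: "chain_complex R X"
  shows "subgroup (boundaries (obj_groups X) (diff X) n) (add_monoid (obj X n))"
proof -
  interpret A: abelian_group "obj X n" by (rule cc_ag[OF X])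
  interpret B: abelian_group "obj X (n + 1)" by (rule cc_ag[OF X])
  have h: "group_hom (add_monoid (obj X (n + 1))) (add_monoid (obj X n)) (diff X (n + 1))"
    using cc_d'[OF X, of n] A.a_group B.a_group
    by (auto simp: group_hom_def group_hom_axioms_def lmod_hom_def)
  show ?thesis unfolding boundaries_def
    using group_hom.img_is_subgroup[OF h] by simp
qed

text \<open>\<open>f\<close> sends boundaries to boundaries, so all members of a coset have the same
  image coset, and \<open>the_elem\<close> is applied to a singleton.\<close>

lemma homology_map_coset:
  assumes X: "chain_complex R X" and Y: "chain_complex R Y" and f: "f \<in> chain_maps R X Y"
    and x: "x \<in> carrier (obj X n)"
  shows "homology_map (obj_groups Y) (diff Y) n (f n)
      (boundaries (obj_groups X) (diff X) n #>\<^bsub>add_monoid (obj X n)\<^esub> x) =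
    boundaries (obj_groups Y) (diff Y) n #>\<^bsub>add_monoid (obj Y n)\<^esub> f n x"
proof -
  let ?BX = "boundaries (obj_groups X) (diff X) n" and ?BY = "boundaries (obj_groups Y) (diff Y) n"
  let ?G = "add_monoid (obj Y n)"
  interpret G: group ?G using abelian_group.a_group[OF cc_ag[OF Y]] .
  note sX = boundaries_subgroup[OF X, of n] and sY = boundaries_subgroup[OF Y, of n]
  have fb: "f n b \<in> ?BY" if b: "b \<in> ?BX" for b
  proof -
    obtain y where "y \<in> carrier (obj X (n + 1))" "b = diff X (n + 1) y" using b by (auto simp: in_boundaries)
    then show ?thesis
      using cm_comm[OF f, of y "n + 1"] lh_closed[OF cm_hom[OF f], of y "n + 1"]
      by (auto simp: in_boundaries intro!: bexI[of _ "f (n + 1) y"])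
  qed
  have "?BY #>\<^bsub>?G\<^esub> f n (b \<oplus>\<^bsub>obj X n\<^esub> x) = ?BY #>\<^bsub>?G\<^esub> f n x" if b: "b \<in> ?BX" for b
  proof -
    have bc: "b \<in> carrier (obj X n)" using subgroup.mem_carrier[OF sX b] by simp
    have "?BY #>\<^bsub>?G\<^esub> (f n b \<otimes>\<^bsub>?G\<^esub> f n x) = (?BY #>\<^bsub>?G\<^esub> f n b) #>\<^bsub>?G\<^esub> f n x"
      using lh_closed[OF cm_hom[OF f]] bc x subgroup.subset[OF sY] by (intro G.coset_mult_assoc[symmetric]) auto
    also have "?BY #>\<^bsub>?G\<^esub> f n b = ?BY"
      using lh_closed[OF cm_hom[OF f] bc] by (intro G.coset_join2 sY fb[OF b]) simp
    finally show ?thesis using lh_add[OF cm_hom[OF f] bc x] by simp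
  qed
  then have "\<And>z. z \<in> ?BX #>\<^bsub>add_monoid (obj X n)\<^esub> x \<Longrightarrow> ?BY #>\<^bsub>?G\<^esub> f n z = ?BY #>\<^bsub>?G\<^esub> f n x"
    unfolding r_coset_def[of "add_monoid (obj X n)"] by auto
  moreover have "?BX #>\<^bsub>add_monoid (obj X n)\<^esub> x \<noteq> {}"
    using subgroup.one_closed[OF sX] by (auto simp: r_coset_def)
  ultimately have "(\<lambda>z. ?BY #>\<^bsub>?G\<^esub> f n z) ` (?BX #>\<^bsub>add_monoid (obj X n)\<^esub> x) = {?BY #>\<^bsub>?G\<^esub> f n x}"
    by (auto simp: image_iff)
  then show ?thesis by (simp add: homology_map_def)
qed

lemma homology_carrier: "carrier (homology (obj_groups X) (diff X) n) =
    {boundaries (obj_groups X) (diff X) n #>\<^bsub>add_monoid (obj X n)\<^esub> x |x. x \<in> cycles (obj_groups X) (diff X) n}"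
  by (auto simp: homology_def FactGroup_def RCOSETS_def r_coset_def)

lemma quasi_iso_inj:
  assumes X: "chain_complex R X" and Y: "chain_complex R Y" and q: "quasi_iso R X Y f"
    and x: "x \<in> cycles (obj_groups X) (diff X) n" "f n x \<in> boundaries (obj_groups Y) (diff Y) n"
  shows "x \<in> boundaries (obj_groups X) (diff X) n"
proof -
  have f: "f \<in> chain_maps R X Y" using q by (simp add: quasi_iso_def)
  let ?BX = "boundaries (obj_groups X) (diff X) n" and ?BY = "boundaries (obj_groups Y) (diff Y) n"
  let ?F = "add_monoid (obj X n)" and ?G = "add_monoid (obj Y n)"
  let ?\<phi> = "homology_map (obj_groups Y) (diff Y) n (f n)"
  interpret F: group ?F using abelian_group.a_group[OF cc_ag[OF X]] .
  interpret G: group ?G using abelian_group.a_group[OF cc_ag[OF Y]] .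
  note sX = boundaries_subgroup[OF X, of n] and sY = boundaries_subgroup[OF Y, of n]
  have inj: "inj_on ?\<phi> (carrier (homology (obj_groups X) (diff X) n))"
    using q unfolding quasi_iso_def iso_def bij_betw_def by blast
  have xc: "x \<in> carrier (obj X n)" using x(1) by (simp add: in_cycles)
  let ?z = "\<zero>\<^bsub>obj X n\<^esub>"
  have z: "?z \<in> carrier (obj X n)" "?z \<in> cycles (obj_groups X) (diff X) n"
    using lm_zero[OF cc_lm[OF X]] lh_zero[OF cc_d[OF X] cc_ag[OF X] cc_ag[OF X]] by (auto simp: in_cycles)
  have "?\<phi> (?BX #>\<^bsub>?F\<^esub> x) = ?\<phi> (?BX #>\<^bsub>?F\<^esub> ?z)"
    using lh_closed[OF cm_hom[OF f] xc] lh_zero[OF cm_hom[OF f] cc_ag[OF X] cc_ag[OF Y]]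
      subgroup.one_closed[OF sY] G.coset_join2[OF _ sY x(2)] G.coset_join2[OF _ sY subgroup.one_closed[OF sY]]
    by (simp add: homology_map_coset[OF X Y f] xc z lm_zero[OF cc_lm[OF Y]])
  then have "?BX #>\<^bsub>?F\<^esub> x = ?BX #>\<^bsub>?F\<^esub> ?z"
    using inj x(1) z(2) unfolding inj_on_def homology_carrier by blast
  moreover have "?BX #>\<^bsub>?F\<^esub> ?z = ?BX"
    using F.coset_join2[OF _ sX subgroup.one_closed[OF sX]] z by simp
  moreover have "x \<in> ?BX #>\<^bsub>?F\<^esub> x" using F.rcos_self[OF _ sX] xc by simp
  ultimately show ?thesis by simp
qed

lemma quasi_iso_surj:
  assumes X: "chain_complex R X" and Y: "chain_complex R Y" and q: "quasi_iso R X Y f"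
    and y: "y \<in> cycles (obj_groups Y) (diff Y) n"
  shows "\<exists>x\<in>cycles (obj_groups X) (diff X) n. \<exists>b\<in>boundaries (obj_groups Y) (diff Y) n. y = b \<oplus>\<^bsub>obj Y n\<^esub> f n x"
proof -
  have f: "f \<in> chain_maps R X Y" using q by (simp add: quasi_iso_def)
  let ?BX = "boundaries (obj_groups X) (diff X) n" and ?BY = "boundaries (obj_groups Y) (diff Y) n"
  let ?F = "add_monoid (obj X n)" and ?G = "add_monoid (obj Y n)"
  let ?\<phi> = "homology_map (obj_groups Y) (diff Y) n (f n)"
  interpret G: group ?G using abelian_group.a_group[OF cc_ag[OF Y]] .
  note sY = boundaries_subgroup[OF Y, of n]
  have sur: "?\<phi> ` carrier (homology (obj_groups X) (diff X) n) = carrier (homology (obj_groups Y) (diff Y) n)"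
    using q unfolding quasi_iso_def iso_def bij_betw_def by blast
  have "?BY #>\<^bsub>?G\<^esub> y \<in> carrier (homology (obj_groups Y) (diff Y) n)"
    using y unfolding homology_carrier by blast
  then have "?BY #>\<^bsub>?G\<^esub> y \<in> ?\<phi> ` carrier (homology (obj_groups X) (diff X) n)"
    unfolding sur .
  then obtain x where x: "x \<in> cycles (obj_groups X) (diff X) n" "?BY #>\<^bsub>?G\<^esub> y = ?\<phi> (?BX #>\<^bsub>?F\<^esub> x)"
    unfolding homology_carrier by blast
  have "y \<in> ?BY #>\<^bsub>?G\<^esub> y" using G.rcos_self[OF _ sY] y by (simp add: in_cycles)
  then have "y \<in> ?BY #>\<^bsub>?G\<^esub> f n x"
    using x by (simp add: homology_map_coset[OF X Y f] in_cycles)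
  then show ?thesis using x(1) by (auto simp: r_coset_def)
qed

lemma ob_cycleE:
  assumes X: "chain_complex R X" and x: "el (ob R X i) x" "dm X i x = 0"
  obtains a where "a \<in> cycles (obj_groups X) (diff X) i" "x = emb (obj X i) a"
proof -
  obtain y where y: "y \<in> carrier (obj X i)" "x = emb (obj X i) y"
    using elE[OF x(1)[unfolded ob_def] cc_ag[OF X]] .
  have "diff X i y = \<zero>\<^bsub>obj X (i - 1)\<^esub>"
    using mmap_eq_zeroD[where f="diff X i", OF cc_ag[OF X] cc_ag[OF X] y(1) lh_closed[OF cc_d[OF X] y(1)]] x(2) y(2)
    by (simp add: dm_def)
  then show ?thesis using that y by (simp add: in_cycles)
qed

lemma emb_boundary:
  assumes X: "chain_complex R X" and b: "b \<in> boundaries (obj_groups X) (diff X) i"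
  shows "\<exists>y. el (ob R X (i + 1)) y \<and> dm X (i + 1) y = emb (obj X i) b"
proof -
  obtain c where "c \<in> carrier (obj X (i + 1))" "b = diff X (i + 1) c" using b by (auto simp: in_boundaries)
  then show ?thesis
    by (intro exI[of _ "emb (obj X (i + 1)) c"]) (simp add: ob_def dm_def el_emb cc_ag[OF X] mmap_emb)
qed

lemma boundary_emb:
  assumes X: "chain_complex R X" and b: "dm X (i + 1) y = emb (obj X i) b" "b \<in> carrier (obj X i)"
  shows "b \<in> boundaries (obj_groups X) (diff X) i"
proof -
  let ?c = "prj (obj X (i + 1)) y"
  have c: "?c \<in> carrier (obj X (i + 1))" by (rule prj_closed[OF cc_ag[OF X]])
  have "emb (obj X i) (diff X (i + 1) ?c) = emb (obj X i) b" using b(1) by (simp add: dm_def mmap_def)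
  then have "diff X (i + 1) ?c = b"
    by (simp add: emb_inj cc_ag[OF X] b(2) lh_closed[OF cc_d'[OF X] c])
  then show ?thesis using c by (auto simp: in_boundaries)
qed

text \<open>The two halves of bijectivity on homology, in the elementwise form in which the later
  diagram chases use them.\<close>

lemma quasi_iso_ob:
  assumes X: "chain_complex R X" and Y: "chain_complex R Y" and q: "quasi_iso R X Y f"
  shows quasi_iso_ob_inj: "el (ob R X i) x \<Longrightarrow> dm X i x = 0 \<Longrightarrow> cm X Y f i x = dm Y (i + 1) m \<Longrightarrow>
      \<exists>y. el (ob R X (i + 1)) y \<and> dm X (i + 1) y = x"
    and quasi_iso_ob_surj: "el (ob R Y i) z \<Longrightarrow> dm Y i z = 0 \<Longrightarrow>
      \<exists>x m. el (ob R X i) x \<and> dm X i x = 0 \<and> el (ob R Y (i + 1)) m \<and> z = cm X Y f i x + dm Y (i + 1) m"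
proof -
  have f: "f \<in> chain_maps R X Y" using q by (simp add: quasi_iso_def)
  show "\<exists>y. el (ob R X (i + 1)) y \<and> dm X (i + 1) y = x"
    if x: "el (ob R X i) x" "dm X i x = 0" "cm X Y f i x = dm Y (i + 1) m"
  proof -
    obtain a where a: "a \<in> cycles (obj_groups X) (diff X) i" "x = emb (obj X i) a"
      using ob_cycleE[OF X x(1,2)] .
    have ac: "a \<in> carrier (obj X i)" using a(1) by (simp add: in_cycles)
    have "dm Y (i + 1) m = emb (obj Y i) (f i a)"
      using x(3) a(2) ac by (simp add: cm_def mmap_emb cc_ag[OF X])
    then have "f i a \<in> boundaries (obj_groups Y) (diff Y) i"
      by (rule boundary_emb[OF Y _ lh_closed[OF cm_hom[OF f] ac]])
    from emb_boundary[OF X quasi_iso_inj[OF X Y q a(1) this]] show ?thesis using a(2) by simp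
  qed
  show "\<exists>x m. el (ob R X i) x \<and> dm X i x = 0 \<and> el (ob R Y (i + 1)) m \<and> z = cm X Y f i x + dm Y (i + 1) m"
    if z: "el (ob R Y i) z" "dm Y i z = 0"
  proof -
    obtain c where c: "c \<in> cycles (obj_groups Y) (diff Y) i" "z = emb (obj Y i) c"
      using ob_cycleE[OF Y z] .
    from quasi_iso_surj[OF X Y q c(1)] obtain a b where
      a: "a \<in> cycles (obj_groups X) (diff X) i" and b: "b \<in> boundaries (obj_groups Y) (diff Y) i"
      and cab: "c = b \<oplus>\<^bsub>obj Y i\<^esub> f i a" by blast
    have ac: "a \<in> carrier (obj X i)" "diff X i a = \<zero>\<^bsub>obj X (i - 1)\<^esub>" using a by (auto simp: in_cycles)
    have bc: "b \<in> carrier (obj Y i)" using subgroup.mem_carrier[OF boundaries_subgroup[OF Y] b] by simp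
    obtain m where m: "el (ob R Y (i + 1)) m" "dm Y (i + 1) m = emb (obj Y i) b"
      using emb_boundary[OF Y b] by blast
    have "z = cm X Y f i (emb (obj X i) a) + dm Y (i + 1) m"
      using c(2) cab m(2) emb_add[OF cc_ag[OF Y] bc lh_closed[OF cm_hom[OF f] ac(1)]]
      by (simp add: cm_def mmap_emb cc_ag[OF X] ac)
    moreover have "dm X i (emb (obj X i) a) = 0"
      by (simp add: dm_def mmap_emb cc_ag[OF X] ac emb_zero)
    ultimately show ?thesis using m(1) el_emb[OF cc_ag[OF X] ac(1)] by (auto simp: ob_def)
  qed
qed

text \<open>Descending induction over the syzygy complexes, starting at the zero terms. If
  \<open>z\<close> lies over the cycle \<open>x\<close>, then \<open>d z\<close> is a cycle of the
  next syzygy one degree lower, hence equal to \<open>d w\<close> with \<open>w\<close> in that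
  syzygy; so \<open>z - w\<close> is a cycle over \<open>x\<close> in the exact complex
  \<open>A (k + 1)\<close>.\<close>

lemma exact_at_of_resolution:
  fixes A :: "nat \<Rightarrow> int \<Rightarrow> ('r, 'v::ab_group_add) object"
  assumes col: "\<And>k. cpx (A k) (d k)"
    and \<delta>: "\<And>k i. \<delta> k i \<in> hm (A (Suc k) i) (A k i)" and \<delta>\<delta>: "\<And>k i x. \<delta> k i (\<delta> (Suc k) i x) = 0"
    and d\<delta>: "\<And>k i x. d k i (\<delta> k i x) = \<delta> k (i - 1) (d (Suc k) i x)"
    and row: "\<And>k i x. el (A (Suc k) i) x \<Longrightarrow> \<delta> k i x = 0 \<Longrightarrow> \<exists>y. \<delta> (Suc k) i y = x"
    and aug: "\<And>i x. el (A 0 i) x \<Longrightarrow> \<exists>y. \<delta> 0 i y = x"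
    and fin: "\<And>k i x. D < k \<Longrightarrow> el (A k i) x \<Longrightarrow> x = 0"
    and ex: "\<And>k i. exact_at (A (Suc k)) (d (Suc k)) i"
  shows "exact_at (A 0) (d 0) i"
proof -
  note ok = cpx_ok[OF col]
  note dh = cpx_d[OF col] and dd = cpx_dd[OF col]
  have "\<exists>y. d k (i + 1) y = x \<and> (\<forall>k'. k = Suc k' \<longrightarrow> \<delta> k' (i + 1) y = 0)"
    if "el (A k i) x" "d k i x = 0" "\<And>k'. k = Suc k' \<Longrightarrow> \<delta> k' i x = 0" for k i x
    using that
  proof (induction "Suc D - k" arbitrary: k i x)
    case 0
    then have "x = 0" using fin[of k i x] by simp
    then show ?case by (intro exI[of _ 0]) (auto simp: hm_zero[OF \<delta>] hm_zero[OF cpx_d'[OF col]])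
  next
    case (Suc n)
    obtain z where z: "\<delta> k i z = x"
      using aug[of i x] row[of "k - 1" i x] Suc(3,5) by (cases k) auto
    let ?y = "d (Suc k) i z"
    have "\<exists>w. d (Suc k) (i - 1 + 1) w = ?y \<and> (\<forall>k'. Suc k = Suc k' \<longrightarrow> \<delta> k' (i - 1 + 1) w = 0)"
      using Suc(2,4) z by (intro Suc(1) hm_el[OF dh] dd) (auto simp: d\<delta>[symmetric])
    then obtain w where w: "d (Suc k) i w = ?y" "\<delta> k i w = 0" by auto
    let ?e = "snd (A (Suc k) i)"
    have "el (A (Suc k) i) (?e z - ?e w)" by (intro el_diff ok el_snd)
    moreover have "d (Suc k) i (?e z - ?e w) = 0" using w by (simp add: hm_lin[OF dh] hm_src[OF dh])
    ultimately obtain t where t: "d (Suc k) (i + 1) t = ?e z - ?e w" using exact_atD[OF ex] by blast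
    have "d k (i + 1) (\<delta> k (i + 1) t) = \<delta> k i (?e z - ?e w)" using d\<delta>[of k "i + 1" t] t by simp
    also have "\<dots> = x" by (simp add: hm_lin[OF \<delta>] hm_src[OF \<delta>] z w)
    finally show ?case by (intro exI[of _ "\<delta> k (i + 1) t"]) (auto simp: \<delta>\<delta>)
  qed
  from this[of 0 i] show ?thesis
    unfolding exact_at_def using el_snd[OF ok] hm_src[OF cpx_d'[OF col]] by (metis nat.distinct(1))
qed

section \<open>Gorenstein projective complexes\<close>

lemma cm_cm:
  assumes X: "chain_complex R X" and Y: "chain_complex R Y" and Z: "chain_complex R Z"
    and f: "f \<in> chain_maps R X Y" and g: "g \<in> chain_maps R Y Z" and e: "exact_maps X f Y g Z"
  shows "cm Y Z g i (cm X Y f i x) = 0"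
    and "el (ob R Y i) y \<Longrightarrow> cm Y Z g i y = 0 \<Longrightarrow> \<exists>x. el (ob R X i) x \<and> cm X Y f i x = y"
  using mmap_exact'[OF cc_lm[OF X] cc_lm[OF Y] cc_lm[OF Z]] mmap_exact[OF cc_lm[OF X] cc_lm[OF Y] cc_lm[OF Z] _ _ _ cm_hom[OF g]]
    e unfolding exact_maps_def ob_def cm_def by auto

lemma cm_surj:
  assumes X: "chain_complex R X" and Y: "chain_complex R Y" and s: "surjective_map X Y f"
    and y: "el (ob R Y i) y"
  shows "\<exists>x. el (ob R X i) x \<and> cm X Y f i x = y"
proof -
  obtain b where b: "b \<in> carrier (obj Y i)" "y = emb (obj Y i) b"
    using elE[OF y[unfolded ob_def] cc_ag[OF Y]] .
  moreover from this have "b \<in> f i ` carrier (obj X i)" using s by (simp add: surjective_map_def)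
  ultimately obtain a where "a \<in> carrier (obj X i)" "f i a = b" by blast
  then show ?thesis using b
    by (intro exI[of _ "emb (obj X i) a"]) (simp add: ob_def cm_def el_emb cc_ag[OF X] mmap_emb)
qed

lemma zero_el:
  assumes A: "left_module R A" and z: "zero_lmodule A" and x: "el (mobj R A) x"
  shows "x = 0"
  using elE[OF x lm_ag[OF A]] z emb_zero[OF lm_ag[OF A]] by (auto simp: zero_lmodule_def)

text \<open>The resolved complex becomes the term \<open>A 0\<close> and the augmentation becomes
  \<open>\<delta> 0\<close>, so that one exactness statement covers the whole sequence. This shift
  of the index turns the bound \<open>D\<close> into \<open>Suc D\<close>.\<close>

lemma finite_projective_resolution:
  fixes L :: "('r, 'm) cplx"
  assumes "finite_projective_dimension R L"
  obtains A d \<delta> D where "A 0 = ob R L" "d 0 = dm L"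
    "\<forall>k. \<exists>X :: ('r, 'm) cplx. projective_cplx R X \<and> A (Suc k) = ob R X \<and> d (Suc k) = dm X"
    "\<forall>k i. \<delta> k i \<in> hm (A (Suc k) i) (A k i)" "\<forall>k i x. \<delta> k i (\<delta> (Suc k) i x) = 0"
    "\<forall>k i x. d k i (\<delta> k i x) = \<delta> k (i - 1) (d (Suc k) i x)"
    "\<forall>k i x. el (A (Suc k) i) x \<longrightarrow> \<delta> k i x = 0 \<longrightarrow> (\<exists>y. \<delta> (Suc k) i y = x)"
    "\<forall>i x. el (A 0 i) x \<longrightarrow> (\<exists>y. \<delta> 0 i y = x)"
    "\<forall>k i x. Suc D < k \<longrightarrow> el (A k i) x \<longrightarrow> x = 0"
proof -
  obtain Q :: "nat \<Rightarrow> ('r, 'm) cplx" and \<delta>' \<epsilon> D where L: "chain_complex R L"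
    and Q: "\<And>k. projective_cplx R (Q k)" and z: "\<And>k. D < k \<Longrightarrow> zero_cplx (Q k)"
    and \<epsilon>: "\<epsilon> \<in> chain_maps R (Q 0) L" and \<delta>: "\<And>k. \<delta>' k \<in> chain_maps R (Q (Suc k)) (Q k)"
    and s: "surjective_map (Q 0) L \<epsilon>" and e0: "exact_maps (Q (Suc 0)) (\<delta>' 0) (Q 0) \<epsilon> L"
    and e: "\<And>k. exact_maps (Q (Suc (Suc k))) (\<delta>' (Suc k)) (Q (Suc k)) (\<delta>' k) (Q k)"
    using assms unfolding finite_projective_dimension_def by blast
  note QC = projective_cplxD(1)[OF Q]
  let ?A = "\<lambda>k. case k of 0 \<Rightarrow> ob R L | Suc k \<Rightarrow> ob R (Q k)"
  let ?d = "\<lambda>k. case k of 0 \<Rightarrow> dm L | Suc k \<Rightarrow> dm (Q k)"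
  let ?\<delta> = "\<lambda>k i. case k of 0 \<Rightarrow> cm (Q 0) L \<epsilon> i | Suc k \<Rightarrow> cm (Q (Suc k)) (Q k) (\<delta>' k) i"
  show ?thesis
  proof (rule that[of ?A ?d ?\<delta> D]; (intro allI impI)?)
    show "\<exists>X :: ('r, 'm) cplx. projective_cplx R X \<and> ?A (Suc k) = ob R X \<and> ?d (Suc k) = dm X" for k
      using Q by auto
    show "?\<delta> k i \<in> hm (?A (Suc k) i) (?A k i)" for k i
      using cm_hm[OF QC L \<epsilon>] cm_hm[OF QC QC \<delta>] by (cases k) auto
    show "?\<delta> k i (?\<delta> (Suc k) i x) = 0" for k i x
      using cm_cm(1)[OF QC QC L \<delta> \<epsilon> e0] cm_cm(1)[OF QC QC QC \<delta> \<delta> e] by (cases k) auto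
    show "?d k i (?\<delta> k i x) = ?\<delta> k (i - 1) (?d (Suc k) i x)" for k i x
      using cm_dm[OF QC L \<epsilon>] cm_dm[OF QC QC \<delta>] by (cases k) auto
    show "\<exists>y. ?\<delta> (Suc k) i y = x" if "el (?A (Suc k) i) x" "?\<delta> k i x = 0" for k i x
      using that cm_cm(2)[OF QC QC L \<delta> \<epsilon> e0] cm_cm(2)[OF QC QC QC \<delta> \<delta> e] by (cases k) (simp, blast)+
    show "\<exists>y. ?\<delta> 0 i y = x" if "el (?A 0 i) x" for i x
      using that cm_surj[OF QC L s] by (simp, blast)
    show "x = 0" if "Suc D < k" "el (?A k i) x" for k i x
      using that z[of "k - 1"] zero_el[OF cc_lm[OF QC], of "k - 1" i x]
      by (cases k) (auto simp: ob_def zero_cplx_def)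
  qed auto
qed

text \<open>As the kernel of the map leaving \<open>Q 0\<close>, the complex \<open>G\<close> is
  also the image of \<open>Q 1\<close>. So \<open>Q 1\<close>, \<open>Q 2\<close>, ... resolve
  \<open>G\<close> through \<open>\<epsilon>\<close>, while \<open>Q 0\<close> is kept as the place
  to which homomorphisms vanishing on the image of \<open>\<beta> 1\<close> extend. The map
  \<open>\<epsilon>\<close> is a degreewise lift of \<open>\<beta> 0\<close> through
  \<open>\<iota>\<close>; the injectivity of \<open>\<iota>\<close> makes it a map of
  complexes.\<close>

lemma gorenstein_resolution:
  fixes G :: "('r, 'm) cplx"
  assumes "gorenstein_projective R G"
  obtains Q :: "nat \<Rightarrow> ('r, 'm) cplx" and \<beta> \<epsilon> \<iota>
  where "\<forall>m. projective_cplx R (Q m)"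
    "\<forall>m i. \<beta> m i \<in> hm (ob R (Q (Suc m)) i) (ob R (Q m) i)"
    "\<forall>m i x. \<beta> m i (\<beta> (Suc m) i x) = 0"
    "\<forall>m i x. dm (Q m) i (\<beta> m i x) = \<beta> m (i - 1) (dm (Q (Suc m)) i x)"
    "\<forall>m i x. el (ob R (Q (Suc m)) i) x \<longrightarrow> \<beta> m i x = 0 \<longrightarrow> (\<exists>y. \<beta> (Suc m) i y = x)"
    "\<forall>m i (A :: ('r, 'm) module) f. projective_lmodule R A \<longrightarrow> f \<in> hm (ob R (Q (Suc m)) i) (mobj R A) \<longrightarrow>
      (\<forall>x. f (\<beta> (Suc m) i x) = 0) \<longrightarrow> (\<exists>g\<in>hm (ob R (Q m) i) (mobj R A). \<forall>x. f x = g (\<beta> m i x))"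
    "\<forall>i. \<epsilon> i \<in> hm (ob R (Q (Suc 0)) i) (ob R G i)"
    "\<forall>i x. dm G i (\<epsilon> i x) = \<epsilon> (i - 1) (dm (Q (Suc 0)) i x)"
    "\<forall>i x. el (ob R G i) x \<longrightarrow> (\<exists>y. \<epsilon> i y = x)"
    "\<forall>i x. \<epsilon> i x = 0 \<longleftrightarrow> \<beta> 0 i x = 0"
    "\<forall>i. \<iota> i \<in> hm (ob R G i) (ob R (Q 0) i)"
    "\<forall>i x. \<iota> i (\<epsilon> i x) = \<beta> 0 i x"
proof -
  obtain Q' :: "int \<Rightarrow> ('r, 'm) cplx" and \<delta> \<iota>' where G: "chain_complex R G"
    and Q': "\<And>i. projective_cplx R (Q' i)" and \<delta>: "\<And>i. \<delta> i \<in> chain_maps R (Q' i) (Q' (i - 1))"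
    and ex: "\<And>i. exact_maps (Q' (i + 1)) (\<delta> (i + 1)) (Q' i) (\<delta> i) (Q' (i - 1))"
    and hom: "\<And>(W :: ('r, 'm) cplx) i. projective_cplx R W \<Longrightarrow>
        (\<lambda>g. comp_map (Q' i) g (\<delta> i)) ` chain_maps R (Q' (i - 1)) W =
          {f \<in> chain_maps R (Q' i) W. comp_map (Q' (i + 1)) f (\<delta> (i + 1)) = zero_map (Q' (i + 1)) W}"
    and \<iota>': "\<iota>' \<in> chain_maps R G (Q' 0)" "injective_map G \<iota>'" "exact_maps G \<iota>' (Q' 0) (\<delta> 0) (Q' (- 1))"
    using assms unfolding gorenstein_projective_def by blast
  define Q where "Q m = Q' (int m)" for m
  define e where "e m = \<delta> (int (Suc m))" for m
  note QC = projective_cplxD(1)[OF Q']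
  have Q: "projective_cplx R (Q m)" for m using Q' by (simp add: Q_def)
  note QC' = projective_cplxD(1)[OF Q]
  have e: "e m \<in> chain_maps R (Q (Suc m)) (Q m)" for m
    using \<delta>[of "int (Suc m)"] by (simp add: e_def Q_def)
  have ee: "exact_maps (Q (Suc (Suc m))) (e (Suc m)) (Q (Suc m)) (e m) (Q m)" for m
    using ex[of "int (Suc m)"] by (simp add: e_def Q_def add.commute)
  have ee0: "exact_maps (Q (Suc 0)) (e 0) (Q 0) (\<delta> 0) (Q' (- 1))"
    using ex[of 0] by (simp add: e_def Q_def)
  have hom': "(\<lambda>g. comp_map (Q (Suc m)) g (e m)) ` chain_maps R (Q m) W =
      {f \<in> chain_maps R (Q (Suc m)) W. comp_map (Q (Suc (Suc m))) f (e (Suc m)) = zero_map (Q (Suc (Suc m))) W}"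
    if "projective_cplx R W" for W :: "('r, 'm) cplx" and m
    using hom[OF that, of "int (Suc m)"] by (simp add: e_def Q_def add.commute)
  define \<beta> where "\<beta> m i = cm (Q (Suc m)) (Q m) (e m) i" for m i
  define \<iota> where "\<iota> i = cm G (Q 0) \<iota>' i" for i
  have \<beta>: "\<beta> m i \<in> hm (ob R (Q (Suc m)) i) (ob R (Q m) i)" for m i
    unfolding \<beta>_def by (rule cm_hm[OF QC' QC' e])
  have \<beta>\<beta>: "\<beta> m i (\<beta> (Suc m) i x) = 0" for m i x
    unfolding \<beta>_def by (rule cm_cm(1)[OF QC' QC' QC' e e ee])
  have d\<beta>: "dm (Q m) i (\<beta> m i x) = \<beta> m (i - 1) (dm (Q (Suc m)) i x)" for m i x
    unfolding \<beta>_def by (rule cm_dm[OF QC' QC' e])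
  have \<iota>'': "\<iota>' \<in> chain_maps R G (Q 0)" and \<delta>0: "\<delta> 0 \<in> chain_maps R (Q 0) (Q' (- 1))"
    using \<iota>'(1) \<delta>[of 0] by (simp_all add: Q_def)
  have \<iota>e: "exact_maps G \<iota>' (Q 0) (\<delta> 0) (Q' (- 1))" using \<iota>'(3) by (simp add: Q_def)
  have \<iota>: "\<iota> i \<in> hm (ob R G i) (ob R (Q 0) i)" for i
    unfolding \<iota>_def by (rule cm_hm[OF G QC' \<iota>''])
  have d\<iota>: "dm (Q 0) i (\<iota> i x) = \<iota> (i - 1) (dm G i x)" for i x
    unfolding \<iota>_def by (rule cm_dm[OF G QC' \<iota>''])
  have inj: "x = y" if xy: "el (ob R G i) x" "el (ob R G i) y" "\<iota> i x = \<iota> i y" for i x y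
  proof -
    obtain a b where ab: "a \<in> carrier (obj G i)" "x = emb (obj G i) a" "b \<in> carrier (obj G i)" "y = emb (obj G i) b"
      using elE[OF xy(1)[unfolded ob_def] cc_ag[OF G]] elE[OF xy(2)[unfolded ob_def] cc_ag[OF G]] by metis
    then have "\<iota>' i a = \<iota>' i b"
      using xy(3) lh_closed[OF cm_hom[OF \<iota>'']]
      by (simp add: \<iota>_def cm_def mmap_emb cc_ag[OF G] emb_inj cc_ag[OF QC'])
    then show ?thesis using \<iota>'(2) ab unfolding injective_map_def inj_on_def by blast
  qed
  have "\<exists>h\<in>hm (ob R (Q (Suc 0)) i) (ob R G i). \<forall>x. \<iota> i (h x) = \<beta> 0 i x" for i
  proof (rule liftsD[OF _ \<beta> \<iota>])
    show "lifts (ob R (Q (Suc 0)) i) (ob R G i) (ob R (Q 0) i)"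
      unfolding ob_def by (intro projective_lifts projective_cplxD(3)[OF Q] good_mobj cc_lm[OF G])
    show "\<exists>y. \<beta> 0 i x = \<iota> i y" for x
    proof -
      have "cm (Q 0) (Q' (- 1)) (\<delta> 0) i (\<beta> 0 i x) = 0"
        unfolding \<beta>_def by (rule cm_cm(1)[OF QC' QC' QC e \<delta>0 ee0])
      from cm_cm(2)[OF G QC' QC \<iota>'' \<delta>0 \<iota>e hm_el[OF \<beta>] this] show ?thesis by (metis \<iota>_def)
    qed
  qed
  then obtain \<epsilon> where \<epsilon>: "\<And>i. \<epsilon> i \<in> hm (ob R (Q (Suc 0)) i) (ob R G i)" "\<And>i x. \<iota> i (\<epsilon> i x) = \<beta> 0 i x"
    by metis
  note GC = cpx_ob[OF G]
  show ?thesis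
  proof (rule that[of Q \<beta> \<epsilon> \<iota>]; (intro allI impI)?; (rule Q \<beta> \<beta>\<beta> d\<beta> \<epsilon> \<iota>)?)
    show "\<exists>y. \<beta> (Suc m) i y = x" if "el (ob R (Q (Suc m)) i) x" "\<beta> m i x = 0" for m i x
      using cm_cm(2)[OF QC' QC' QC' e e ee] that unfolding \<beta>_def by blast
    show "\<exists>g\<in>hm (ob R (Q m) i) (mobj R A). \<forall>x. f x = g (\<beta> m i x)"
      if "projective_lmodule R A" "f \<in> hm (ob R (Q (Suc m)) i) (mobj R A)" "\<forall>x. f (\<beta> (Suc m) i x) = 0"
      for m i and A :: "('r, 'm) module" and f
      using degreewise_hom_exact[OF QC' QC' QC' e e hom' that(1,2)] that(3) unfolding \<beta>_def by blast
    show "dm G i (\<epsilon> i x) = \<epsilon> (i - 1) (dm (Q (Suc 0)) i x)" for i x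
    proof (rule inj)
      show "\<iota> (i - 1) (dm G i (\<epsilon> i x)) = \<iota> (i - 1) (\<epsilon> (i - 1) (dm (Q (Suc 0)) i x))"
        by (simp add: d\<iota>[symmetric] \<epsilon>(2) d\<beta>)
    qed (rule hm_el[OF cpx_d[OF GC]] hm_el[OF \<epsilon>(1)])+
    show "\<exists>y. \<epsilon> i y = x" if x: "el (ob R G i) x" for i x
    proof -
      have "cm (Q 0) (Q' (- 1)) (\<delta> 0) i (\<iota> i x) = 0"
        unfolding \<iota>_def by (rule cm_cm(1)[OF G QC' QC \<iota>'' \<delta>0 \<iota>e])
      from cm_cm(2)[OF QC' QC' QC e \<delta>0 ee0 hm_el[OF \<iota>] this] obtain y where "\<beta> 0 i y = \<iota> i x"
        by (metis \<beta>_def)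
      then have "\<epsilon> i y = x" by (intro inj[OF hm_el[OF \<epsilon>(1)] x]) (simp add: \<epsilon>(2))
      then show ?thesis by blast
    qed
    show "\<epsilon> i x = 0 \<longleftrightarrow> \<beta> 0 i x = 0" for i x
      using inj[OF hm_el[OF \<epsilon>(1)] el_zero[OF cpx_ok[OF GC]], of i x] \<epsilon>(2)[of i x] hm_zero[OF \<iota>, of i] by metis
  qed
qed

section \<open>The kernel of the precover\<close>

lemma ker_cplx_obj: "obj (ker_cplx X Y f) i = (obj X i)\<lparr>carrier := a_kernel (obj X i) (obj Y i) (f i)\<rparr>"
  and ker_cplx_diff: "diff (ker_cplx X Y f) i = restrict (diff X i) (a_kernel (obj X i) (obj Y i) (f i))"
  by (simp_all add: ker_cplx_def Let_def)

lemma finite_projective_dimension_exact: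
  fixes L :: "('r, 'm) cplx"
  assumes "finite_projective_dimension R L"
  shows "exact_at (ob R L) (dm L) i"
proof -
  have L: "chain_complex R L" using assms by (simp add: finite_projective_dimension_def)
  obtain A d \<delta> D where A': "A 0 = ob R L" "d 0 = dm L"
    "\<forall>k. \<exists>X :: ('r, 'm) cplx. projective_cplx R X \<and> A (Suc k) = ob R X \<and> d (Suc k) = dm X"
    "\<forall>k i. \<delta> k i \<in> hm (A (Suc k) i) (A k i)" "\<forall>k i x. \<delta> k i (\<delta> (Suc k) i x) = 0"
    "\<forall>k i x. d k i (\<delta> k i x) = \<delta> k (i - 1) (d (Suc k) i x)"
    "\<forall>k i x. el (A (Suc k) i) x \<longrightarrow> \<delta> k i x = 0 \<longrightarrow> (\<exists>y. \<delta> (Suc k) i y = x)"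
    "\<forall>i x. el (A 0 i) x \<longrightarrow> (\<exists>y. \<delta> 0 i y = x)"
    "\<forall>k i x. Suc D < k \<longrightarrow> el (A k i) x \<longrightarrow> x = 0"
    using finite_projective_resolution[OF assms] .
  note A = A'[rule_format]
  have c: "cpx (A k) (d k)" for k
    using cpx_ob[OF L] A(1,2) A(3)[of "k - 1"] projective_cplxD(1) cpx_ob by (cases k) (simp, fastforce)
  have e: "exact_at (A (Suc k)) (d (Suc k)) i" for k i
    using A(3)[of k] projective_cplxD(2) by metis
  show ?thesis using exact_at_of_resolution[where A=A and d=d and \<delta>=\<delta> and D="Suc D" and i=i, OF c A(4-9) e] A(1,2) by simp
qed

text \<open>The terms of the kernel complex are module records of their own, with their own
  coordinates in the ambient group; exactness is therefore carried to \<open>G\<close> through the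
  carriers.\<close>

lemma ker_cplx_exact:
  fixes G M :: "('r, 'm) cplx"
  assumes G: "chain_complex R G" and M: "chain_complex R M" and \<phi>: "\<phi> \<in> chain_maps R G M"
    and L: "finite_projective_dimension R (ker_cplx G M \<phi>)"
    and x: "el (ob R G i) x" "cm G M \<phi> i x = 0" "dm G i x = 0"
  shows "\<exists>y. el (ob R G (i + 1)) y \<and> cm G M \<phi> (i + 1) y = 0 \<and> dm G (i + 1) y = x"
proof -
  let ?L = "ker_cplx G M \<phi>"
  have LC: "chain_complex R ?L" using L by (simp add: finite_projective_dimension_def)
  obtain a where a: "a \<in> cycles (obj_groups G) (diff G) i" "x = emb (obj G i) a"
    using ob_cycleE[OF G x(1,3)] .
  have ac: "a \<in> carrier (obj G i)" "diff G i a = \<zero>\<^bsub>obj G (i - 1)\<^esub>" using a(1) by (auto simp: in_cycles)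
  have "\<phi> i a = \<zero>\<^bsub>obj M i\<^esub>"
    using mmap_eq_zeroD[where f="\<phi> i", OF cc_ag[OF G] cc_ag[OF M] ac(1) lh_closed[OF cm_hom[OF \<phi>] ac(1)]] x(2) a(2)
    by (simp add: cm_def)
  then have aL: "a \<in> carrier (obj ?L i)" "diff ?L i a = \<zero>\<^bsub>obj ?L (i - 1)\<^esub>"
    using ac by (auto simp: ker_cplx_obj ker_cplx_diff a_kernel_def')
  have "dm ?L i (emb (obj ?L i) a) = 0"
    using aL by (simp add: dm_def mmap_emb cc_ag[OF LC] emb_zero)
  from exact_atD[OF finite_projective_dimension_exact[OF L] _ this]
  obtain y where "dm ?L (i + 1) y = emb (obj ?L i) a"
    using el_emb[OF cc_ag[OF LC] aL(1)] by (auto simp: ob_def)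
  from boundary_emb[OF LC this aL(1)] obtain b where b: "b \<in> carrier (obj ?L (i + 1))" "a = diff ?L (i + 1) b"
    by (auto simp: in_boundaries)
  then have "b \<in> carrier (obj G (i + 1))" "\<phi> (i + 1) b = \<zero>\<^bsub>obj M (i + 1)\<^esub>" "a = diff G (i + 1) b"
    by (auto simp: ker_cplx_obj ker_cplx_diff a_kernel_def')
  then show ?thesis using a(2)
    by (intro exI[of _ "emb (obj G (i + 1)) b"])
      (simp add: ob_def cm_def dm_def mmap_emb cc_ag[OF G] el_emb emb_zero cc_ag[OF M])
qed

lemma gorenstein_precover_facts:
  fixes G M :: "('r, 'm) cplx" and n :: nat
  assumes gor: "gorenstein_projective R G" and M: "chain_complex R M" and \<phi>: "\<phi> \<in> chain_maps R G M"
    and fpd: "finite_projective_dimension R (ker_cplx G M \<phi>)"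
    and zero: "\<And>i. i < 0 \<or> int n < i \<Longrightarrow> zero_lmodule (obj M i)"
  shows "i < 0 \<or> int n < i \<Longrightarrow> projective_lmodule R (obj G i)"
    and "\<exists>K. \<forall>i. i \<le> - 2 \<or> K \<le> i \<longrightarrow> (\<exists>h. cycle_section (ob R G) (dm G) i h)"
proof -
  let ?L = "ker_cplx G M \<phi>"
  have G: "chain_complex R G" using gor by (simp add: gorenstein_projective_def)
  have LC: "chain_complex R ?L" using fpd by (simp add: finite_projective_dimension_def)
  obtain A d \<delta> D where A': "A 0 = ob R ?L" "d 0 = dm ?L"
    "\<forall>k. \<exists>X :: ('r, 'm) cplx. projective_cplx R X \<and> A (Suc k) = ob R X \<and> d (Suc k) = dm X"
    "\<forall>k i. \<delta> k i \<in> hm (A (Suc k) i) (A k i)" "\<forall>k i x. \<delta> k i (\<delta> (Suc k) i x) = 0"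
    "\<forall>k i x. d k i (\<delta> k i x) = \<delta> k (i - 1) (d (Suc k) i x)"
    "\<forall>k i x. el (A (Suc k) i) x \<longrightarrow> \<delta> k i x = 0 \<longrightarrow> (\<exists>y. \<delta> (Suc k) i y = x)"
    "\<forall>i x. el (A 0 i) x \<longrightarrow> (\<exists>y. \<delta> 0 i y = x)"
    "\<forall>k i x. Suc D < k \<longrightarrow> el (A k i) x \<longrightarrow> x = 0"
    using finite_projective_resolution[OF fpd] .
  note A = A'[rule_format]
  obtain X :: "nat \<Rightarrow> ('r, 'm) cplx" where X: "\<And>k. projective_cplx R (X k)" "\<And>k. A (Suc k) = ob R (X k)"
    "\<And>k. d (Suc k) = dm (X k)" using A(3) by metis
  note XC = projective_cplxD(1)[OF X(1)]
  have c: "cpx (A k) (d k)" for k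
    using cpx_ob[OF LC] A(1,2) cpx_ob[OF XC] by (cases k) (simp_all add: X)
  have gA: "\<exists>B :: ('r, 'm) module. A k i = mobj R B \<and> left_module R B" for k i
    using cc_lm[OF LC] cc_lm[OF XC] by (cases k) (auto simp: A(1) X(2) ob_def)
  obtain Q :: "nat \<Rightarrow> ('r, 'm) cplx" and \<beta> \<epsilon> \<iota> where
    Q': "\<forall>m. projective_cplx R (Q m)"
    "\<forall>m i. \<beta> m i \<in> hm (ob R (Q (Suc m)) i) (ob R (Q m) i)"
    "\<forall>m i x. \<beta> m i (\<beta> (Suc m) i x) = 0"
    "\<forall>m i x. dm (Q m) i (\<beta> m i x) = \<beta> m (i - 1) (dm (Q (Suc m)) i x)"
    "\<forall>m i x. el (ob R (Q (Suc m)) i) x \<longrightarrow> \<beta> m i x = 0 \<longrightarrow> (\<exists>y. \<beta> (Suc m) i y = x)"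
    "\<forall>m i (A :: ('r, 'm) module) f. projective_lmodule R A \<longrightarrow> f \<in> hm (ob R (Q (Suc m)) i) (mobj R A) \<longrightarrow>
      (\<forall>x. f (\<beta> (Suc m) i x) = 0) \<longrightarrow> (\<exists>g\<in>hm (ob R (Q m) i) (mobj R A). \<forall>x. f x = g (\<beta> m i x))"
    "\<forall>i. \<epsilon> i \<in> hm (ob R (Q (Suc 0)) i) (ob R G i)"
    "\<forall>i x. dm G i (\<epsilon> i x) = \<epsilon> (i - 1) (dm (Q (Suc 0)) i x)"
    "\<forall>i x. el (ob R G i) x \<longrightarrow> (\<exists>y. \<epsilon> i y = x)"
    "\<forall>i x. \<epsilon> i x = 0 \<longleftrightarrow> \<beta> 0 i x = 0"
    "\<forall>i. \<iota> i \<in> hm (ob R G i) (ob R (Q 0) i)"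
    "\<forall>i x. \<iota> i (\<epsilon> i x) = \<beta> 0 i x"
    using gorenstein_resolution[OF gor] .
  note Q = Q'(1,2,3,6,7,9,10,11,12)[rule_format]
  note QC = projective_cplxD(1)[OF Q(1)]
  have LG: "obj ?L i = obj G i" if i: "i < 0 \<or> int n < i" for i
  proof -
    have "\<phi> i x = \<zero>\<^bsub>obj M i\<^esub>" if "x \<in> carrier (obj G i)" for x
      using lh_closed[OF cm_hom[OF \<phi>] that] zero[OF i] by (simp add: zero_lmodule_def)
    then have "a_kernel (obj G i) (obj M i) (\<phi> i) = carrier (obj G i)" by (auto simp: a_kernel_def')
    then show ?thesis by (simp add: ker_cplx_obj)
  qed
  have sec: "\<exists>\<sigma>\<in>hm (A 0 i) (A (Suc 0) i). \<forall>x. el (A 0 i) x \<longrightarrow> \<delta> 0 i (\<sigma> x) = x"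
    if i: "i < 0 \<or> int n < i" for i
  proof -
    have A0: "A 0 i = ob R G i" using LG[OF i] by (simp add: A(1) ob_def)
    show ?thesis
    proof (rule resolution_section[where A="\<lambda>k. A k i" and B="\<lambda>m. ob R (Q m) i" and \<delta>="\<lambda>k. \<delta> k i"
          and \<beta>="\<lambda>m. \<beta> m i" and D="Suc D" and p="\<epsilon> i" and \<iota>="\<iota> i"])
      show "\<exists>g\<in>hm (ob R (Q m) i) (A (Suc k) i). \<forall>x. f x = g (\<beta> m i x)"
        if "f \<in> hm (ob R (Q (Suc m)) i) (A (Suc k) i)" "\<And>x. f (\<beta> (Suc m) i x) = 0" for m k f
        using Q(4)[OF projective_cplxD(3)[OF X(1)]] that by (simp add: X(2) ob_def)
      show "lifts (ob R (Q (Suc m)) i) (A (Suc k) i) (A k i)" for m k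
        unfolding ob_def X(2) by (intro projective_lifts projective_cplxD(3)[OF Q(1)] good_mobj cc_lm[OF XC])
      show "\<epsilon> i (\<beta> (Suc 0) i x) = 0" for x by (simp add: Q(3,7))
      show "obj_ok (A k i)" "obj_ok (ob R (Q k) i)" for k
        using cpx_ok[OF c] cpx_ok[OF cpx_ob[OF QC]] by auto
    qed (use Q A A0 in \<open>auto\<close>)
  qed
  show proj: "projective_lmodule R (obj G i)" if i: "i < 0 \<or> int n < i" for i
  proof -
    obtain \<sigma> where \<sigma>: "\<sigma> \<in> hm (A 0 i) (A (Suc 0) i)" "\<And>x. el (A 0 i) x \<Longrightarrow> \<delta> 0 i (\<sigma> x) = x"
      using sec[OF i] by blast
    have A0: "A 0 i = mobj R (obj G i)" using LG[OF i] by (simp add: A(1) ob_def)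
    show ?thesis
      by (rule projective_retract[OF projective_cplxD(3)[OF X(1), of 0 i] cc_lm[OF G], where s=\<sigma> and r="\<delta> 0 i"])
        (use \<sigma> A(4)[of 0 i] A0 in \<open>auto simp: X(2) ob_def\<close>)
  qed
  have "\<exists>t. cycle_section (A (Suc k)) (d (Suc k)) i t" for k i
    using projective_cplx_section[OF X(1)] by (simp add: X(2,3))
  then obtain t where t: "\<And>k i. cycle_section (A (Suc k)) (d (Suc k)) i (t k i)" by metis
  \<comment> \<open>The resolution of the kernel has its bound shifted to \<open>Suc D\<close>, so
    \<open>cycle_section_of_resolution\<close> looks \<open>D + 2\<close> degrees down, and at the
    upper end all of these must lie above \<open>n\<close>. At the lower end \<open>i + 1\<close>
    must still be negative, which gives \<open>- 2\<close>.\<close>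
  have "\<exists>h. cycle_section (ob R G) (dm G) i h" if i: "i \<le> - 2 \<or> int n + int (Suc (Suc D)) + 2 \<le> i" for i
  proof -
    have "\<exists>h. cycle_section (A 0) (d 0) i h"
    proof (rule cycle_section_of_resolution[where A=A and d=d and \<delta>=\<delta> and t=t and D="Suc D", OF c A(4-7,9) t])
      show "lifts (A (Suc k) i) (A (Suc (Suc k)) i) (A (Suc k) i)" for k i
        unfolding X(2) ob_def by (intro projective_lifts projective_cplxD(3)[OF X(1)] good_mobj cc_lm[OF XC])
    qed (use i in \<open>auto intro!: sec\<close>)
    then obtain h where h: "cycle_section (A 0) (d 0) i h" by blast
    have e: "obj ?L i = obj G i" "obj ?L (i + 1) = obj G (i + 1)" "obj ?L (i - 1) = obj G (i - 1)"
      using i by (auto intro!: LG)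
    have "a_kernel (obj G j) (obj M j) (\<phi> j) = carrier (obj G j)" if "obj ?L j = obj G j" for j
      using arg_cong[OF that, of carrier] by (simp add: ker_cplx_obj)
    then have "diff ?L j = diff G j" if "obj ?L j = obj G j" for j
      using that lh_ext[OF cc_d[OF G, of j]] by (simp add: ker_cplx_diff extensional_restrict)
    then have "dm ?L i = dm G i" "dm ?L (i + 1) = dm G (i + 1)" using e by (simp_all add: dm_def)
    then have "cycle_section (ob R G) (dm G) i h"
      using h e by (simp add: cycle_section_def A(1,2) ob_def)
    then show ?thesis by blast
  qed
  then show "\<exists>K. \<forall>i. i \<le> - 2 \<or> K \<le> i \<longrightarrow> (\<exists>h. cycle_section (ob R G) (dm G) i h)" by blast
qed

section \<open>Homomorphisms from the mapping cone to projective modules\<close>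

text \<open>The sign \<open>(-1)^m\<close>; its alternation makes consecutive maps \<open>N\<close>
  of the resolution below compose to zero.\<close>

definition sg :: "nat \<Rightarrow> 'v::ab_group_add \<Rightarrow> 'v" where
  "sg m x = (if even m then x else - x)"

lemma sg_simps: "sg m (x + y) = sg m x + sg m y" "sg m (- x) = - sg m x" "sg m (x - y) = sg m x - sg m y"
    "sg m 0 = 0" "sg (Suc m) x = - sg m x" "sg m (sg m x) = x" "sg 0 x = x"
  by (simp_all add: sg_def)

lemma sg_hm: "f \<in> hm A B \<Longrightarrow> f (sg m x) = sg m (f x)"
  by (simp add: sg_def hm_minus)

lemma hm_sg: "f \<in> hm A B \<Longrightarrow> obj_ok B \<Longrightarrow> (\<lambda>x. sg m (f x)) \<in> hm A B"
  by (cases "even m") (simp_all add: sg_def hm_uminus)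

definition zobj :: "('r, 'v::ab_group_add) object \<Rightarrow> ('r, 'v) object" where
  "zobj A = (fst A, \<lambda>x. 0)"

lemma zobj_ok: "obj_ok A \<Longrightarrow> obj_ok (zobj A)"
  using act_zero[of A] by (auto simp: zobj_def obj_ok_def hm_def)

lemma el_zobj: "el (zobj A) x \<longleftrightarrow> x = 0"
  by (auto simp: zobj_def el_def)

lemma lifts_zobj: "obj_ok X \<Longrightarrow> lifts (zobj A) X Y"
  unfolding lifts_def
proof (intro ballI impI)
  fix f g assume X: "obj_ok X" and f: "f \<in> hm (zobj A) Y" and g: "g \<in> hm X Y"
  have "f x = 0" for x using hm_src[OF f, of x] hm_zero[OF f] by (simp add: zobj_def)
  then show "\<exists>h\<in>hm (zobj A) X. \<forall>x. g (h x) = f x"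
    by (intro bexI[OF _ hm_0[OF X]]) (simp add: hm_zero[OF g])
qed

text \<open>\<open>k\<close> is the degree in which the cycles of the cone are going to split. The
  cone has the term \<open>G k \<oplus> P (k - 1)\<close> there, which explains the two different
  degrees in \<open>low\<close>.\<close>

locale cone_setup =
  fixes R :: "('r, 'x) ring_scheme" and P G :: "('r, 'm) cplx" and u :: "int \<Rightarrow> ('r, 'm) amb \<Rightarrow> ('r, 'm) amb"
    and Q :: "nat \<Rightarrow> ('r, 'm) cplx" and \<beta> :: "nat \<Rightarrow> int \<Rightarrow> ('r, 'm) amb \<Rightarrow> ('r, 'm) amb"
    and \<epsilon> :: "int \<Rightarrow> ('r, 'm) amb \<Rightarrow> ('r, 'm) amb" and \<iota> :: "int \<Rightarrow> ('r, 'm) amb \<Rightarrow> ('r, 'm) amb" and k :: int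
  assumes inf: "infinite (UNIV :: 'm set)"
    and P: "chain_complex R P" "\<And>i. projective_lmodule R (obj P i)"
    and G: "chain_complex R G"
    and u: "\<And>i. u i \<in> hm (ob R P i) (ob R G i)" "\<And>i x. dm G i (u i x) = u (i - 1) (dm P i x)"
    and Q: "\<And>m. projective_cplx R (Q m)"
    and \<beta>: "\<And>m i. \<beta> m i \<in> hm (ob R (Q (Suc m)) i) (ob R (Q m) i)"
    and \<beta>\<beta>: "\<And>m i x. \<beta> m i (\<beta> (Suc m) i x) = 0"
    and d\<beta>: "\<And>m i x. dm (Q m) i (\<beta> m i x) = \<beta> m (i - 1) (dm (Q (Suc m)) i x)"
    and row: "\<And>m i x. el (ob R (Q (Suc m)) i) x \<Longrightarrow> \<beta> m i x = 0 \<Longrightarrow> \<exists>y. \<beta> (Suc m) i y = x"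
    and hom_row: "\<And>m i A f. projective_lmodule R (A :: ('r, 'm) module) \<Longrightarrow> f \<in> hm (ob R (Q (Suc m)) i) (mobj R A) \<Longrightarrow>
      (\<And>x. f (\<beta> (Suc m) i x) = 0) \<Longrightarrow> \<exists>g\<in>hm (ob R (Q m) i) (mobj R A). \<forall>x. f x = g (\<beta> m i x)"
    and \<epsilon>: "\<And>i. \<epsilon> i \<in> hm (ob R (Q (Suc 0)) i) (ob R G i)"
    and d\<epsilon>: "\<And>i x. dm G i (\<epsilon> i x) = \<epsilon> (i - 1) (dm (Q (Suc 0)) i x)"
    and \<epsilon>_surj: "\<And>i x. el (ob R G i) x \<Longrightarrow> \<exists>y. \<epsilon> i y = x"
    and \<epsilon>_zero: "\<And>i x. \<epsilon> i x = 0 \<longleftrightarrow> \<beta> 0 i x = 0"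
    and \<iota>: "\<And>i. \<iota> i \<in> hm (ob R G i) (ob R (Q 0) i)" "\<And>i x. \<iota> i (\<epsilon> i x) = \<beta> 0 i x"
    and cone_exact: "\<And>i x y. el (ob R G i) x \<Longrightarrow> el (ob R P (i - 1)) y \<Longrightarrow> dm P (i - 1) y = 0 \<Longrightarrow>
      dm G i x + u (i - 1) y = 0 \<Longrightarrow>
      \<exists>x' y'. el (ob R G (i + 1)) x' \<and> el (ob R P i) y' \<and> dm G (i + 1) x' + u i y' = x \<and> - dm P i y' = y"
    and low: "projective_lmodule R (obj G k)" "\<exists>h. cycle_section (ob R G) (dm G) k h"
      "\<exists>h. cycle_section (ob R P) (dm P) (k - 1) h"
begin

lemmas QC = projective_cplxD(1)[OF Q]
lemmas cP = cpx_ob[OF P(1)] and cG = cpx_ob[OF G] and cQ = cpx_ob[OF QC]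
lemmas okP = cpx_ok[OF cP] and okG = cpx_ok[OF cG] and okQ = cpx_ok[OF cQ]

text \<open>The contractible complex with terms \<open>V m i \<oplus> V m (i - 1)\<close> maps onto
  \<open>V m (i - 1)\<close> with a kernel isomorphic to \<open>V m i\<close>, which is
  \<open>V (m + 1) (i - 1)\<close>. So the shift of \<open>P\<close> grows by one with each step of
  the resolution.\<close>

definition V :: "nat \<Rightarrow> int \<Rightarrow> ('r, ('r, 'm) amb) object" where
  "V m i = ob R P (i + int m)"
definition D :: "nat \<Rightarrow> int \<Rightarrow> ('r, 'm) amb \<Rightarrow> ('r, 'm) amb" where
  "D m i = dm P (i + int m)"

lemma V_Suc: "V (Suc m) i = V m (i + 1)" and D_Suc: "D (Suc m) i = D m (i + 1)"
  by (simp_all add: V_def D_def algebra_simps)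

lemma V_0: "V 0 i = ob R P i" and D_0: "D 0 i = dm P i"
  by (simp_all add: V_def D_def)

lemma okV: "obj_ok (V m i)" by (simp add: V_def okP)

lemma D_hm: "D m i \<in> hm (V m i) (V m (i - 1))"
  using cpx_d[OF cP, of "i + int m"] by (simp add: V_def D_def algebra_simps)

lemma D_hm': "D m (i + 1) \<in> hm (V m (i + 1)) (V m i)"
  using D_hm[of m "i + 1"] by simp

lemma DD: "D m (i - 1) (D m i x) = 0"
  using cpx_dd[OF cP, of "i + int m" x] by (simp add: D_def algebra_simps)

lemma DD': "D m i (D m (i + 1) x) = 0"
  using DD[of m "i + 1" x] by simp

lemma V_lifts: "good TYPE('m) R X \<Longrightarrow> lifts (V m i) X Y"
  unfolding V_def ob_def by (rule projective_lifts[OF P(2)])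

lemma Q_lifts: "good TYPE('m) R X \<Longrightarrow> lifts (ob R (Q m) i) X Y"
  unfolding ob_def by (rule projective_lifts[OF projective_cplxD(3)[OF Q]])

lemma goods: "good TYPE('m) R (ob R P i)" "good TYPE('m) R (ob R G i)" "good TYPE('m) R (ob R (Q m) i)"
    "good TYPE('m) R (V m i)"
  unfolding V_def ob_def by (intro good_mobj cc_lm P G QC)+

abbreviation "dQ m i \<equiv> dm (Q m) i"

lemmas dQ_hm = cpx_d[OF cQ] and dQ_hm' = cpx_d'[OF cQ] and dQ_dd = cpx_dd[OF cQ] and dQ_dd' = cpx_dd'[OF cQ]

text \<open>Lifting \<open>u\<close> along the rows: the homotopies \<open>\<sigma> m\<close> measure how far the degreewise lift of the
  previous step is from being a chain map.\<close>

lemma ladder: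
  obtains \<sigma> where "\<forall>m i. \<sigma> m i \<in> hm (V m i) (ob R (Q (Suc m)) i)"
    "\<forall>i x. \<epsilon> i (\<sigma> 0 i x) = - u i x"
    "\<forall>m i x. \<beta> (Suc m) i (\<sigma> (Suc m) i x) = sg m (\<sigma> m i (D m (i + 1) x)) - dQ (Suc m) (i + 1) (\<sigma> m (i + 1) x)"
proof -
  \<comment> \<open>\<open>\<tau>\<close> is the failure of \<open>s\<close> to commute with the
    differentials up to sign. The invariant \<open>I\<close> places it in the kernel of
    \<open>\<beta> m\<close>, from where row exactness lifts it to the next homotopy.\<close>
  define \<tau> where "\<tau> m s i x = sg m (s i (D m (i + 1) x)) - dQ (Suc m) (i + 1) (s (i + 1) x)" for m s i x
  define I where "I m s \<longleftrightarrow> (\<forall>i. s i \<in> hm (V m i) (ob R (Q (Suc m)) i)) \<and> (\<forall>i x. \<beta> m i (\<tau> m s i x) = 0) \<and>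
    (m = 0 \<longrightarrow> (\<forall>i x. \<epsilon> i (s i x) = - u i x))" for m s
  have "\<exists>s. I 0 s"
  proof -
    have "\<exists>h\<in>hm (V 0 i) (ob R (Q (Suc 0)) i). \<forall>x. \<epsilon> i (h x) = - u i x" for i
    proof (rule liftsD[OF V_lifts[OF goods(3)] _ \<epsilon>])
      show h: "(\<lambda>x. - u i x) \<in> hm (V 0 i) (ob R G i)" unfolding V_0 by (intro hm_uminus u okG)
      show "\<exists>y. - u i x = \<epsilon> i y" for x using \<epsilon>_surj[OF hm_el[OF h, of x]] by metis
    qed
    then obtain s where s: "\<And>i. s i \<in> hm (V 0 i) (ob R (Q (Suc 0)) i)" "\<And>i x. \<epsilon> i (s i x) = - u i x" by metis
    have "\<epsilon> i (\<tau> 0 s i x) = 0" for i x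
      using d\<epsilon>[of "i + 1" "s (i + 1) x"] u(2)[of "i + 1" x]
      by (simp add: \<tau>_def hm_lin[OF \<epsilon>] sg_simps s(2) D_0 hm_lin[OF cpx_d[OF cG]])
    then show ?thesis using s by (auto simp: I_def \<epsilon>_zero)
  qed
  moreover have "\<exists>s'. I (Suc m) s' \<and> (\<forall>i x. \<beta> (Suc m) i (s' i x) = \<tau> m s i x)" if I: "I m s" for m s
  proof -
    have s: "s i \<in> hm (V m i) (ob R (Q (Suc m)) i)" for i using I by (simp add: I_def)
    have "\<exists>h\<in>hm (V (Suc m) i) (ob R (Q (Suc (Suc m))) i). \<forall>x. \<beta> (Suc m) i (h x) = \<tau> m s i x" for i
    proof (rule liftsD[OF V_lifts[OF goods(3)] _ \<beta>])
      show h: "\<tau> m s i \<in> hm (V (Suc m) i) (ob R (Q (Suc m)) i)" unfolding V_Suc \<tau>_def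
        by (intro hm_sub hm_sg hm_comp[OF D_hm' s] hm_comp[OF s dQ_hm'] okQ)
      show "\<exists>y. \<tau> m s i x = \<beta> (Suc m) i y" for x
        using row[OF hm_el[OF h], of x] I by (metis I_def)
    qed
    then obtain s' where s': "\<And>i. s' i \<in> hm (V (Suc m) i) (ob R (Q (Suc (Suc m))) i)"
      "\<And>i x. \<beta> (Suc m) i (s' i x) = \<tau> m s i x" by metis
    have "\<beta> (Suc m) i (\<tau> (Suc m) s' i x) = 0" for i x
    proof -
      have "\<beta> (Suc m) i (\<tau> (Suc m) s' i x) =
          - sg m (\<tau> m s i (D (Suc m) (i + 1) x)) - dQ (Suc m) (i + 1) (\<tau> m s (i + 1) x)"
        using d\<beta>[of "Suc m" "i + 1" "s' (i + 1) x"] unfolding \<tau>_def[of "Suc m" s']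
        by (simp add: hm_lin[OF \<beta>] sg_hm[OF \<beta>] sg_simps s'(2))
      also have "\<dots> = 0"
        using hm_zero[OF s] DD'[of m "i + 1" x] dQ_dd'[of "Suc m" "i + 1"]
        by (simp add: \<tau>_def D_Suc sg_simps hm_lin[OF dQ_hm] sg_hm[OF dQ_hm])
      finally show ?thesis .
    qed
    then show ?thesis using s' by (auto simp: I_def)
  qed
  ultimately obtain \<sigma> where \<sigma>: "\<And>m. I m (\<sigma> m)"
    "\<And>m i x. \<beta> (Suc m) i (\<sigma> (Suc m) i x) = \<tau> m (\<sigma> m) i x"
    using dependent_nat_choice[of I "\<lambda>m s s'. \<forall>i x. \<beta> (Suc m) i (s' i x) = \<tau> m s i x"] by metis
  show ?thesis by (rule that[of \<sigma>]) (use \<sigma> in \<open>auto simp: I_def \<tau>_def\<close>)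
qed

end

locale cone_ladder = cone_setup R P G u Q \<beta> \<epsilon> \<iota> k
  for R :: "('r, 'x) ring_scheme" and P G :: "('r, 'm) cplx" and u Q \<beta> \<epsilon> \<iota> k +
  fixes \<sigma> t :: "nat \<Rightarrow> int \<Rightarrow> ('r, 'm) amb \<Rightarrow> ('r, 'm) amb" and hG hP :: "('r, 'm) amb \<Rightarrow> ('r, 'm) amb"
  assumes \<sigma>: "\<And>m i. \<sigma> m i \<in> hm (V m i) (ob R (Q (Suc m)) i)"
    and \<epsilon>\<sigma>: "\<And>i x. \<epsilon> i (\<sigma> 0 i x) = - u i x"
    and \<beta>\<sigma>: "\<And>m i x. \<beta> (Suc m) i (\<sigma> (Suc m) i x) =
      sg m (\<sigma> m i (D m (i + 1) x)) - dQ (Suc m) (i + 1) (\<sigma> m (i + 1) x)"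
    and t: "\<And>m i. cycle_section (ob R (Q (Suc m))) (dQ (Suc m)) i (t m i)"
    and hG: "cycle_section (ob R G) (dm G) k hG" and hP: "cycle_section (ob R P) (dm P) (k - 1) hP"
begin

text \<open>
  \<open>X 0\<close> is the cone, padded with a zero summand so that all \<open>X m\<close> live on one type, and \<open>X (m + 1)\<close> is
  \<open>Q (m + 1)\<close> plus the contractible complex on the shift of \<open>P\<close> by \<open>m\<close>; \<open>N\<close> is the augmented resolution
  of the cone that they form.
\<close>

definition X where
  "X m i = (case m of 0 \<Rightarrow> osum (ob R G i) (osum (ob R P (i - 1)) (zobj (ob R P 0)))
    | Suc m \<Rightarrow> osum (ob R (Q (Suc m)) i) (osum (V m i) (V m (i - 1))))"

definition dX where
  "dX m i z = (case m of 0 \<Rightarrow> (dm G i (fst z) + u (i - 1) (fst (snd z)), - dm P (i - 1) (fst (snd z)), 0)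
    | Suc m \<Rightarrow> (dQ (Suc m) i (fst z), snd (V m (i - 1)) (snd (snd z)), 0))"

text \<open>On the contractible summand \<open>N\<close> is determined by its values on
  \<open>(0, 0, p')\<close>. These are a degreewise lift of \<open>V m i\<close> into the kernel of
  the preceding map, with components \<open>\<sigma> m p'\<close>, \<open>p'\<close> and
  \<open>D p'\<close> up to sign; for the cone it is the inclusion of \<open>P (i - 1)\<close>. The
  value on \<open>(0, p, 0)\<close> is the differential of such a lift, and this makes
  \<open>N\<close> a map of complexes although the lift itself is none.\<close>

definition N where
  "N m i z = (case m of
      0 \<Rightarrow> (\<epsilon> i (fst z) + u i (fst (snd z)), snd (ob R P (i - 1)) (snd (snd z)) - dm P i (fst (snd z)), 0)
    | Suc m \<Rightarrow> (\<beta> (Suc m) i (fst z) + (\<sigma> m i (snd (snd z)) + dQ (Suc m) (i + 1) (\<sigma> m (i + 1) (fst (snd z)))),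
        snd (V m i) (snd (snd z)) + sg m (D m (i + 1) (fst (snd z))), sg m (D m i (snd (snd z)))))"

definition sX where
  "sX m i z = (t m i (fst z), 0, snd (V m i) (fst (snd z)))"

lemma X_simps: "X 0 i = osum (ob R G i) (osum (ob R P (i - 1)) (zobj (ob R P 0)))"
    "X (Suc m) i = osum (ob R (Q (Suc m)) i) (osum (V m i) (V m (i - 1)))"
    "dX 0 i = (\<lambda>z. (dm G i (fst z) + u (i - 1) (fst (snd z)), - dm P (i - 1) (fst (snd z)), 0))"
    "dX (Suc m) i = (\<lambda>z. (dQ (Suc m) i (fst z), snd (V m (i - 1)) (snd (snd z)), 0))"
  by (auto simp: X_def dX_def)

lemma N_simps: "N 0 i = (\<lambda>z. (\<epsilon> i (fst z) + u i (fst (snd z)),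
      snd (ob R P (i - 1)) (snd (snd z)) - dm P i (fst (snd z)), 0))"
    "N (Suc m) i = (\<lambda>z. (\<beta> (Suc m) i (fst z) + (\<sigma> m i (snd (snd z)) + dQ (Suc m) (i + 1) (\<sigma> m (i + 1) (fst (snd z)))),
        snd (V m i) (snd (snd z)) + sg m (D m (i + 1) (fst (snd z))), sg m (D m i (snd (snd z)))))"
  by (auto simp: N_def)

lemmas okZ = zobj_ok[OF okP]
lemmas e_lin = hm_lin[OF obj_okI[OF okV]] hm_lin[OF obj_okI[OF okP]]
lemmas lins = hm_lin[OF u(1)] hm_lin[OF \<beta>] hm_lin[OF \<epsilon>] hm_lin[OF \<sigma>] hm_lin[OF D_hm] hm_lin[OF dQ_hm]
  hm_lin[OF cpx_d[OF cP]] hm_lin[OF cpx_d[OF cG]]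
lemmas sgs = sg_hm[OF \<sigma>] sg_hm[OF D_hm] sg_hm[OF dQ_hm] sg_hm[OF obj_okI[OF okV]] sg_simps

lemma X_ok: "obj_ok (X m i)"
  by (cases m) (auto simp: X_simps intro!: obj_ok_osum okG okP okZ okQ okV)

lemma dX_hm: "dX m i \<in> hm (X m i) (X m (i - 1))"
proof (cases m)
  case 0
  show ?thesis unfolding 0 X_simps
    by (intro hm_pair hm_plus hm_uminus hm_0 okZ okP okG hm_fst[OF cpx_d[OF cG]] hm_snd[OF hm_fst[OF u(1)]]
        hm_snd[OF hm_fst[OF cpx_d[OF cP]]])
next
  case (Suc m')
  show ?thesis unfolding Suc X_simps
    by (intro hm_pair hm_0 okV hm_fst[OF dQ_hm] hm_snd[OF hm_snd[OF obj_okI[OF okV]]])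
qed

lemma X_cpx: "cpx (X m) (dX m)"
proof -
  have "dX m (i - 1) (dX m i z) = 0" for i z
    using u(2)[of "i - 1" "fst (snd z)"] cpx_dd[OF cP, of "i - 1" "fst (snd z)"]
    by (cases m) (simp_all add: X_simps zero_prod_def lins e_lin cpx_dd[OF cP] cpx_dd[OF cG] dQ_dd)
  then show ?thesis unfolding cpx_def using X_ok dX_hm by blast
qed

lemma N_hm: "N m i \<in> hm (X (Suc m) i) (X m i)"
proof (cases m)
  case 0
  show ?thesis unfolding 0 X_simps N_simps V_0
    by (intro hm_pair hm_plus hm_sub hm_0 okZ okP okG hm_fst[OF \<epsilon>] hm_snd[OF hm_fst[OF u(1)]]
        hm_snd[OF hm_fst[OF cpx_d[OF cP]]] hm_snd[OF hm_snd[OF obj_okI[OF okP]]])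
next
  case (Suc m')
  have V: "V (Suc m') (i - 1) = V m' i" by (simp add: V_Suc)
  show ?thesis unfolding Suc X_simps N_simps V unfolding V_Suc
    by (intro hm_pair hm_plus okV okQ hm_fst[OF \<beta>] hm_snd[OF hm_snd[OF \<sigma>]] hm_sg
        hm_snd[OF hm_fst[OF hm_comp[OF \<sigma> dQ_hm']]] hm_snd[OF hm_snd[OF obj_okI[OF okV]]]
        hm_snd[OF hm_fst[OF D_hm']] hm_snd[OF hm_snd[OF D_hm]])
qed

lemma V_src: "f \<in> hm (V m i) B \<Longrightarrow> f (snd (V m i) x) = f x"
  by (rule hm_src)

lemma NN: "N m i (N (Suc m) i z) = 0"
proof (cases m)
  case 0
  let ?p = "fst (snd z)" and ?p' = "snd (snd z)"
  have 1: "\<epsilon> i (dQ (Suc 0) (i + 1) (\<sigma> 0 (i + 1) ?p)) = - u i (dm P (i + 1) ?p)"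
    using d\<epsilon>[of "i + 1" "\<sigma> 0 (i + 1) ?p"] u(2)[of "i + 1" ?p]
    by (simp add: \<epsilon>\<sigma> lins)
  have 2: "\<epsilon> i (\<beta> (Suc 0) i (fst z)) = 0" by (simp add: \<epsilon>_zero \<beta>\<beta>)
  show ?thesis unfolding 0 N_simps
    by (simp add: zero_prod_def lins 1 2 \<epsilon>\<sigma> sg_simps D_0 V_0 hm_src[OF u(1)] hm_src[OF cpx_d[OF cP]]
        cpx_dd'[OF cP] hm_tgt[OF cpx_d[OF cP]])
next
  case (Suc m')
  let ?p = "fst (snd z)" and ?p' = "snd (snd z)"
  have 1: "\<beta> (Suc m') i (dQ (Suc (Suc m')) (i + 1) (\<sigma> (Suc m') (i + 1) ?p)) =
      sg m' (dQ (Suc m') (i + 1) (\<sigma> m' (i + 1) (D m' (i + 1 + 1) ?p)))"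
    using d\<beta>[of "Suc m'" "i + 1" "\<sigma> (Suc m') (i + 1) ?p"] dQ_dd'[of "Suc m'" "i + 1"]
    by (simp add: \<beta>\<sigma> lins sgs)
  have 2: "D m' (i + 1) (D m' (2 + i) ?p) = 0" using DD'[of m' "i + 1" ?p] by simp
  have 3: "snd (V m' i) (D m' (i + 1) ?p') = D m' (i + 1) ?p'" by (rule hm_tgt[OF D_hm'])
  have 4: "f (snd (V m' (i + 1)) x) = f x" if "f \<in> hm (V m' (i + 1)) B" for f B x
    using that by (rule hm_src)
  show ?thesis unfolding Suc N_simps
    by (simp add: zero_prod_def lins 1 \<beta>\<sigma> \<beta>\<beta> sgs D_Suc V_Suc 4[OF \<sigma>] 4[OF D_hm] DD' 2 3 e_lin)
qed

lemma dN: "dX m i (N m i z) = N m (i - 1) (dX (Suc m) i z)"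
proof (cases m)
  case 0
  let ?p = "fst (snd z)" and ?p' = "snd (snd z)"
  show ?thesis unfolding 0 N_simps X_simps
    by (simp add: lins e_lin d\<epsilon> u(2) V_0 hm_src[OF u(1)] hm_src[OF cpx_d[OF cP]] cpx_dd[OF cP])
next
  case (Suc m')
  let ?p' = "snd (snd z)"
  have V: "V (Suc m') (i - 1) = V m' i" by (simp add: V_Suc)
  have 1: "snd (V m' (i - 1)) (D m' i ?p') = D m' i ?p'" by (rule hm_tgt[OF D_hm])
  show ?thesis unfolding Suc N_simps X_simps V
    by (simp add: lins d\<beta> sgs e_lin dQ_dd' V_src[OF \<sigma>] V_src[OF D_hm] 1)
qed

lemma aug: "el (X 0 i) x \<Longrightarrow> \<exists>y. N 0 i y = x"
proof -
  assume x: "el (X 0 i) x"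
  obtain q where q: "\<epsilon> i q = fst x" using \<epsilon>_surj x by (auto simp: X_simps el_osum)
  have "snd (ob R P (i - 1)) (fst (snd x)) = fst (snd x)" "snd (snd x) = 0"
    using x by (auto simp: X_simps el_osum el_zobj el_def[of "ob R P (i - 1)"])
  then show ?thesis
    by (intro exI[of _ "(q, 0, fst (snd x))"]) (simp add: N_simps q lins prod_eq_iff)
qed

text \<open>In the kernel of \<open>N m\<close> the entry \<open>p\<close> is free,
  \<open>p'\<close> is determined by \<open>p\<close>, and \<open>q - \<sigma> m p\<close> ranges
  over the kernel of \<open>\<beta> m\<close>, which for \<open>m = 0\<close> is that of
  \<open>\<epsilon>\<close>. With \<open>q'\<close> over \<open>q - \<sigma> m p\<close>, a preimage
  is \<open>(q', 0, p)\<close>.\<close>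

lemma rowX: "el (X (Suc m) i) x \<Longrightarrow> N m i x = 0 \<Longrightarrow> \<exists>y. N (Suc m) i y = x"
proof -
  assume x: "el (X (Suc m) i) x" and Nx: "N m i x = 0"
  obtain q p p' where xe: "x = (q, p, p')" by (cases x) auto
  have "el (ob R (Q (Suc m)) i) q \<and> el (V m i) p \<and> el (V m (i - 1)) p'"
    using x by (simp add: X_simps el_osum xe)
  then have e: "el (ob R (Q (Suc m)) i) q" "snd (V m i) p = p" "snd (V m (i - 1)) p' = p'"
    by (simp_all add: el_def)
  have "el (ob R (Q (Suc m)) i) (q - \<sigma> m i p)" by (intro el_diff okQ e hm_el[OF \<sigma>])
  moreover have "\<beta> m i (q - \<sigma> m i p) = 0 \<and> p' = sg m (D m i p)"
  proof (cases m)
    case [simp]: 0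
    have "p' = dm P i p" "\<epsilon> i q + u i p = 0"
      using Nx e by (auto simp: N_simps xe zero_prod_def V_0)
    then have "p' = dm P i p" "\<epsilon> i (q - \<sigma> 0 i p) = 0" by (auto simp: lins \<epsilon>\<sigma>)
    then show ?thesis
      by (simp add: \<epsilon>_zero sg_simps D_0)
  next
    case [simp]: (Suc m')
    have V: "V (Suc m') (i - 1) = V m' i" by (simp add: V_Suc)
    have p': "p' = - sg m' (D m' (i + 1) p)"
      using Nx e by (simp add: N_simps xe zero_prod_def V eq_neg_iff_add_eq_0)
    moreover have "\<beta> (Suc m') i q + (\<sigma> m' i p' + dQ (Suc m') (i + 1) (\<sigma> m' (i + 1) p)) = 0"
      using Nx by (simp add: N_simps xe zero_prod_def)
    ultimately have "\<beta> (Suc m') i (q - \<sigma> (Suc m') i p) = 0"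
      by (simp add: lins \<beta>\<sigma> sgs algebra_simps)
    then show ?thesis using p' by (simp add: D_Suc sg_simps)
  qed
  ultimately obtain q' where q': "\<beta> (Suc m) i q' = q - \<sigma> m i p" "p' = sg m (D m i p)"
    using row by blast
  show ?thesis
    by (rule exI[of _ "(q', 0, p)"])
      (use q' e in \<open>auto simp: N_simps xe lins sg_simps\<close>)
qed

end

lemma good_zobj:
  assumes A: "good TYPE('m) R A"
  shows "good TYPE('m) R (zobj A)"
proof -
  have ok: "obj_ok A" using A by (simp add: good_def)
  have "{x. el (zobj A) x} = {0}" by (auto simp: el_zobj)
  then have "Collect (el (zobj A)) \<lesssim> (UNIV :: 'm set)"
    unfolding lepoll_def by (intro exI[of _ "\<lambda>_. undefined"]) auto
  moreover have "fst (zobj A) = fst A" by (simp add: zobj_def)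
  ultimately show ?thesis using A zobj_ok[OF ok] unfolding good_def
    by (simp add: el_zobj act_zero ok)
qed

lemma hm_in3:
  assumes f: "f \<in> hm (osum A (osum B C)) Y" and ok: "obj_ok A" "obj_ok B" "obj_ok C"
  shows "(\<lambda>x. f (x, 0, 0)) \<in> hm A Y" "(\<lambda>x. f (0, x, 0)) \<in> hm B Y" "(\<lambda>x. f (0, 0, x)) \<in> hm C Y"
    and "f z = f (fst z, 0, 0) + (f (0, fst (snd z), 0) + f (0, 0, snd (snd z)))"
proof -
  note okBC = obj_ok_osum[OF ok(2,3)]
  show "(\<lambda>x. f (x, 0, 0)) \<in> hm A Y" using hm_in1[OF f ok(1) okBC] by (simp add: zero_prod_def)
  note f2 = hm_in2[OF f ok(1) okBC]
  show "(\<lambda>x. f (0, x, 0)) \<in> hm B Y" using hm_in1[OF f2 ok(2,3)] by simp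
  show "(\<lambda>x. f (0, 0, x)) \<in> hm C Y" using hm_in2[OF f2 ok(2,3)] by simp
  show "f z = f (fst z, 0, 0) + (f (0, fst (snd z), 0) + f (0, 0, snd (snd z)))"
    using hm_osum_split[OF f, of "fst z" "snd z"] hm_osum_split[OF f2, of "fst (snd z)" "snd (snd z)"]
    by (simp add: zero_prod_def)
qed

section \<open>The hypotheses of the dimension shift, for the resolved cone\<close>

context cone_ladder
begin

lemma X_good: "good TYPE('m) R (X m i)"
  by (cases m) (auto simp: X_simps intro!: good_osum inf goods good_zobj)

lemma X_lifts: "lifts (X (Suc m) i) (X m' i') (X m'' i'')"
  unfolding X_simps by (intro lifts_osum Q_lifts V_lifts X_good okQ okV obj_ok_osum X_ok)

lemma X_lifts0: "lifts (X 0 k) (X m' i') (X m'' i'')"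
proof -
  have "lifts (ob R G k) (X m' i') (X m'' i'')"
    unfolding ob_def by (rule projective_lifts[OF low(1) X_good])
  moreover have "lifts (ob R P (k - 1)) (X m' i') (X m'' i'')"
    using V_lifts[OF X_good, of 0 "k - 1"] by (simp add: V_0)
  ultimately show ?thesis unfolding X_simps(1)
    by (intro lifts_osum lifts_zobj okG okP okZ obj_ok_osum X_ok)
qed

lemma X_exact: "exact_at (X m) (dX m) i"
proof (cases m)
  case 0
  show ?thesis unfolding exact_at_def 0 X_simps el_osum el_zobj
  proof (intro allI impI)
    fix z assume z: "el (ob R G i) (fst z) \<and> el (ob R P (i - 1)) (fst (snd z)) \<and> snd (snd z) = 0"
      "(dm G i (fst z) + u (i - 1) (fst (snd z)), - dm P (i - 1) (fst (snd z)), 0) = (0 :: ('r, 'm) amb \<times> ('r, 'm) amb \<times> ('r, 'm) amb)"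
    then obtain x' y' where "el (ob R G (i + 1)) x'" "el (ob R P i) y'"
      "dm G (i + 1) x' + u i y' = fst z" "- dm P i y' = fst (snd z)"
      using cone_exact[of i "fst z" "fst (snd z)"] by (auto simp: zero_prod_def)
    then show "\<exists>y. (el (ob R G (i + 1)) (fst y) \<and> el (ob R P (i + 1 - 1)) (fst (snd y)) \<and> snd (snd y) = 0) \<and>
        (dm G (i + 1) (fst y) + u (i + 1 - 1) (fst (snd y)), - dm P (i + 1 - 1) (fst (snd y)), 0) = z"
      using z by (intro exI[of _ "(x', y', 0)"]) (simp add: prod_eq_iff)
  qed
next
  case (Suc m')
  show ?thesis unfolding exact_at_def Suc X_simps el_osum
  proof (intro allI impI)
    fix z assume z: "el (ob R (Q (Suc m')) i) (fst z) \<and> el (V m' i) (fst (snd z)) \<and> el (V m' (i - 1)) (snd (snd z))"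
      "(dQ (Suc m') i (fst z), snd (V m' (i - 1)) (snd (snd z)), 0) = (0 :: ('r, 'm) amb \<times> ('r, 'm) amb \<times> ('r, 'm) amb)"
    then have z0: "dQ (Suc m') i (fst z) = 0" "snd (snd z) = 0"
      by (auto simp: zero_prod_def el_def[of "V m' (i - 1)"])
    obtain q where "el (ob R (Q (Suc m')) (i + 1)) q" "dQ (Suc m') (i + 1) q = fst z"
      using exact_atD[OF projective_cplxD(2)[OF Q] _ z0(1)] z(1) by blast
    then show "\<exists>y. (el (ob R (Q (Suc m')) (i + 1)) (fst y) \<and> el (V m' (i + 1)) (fst (snd y)) \<and>
        el (V m' (i + 1 - 1)) (snd (snd y))) \<and>
        (dQ (Suc m') (i + 1) (fst y), snd (V m' (i + 1 - 1)) (snd (snd y)), 0) = z"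
      using z z0 el_zero[OF okV]
      by (intro exI[of _ "(q, 0, fst (snd z))"]) (simp add: prod_eq_iff el_def[of "V m' i"])
  qed
qed

lemma X_section: "cycle_section (X (Suc m)) (dX (Suc m)) i (sX m i)"
proof -
  have t': "t m i \<in> hm (ob R (Q (Suc m)) i) (ob R (Q (Suc m)) (i + 1))"
    "\<And>x. el (ob R (Q (Suc m)) i) x \<Longrightarrow> dQ (Suc m) i x = 0 \<Longrightarrow> dQ (Suc m) (i + 1) (t m i x) = x"
    using t by (auto simp: cycle_section_def)
  have "sX m i \<in> hm (osum (ob R (Q (Suc m)) i) (osum (V m i) (V m (i - 1))))
      (osum (ob R (Q (Suc m)) (i + 1)) (osum (V m (i + 1)) (V m i)))"
    unfolding sX_def by (intro hm_pair hm_0 okV hm_fst[OF t'(1)] hm_snd[OF hm_fst[OF obj_okI[OF okV]]])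
  moreover have "dX (Suc m) (i + 1) (sX m i z) = z" if "el (X (Suc m) i) z" "dX (Suc m) i z = 0" for z
  proof -
    have z: "el (ob R (Q (Suc m)) i) (fst z)" "snd (V m i) (fst (snd z)) = fst (snd z)"
      "dQ (Suc m) i (fst z) = 0" "snd (snd z) = 0"
      using that by (auto simp: X_simps el_osum zero_prod_def el_def[of "V _ _"])
    then show ?thesis by (simp add: X_simps sX_def t'(2) prod_eq_iff)
  qed
  moreover from calculation(1) have "sX m i \<in> hm (X (Suc m) i) (X (Suc m) (i + 1))" by (simp add: X_simps)
  ultimately show ?thesis unfolding cycle_section_def by blast
qed

text \<open>If \<open>(x, y)\<close> is a cycle of the cone, \<open>y\<close> is a cycle of
  \<open>P\<close> and so equals \<open>d (hP y)\<close>; then \<open>x + u (hP y)\<close> is a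
  cycle of \<open>G\<close>, to which \<open>hG\<close> applies. The minus sign is that of the cone
  differential on \<open>P\<close>.\<close>

lemma X_section0:
  "cycle_section (X 0) (dX 0) k (\<lambda>z. (hG (fst z) + hG (u k (hP (fst (snd z)))), - hP (fst (snd z)), 0))"
  (is "cycle_section _ _ _ ?s")
proof -
  have G': "hG \<in> hm (ob R G k) (ob R G (k + 1))"
    "\<And>x. el (ob R G k) x \<Longrightarrow> dm G k x = 0 \<Longrightarrow> dm G (k + 1) (hG x) = x"
    using hG by (auto simp: cycle_section_def)
  have P': "hP \<in> hm (ob R P (k - 1)) (ob R P k)"
    "\<And>x. el (ob R P (k - 1)) x \<Longrightarrow> dm P (k - 1) x = 0 \<Longrightarrow> dm P k (hP x) = x"
    using hP by (auto simp: cycle_section_def)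
  have "?s \<in> hm (X 0 k) (osum (ob R G (k + 1)) (osum (ob R P k) (zobj (ob R P 0))))"
    unfolding X_simps
    by (intro hm_pair hm_0 okZ okP okG hm_uminus hm_snd[OF hm_fst[OF P'(1)]] hm_plus hm_fst[OF G'(1)]
        hm_snd[OF hm_fst[OF hm_comp[OF hm_comp[OF P'(1) u(1)] G'(1)]]])
  moreover have "dX 0 (k + 1) (?s z) = z" if z: "el (X 0 k) z" "dX 0 k z = 0" for z
  proof -
    let ?x = "fst z" and ?y = "fst (snd z)"
    have e: "el (ob R G k) ?x" "el (ob R P (k - 1)) ?y" "snd (snd z) = 0"
      "dm G k ?x + u (k - 1) ?y = 0" "dm P (k - 1) ?y = 0"
      using z by (auto simp: X_simps el_osum el_zobj zero_prod_def)
    have y: "dm P k (hP ?y) = ?y" using P'(2) e by blast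
    have "dm G (k + 1) (hG (?x + u k (hP ?y))) = ?x + u k (hP ?y)"
      using e y by (intro G'(2) el_add okG hm_el[OF u(1)]) (simp_all add: lins u(2))
    then show ?thesis using e y
      by (simp add: X_simps hm_lin[OF G'(1)] lins prod_eq_iff)
  qed
  moreover from calculation(1) have "?s \<in> hm (X 0 k) (X 0 (k + 1))" by (simp add: X_simps)
  ultimately show ?thesis unfolding cycle_section_def by blast
qed

text \<open>Of the three components of \<open>f\<close>, the first extends along
  \<open>\<beta> m\<close> by \<open>hom_row\<close>, and the second is expressed by the other two
  because \<open>f\<close> kills \<open>N (m + 1)\<close> on \<open>(0, 0, p)\<close>. The third is
  defined on \<open>V m (i - 1)\<close>, which is already a summand of \<open>X m i\<close>, so it
  contributes to the extension directly, up to the correction by \<open>g1 \<sigma>\<close> for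
  positive \<open>m\<close>.\<close>

lemma X_hom_row:
  assumes A: "projective_lmodule R (A :: ('r, 'm) module)" and f: "f \<in> hm (X (Suc m) i) (mobj R A)"
    and fN: "\<And>z. f (N (Suc m) i z) = 0"
  shows "\<exists>g\<in>hm (X m i) (mobj R A). \<forall>z. f z = g (N m i z)"
proof -
  note okA = obj_ok_mobj[OF projective_lm[OF A]]
  note f3 = hm_in3[OF f[unfolded X_simps] okQ okV okV]
  define f1 where "f1 = (\<lambda>x. f (x, 0, 0))"
  define f2 where "f2 = (\<lambda>x. f (0, x, 0))"
  define f3 where "f3 = (\<lambda>x. f (0, 0, x))"
  have h1: "f1 \<in> hm (ob R (Q (Suc m)) i) (mobj R A)" and h2: "f2 \<in> hm (V m i) (mobj R A)"
    and h3: "f3 \<in> hm (V m (i - 1)) (mobj R A)"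
    unfolding f1_def f2_def f3_def by (rule f3)+
  have fz: "f z = f1 (fst z) + (f2 (fst (snd z)) + f3 (snd (snd z)))" for z
    unfolding f1_def f2_def f3_def by (rule f3(4))
  have "f1 (\<beta> (Suc m) i q) = 0" for q
    using fN[of "(q, 0, 0)"] by (simp add: fz N_simps lins sg_simps e_lin hm_lin[OF h2] hm_lin[OF h3])
  from hom_row[OF A h1 this] obtain g1 where
    g1: "g1 \<in> hm (ob R (Q m) i) (mobj R A)" "\<And>x. f1 x = g1 (\<beta> m i x)" by blast
  have rel: "f2 p = - f1 (\<sigma> m i p) - sg m (f3 (D m i p))" for p
  proof -
    have "f2 (snd (V m i) p) = f2 p" by (rule hm_src[OF h2])
    moreover have "f1 (\<sigma> m i p) + (f2 (snd (V m i) p) + sg m (f3 (D m i p))) = 0"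
      using fN[of "(0, 0, p)"] by (simp add: fz N_simps lins sg_simps e_lin sg_hm[OF h3])
    ultimately show ?thesis by (simp add: algebra_simps eq_neg_iff_add_eq_0)
  qed
  show ?thesis
  proof (cases m)
    case [simp]: 0
    have h3': "f3 \<in> hm (ob R P (i - 1)) (mobj R A)" using h3 by (simp add: V_0)
    have "(\<lambda>z. g1 (\<iota> i (fst z)) + f3 (fst (snd z))) \<in> hm (X 0 i) (mobj R A)"
      unfolding X_simps using g1(1)
      by (intro hm_plus okA hm_fst[OF hm_comp[OF \<iota>(1)]] hm_snd[OF hm_fst[OF h3']]) simp
    moreover have "f z = g1 (\<iota> i (fst (N 0 i z))) + f3 (fst (snd (N 0 i z)))" for z
    proof -
      have 1: "g1 (\<iota> i (\<epsilon> i x)) = f1 x" for x using g1(2) \<iota>(2) by simp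
      have 2: "g1 (\<iota> i (u i p)) = - f1 (\<sigma> 0 i p)" for p
        using 1[of "\<sigma> 0 i p"] by (simp add: \<epsilon>\<sigma> hm_lin[OF \<iota>(1)] hm_lin[OF g1(1)])
          (metis minus_minus)
      show ?thesis
        by (simp add: N_simps fz rel hm_lin[OF \<iota>(1)] hm_lin[OF g1(1)] hm_lin[OF h3] 1 2 sg_simps D_0
            hm_src[OF h3'])
    qed
    ultimately show ?thesis by (intro bexI[of _ "\<lambda>z. g1 (\<iota> i (fst z)) + f3 (fst (snd z))"]) auto
  next
    case [simp]: (Suc m')
    have h3': "f3 \<in> hm (V m' i) (mobj R A)" using h3 by (simp add: V_Suc)
    have g1': "g1 \<in> hm (ob R (Q (Suc m')) i) (mobj R A)" using g1(1) by simp
    let ?g = "\<lambda>z. g1 (fst z) + (f3 (fst (snd z)) - g1 (\<sigma> m' i (fst (snd z))))"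
    have "?g \<in> hm (X (Suc m') i) (mobj R A)"
      unfolding X_simps
      by (intro hm_plus hm_sub okA hm_fst[OF g1'] hm_snd[OF hm_fst[OF h3']] hm_snd[OF hm_fst[OF hm_comp[OF \<sigma> g1']]])
    moreover have "f z = ?g (N (Suc m') i z)" for z
      using g1(2)[of "\<sigma> (Suc m') i (fst (snd z))"] hm_src[OF h3'] hm_src[OF \<sigma>, of m' i]
      by (simp add: N_simps fz rel hm_lin[OF g1'] hm_lin[OF h3'] g1(2) sg_simps D_Suc \<beta>\<sigma> lins
          sg_hm[OF g1'] sg_hm[OF h3'] sgs)
    ultimately show ?thesis by (intro bexI[of _ ?g]) auto
  qed
qed

lemma cone_hom_exact_triple:
  assumes A: "projective_lmodule R (A :: ('r, 'm) module)" and a: "a \<in> hm (X 0 i) (mobj R A)"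
    "\<And>z. a (dX 0 (i + 1) z) = 0" and i: "k + 2 \<le> i"
  shows "\<exists>c\<in>hm (X 0 (i - 1)) (mobj R A). \<forall>z. a z = c (dX 0 i z)"
proof -
  interpret resolved_complex X dX N "mobj R A" sX
    "\<lambda>z. (hG (fst z) + hG (u k (hP (fst (snd z)))), - hP (fst (snd z)), 0)" k
    by unfold_locales (intro X_cpx N_hm NN dN aug rowX X_exact X_section X_section0 X_lifts X_lifts0
      obj_ok_mobj[OF projective_lm[OF A]] X_hom_row[OF A]; assumption)+
  show ?thesis by (rule hom_exact[OF a i])
qed

end

text \<open>Cocycles and coboundaries of the Hom complex of the cone are written in components, to
  free the conclusion from the padded triples; the sign before \<open>c2\<close> is that of the cone
  differential on \<open>P\<close>.\<close>

theorem (in cone_setup) cone_hom_exact: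
  assumes A: "projective_lmodule R (A :: ('r, 'm) module)"
    and a: "a1 \<in> hm (ob R G i) (mobj R A)" "a2 \<in> hm (ob R P (i - 1)) (mobj R A)"
      "\<And>x. a1 (dm G (i + 1) x) = 0" "\<And>y. a1 (u i y) = a2 (dm P i y)"
    and i: "k + 2 \<le> i"
  shows "\<exists>c1\<in>hm (ob R G (i - 1)) (mobj R A). \<exists>c2\<in>hm (ob R P (i - 1 - 1)) (mobj R A).
    (\<forall>x. a1 x = c1 (dm G i x)) \<and> (\<forall>y. a2 y = c1 (u (i - 1) y) - c2 (dm P (i - 1) y))"
proof -
  obtain \<sigma> where \<sigma>: "\<forall>m i. \<sigma> m i \<in> hm (V m i) (ob R (Q (Suc m)) i)"
    "\<forall>i x. \<epsilon> i (\<sigma> 0 i x) = - u i x"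
    "\<forall>m i x. \<beta> (Suc m) i (\<sigma> (Suc m) i x) = sg m (\<sigma> m i (D m (i + 1) x)) - dQ (Suc m) (i + 1) (\<sigma> m (i + 1) x)"
    using ladder .
  have "\<forall>m i. \<exists>t. cycle_section (ob R (Q (Suc m))) (dQ (Suc m)) i t"
    using projective_cplx_section[OF Q] by blast
  then obtain t where t: "\<And>m i. cycle_section (ob R (Q (Suc m))) (dQ (Suc m)) i (t m i)" by metis
  obtain hG hP where h: "cycle_section (ob R G) (dm G) k hG" "cycle_section (ob R P) (dm P) (k - 1) hP"
    using low by blast
  interpret cone_ladder R P G u Q \<beta> \<epsilon> \<iota> k \<sigma> t hG hP
    by unfold_locales (use \<sigma> t h in auto)
  note okA = obj_ok_mobj[OF projective_lm[OF A]]
  let ?a = "\<lambda>z. a1 (fst z) + a2 (fst (snd z))"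
  have "?a \<in> hm (X 0 i) (mobj R A)"
    unfolding X_simps by (intro hm_plus okA hm_fst[OF a(1)] hm_snd[OF hm_fst[OF a(2)]])
  moreover have "?a (dX 0 (i + 1) z) = 0" for z
    by (simp add: X_simps hm_lin[OF a(1)] hm_lin[OF a(2)] a(3,4))
  ultimately obtain c where c: "c \<in> hm (X 0 (i - 1)) (mobj R A)" "\<And>z. ?a z = c (dX 0 i z)"
    using cone_hom_exact_triple[OF A _ _ i] by blast
  note c3 = hm_in3[OF c(1)[unfolded X_simps] okG okP okZ]
  show ?thesis
  proof (intro bexI[OF _ c3(1)] bexI[OF _ c3(2)] conjI allI)
    show "a1 x = c (dm G i x, 0, 0)" for x
      using c(2)[of "(x, 0, 0)"] by (simp add: X_simps lins hm_lin[OF a(2)])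
    show "a2 y = c (u (i - 1) y, 0, 0) - c (0, dm P (i - 1) y, 0)" for y
    proof -
      have "c (0, - dm P (i - 1) y, 0) = - c (0, dm P (i - 1) y, 0)"
        using hm_minus[OF c3(2)] by simp
      then show ?thesis
        using c(2)[of "(0, y, 0)"] c3(4)[of "(u (i - 1) y, - dm P (i - 1) y, 0)"] hm_zero[OF c3(3)]
        by (simp add: X_simps lins hm_lin[OF a(1)])
    qed
  qed
qed

section \<open>Comparison of the mapping cone with a complete resolution\<close>

lemma hm_fst_comp: "f \<in> hm A (osum B C) \<Longrightarrow> (\<lambda>x. fst (f x)) \<in> hm A B"
  and hm_snd_comp: "f \<in> hm A (osum B C) \<Longrightarrow> (\<lambda>x. snd (f x)) \<in> hm A C"
  by (auto simp: hm_def osum_def prod_eq_iff)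

text \<open>Above \<open>n\<close> the terms of \<open>G\<close> are projective. From
  \<open>K\<close> on \<open>v\<close> is bijective and the cycles of \<open>G\<close> split.
  \<open>C_hom\<close> is the exactness of \<open>Hom(C, A)\<close> for the cone \<open>C\<close> of
  \<open>u\<close>.\<close>

locale comparison =
  fixes R :: "('r, 'x) ring_scheme" and M P P' G T :: "('r, 'm) cplx"
    and p p' u v :: "int \<Rightarrow> ('r, 'm) amb \<Rightarrow> ('r, 'm) amb" and n K :: int
  assumes inf: "infinite (UNIV :: 'm set)"
    and cc: "chain_complex R M" "chain_complex R P" "chain_complex R P'" "chain_complex R G" "chain_complex R T"
    and proj: "\<And>i. projective_lmodule R (obj P i)" "\<And>i. projective_lmodule R (obj P' i)"
      "\<And>i. n < i \<Longrightarrow> projective_lmodule R (obj G i)" "\<And>i. projective_lmodule R (obj T i)"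
    and p: "\<And>i. p i \<in> hm (ob R P i) (ob R M i)" "\<And>i x. dm M i (p i x) = p (i - 1) (dm P i x)"
    and p': "\<And>i. p' i \<in> hm (ob R P' i) (ob R M i)" "\<And>i x. dm M i (p' i x) = p' (i - 1) (dm P' i x)"
    and u: "\<And>i. u i \<in> hm (ob R P i) (ob R G i)" "\<And>i x. dm G i (u i x) = u (i - 1) (dm P i x)"
    and v: "\<And>i. v i \<in> hm (ob R T i) (ob R P' i)" "\<And>i x. dm P' i (v i x) = v (i - 1) (dm T i x)"
    and p_surj: "\<And>i x. el (ob R M i) x \<Longrightarrow> \<exists>y. p i y = x"
    and p_ker: "\<And>i x. el (ob R P i) x \<Longrightarrow> p i x = 0 \<Longrightarrow> dm P i x = 0 \<Longrightarrow>
      \<exists>y. el (ob R P (i + 1)) y \<and> p (i + 1) y = 0 \<and> dm P (i + 1) y = x"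
    and p'_inj: "\<And>i x m. el (ob R P' i) x \<Longrightarrow> dm P' i x = 0 \<Longrightarrow> p' i x = dm M (i + 1) m \<Longrightarrow>
      \<exists>y. el (ob R P' (i + 1)) y \<and> dm P' (i + 1) y = x"
    and p'_surj: "\<And>i z. el (ob R M i) z \<Longrightarrow> dm M i z = 0 \<Longrightarrow>
      \<exists>x m. el (ob R P' i) x \<and> dm P' i x = 0 \<and> el (ob R M (i + 1)) m \<and> z = p' i x + dm M (i + 1) m"
    and M_zero: "\<And>i x. i < 0 \<Longrightarrow> el (ob R M i) x \<Longrightarrow> x = 0"
    and low: "\<And>i. i \<le> - 2 \<Longrightarrow> \<exists>h. cycle_section (ob R P) (dm P) i h"
      "\<And>i. i \<le> - 2 \<Longrightarrow> \<exists>h. cycle_section (ob R P') (dm P') i h"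
    and n: "0 \<le> n" "n \<le> K"
    and T_hom: "\<And>A F i. projective_lmodule R (A :: ('r, 'm) module) \<Longrightarrow> F \<in> hm (ob R T i) (mobj R A) \<Longrightarrow>
      (\<And>x. F (dm T (i + 1) x) = 0) \<Longrightarrow> \<exists>H\<in>hm (ob R T (i - 1)) (mobj R A). \<forall>x. F x = H (dm T i x)"
    and v_surj: "\<And>i x. K \<le> i \<Longrightarrow> el (ob R P' i) x \<Longrightarrow> \<exists>y. el (ob R T i) y \<and> v i y = x"
    and v_inj: "\<And>i x. K \<le> i \<Longrightarrow> el (ob R T i) x \<Longrightarrow> v i x = 0 \<Longrightarrow> x = 0"
    and C_hom: "\<And>A a1 a2 i. projective_lmodule R (A :: ('r, 'm) module) \<Longrightarrow> n + 2 \<le> i \<Longrightarrow>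
      a1 \<in> hm (ob R G i) (mobj R A) \<Longrightarrow> a2 \<in> hm (ob R P (i - 1)) (mobj R A) \<Longrightarrow>
      (\<And>x. a1 (dm G (i + 1) x) = 0) \<Longrightarrow> (\<And>y. a1 (u i y) = a2 (dm P i y)) \<Longrightarrow>
      \<exists>c1\<in>hm (ob R G (i - 1)) (mobj R A). \<exists>c2\<in>hm (ob R P (i - 1 - 1)) (mobj R A).
        (\<forall>x. a1 x = c1 (dm G i x)) \<and> (\<forall>y. a2 y = c1 (u (i - 1) y) - c2 (dm P (i - 1) y))"
    and G_section: "\<And>i. K \<le> i \<Longrightarrow> \<exists>h. cycle_section (ob R G) (dm G) i h"
begin

lemmas cP = cpx_ob[OF cc(2)] and cP' = cpx_ob[OF cc(3)] and cG = cpx_ob[OF cc(4)] and cT = cpx_ob[OF cc(5)]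
lemmas cM = cpx_ob[OF cc(1)]
lemmas ok = cpx_ok[OF cP] cpx_ok[OF cP'] cpx_ok[OF cG] cpx_ok[OF cT] cpx_ok[OF cM]
lemmas lins = hm_lin[OF u(1)] hm_lin[OF v(1)] hm_lin[OF p(1)] hm_lin[OF p'(1)] hm_lin[OF cpx_d[OF cP]]
  hm_lin[OF cpx_d[OF cP']] hm_lin[OF cpx_d[OF cG]] hm_lin[OF cpx_d[OF cT]] hm_lin[OF cpx_d[OF cM]]
lemmas goods = good_mobj[OF cc_lm[OF cc(2)], folded ob_def] good_mobj[OF cc_lm[OF cc(3)], folded ob_def]
  good_mobj[OF cc_lm[OF cc(4)], folded ob_def] good_mobj[OF cc_lm[OF cc(5)], folded ob_def]

lemma lift: "good TYPE('m) R X \<Longrightarrow> lifts (ob R P i) X Y" "good TYPE('m) R X \<Longrightarrow> lifts (ob R P' i) X Y"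
  unfolding ob_def by (intro projective_lifts proj; assumption)+

text \<open>Both conditions on \<open>s'\<close> are met by one lift through the map
  \<open>(d, p)\<close> on \<open>P i\<close>. That every required pair lies in its image is the
  exactness of the kernel of \<open>p\<close>, which corrects a preimage \<open>y\<close> of
  \<open>p' i x\<close> to one with the prescribed boundary.\<close>

lemma comparison_step:
  assumes s: "s \<in> hm (ob R P' (i - 1)) (ob R P (i - 1))" "\<And>x. p (i - 1) (s x) = p' (i - 1) x"
    "\<And>x. dm P (i - 1) (s (dm P' i x)) = 0"
  shows "\<exists>s'\<in>hm (ob R P' i) (ob R P i). (\<forall>x. p i (s' x) = p' i x) \<and> (\<forall>x. dm P i (s' x) = s (dm P' i x))"
proof -
  have "\<exists>h\<in>hm (ob R P' i) (ob R P i). \<forall>x. (dm P i (h x), p i (h x)) = (s (dm P' i x), p' i x)"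
  proof (rule liftsD[OF lift(2)[OF goods(1)] hm_pair[OF hm_comp[OF cpx_d[OF cP'] s(1)] p'(1)]
        hm_pair[OF cpx_d[OF cP] p(1)]])
    fix x
    obtain y where y: "p i y = p' i x" using p_surj[OF hm_el[OF p'(1)]] by blast
    let ?z = "dm P i y - s (dm P' i x)"
    have "p (i - 1) ?z = 0" using p(2)[of i y] p'(2)[of i x] by (simp add: lins s(2) y)
    moreover have "dm P (i - 1) ?z = 0" by (simp add: lins cpx_dd[OF cP] s(3))
    moreover have "el (ob R P (i - 1)) ?z" by (intro el_diff ok hm_el[OF cpx_d[OF cP]] hm_el[OF s(1)])
    ultimately obtain k where "p i k = 0" "dm P i k = ?z" using p_ker[of "i - 1" ?z] by auto
    then have "(s (dm P' i x), p' i x) = (dm P i (y - k), p i (y - k))" using y by (simp add: lins)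
    then show "\<exists>y. (s (dm P' i x), p' i x) = (dm P i y, p i y)" by blast
  qed
  then show ?thesis by auto
qed

text \<open>As \<open>M\<close> vanishes in negative degrees, the comparison may start with zero
  there and grow degree by degree. The zero start is exploited again at the bottom of the cone of
  \<open>w\<close>.\<close>

lemma comparison_map:
  obtains w where "\<forall>i. w i \<in> hm (ob R P' i) (ob R P i)" "\<forall>i x. dm P i (w i x) = w (i - 1) (dm P' i x)"
    "\<forall>i x. p i (w i x) = p' i x" "\<forall>i x. i < 0 \<longrightarrow> w i x = 0"
proof -
  have p'0: "p' i x = 0" if "i < 0" for i x using M_zero[OF that hm_el[OF p'(1)]] .
  \<comment> \<open>The third clause is the hypothesis of the next application of
    \<open>comparison_step\<close>; for \<open>m = 0\<close> compatibility with the zero map in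
    degree \<open>- 1\<close> is recorded in addition.\<close>
  define I where "I m s \<longleftrightarrow> s \<in> hm (ob R P' (int m)) (ob R P (int m)) \<and> (\<forall>x. p (int m) (s x) = p' (int m) x) \<and>
    (\<forall>x. dm P (int m) (s (dm P' (int m + 1) x)) = 0) \<and> (m = 0 \<longrightarrow> (\<forall>x. dm P (int m) (s x) = 0))" for m s
  have "\<exists>s'\<in>hm (ob R P' 0) (ob R P 0). (\<forall>x. p 0 (s' x) = p' 0 x) \<and> (\<forall>x. dm P 0 (s' x) = 0)"
    using comparison_step[of "\<lambda>x. 0" 0] p'0[of "- 1"] hm_0[OF ok(1), where A="ob R P' (- 1)"] by (simp add: lins)
  then have "\<exists>s. I 0 s" by (auto simp: I_def)
  moreover have "\<exists>s'. I (Suc m) s' \<and> (\<forall>x. dm P (int m + 1) (s' x) = s (dm P' (int m + 1) x))" if "I m s" for m s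
  proof -
    have "\<exists>s'\<in>hm (ob R P' (int m + 1)) (ob R P (int m + 1)). (\<forall>x. p (int m + 1) (s' x) = p' (int m + 1) x) \<and>
      (\<forall>x. dm P (int m + 1) (s' x) = s (dm P' (int m + 1) x))"
      using that comparison_step[of s "int m + 1"] by (simp add: I_def)
    then obtain s' where s': "s' \<in> hm (ob R P' (int m + 1)) (ob R P (int m + 1))"
      "\<And>x. p (int m + 1) (s' x) = p' (int m + 1) x" "\<And>x. dm P (int m + 1) (s' x) = s (dm P' (int m + 1) x)" by blast
    have "s 0 = 0" using that hm_zero unfolding I_def by blast
    then have "I (Suc m) s'" unfolding I_def
      using s' cpx_dd'[OF cP', of "int m + 1"] that by (auto simp: I_def add.commute)
    then show ?thesis using s' by blast
  qed
  ultimately obtain f where f: "\<And>m. I m (f m)" "\<And>m x. dm P (int m + 1) (f (Suc m) x) = f m (dm P' (int m + 1) x)"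
    using dependent_nat_choice[of I "\<lambda>m s s'. \<forall>x. dm P (int m + 1) (s' x) = s (dm P' (int m + 1) x)"] by metis
  define w where "w i = (if i < 0 then (\<lambda>x. 0) else f (nat i))" for i :: int
  show ?thesis
  proof (rule that[of w]; intro allI impI)
    show "w i \<in> hm (ob R P' i) (ob R P i)" for i
      using f(1)[of "nat i"] hm_0[OF ok(1), where A="ob R P' i"] by (cases "i < 0") (simp_all add: w_def I_def)
    show "p i (w i x) = p' i x" for i x
      using f(1)[of "nat i"] p'0 by (cases "i < 0") (simp_all add: w_def I_def lins)
    show "dm P i (w i x) = w (i - 1) (dm P' i x)" for i x
    proof -
      consider "i < 0" | "i = 0" | "i > 0" by linarith
      then show ?thesis
      proof cases
        case 2
        then show ?thesis using f(1)[of 0] by (simp add: w_def I_def)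
      next
        case 3
        then have e: "int (nat (i - 1)) + 1 = i" "Suc (nat (i - 1)) = nat i" by simp_all
        show ?thesis using f(2)[of "nat (i - 1)" x] 3 unfolding e by (simp add: w_def)
      qed (simp add: w_def lins)
    qed
  qed (simp add: w_def)
qed

text \<open>The cone of \<open>w\<close> is exact because \<open>P\<close> and \<open>P'\<close>
  both resolve \<open>M\<close>, and its terms are projective. In degree \<open>- 2\<close> the
  vanishing of \<open>w\<close> makes its differential a direct sum, which splits by
  \<open>low\<close>; from there the splitting climbs by \<open>cycle_section_up\<close>. The result
  takes the place of a homotopy inverse of \<open>w\<close>.\<close>

lemma comparison_cone_section:
  assumes w: "\<And>i. w i \<in> hm (ob R P' i) (ob R P i)" "\<And>i x. dm P i (w i x) = w (i - 1) (dm P' i x)"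
    "\<And>i x. p i (w i x) = p' i x" "\<And>i x. i < 0 \<Longrightarrow> w i x = 0" and i: "- 2 \<le> i"
  shows "\<exists>h\<in>hm (osum (ob R P i) (ob R P' (i - 1))) (osum (ob R P (i + 1)) (ob R P' i)).
    \<forall>y z. el (ob R P i) y \<longrightarrow> el (ob R P' (i - 1)) z \<longrightarrow> dm P i y = w (i - 1) z \<longrightarrow> dm P' (i - 1) z = 0 \<longrightarrow>
      w i (snd (h (y, z))) - dm P (i + 1) (fst (h (y, z))) = y \<and> dm P' i (snd (h (y, z))) = z"
proof -
  define W where "W i = osum (ob R P i) (ob R P' (i - 1))" for i
  define d where "d i = (\<lambda>z. (w (i - 1) (snd z) - dm P i (fst z), dm P' (i - 1) (snd z)))" for i
  note wl = hm_lin[OF w(1)]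
  have dh: "d i \<in> hm (W i) (W (i - 1))" for i
    unfolding d_def W_def
    by (intro hm_pair hm_sub ok hm_snd[OF w(1)] hm_fst[OF cpx_d[OF cP]] hm_snd[OF cpx_d[OF cP']])
  have okW: "obj_ok (W i)" for i unfolding W_def by (intro obj_ok_osum ok)
  have "d (i - 1) (d i z) = 0" for i z
    using cpx_dd[OF cP', of "i - 1" "snd z"] unfolding d_def
    by (simp add: wl lins cpx_dd[OF cP] w(2) zero_prod_def)
  then have cW: "cpx W d" unfolding cpx_def using okW dh by blast
  have ex: "exact_at W d i" for i
    unfolding exact_at_def
  proof (intro allI impI)
    fix z assume z: "el (W i) z" "d i z = 0"
    obtain y q where yq: "z = (y, q)" by (cases z)
    have e: "el (ob R P i) y" "el (ob R P' (i - 1)) q" "dm P i y = w (i - 1) q" "dm P' (i - 1) q = 0"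
      using z by (auto simp: W_def d_def yq el_osum zero_prod_def)
    have "p' (i - 1) q = dm M i (p i y)" using w(3)[of "i - 1" q] e(3) p(2)[of i y] by simp
    then obtain q1 where q1: "el (ob R P' i) q1" "dm P' i q1 = q"
      using p'_inj[OF e(2,4), of "p i y"] by auto
    \<comment> \<open>Modulo a boundary the given cycle is now \<open>(?y, 0)\<close>. Its image in
      \<open>M\<close> is homologous to that of a cycle \<open>q2\<close> of \<open>P'\<close>,
      hence \<open>?y - w i q2\<close> is a boundary of \<open>P\<close> up to a cycle in the kernel
      of \<open>p\<close>, which is a boundary as well.\<close>
    let ?y = "y - w i q1"
    have y: "el (ob R P i) ?y" "dm P i ?y = 0"
      using e q1 by (auto intro!: el_diff ok hm_el[OF w(1)] simp: lins w(2))
    have "dm M i (p i ?y) = 0" using p(2)[of i ?y] y(2) by (simp add: lins)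
    from p'_surj[OF hm_el[OF p(1)] this] obtain q2 m where q2: "el (ob R P' i) q2" "dm P' i q2 = 0"
      "el (ob R M (i + 1)) m" "p i ?y = p' i q2 + dm M (i + 1) m" by blast
    obtain x where x: "p (i + 1) x = m" using p_surj[OF q2(3)] by blast
    let ?x = "snd (ob R P (i + 1)) x"
    have x': "p (i + 1) ?x = m" "dm P (i + 1) ?x = dm P (i + 1) x"
      using x hm_src[OF p(1)] hm_src[OF cpx_d[OF cP]] by auto
    let ?k = "?y - w i q2 - dm P (i + 1) ?x"
    have "p i ?k = 0" using p(2)[of "i + 1" x] x x' q2(4) w(3) by (simp add: lins algebra_simps)
    moreover have "dm P i ?k = 0" using y(2) q2(2) cpx_dd'[OF cP] w(2) x' by (simp add: lins wl)
    moreover have "el (ob R P i) ?k"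
      by (intro el_diff ok y(1) hm_el[OF w(1)] hm_el[OF cpx_d'[OF cP]])
    ultimately obtain k where k: "el (ob R P (i + 1)) k" "dm P (i + 1) k = ?k" using p_ker by blast
    show "\<exists>y. el (W (i + 1)) y \<and> d (i + 1) y = z"
    proof (intro exI conjI)
      show "el (W (i + 1)) (- (?x + k), q1 + q2)"
        using q1 q2 k by (simp add: W_def el_osum el_add el_minus el_diff el_snd ok)
      show "d (i + 1) (- (?x + k), q1 + q2) = z"
        using q1 q2 k by (simp add: d_def yq lins wl)
    qed
  qed
  have lW: "lifts (W i) (W (i + 1)) (W i)" for i
  proof -
    have g: "good TYPE('m) R (W j)" for j unfolding W_def by (intro good_osum inf goods)
    show ?thesis unfolding W_def[of i] by (intro lifts_osum lift g ok okW)
  qed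
  have "\<exists>h. cycle_section W d i h"
    using i
  proof (induction i rule: int_ge_induct)
    case base
    obtain h where h: "h \<in> hm (ob R P (- 2)) (ob R P (- 1))"
      "\<And>x. el (ob R P (- 2)) x \<Longrightarrow> dm P (- 2) x = 0 \<Longrightarrow> dm P (- 1) (h x) = x"
      using low(1)[of "- 2"] by (auto simp: cycle_section_def)
    obtain h' where h': "h' \<in> hm (ob R P' (- 3)) (ob R P' (- 2))"
      "\<And>x. el (ob R P' (- 3)) x \<Longrightarrow> dm P' (- 3) x = 0 \<Longrightarrow> dm P' (- 2) (h' x) = x"
      using low(2)[of "- 3"] by (auto simp: cycle_section_def)
    have "(\<lambda>z. (- h (fst z), h' (snd z))) \<in> hm (W (- 2)) (W (- 1))"
      unfolding W_def using hm_fst[OF hm_uminus[OF h(1) ok(1)]] hm_snd[OF h'(1)] by (intro hm_pair) simp_all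
    then have "cycle_section W d (- 2) (\<lambda>z. (- h (fst z), h' (snd z)))"
      using h(2) h'(2) by (auto simp: cycle_section_def W_def d_def el_osum w(4) lins zero_prod_def)
    then show ?case by blast
  next
    case (step i)
    then show ?case using cycle_section_up[OF cW _ ex lW, of "i + 1"] by auto
  qed
  then obtain h where h: "cycle_section W d i h" by blast
  have "h \<in> hm (osum (ob R P i) (ob R P' (i - 1))) (osum (ob R P (i + 1)) (ob R P' i))"
    using h by (simp add: cycle_section_def W_def)
  moreover have "d (i + 1) (h (y, z)) = (y, z)"
    if "el (ob R P i) y" "el (ob R P' (i - 1)) z" "dm P i y = w (i - 1) z" "dm P' (i - 1) z = 0" for y z
    using h that by (simp add: cycle_section_def W_def el_osum d_def[of i] zero_prod_def)
  ultimately show ?thesis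
    by (intro bexI[of _ h]) (simp_all add: d_def)
qed

end

locale tate_comparison = comparison R M P P' G T p p' u v n K
  for R :: "('r, 'x) ring_scheme" and M P P' G T :: "('r, 'm) cplx" and p p' u v n K +
  fixes w b1 b2 :: "int \<Rightarrow> ('r, 'm) amb \<Rightarrow> ('r, 'm) amb"
  assumes w: "\<And>i. w i \<in> hm (ob R P' i) (ob R P i)" "\<And>i x. dm P i (w i x) = w (i - 1) (dm P' i x)"
      "\<And>i x. p i (w i x) = p' i x" "\<And>i x. i < 0 \<Longrightarrow> w i x = 0"
    and b: "\<And>i. n \<le> i \<Longrightarrow> b1 i \<in> hm (ob R T i) (ob R G (i + 1))" "\<And>i. n \<le> i \<Longrightarrow> b2 i \<in> hm (ob R T i) (ob R P i)"
    and b1d: "\<And>i t. n + 1 \<le> i \<Longrightarrow> dm G (i + 1) (b1 i t) + u i (b2 i t) = - b1 (i - 1) (dm T i t)"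
    and b2d: "\<And>i t. n + 1 \<le> i \<Longrightarrow> dm P i (b2 i t) = b2 (i - 1) (dm T i t)"
    and b2w: "\<And>i t. K + 2 \<le> i \<Longrightarrow> b2 i t = w i (v i t)"

text \<open>The composite \<open>u w v\<close> is null-homotopic in high degrees because
  \<open>G\<close> splits there, and \<open>b1\<close> is such a homotopy. In the descent
  \<open>b1 (m - 1)\<close> takes values in \<open>G m\<close>, and for \<open>m > n\<close> this is
  a projective module, so \<open>T_hom\<close> applies; this limits the descent to degree
  \<open>n\<close>.\<close>

lemma (in comparison) tate_map:
  assumes w: "\<And>i. w i \<in> hm (ob R P' i) (ob R P i)" "\<And>i x. dm P i (w i x) = w (i - 1) (dm P' i x)"
  shows "\<exists>b1 b2. (\<forall>i. n \<le> i \<longrightarrow> b1 i \<in> hm (ob R T i) (ob R G (i + 1)) \<and> b2 i \<in> hm (ob R T i) (ob R P i)) \<and>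
    (\<forall>i t. n + 1 \<le> i \<longrightarrow> dm G (i + 1) (b1 i t) + u i (b2 i t) = - b1 (i - 1) (dm T i t) \<and>
      dm P i (b2 i t) = b2 (i - 1) (dm T i t)) \<and> (\<forall>i t. K + 2 \<le> i \<longrightarrow> b2 i t = w i (v i t))"
proof -
  define S where "S m b1 b2 \<longleftrightarrow>
    (\<forall>i. m \<le> i \<longrightarrow> b1 i \<in> hm (ob R T i) (ob R G (i + 1)) \<and> b2 i \<in> hm (ob R T i) (ob R P i)) \<and>
    (\<forall>i t. m + 1 \<le> i \<longrightarrow> dm G (i + 1) (b1 i t) + u i (b2 i t) = - b1 (i - 1) (dm T i t) \<and>
      dm P i (b2 i t) = b2 (i - 1) (dm T i t)) \<and> (\<forall>i t. K + 2 \<le> i \<longrightarrow> b2 i t = w i (v i t))" for m b1 b2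
  have "n \<le> m \<longrightarrow> (\<exists>b1 b2. S m b1 b2)" if "m \<le> K + 2" for m
    using that
  proof (induction m rule: int_le_induct)
    case base
    have "\<forall>i. \<exists>h. K \<le> i \<longrightarrow> cycle_section (ob R G) (dm G) i h" using G_section by blast
    then obtain h where h: "\<And>i. K \<le> i \<Longrightarrow> cycle_section (ob R G) (dm G) i (h i)" by metis
    have hh: "h i \<in> hm (ob R G i) (ob R G (i + 1))" if "K \<le> i" for i
      using h[OF that] by (simp add: cycle_section_def)
    have hs: "dm G (i + 1) (h i x) = x" if "K \<le> i" "el (ob R G i) x" "dm G i x = 0" for i x
      using h[OF that(1)] that by (simp add: cycle_section_def)
    define x where "x i t = u i (w i (v i t))" for i t
    have x: "x i \<in> hm (ob R T i) (ob R G i)" for i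
      unfolding x_def by (intro hm_comp[OF hm_comp[OF v(1) w(1)] u(1)])
    have dx: "dm G i (x i t) = x (i - 1) (dm T i t)" for i t
      unfolding x_def by (simp add: u(2) w(2) v(2))
    \<comment> \<open>\<open>h\<close> inverts the differential on cycles only, so \<open>x\<close>
      is first corrected to the cycle \<open>x - h (d x)\<close>. The correction term is what
      \<open>b1\<close> contributes in the preceding degree.\<close>
    define b1 where "b1 i t = - h i (x i t - h (i - 1) (dm G i (x i t)))" for i t
    have h1: "h (i - 1) \<in> hm (ob R G (i - 1)) (ob R G i)" if "K + 1 \<le> i" for i
      using hh[of "i - 1"] that by simp
    have y: "(\<lambda>t. x i t - h (i - 1) (dm G i (x i t))) \<in> hm (ob R T i) (ob R G i)" if "K + 1 \<le> i" for i
      by (intro hm_sub ok x hm_comp[OF hm_comp[OF x cpx_d[OF cG]] h1[OF that]])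
    have "S (K + 2) b1 (\<lambda>i t. w i (v i t))"
      unfolding S_def
    proof (intro conjI allI impI)
      fix i assume i: "K + 2 \<le> i"
      show "b1 i \<in> hm (ob R T i) (ob R G (i + 1))"
        unfolding b1_def using i by (intro hm_uminus ok hm_comp[OF y hh]) auto
    next
      fix i assume i: "K + 2 + 1 \<le> i"
      fix t
      have "el (ob R G (i - 1)) (dm G i (x i t))" by (rule hm_el[OF cpx_d[OF cG]])
      then have "dm G i (h (i - 1) (dm G i (x i t))) = dm G i (x i t)"
        using hs[of "i - 1" "dm G i (x i t)"] i cpx_dd[OF cG] by simp
      then have "dm G (i + 1) (h i (x i t - h (i - 1) (dm G i (x i t)))) = x i t - h (i - 1) (dm G i (x i t))"
        using i by (intro hs hm_el[OF y]) (simp_all add: lins)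
      moreover have "b1 (i - 1) (dm T i t) = - h (i - 1) (dm G i (x i t))"
        using hm_zero[OF hh[of "i - 1 - 1"]] i cpx_dd[OF cG] by (simp add: b1_def dx[symmetric])
      ultimately show "dm G (i + 1) (b1 i t) + u i (w i (v i t)) = - b1 (i - 1) (dm T i t)"
        by (simp add: b1_def lins) (simp add: x_def)
    qed (auto simp: w(2) v(2) intro: hm_comp[OF v(1) w(1)])
    then show ?case by blast
  next
    case (step m)
    show ?case
    proof
      assume m: "n \<le> m - 1"
      then obtain b1 b2 where S: "S m b1 b2" using step by auto
      have bh: "b1 i \<in> hm (ob R T i) (ob R G (i + 1))" "b2 i \<in> hm (ob R T i) (ob R P i)" if "m \<le> i" for i
        using S that by (auto simp: S_def)
      have bd: "dm G (i + 1) (b1 i t) + u i (b2 i t) = - b1 (i - 1) (dm T i t)"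
        "dm P i (b2 i t) = b2 (i - 1) (dm T i t)" if "m + 1 \<le> i" for i t
        using S that by (auto simp: S_def)
      \<comment> \<open>The relations in degree \<open>m\<close> prescribe what
        \<open>b1 (m - 1)\<close> and \<open>b2 (m - 1)\<close> must give after
        \<open>dm T m\<close>, namely \<open>?f1\<close> and \<open>?f2\<close>. Both kill the image
        of \<open>dm T (m + 1)\<close> by the relations one degree higher.\<close>
      let ?f1 = "\<lambda>t. - (dm G (m + 1) (b1 m t) + u m (b2 m t))" and ?f2 = "\<lambda>t. dm P m (b2 m t)"
      have b2m: "b2 m (dm T (m + 1) t) = dm P (m + 1) (b2 (m + 1) t)" for t using bd(2)[of "m + 1" t] by simp
      have b1m: "b1 m (dm T (m + 1) t) = - (dm G (m + 1 + 1) (b1 (m + 1) t) + u (m + 1) (b2 (m + 1) t))" for t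
        using bd(1)[of "m + 1" t] by simp
      have f1: "?f1 \<in> hm (ob R T m) (mobj R (obj G m))"
        unfolding ob_def[symmetric]
        by (intro hm_uminus hm_plus ok hm_comp[OF bh(1) cpx_d'[OF cG]] hm_comp[OF bh(2) u(1)]) auto
      have f2: "?f2 \<in> hm (ob R T m) (mobj R (obj P (m - 1)))"
        unfolding ob_def[symmetric] by (intro hm_comp[OF bh(2) cpx_d[OF cP]]) auto
      have u1: "dm G (m + 1) (u (m + 1) y) = u m (dm P (m + 1) y)" for y using u(2)[of "m + 1" y] by simp
      have "?f1 (dm T (m + 1) t) = 0" for t
        using cpx_dd'[OF cG, of "m + 1"] by (simp add: b2m b1m lins u1 del: add_uminus_conv_diff)
      from T_hom[OF proj(3) f1 this] m obtain c1 where
        c1: "c1 \<in> hm (ob R T (m - 1)) (ob R G m)" "\<And>t. ?f1 t = c1 (dm T m t)"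
        by (auto simp: ob_def)
      have "?f2 (dm T (m + 1) t) = 0" for t by (simp add: b2m cpx_dd'[OF cP])
      from T_hom[OF proj(1) f2 this] obtain c2 where
        c2: "c2 \<in> hm (ob R T (m - 1)) (ob R P (m - 1))" "\<And>t. ?f2 t = c2 (dm T m t)"
        by (auto simp: ob_def)
      have "S (m - 1) (b1(m - 1 := c1)) (b2(m - 1 := c2))"
        unfolding S_def
      proof (intro conjI allI impI)
        fix i t assume "m - 1 + 1 \<le> i"
        then consider "i = m" | "m + 1 \<le> i" by linarith
        then show "dm G (i + 1) ((b1(m - 1 := c1)) i t) + u i ((b2(m - 1 := c2)) i t) =
            - (b1(m - 1 := c1)) (i - 1) (dm T i t)"
          "dm P i ((b2(m - 1 := c2)) i t) = (b2(m - 1 := c2)) (i - 1) (dm T i t)"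
          using c1(2)[of t, symmetric] c2(2)[of t, symmetric] bd[of i t] by (cases; simp)+
      qed (use bh c1(1) c2(1) S step(1) in \<open>auto simp: S_def\<close>)
      then show "\<exists>b1 b2. S (m - 1) b1 b2" by blast
    qed
  qed
  from this[of n] n show ?thesis unfolding S_def by auto
qed

section \<open>Contraction of the cone of the comparison map\<close>

context tate_comparison
begin

text \<open>
  The cone of the map from \<open>T\<close> to the shifted mapping cone of \<open>u\<close> with components \<open>b1\<close> and \<open>b2\<close>.
\<close>

definition E where
  "E i = osum (ob R G (i + 1)) (osum (ob R P i) (ob R T (i - 1)))"

definition dE where
  "dE i z = (dm G (i + 1) (fst z) + u i (fst (snd z)) + b1 (i - 1) (snd (snd z)),
     b2 (i - 1) (snd (snd z)) - dm P i (fst (snd z)), dm T (i - 1) (snd (snd z)))"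

lemmas b_lin = hm_lin[OF b(1)] hm_lin[OF b(2)]

lemma E_ok: "obj_ok (E i)"
  unfolding E_def by (intro obj_ok_osum ok)

lemma dE_hm: "n + 1 \<le> i \<Longrightarrow> dE i \<in> hm (E i) (E (i - 1))"
proof -
  assume i: "n + 1 \<le> i"
  have "b1 (i - 1) \<in> hm (ob R T (i - 1)) (ob R G i)" "b2 (i - 1) \<in> hm (ob R T (i - 1)) (ob R P (i - 1))"
    using b(1)[of "i - 1"] b(2)[of "i - 1"] i by auto
  then have "dE i \<in> hm (E i) (osum (ob R G i) (osum (ob R P (i - 1)) (ob R T (i - 1 - 1))))"
    unfolding E_def dE_def
    by (intro hm_pair hm_plus hm_sub ok hm_fst[OF cpx_d'[OF cG]] hm_snd[OF hm_fst[OF u(1)]]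
        hm_snd[OF hm_fst[OF cpx_d[OF cP]]] hm_snd[OF hm_snd[OF cpx_d[OF cT]]] hm_snd[OF hm_snd])
  then show ?thesis by (simp add: E_def)
qed

lemma dE_hm': "n \<le> i \<Longrightarrow> dE (i + 1) \<in> hm (E (i + 1)) (E i)"
  using dE_hm[of "i + 1"] by simp

lemma dE_dE: "n + 1 \<le> i \<Longrightarrow> dE i (dE (i + 1) z) = 0"
proof -
  assume i: "n + 1 \<le> i"
  have "b1 (i - 1) (dm T i t) = - (dm G (i + 1) (b1 i t) + u i (b2 i t))" for t using b1d[OF i, of t] by simp
  then show ?thesis
    using cpx_dd'[OF cG, of "i + 1"] cpx_dd'[OF cP, of i] cpx_dd[OF cT, of i] u(2)[of "i + 1"]
    by (simp add: dE_def lins zero_prod_def b2d[OF i] algebra_simps)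
qed

text \<open>The restriction of \<open>f\<close> to the shifted cone of \<open>u\<close> is a
  cocycle, hence a coboundary of some \<open>(c1, c2)\<close> by \<open>C_hom\<close>. What then
  remains on \<open>T\<close> is a cocycle, and \<open>T_hom\<close> applies to it. The shift by one
  turns the bound \<open>n + 2\<close> of \<open>C_hom\<close> into \<open>n + 1\<close>.\<close>

lemma E_hom_exact_projective:
  assumes A: "projective_lmodule R (A :: ('r, 'm) module)" and i: "n + 1 \<le> i"
    and f: "f \<in> hm (E i) (mobj R A)" "\<And>z. f (dE (i + 1) z) = 0"
  shows "\<exists>g\<in>hm (E (i - 1)) (mobj R A). \<forall>z. f z = g (dE i z)"
proof -
  note okA = obj_ok_mobj[OF projective_lm[OF A]]
  note f3 = hm_in3[OF f(1)[unfolded E_def] ok(3) ok(1) ok(4)]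
  define a1 where "a1 = (\<lambda>x. f (x, 0, 0))"
  define a2 where "a2 = (\<lambda>x. f (0, x, 0))"
  define a3 where "a3 = (\<lambda>x. f (0, 0, x))"
  have h1: "a1 \<in> hm (ob R G (i + 1)) (mobj R A)" and h2: "a2 \<in> hm (ob R P i) (mobj R A)"
    and h3: "a3 \<in> hm (ob R T (i - 1)) (mobj R A)"
    unfolding a1_def a2_def a3_def by (rule f3)+
  have fz: "f z = a1 (fst z) + (a2 (fst (snd z)) + a3 (snd (snd z)))" for z
    unfolding a1_def a2_def a3_def by (rule f3(4))
  have bz: "b1 i 0 = 0" "b2 i 0 = 0" using b_lin(2,6)[of i] i by auto
  note zs = hm_lin[OF h1] hm_lin[OF h2] hm_lin[OF h3] bz lins
  have r1: "a1 (dm G (i + 1 + 1) x) = 0" for x using f(2)[of "(x, 0, 0)"] by (simp add: fz dE_def zs)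
  have r2: "a1 (u (i + 1) y) = a2 (dm P (i + 1) y)" for y
    using f(2)[of "(0, y, 0)"] by (simp add: fz dE_def zs)
  have r3: "a1 (b1 i t) + (a2 (b2 i t) + a3 (dm T i t)) = 0" for t
    using f(2)[of "(0, 0, t)"] by (simp add: fz dE_def zs)
  have h2': "a2 \<in> hm (ob R P (i + 1 - 1)) (mobj R A)" using h2 by simp
  have i2: "n + 2 \<le> i + 1" using i by simp
  from C_hom[OF A i2 h1 h2' r1 r2] obtain c1 c2 where
    c: "c1 \<in> hm (ob R G i) (mobj R A)" "c2 \<in> hm (ob R P (i - 1)) (mobj R A)"
    "\<And>x. a1 x = c1 (dm G (i + 1) x)" "\<And>y. a2 y = c1 (u i y) - c2 (dm P i y)" by auto
  have bi: "b1 (i - 1) \<in> hm (ob R T (i - 1)) (ob R G i)" "b2 (i - 1) \<in> hm (ob R T (i - 1)) (ob R P (i - 1))"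
    using b(1)[of "i - 1"] b(2)[of "i - 1"] i by auto
  let ?a = "\<lambda>t. a3 t - c1 (b1 (i - 1) t) - c2 (b2 (i - 1) t)"
  have a: "?a \<in> hm (ob R T (i - 1)) (mobj R A)"
    by (intro hm_sub okA h3 hm_comp[OF bi(1) c(1)] hm_comp[OF bi(2) c(2)])
  have "?a (dm T (i - 1 + 1) t) = 0" for t
  proof -
    have "b1 (i - 1) (dm T i t) = - (dm G (i + 1) (b1 i t) + u i (b2 i t))" using b1d[OF i, of t] by simp
    then have "c1 (b1 (i - 1) (dm T i t)) = - (c1 (dm G (i + 1) (b1 i t)) + c1 (u i (b2 i t)))"
      by (simp only: hm_lin[OF c(1)])
    then have "?a (dm T i t) = a3 (dm T i t) + (c1 (dm G (i + 1) (b1 i t)) + c1 (u i (b2 i t))) - c2 (dm P i (b2 i t))"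
      by (simp add: b2d[OF i])
    also have "\<dots> = 0" using r3[of t] by (simp add: c(3,4) algebra_simps)
    finally show ?thesis by simp
  qed
  from T_hom[OF A a this] obtain c3 where c3: "c3 \<in> hm (ob R T (i - 1 - 1)) (mobj R A)"
    "\<And>t. ?a t = c3 (dm T (i - 1) t)" by blast
  have c3': "a3 t = c3 (dm T (i - 1) t) + c1 (b1 (i - 1) t) + c2 (b2 (i - 1) t)" for t
    using c3(2)[of t] by (simp add: algebra_simps)
  have "(\<lambda>z. c1 (fst z) + (c2 (fst (snd z)) + c3 (snd (snd z)))) \<in> hm (E (i - 1)) (mobj R A)"
    unfolding E_def using hm_fst[OF c(1)] by (intro hm_plus okA hm_snd[OF hm_fst[OF c(2)]] hm_snd[OF hm_snd[OF c3(1)]]) simp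
  then show ?thesis
    by (intro bexI) (auto simp: fz dE_def c(3,4) c3' hm_lin[OF c(1)] hm_lin[OF c(2)] algebra_simps)
qed

text \<open>The condition on \<open>h\<close> says that \<open>d h\<close> is the identity on
  boundaries, so \<open>id - d h\<close> is a cocycle with values in \<open>E i\<close>. The
  summands \<open>G (i + 1)\<close>, \<open>P i\<close> and \<open>T (i - 1)\<close> are projective
  and thus admissible coefficients, so that it factors as \<open>h' d\<close>.\<close>

lemma E_section_down:
  assumes i: "n + 1 \<le> i" and h: "h \<in> hm (E i) (E (i + 1))" "\<And>z. dE (i + 1) (h (dE (i + 1) z)) = dE (i + 1) z"
  shows "\<exists>h'\<in>hm (E (i - 1)) (E i). \<forall>z. snd (E i) z = dE (i + 1) (h z) + h' (dE i z)"
proof -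
  have di: "dE (i + 1) \<in> hm (E (i + 1)) (E i)" using dE_hm'[of i] i by simp
  define f where "f = (\<lambda>z. snd (E i) z - dE (i + 1) (h z))"
  have f: "f \<in> hm (E i) (E i)"
    unfolding f_def by (intro hm_sub obj_okI E_ok hm_comp[OF h(1) di])
  have f0: "f (dE (i + 1) z) = 0" for z
    by (simp add: f_def h(2) hm_tgt[OF di])
  have pr: "projective_lmodule R (obj G (i + 1))" using proj(3) i by simp
  note fE = f[unfolded E_def[of i]]
  have fz: "fst (f (dE (i + 1) z)) = 0" "fst (snd (f (dE (i + 1) z))) = 0" "snd (snd (f (dE (i + 1) z))) = 0" for z
    by (simp_all add: f0 zero_prod_def)
  have "\<exists>g\<in>hm (E (i - 1)) (ob R G (i + 1)). \<forall>z. fst (f z) = g (dE i z)"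
    using E_hom_exact_projective[OF pr i, of "\<lambda>z. fst (f z)"] hm_fst_comp[OF fE] fz(1) by (simp add: ob_def E_def)
  moreover have "\<exists>g\<in>hm (E (i - 1)) (ob R P i). \<forall>z. fst (snd (f z)) = g (dE i z)"
    using E_hom_exact_projective[OF proj(1) i, of "\<lambda>z. fst (snd (f z))" i] hm_fst_comp[OF hm_snd_comp[OF fE]] fz(2)
    by (simp add: ob_def E_def)
  moreover have "\<exists>g\<in>hm (E (i - 1)) (ob R T (i - 1)). \<forall>z. snd (snd (f z)) = g (dE i z)"
    using E_hom_exact_projective[OF proj(4) i, of "\<lambda>z. snd (snd (f z))" "i - 1"] hm_snd_comp[OF hm_snd_comp[OF fE]] fz(3)
    by (simp add: ob_def E_def)
  ultimately obtain g1 g2 g3 where g: "g1 \<in> hm (E (i - 1)) (ob R G (i + 1))" "\<And>z. fst (f z) = g1 (dE i z)"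
    "g2 \<in> hm (E (i - 1)) (ob R P i)" "\<And>z. fst (snd (f z)) = g2 (dE i z)"
    "g3 \<in> hm (E (i - 1)) (ob R T (i - 1))" "\<And>z. snd (snd (f z)) = g3 (dE i z)" by blast
  have "(\<lambda>z. (g1 z, g2 z, g3 z)) \<in> hm (E (i - 1)) (E i)"
    unfolding E_def[of i] by (intro hm_pair g)
  moreover have "snd (E i) z = dE (i + 1) (h z) + (g1 (dE i z), g2 (dE i z), g3 (dE i z))" for z
  proof -
    have "f z = (g1 (dE i z), g2 (dE i z), g3 (dE i z))"
      using g(2,4,6)[of z] by (simp add: prod_eq_iff)
    then show ?thesis by (simp add: f_def algebra_simps)
  qed
  ultimately show ?thesis by (intro bexI) auto
qed

text \<open>In these degrees \<open>v\<close> identifies \<open>T\<close> with \<open>P'\<close> and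
  \<open>b2\<close> with \<open>w\<close>, so \<open>E\<close> is an extension of the cone of
  \<open>w\<close> by a shift of \<open>G\<close>, and both ends split. The bound
  \<open>K + 3\<close> is there because \<open>b2 (j - 1)\<close> must already be
  \<open>w v\<close>.\<close>

lemma E_section_top:
  assumes j: "K + 3 \<le> j"
  shows "\<exists>h\<in>hm (E j) (E (j + 1)). \<forall>z. dE (j + 1) (h (dE (j + 1) z)) = dE (j + 1) z"
proof -
  have j2: "- 2 \<le> j" using j n by linarith
  from comparison_cone_section[OF w j2] obtain hW where
    hW: "hW \<in> hm (osum (ob R P j) (ob R P' (j - 1))) (osum (ob R P (j + 1)) (ob R P' j))"
    "\<And>y z. el (ob R P j) y \<Longrightarrow> el (ob R P' (j - 1)) z \<Longrightarrow> dm P j y = w (j - 1) z \<Longrightarrow> dm P' (j - 1) z = 0 \<Longrightarrow>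
      w j (snd (hW (y, z))) - dm P (j + 1) (fst (hW (y, z))) = y"
    "\<And>y z. el (ob R P j) y \<Longrightarrow> el (ob R P' (j - 1)) z \<Longrightarrow> dm P j y = w (j - 1) z \<Longrightarrow> dm P' (j - 1) z = 0 \<Longrightarrow>
      dm P' j (snd (hW (y, z))) = z" by auto
  have "\<exists>h\<in>hm (ob R P' j) (ob R T j). \<forall>x. v j (h x) = snd (ob R P' j) x"
  proof (rule liftsD[OF lift(2)[OF goods(4)] obj_okI[OF ok(2)] v(1)])
    have "K \<le> j" using j by simp
    from v_surj[OF this el_snd[OF ok(2)]] show "\<exists>y. snd (ob R P' j) x = v j y" for x by metis
  qed
  then obtain vi where vi: "vi \<in> hm (ob R P' j) (ob R T j)" "\<And>x. v j (vi x) = snd (ob R P' j) x" by blast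
  obtain hG where "cycle_section (ob R G) (dm G) (j + 1) hG" using G_section[of "j + 1"] j by auto
  then have hG: "hG \<in> hm (ob R G (j + 1)) (ob R G (j + 1 + 1))"
    "\<And>x. el (ob R G (j + 1)) x \<Longrightarrow> dm G (j + 1) x = 0 \<Longrightarrow> dm G (j + 1 + 1) (hG x) = x"
    by (auto simp: cycle_section_def)
  \<comment> \<open>The pair \<open>(y, v t)\<close> is a cycle of the cone of \<open>w\<close>
    whenever \<open>(x, y, t)\<close> is a cycle of \<open>E\<close>. Its preimage gives the last
    two components of \<open>h\<close>; the first one removes with \<open>hG\<close> what they leave
    over in \<open>G\<close>.\<close>
  define q where "q z = hW (snd (ob R P j) (fst (snd z)), v (j - 1) (snd (snd z)))" for z :: "('r, 'm) amb \<times> ('r, 'm) amb \<times> ('r, 'm) amb"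
  define h where "h z = (hG (snd (ob R G (j + 1)) (fst z) - u (j + 1) (fst (q z)) - b1 j (vi (snd (q z)))),
    fst (q z), vi (snd (q z)))" for z
  have bj: "b1 j \<in> hm (ob R T j) (ob R G (j + 1))" using b[of j] j n by auto
  have q: "q \<in> hm (E j) (osum (ob R P (j + 1)) (ob R P' j))"
    unfolding q_def E_def
    by (intro hm_comp[OF hm_pair hW(1)] hm_snd[OF hm_fst[OF obj_okI[OF ok(1)]]] hm_snd[OF hm_snd[OF v(1)]])
  note q1 = hm_fst_comp[OF q] and q2 = hm_snd_comp[OF q]
  have "(\<lambda>z. snd (ob R G (j + 1)) (fst z)) \<in> hm (E j) (ob R G (j + 1))"
    unfolding E_def by (rule hm_fst[OF obj_okI[OF ok(3)]])
  then have "h \<in> hm (E j) (osum (ob R G (j + 1 + 1)) (osum (ob R P (j + 1)) (ob R T j)))"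
    unfolding h_def by (intro hm_pair hm_comp[OF _ hG(1)] hm_sub ok hm_comp[OF q1 u(1)] hm_comp[OF hm_comp[OF q2 vi(1)] bj]
        q1 hm_comp[OF q2 vi(1)])
  then have "h \<in> hm (E j) (E (j + 1))" by (simp add: E_def)
  moreover have "dE (j + 1) (h (dE (j + 1) z)) = dE (j + 1) z" for z
  proof -
    obtain x y t where c: "dE (j + 1) z = (x, y, t)" by (cases "dE (j + 1) z")
    have "el (E j) (x, y, t)" unfolding c[symmetric] using j n by (intro hm_el[OF dE_hm']) simp
    then have e: "el (ob R G (j + 1)) x" "el (ob R P j) y" "el (ob R T (j - 1)) t"
      by (simp_all add: E_def el_osum)
    have "dE j (x, y, t) = 0" unfolding c[symmetric] using j n by (intro dE_dE) simp
    then have z: "dm G (j + 1) x + u j y + b1 (j - 1) t = 0" "b2 (j - 1) t = dm P j y" "dm T (j - 1) t = 0"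
      by (simp_all add: dE_def zero_prod_def)
    have W: "dm P j y = w (j - 1) (v (j - 1) t)" using z(2) b2w[of "j - 1" t] j by simp
    have W': "dm P' (j - 1) (v (j - 1) t) = 0" using v(2)[of "j - 1" t] z(3) by (simp add: lins)
    let ?q = "q (x, y, t)"
    have qe: "?q = hW (y, v (j - 1) t)" using e(2) by (simp add: q_def el_def)
    have Y: "w j (snd ?q) - dm P (j + 1) (fst ?q) = y" and S: "dm P' j (snd ?q) = v (j - 1) t"
      unfolding qe by (rule hW(2,3)[OF e(2) hm_el[OF v(1)] W W'])+
    have elS: "el (ob R P' j) (snd ?q)" by (rule hm_el[OF q2])
    let ?t = "vi (snd ?q)"
    have vt: "v j ?t = snd ?q" using vi(2) elS by (simp add: el_def)
    have "v (j - 1) (dm T j ?t - t) = 0" using v(2)[of j ?t] by (simp add: lins vt S)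
    moreover have "el (ob R T (j - 1)) (dm T j ?t - t)" by (intro el_diff ok hm_el[OF cpx_d[OF cT]] e)
    moreover have "K \<le> j - 1" using j by simp
    ultimately have dt: "dm T j ?t = t" using v_inj[of "j - 1" "dm T j ?t - t"] by simp
    have b2t: "b2 j ?t = w j (snd ?q)" using b2w[of j ?t] j by (simp add: vt)
    have dY: "dm P (j + 1) (fst ?q) = w j (snd ?q) - y" using Y by (simp add: algebra_simps)
    have b1t: "dm G (j + 1) (b1 j ?t) = - b1 (j - 1) t - u j (w j (snd ?q))"
      using b1d[of j ?t] j n by (simp add: dt b2t algebra_simps)
    let ?r = "x - u (j + 1) (fst ?q) - b1 j ?t"
    have elr: "el (ob R G (j + 1)) ?r" by (intro el_diff ok e hm_el[OF u(1)] hm_el[OF bj])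
    have "dm G (j + 1) (u (j + 1) (fst ?q)) = u j (w j (snd ?q)) - u j y"
      using u(2)[of "j + 1" "fst ?q"] by (simp add: dY lins)
    moreover have "dm G (j + 1) x = - (u j y + b1 (j - 1) t)"
      using z(1) by (simp only: add.assoc eq_neg_iff_add_eq_0)
    ultimately have "dm G (j + 1) ?r = 0"
      by (simp only: lins b1t) simp
    from hG(2)[OF elr this] have "dm G (j + 1 + 1) (hG ?r) = ?r" .
    then show ?thesis using e(1) unfolding c
      by (simp add: h_def dE_def el_def b2t dY dt)
  qed
  ultimately show ?thesis by blast
qed

text \<open>Applying the differential to \<open>id = d h + h' d\<close> yields
  \<open>d h' d = d\<close>, so the condition on \<open>h\<close> reproduces itself one degree
  lower, from \<open>K + 3\<close> down to \<open>n\<close>.\<close>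

lemma E_regular:
  assumes i: "n \<le> i"
  shows "\<exists>h\<in>hm (E i) (E (i + 1)). \<forall>z. dE (i + 1) (h (dE (i + 1) z)) = dE (i + 1) z"
proof (cases "K + 3 \<le> i")
  case True
  then show ?thesis by (rule E_section_top)
next
  case False
  have "n \<le> i \<longrightarrow> (\<exists>h\<in>hm (E i) (E (i + 1)). \<forall>z. dE (i + 1) (h (dE (i + 1) z)) = dE (i + 1) z)" if "i \<le> K + 3" for i
    using that
  proof (induction i rule: int_le_induct)
    case base
    then show ?case using E_section_top[of "K + 3"] by blast
  next
    case (step i)
    show ?case
    proof
      assume n: "n \<le> i - 1"
      then obtain h where h: "h \<in> hm (E i) (E (i + 1))" "\<And>z. dE (i + 1) (h (dE (i + 1) z)) = dE (i + 1) z"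
        using step by auto
      have i: "n + 1 \<le> i" using n by simp
      from E_section_down[OF i h] obtain h' where h': "h' \<in> hm (E (i - 1)) (E i)"
        "\<And>z. snd (E i) z = dE (i + 1) (h z) + h' (dE i z)" by blast
      have "dE i (h' (dE i z)) = dE i z" for z
      proof -
        have "dE i (snd (E i) z) = dE i (dE (i + 1) (h z)) + dE i (h' (dE i z))"
          unfolding h'(2) by (rule hm_add[OF dE_hm[OF i]])
        then show ?thesis by (simp add: dE_dE[OF i] hm_src[OF dE_hm[OF i]])
      qed
      then show "\<exists>h\<in>hm (E (i - 1)) (E (i - 1 + 1)). \<forall>z. dE (i - 1 + 1) (h (dE (i - 1 + 1) z)) = dE (i - 1 + 1) z"
        using h'(1) by auto
    qed
  qed
  with False i show ?thesis by simp
qed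

text \<open>On \<open>E i\<close> the identity is \<open>d h + h' d\<close>, so a map that kills
  boundaries is \<open>f h' d\<close>; here the target \<open>B\<close> is arbitrary.\<close>

lemma E_hom_exact:
  assumes i: "n + 1 \<le> i" and f: "f \<in> hm (E i) B" "\<And>z. f (dE (i + 1) z) = 0"
  shows "\<exists>g\<in>hm (E (i - 1)) B. \<forall>z. f z = g (dE i z)"
proof -
  obtain h where h: "h \<in> hm (E i) (E (i + 1))" "\<And>z. dE (i + 1) (h (dE (i + 1) z)) = dE (i + 1) z"
    using E_regular[of i] i by auto
  from E_section_down[OF i h] obtain h' where h': "h' \<in> hm (E (i - 1)) (E i)"
    "\<And>z. snd (E i) z = dE (i + 1) (h z) + h' (dE i z)" by blast
  have "f z = f (h' (dE i z))" for z
    using hm_src[OF f(1), of z] unfolding h'(2) by (simp add: hm_add[OF f(1)] f(2))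
  then show ?thesis by (intro bexI[OF _ hm_comp[OF h'(1) f(1)]]) simp
qed

text \<open>Exactness of \<open>Hom(E, B)\<close> in degree \<open>j\<close> for the cochain
  \<open>(f1, f2, - g)\<close>: the last hypothesis, that the pullback of \<open>(f1, f2)\<close> to
  \<open>T\<close> is a coboundary, is its cocycle condition on the summand
  \<open>T j\<close>.\<close>

theorem comparison_inj:
  assumes B: "obj_ok B" and j: "n + 1 \<le> j"
    and f: "f1 \<in> hm (ob R G (j + 1)) B" "f2 \<in> hm (ob R P j) B" "g \<in> hm (ob R T (j - 1)) B"
      "\<And>x. f1 (dm G (j + 1 + 1) x) = 0" "\<And>y. f1 (u (j + 1) y) = f2 (dm P (j + 1) y)"
      "\<And>t. f1 (b1 j t) + f2 (b2 j t) = g (dm T j t)"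
  shows "\<exists>c1\<in>hm (ob R G j) B. \<exists>c2\<in>hm (ob R P (j - 1)) B.
    (\<forall>x. f1 x = c1 (dm G (j + 1) x)) \<and> (\<forall>y. f2 y = c1 (u j y) - c2 (dm P j y))"
proof -
  let ?f = "\<lambda>z. f1 (fst z) + (f2 (fst (snd z)) - g (snd (snd z)))"
  note fl = hm_lin[OF f(1)] hm_lin[OF f(2)] hm_lin[OF f(3)]
  have "?f \<in> hm (E j) B"
    unfolding E_def by (intro hm_plus hm_sub B hm_fst[OF f(1)] hm_snd[OF hm_fst[OF f(2)]] hm_snd[OF hm_snd[OF f(3)]])
  moreover have "?f (dE (j + 1) z) = 0" for z
    using f(4)[of "fst z"] f(5)[of "fst (snd z)"] f(6)[of "snd (snd z)", symmetric]
    by (simp add: dE_def fl algebra_simps)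
  ultimately obtain c where c: "c \<in> hm (E (j - 1)) B" "\<And>z. ?f z = c (dE j z)"
    using E_hom_exact[OF j, of ?f] by blast
  have "c \<in> hm (osum (ob R G j) (osum (ob R P (j - 1)) (ob R T (j - 1 - 1)))) B"
    using c(1) by (simp add: E_def)
  note c3 = hm_in3[OF this ok(3) ok(1) ok(4)]
  have b0: "b1 (j - 1) 0 = 0" "b2 (j - 1) 0 = 0" using b_lin(2,6)[of "j - 1"] j by auto
  show ?thesis
  proof (intro bexI[OF _ c3(1)] bexI[OF _ c3(2)] conjI allI)
    show "f1 x = c (dm G (j + 1) x, 0, 0)" for x
      using c(2)[of "(x, 0, 0)"] by (simp add: dE_def fl lins b0)
    show "f2 y = c (u j y, 0, 0) - c (0, dm P j y, 0)" for y
      using c(2)[of "(0, y, 0)"] c3(4)[of "(u j y, - dm P j y, 0)"] hm_zero[OF c3(3)] hm_minus[OF c3(2), of "dm P j y"]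
      by (simp add: dE_def fl lins b0)
  qed
qed

text \<open>Exactness of \<open>Hom(E, B)\<close> in degree \<open>j + 1\<close> for the cochain
  that is \<open>f\<close> on the summand \<open>T j\<close> and zero on the others.\<close>

theorem comparison_surj:
  assumes B: "obj_ok B" and j: "n \<le> j" and f: "f \<in> hm (ob R T j) B" "\<And>t. f (dm T (j + 1) t) = 0"
  shows "\<exists>c1\<in>hm (ob R G (j + 1)) B. \<exists>c2\<in>hm (ob R P j) B. \<exists>g\<in>hm (ob R T (j - 1)) B.
    (\<forall>x. c1 (dm G (j + 1 + 1) x) = 0) \<and> (\<forall>y. c1 (u (j + 1) y) = c2 (dm P (j + 1) y)) \<and>
    (\<forall>t. f t = c1 (b1 j t) + c2 (b2 j t) + g (dm T j t))"
proof -
  let ?f = "\<lambda>z. f (snd (snd z))"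
  have j': "n + 1 \<le> j + 1" using j by simp
  have f': "f \<in> hm (ob R T (j + 1 - 1)) B" using f(1) by simp
  have F: "?f \<in> hm (E (j + 1)) B" unfolding E_def by (rule hm_snd[OF hm_snd[OF f']])
  have F0: "?f (dE (j + 1 + 1) z) = 0" for z
    using f(2)[of "snd (snd z)"] by (simp add: dE_def add.commute)
  obtain c where c0: "c \<in> hm (E (j + 1 - 1)) B" "\<And>z. ?f z = c (dE (j + 1) z)"
    using E_hom_exact[OF j' F F0] by blast
  then have c: "c \<in> hm (E j) B" "\<And>z. ?f z = c (dE (j + 1) z)" by simp_all
  note c3 = hm_in3[OF c(1)[unfolded E_def] ok(3) ok(1) ok(4)]
  have b0: "b1 j 0 = 0" "b2 j 0 = 0" using b_lin(2,6)[of j] j by auto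
  show ?thesis
  proof (intro bexI[OF _ c3(1)] bexI[OF _ c3(2)] bexI[OF _ c3(3)] conjI allI)
    show "c (dm G (j + 1 + 1) x, 0, 0) = 0" for x
      using c(2)[of "(x, 0, 0)"] by (simp add: dE_def lins b0 hm_lin[OF f(1)])
    show "c (u (j + 1) y, 0, 0) = c (0, dm P (j + 1) y, 0)" for y
      using c(2)[of "(0, y, 0)"] c3(4)[of "(u (j + 1) y, - dm P (j + 1) y, 0)"] hm_zero[OF c3(3)]
        hm_minus[OF c3(2), of "dm P (j + 1) y"]
      by (simp add: dE_def lins b0 hm_lin[OF f(1)])
    show "f t = c (b1 j t, 0, 0) + c (0, b2 j t, 0) + c (0, 0, dm T j t)" for t
      using c(2)[of "(0, 0, t)"] c3(4)[of "(b1 j t, b2 j t, dm T j t)"]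
      by (simp add: dE_def lins add.assoc)
  qed
qed

end

section \<open>Cohomology of the Hom complex into a module\<close>

text \<open>First isomorphism theorem for the map from \<open>Z\<close> to \<open>Z' / B'\<close>
  induced by \<open>\<psi>\<close>, whose kernel is \<open>B\<close>.\<close>

lemma quotient_iso:
  assumes G: "comm_group G" and Z: "subgroup Z G" and B: "subgroup B G" "B \<subseteq> Z"
    and G': "comm_group G'" and Z': "subgroup Z' G'" and B': "subgroup B' G'" "B' \<subseteq> Z'"
    and \<psi>: "\<And>z. z \<in> Z \<Longrightarrow> \<psi> z \<in> Z'" "\<And>x y. x \<in> Z \<Longrightarrow> y \<in> Z \<Longrightarrow> \<psi> (x \<otimes>\<^bsub>G\<^esub> y) = \<psi> x \<otimes>\<^bsub>G'\<^esub> \<psi> y"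
    and ker: "\<And>z. z \<in> Z \<Longrightarrow> \<psi> z \<in> B' \<longleftrightarrow> z \<in> B"
    and surj: "\<And>y. y \<in> Z' \<Longrightarrow> \<exists>z\<in>Z. \<exists>b\<in>B'. y = b \<otimes>\<^bsub>G'\<^esub> \<psi> z"
  shows "G\<lparr>carrier := Z\<rparr> Mod B \<cong> G'\<lparr>carrier := Z'\<rparr> Mod B'"
proof -
  let ?G = "G\<lparr>carrier := Z\<rparr>" and ?G' = "G'\<lparr>carrier := Z'\<rparr>"
  interpret G: comm_group G by fact
  interpret G': comm_group G' by fact
  have gG: "group ?G" using Z G.group_axioms by (rule subgroup.subgroup_is_group)
  have gG': "group ?G'" using Z' G'.group_axioms by (rule subgroup.subgroup_is_group)
  have cG': "comm_group ?G'"
    using G'.m_comm subgroup.mem_carrier[OF Z'] by (intro group.group_comm_groupI[OF gG']) simp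
  interpret Q: comm_group ?G' by fact
  have sB': "subgroup B' ?G'" using B' Z' by (intro G'.subgroup_incl)
  then interpret n: normal B' ?G' by (rule Q.subgroup_imp_normal)
  let ?h = "\<lambda>z. B' #>\<^bsub>?G'\<^esub> \<psi> z"
  have "\<psi> \<in> hom ?G ?G'" using \<psi> by (auto simp: hom_def)
  from hom_compose[OF this n.r_coset_hom_Mod] have "?h \<in> hom ?G (?G' Mod B')" by (simp add: comp_def)
  then interpret h: group_hom ?G "?G' Mod B'" ?h
    using gG n.factorgroup_is_group by (simp add: group_hom_def group_hom_axioms_def)
  have coset: "B' #>\<^bsub>?G'\<^esub> y = B' \<longleftrightarrow> y \<in> B'" if "y \<in> Z'" for y
    using that Q.coset_join1[OF _ _ sB', of y] Q.coset_join2[OF _ sB', of y] subgroup.subset[OF sB'] by auto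
  have "kernel ?G (?G' Mod B') ?h = B"
  proof -
    have "B' #>\<^bsub>G'\<^esub> \<psi> z = B' \<longleftrightarrow> z \<in> B" if "z \<in> Z" for z
      using coset[simplified, OF \<psi>(1)[OF that]] ker[OF that] by simp
    then show ?thesis using B(2) by (auto simp: kernel_def)
  qed
  moreover have "?h ` carrier ?G = carrier (?G' Mod B')"
  proof
    show "?h ` carrier ?G \<subseteq> carrier (?G' Mod B')" using h.hom_closed by auto
    show "carrier (?G' Mod B') \<subseteq> ?h ` carrier ?G"
    proof
      fix C assume "C \<in> carrier (?G' Mod B')"
      then obtain y where y: "y \<in> Z'" "C = B' #>\<^bsub>?G'\<^esub> y" by (auto simp: FactGroup_def RCOSETS_def)
      obtain z b where zb: "z \<in> Z" "b \<in> B'" "y = b \<otimes>\<^bsub>G'\<^esub> \<psi> z" using surj[OF y(1)] by blast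
      have "B' #>\<^bsub>?G'\<^esub> (b \<otimes>\<^bsub>?G'\<^esub> \<psi> z) = (B' #>\<^bsub>?G'\<^esub> b) #>\<^bsub>?G'\<^esub> \<psi> z"
        using zb B'(2) \<psi>(1) by (intro Q.coset_mult_assoc[symmetric]) auto
      also have "B' #>\<^bsub>?G'\<^esub> b = B'" using zb(2) B'(2) by (subst coset) auto
      finally have "C = ?h z" using y(2) zb(3) by simp
      then show "C \<in> ?h ` carrier ?G" using zb(1) by simp
    qed
  qed
  ultimately show ?thesis using h.FactGroup_iso by simp
qed

lemma lmod_hom_plus:
  assumes B: "left_module R B" and f: "f \<in> lmod_hom R A B" and g: "g \<in> lmod_hom R A B" and A: "left_module R A"
  shows "(\<lambda>x\<in>carrier A. f x \<oplus>\<^bsub>B\<^esub> g x) \<in> lmod_hom R A B"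
proof -
  interpret B: left_module R B by fact
  interpret A: left_module R A by fact
  note c = lh_closed[OF f] lh_closed[OF g]
  show ?thesis
    by (rule lmod_homI) (auto simp: c lh_add[OF f] lh_add[OF g] lh_smult[OF f] lh_smult[OF g] B.M.a_ac B.smult_add_right)
qed

lemma lm_smult_uminus: "left_module R A \<Longrightarrow> r \<in> carrier R \<Longrightarrow> x \<in> carrier A \<Longrightarrow>
    r \<odot>\<^bsub>A\<^esub> (\<ominus>\<^bsub>A\<^esub> x) = \<ominus>\<^bsub>A\<^esub> (r \<odot>\<^bsub>A\<^esub> x)"
proof -
  assume A: "left_module R A" and r: "r \<in> carrier R" and x: "x \<in> carrier A"
  interpret left_module R A by fact
  have "r \<odot>\<^bsub>A\<^esub> (\<ominus>\<^bsub>A\<^esub> x) \<oplus>\<^bsub>A\<^esub> r \<odot>\<^bsub>A\<^esub> x = \<zero>\<^bsub>A\<^esub>"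
    using smult_add_right[OF r, of "\<ominus>\<^bsub>A\<^esub> x" x] r x lm_smult_zero[OF A r] by (simp add: M.l_neg)
  then show ?thesis using r x by (intro M.minus_equality[symmetric]) auto
qed

lemma lmod_hom_uminus:
  assumes B: "left_module R B" and f: "f \<in> lmod_hom R A B" and A: "left_module R A"
  shows "(\<lambda>x\<in>carrier A. \<ominus>\<^bsub>B\<^esub> f x) \<in> lmod_hom R A B"
proof -
  interpret B: left_module R B by fact
  interpret A: left_module R A by fact
  note c = lh_closed[OF f]
  show ?thesis
    by (rule lmod_homI)
      (auto simp: c lh_add[OF f] lh_smult[OF f] B.M.minus_add lm_smult_uminus[OF B])
qed

lemma lmod_hom_eqI:
  assumes "f \<in> lmod_hom R A B" "g \<in> lmod_hom R A B" "\<And>x. x \<in> carrier A \<Longrightarrow> f x = g x"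
  shows "f = g"
  using lh_ext[OF assms(1)] lh_ext[OF assms(2)] assms(3) by (rule extensionalityI)

lemma hom_cplx_comm_group:
  assumes X: "\<And>i. left_module R (obj X i)" and Y: "\<And>i. left_module R (obj Y i)"
  shows "comm_group (hom_cplx R X Y n)"
proof (rule comm_groupI)
  note z = zero_hom_lmod[OF X Y] and pl = lmod_hom_plus[OF Y _ _ X] and ag = abelian_group.axioms(1)[OF lm_ag[OF Y]]
  let ?G = "hom_cplx R X Y n"
  have c: "f p t \<in> carrier (obj Y (p + n))" if "\<forall>p. f p \<in> lmod_hom R (obj X p) (obj Y (p + n))" "t \<in> carrier (obj X p)" for f p t
    by (rule lh_closed[OF spec[OF that(1)] that(2)])
  show "x \<otimes>\<^bsub>?G\<^esub> y \<in> carrier ?G" if "x \<in> carrier ?G" "y \<in> carrier ?G" for x y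
    using that pl by (auto simp: hom_cplx_def)
  show "\<one>\<^bsub>?G\<^esub> \<in> carrier ?G" using z by (auto simp: hom_cplx_def)
  show "x \<otimes>\<^bsub>?G\<^esub> y \<otimes>\<^bsub>?G\<^esub> w = x \<otimes>\<^bsub>?G\<^esub> (y \<otimes>\<^bsub>?G\<^esub> w)" if "x \<in> carrier ?G" "y \<in> carrier ?G" "w \<in> carrier ?G" for x y w
    using that c by (auto simp: hom_cplx_def fun_eq_iff restrict_def abelian_monoid.a_assoc[OF ag])
  show "x \<otimes>\<^bsub>?G\<^esub> y = y \<otimes>\<^bsub>?G\<^esub> x" if "x \<in> carrier ?G" "y \<in> carrier ?G" for x y
    using that c by (auto simp: hom_cplx_def fun_eq_iff restrict_def abelian_monoid.a_comm[OF ag])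
  show "\<one>\<^bsub>?G\<^esub> \<otimes>\<^bsub>?G\<^esub> x = x" if "x \<in> carrier ?G" for x
  proof -
    have "(\<lambda>t\<in>carrier (obj X p). zero_hom (obj X p) (obj Y (p + n)) t \<oplus>\<^bsub>obj Y (p + n)\<^esub> x p t) = x p" for p
    proof -
      have x: "x p \<in> lmod_hom R (obj X p) (obj Y (p + n))" using that by (simp add: hom_cplx_def)
      show ?thesis
        by (rule lmod_hom_eqI[OF pl[OF z x] x]) (simp add: zero_hom_def lh_closed[OF x] abelian_monoid.l_zero[OF ag])
    qed
    then show ?thesis by (simp add: hom_cplx_def)
  qed
  show "\<exists>y\<in>carrier ?G. y \<otimes>\<^bsub>?G\<^esub> x = \<one>\<^bsub>?G\<^esub>" if "x \<in> carrier ?G" for x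
  proof
    let ?y = "\<lambda>p. \<lambda>t\<in>carrier (obj X p). \<ominus>\<^bsub>obj Y (p + n)\<^esub> x p t"
    show "?y \<in> carrier ?G" using that lmod_hom_uminus[OF Y _ X] by (simp add: hom_cplx_def)
    show "?y \<otimes>\<^bsub>?G\<^esub> x = \<one>\<^bsub>?G\<^esub>"
      using that by (auto simp: hom_cplx_def fun_eq_iff zero_hom_def restrict_def c abelian_group.l_neg[OF lm_ag[OF Y]])
  qed
qed

section \<open>The Hom complex into a module concentrated in degree 0\<close>

lemma concentrated_simps:
  "obj (concentrated N) q = (if q = 0 then N else N\<lparr>carrier := {\<zero>\<^bsub>N\<^esub>}\<rparr>)"
  "diff (concentrated N) q = zero_hom (obj (concentrated N) q) (obj (concentrated N) (q - 1))"
  by (simp_all add: concentrated_def Let_def)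

lemma concentrated_left_module: "left_module R N \<Longrightarrow> left_module R (obj (concentrated N) q)"
  using zero_left_module by (auto simp: concentrated_simps)

lemma concentrated_ops:
  "\<zero>\<^bsub>obj (concentrated N) q\<^esub> = \<zero>\<^bsub>N\<^esub>" "x \<oplus>\<^bsub>obj (concentrated N) q\<^esub> y = x \<oplus>\<^bsub>N\<^esub> y"
  by (simp_all add: concentrated_simps)

text \<open>Away from degree \<open>i\<close> the target is the zero module, so a cochain is
  determined by one homomorphism and must be the extensional zero map elsewhere.\<close>

definition single :: "('r, 'a) cplx \<Rightarrow> ('r, 'm) module \<Rightarrow> int \<Rightarrow> ('a \<Rightarrow> 'm) \<Rightarrow> int \<Rightarrow> 'a \<Rightarrow> 'm" where
  "single X N i f = (\<lambda>q. if q = i then f else (\<lambda>x\<in>carrier (obj X q). \<zero>\<^bsub>N\<^esub>))"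

context
  fixes R :: "('r, 'x) ring_scheme" and X :: "('r, 'a) cplx" and N :: "('r, 'm) module" and i :: int
  assumes X: "chain_complex R X" and N: "left_module R N"
begin

lemma hom_concentrated_value:
  assumes f: "f \<in> carrier (hom_cplx R X (concentrated N) m)" and p: "p + m \<noteq> 0" and x: "x \<in> carrier (obj X p)"
  shows "f p x = \<zero>\<^bsub>N\<^esub>"
proof -
  have "f p \<in> lmod_hom R (obj X p) (obj (concentrated N) (p + m))" using f by (simp add: hom_cplx_def)
  from lh_closed[OF this x] p show ?thesis by (simp add: concentrated_simps)
qed

lemma single_carrier:
  assumes f: "f \<in> lmod_hom R (obj X i) N" and m: "m = - i"
  shows "single X N i f \<in> carrier (hom_cplx R X (concentrated N) m)"
proof -
  have "(\<lambda>x\<in>carrier (obj X p). \<zero>\<^bsub>N\<^esub>) = zero_hom (obj X p) (obj (concentrated N) (p + m))" for p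
    by (simp add: zero_hom_def concentrated_ops)
  then show ?thesis
    using f m zero_hom_lmod[OF cc_lm[OF X] concentrated_left_module[OF N]]
    by (auto simp: hom_cplx_def single_def concentrated_simps(1)[of N 0])
qed

lemma hom_concentrated_single:
  assumes f: "f \<in> carrier (hom_cplx R X (concentrated N) (- i))"
  shows "f = single X N i (f i)" and "f i \<in> lmod_hom R (obj X i) N"
proof -
  show fi: "f i \<in> lmod_hom R (obj X i) N" using f by (auto simp: hom_cplx_def concentrated_simps dest: spec[of _ i])
  have "f p \<in> extensional (carrier (obj X p))" for p
  proof -
    have "f p \<in> lmod_hom R (obj X p) (obj (concentrated N) (p + - i))" using f by (simp add: hom_cplx_def)
    then show ?thesis by (rule lh_ext)
  qed
  then show "f = single X N i (f i)"
    using hom_concentrated_value[OF f] by (auto simp: single_def fun_eq_iff extensional_def)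
qed

text \<open>The differential of the target vanishes, so only precomposition with the differential of
  \<open>X\<close> survives, in the one degree that reaches \<open>N\<close>, with a sign depending
  on the parity of \<open>m\<close>.\<close>

lemma hom_diff_concentrated:
  assumes f: "f \<in> carrier (hom_cplx R X (concentrated N) m)" and x: "x \<in> carrier (obj X p)"
  shows "hom_diff X (concentrated N) m f p x = (if p + m = 1 then
    (if even m then \<ominus>\<^bsub>N\<^esub> f (p - 1) (diff X p x) else f (p - 1) (diff X p x)) else \<zero>\<^bsub>N\<^esub>)"
proof -
  interpret N: abelian_group N by (rule lm_ag[OF N])
  have fp: "f p x \<in> carrier (obj (concentrated N) (p + m))"
    if "x \<in> carrier (obj X p)" for p x
    using f that by (auto simp: hom_cplx_def intro: lh_closed)
  have z: "diff (concentrated N) (p + m) (f p x) = \<zero>\<^bsub>N\<^esub>"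
    using fp[OF x] by (simp add: concentrated_simps(2) zero_hom_def concentrated_ops)
  note dx = lh_closed[OF cc_d[OF X] x]
  have h: "hom_diff X (concentrated N) m f p x =
    (if even m then diff (concentrated N) (p + m) (f p x) \<ominus>\<^bsub>obj (concentrated N) (p + m - 1)\<^esub> f (p - 1) (diff X p x)
     else diff (concentrated N) (p + m) (f p x) \<oplus>\<^bsub>obj (concentrated N) (p + m - 1)\<^esub> f (p - 1) (diff X p x))"
    using x by (simp add: hom_diff_def)
  show ?thesis
  proof (cases "p + m = 1")
    case True
    then have e: "p + m - 1 = 0" "p - 1 + m = 0" by simp_all
    have c: "obj (concentrated N) (p + m - 1) = N" unfolding e by (simp add: concentrated_simps)
    have "f (p - 1) (diff X p x) \<in> carrier N" using fp[OF dx] unfolding e by (simp add: concentrated_simps)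
    then show ?thesis using True unfolding h z c by (simp add: a_minus_def)
  next
    case False
    have "f (p - 1) (diff X p x) = \<zero>\<^bsub>N\<^esub>" using hom_concentrated_value[OF f _ dx] False by simp
    moreover have c: "obj (concentrated N) (p + m - 1) = N\<lparr>carrier := {\<zero>\<^bsub>N\<^esub>}\<rparr>" using False by (simp add: concentrated_simps)
    have "\<ominus>\<^bsub>N\<lparr>carrier := {\<zero>\<^bsub>N\<^esub>}\<rparr>\<^esub> \<zero>\<^bsub>N\<^esub> = \<zero>\<^bsub>N\<^esub>"
      by (rule abelian_group.minus_equality[OF lm_ag[OF zero_left_module[OF N]]]) auto
    ultimately show ?thesis using False unfolding h z c by (simp add: a_minus_def)
  qed
qed

lemma hom_cycles:
  "f \<in> cycles (hom_cplx R X (concentrated N)) (hom_diff X (concentrated N)) (- i) \<longleftrightarrow>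
    f \<in> carrier (hom_cplx R X (concentrated N) (- i)) \<and> (\<forall>x\<in>carrier (obj X (i + 1)). f i (diff X (i + 1) x) = \<zero>\<^bsub>N\<^esub>)"
proof -
  interpret N: abelian_group N by (rule lm_ag[OF N])
  let ?C = "concentrated N"
  have "hom_diff X ?C (- i) f = \<one>\<^bsub>hom_cplx R X ?C (- i - 1)\<^esub> \<longleftrightarrow> (\<forall>x\<in>carrier (obj X (i + 1)). f i (diff X (i + 1) x) = \<zero>\<^bsub>N\<^esub>)"
    if f: "f \<in> carrier (hom_cplx R X ?C (- i))"
  proof -
    have fi: "f i (diff X (i + 1) x) \<in> carrier N" if "x \<in> carrier (obj X (i + 1))" for x
      using lh_closed[OF hom_concentrated_single(2)[OF f] lh_closed[OF cc_d'[OF X] that]] .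
    have "hom_diff X ?C (- i) f = \<one>\<^bsub>hom_cplx R X ?C (- i - 1)\<^esub> \<longleftrightarrow>
      (\<forall>p. \<forall>x\<in>carrier (obj X p). hom_diff X ?C (- i) f p x = \<zero>\<^bsub>N\<^esub>)"
      by (auto simp: hom_cplx_def fun_eq_iff zero_hom_def concentrated_ops hom_diff_def)
    also have "\<dots> \<longleftrightarrow> (\<forall>x\<in>carrier (obj X (i + 1)). hom_diff X ?C (- i) f (i + 1) x = \<zero>\<^bsub>N\<^esub>)"
    proof -
      have "hom_diff X ?C (- i) f p x = \<zero>\<^bsub>N\<^esub>" if "x \<in> carrier (obj X p)" "p \<noteq> i + 1" for p x
        using that(2) by (simp add: hom_diff_concentrated[OF f that(1)])
      then show ?thesis by blast
    qed
    also have "\<dots> \<longleftrightarrow> (\<forall>x\<in>carrier (obj X (i + 1)). f i (diff X (i + 1) x) = \<zero>\<^bsub>N\<^esub>)"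
      using fi by (auto simp: hom_diff_concentrated[OF f])
    finally show ?thesis .
  qed
  then show ?thesis by (auto simp: cycles_def kernel_def)
qed

text \<open>The sign of the Hom differential is absorbed by the freedom in \<open>g\<close>, so
  coboundaries may be described without it.\<close>

lemma hom_boundaries:
  "f \<in> boundaries (hom_cplx R X (concentrated N)) (hom_diff X (concentrated N)) (- i) \<longleftrightarrow>
    f \<in> carrier (hom_cplx R X (concentrated N) (- i)) \<and>
    (\<exists>g\<in>lmod_hom R (obj X (i - 1)) N. \<forall>x\<in>carrier (obj X i). f i x = g (diff X i x))"
  (is "_ \<longleftrightarrow> ?r f")
proof
  interpret N: abelian_group N by (rule lm_ag[OF N])
  let ?C = "concentrated N"
  define m where "m = - i + 1"
  have m: "p + m = 1 \<longleftrightarrow> p = i" "p + m = 0 \<longleftrightarrow> p = i - 1" for p by (auto simp: m_def)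
  have df: "hom_diff X ?C m g = single X N i (\<lambda>x\<in>carrier (obj X i). if even m then \<ominus>\<^bsub>N\<^esub> g (i - 1) (diff X i x) else g (i - 1) (diff X i x))"
    if "g \<in> carrier (hom_cplx R X ?C m)" for g
  proof (intro ext)
    fix p x
    show "hom_diff X ?C m g p x = single X N i (\<lambda>x\<in>carrier (obj X i). if even m then \<ominus>\<^bsub>N\<^esub> g (i - 1) (diff X i x) else g (i - 1) (diff X i x)) p x"
    proof (cases "x \<in> carrier (obj X p)")
      case True
      then show ?thesis by (cases "p = i") (simp_all add: hom_diff_concentrated[OF that] single_def m)
    next
      case False
      then show ?thesis by (cases "p = i") (simp_all add: single_def hom_diff_def)
    qed
  qed
  have comp: "(\<lambda>x\<in>carrier (obj X i). g (diff X i x)) \<in> lmod_hom R (obj X i) N" if "g \<in> lmod_hom R (obj X (i - 1)) N" for g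
    by (rule lmod_homI)
      (auto simp: lh_closed[OF that] lh_add[OF that] lh_smult[OF that] lh_closed[OF cc_d[OF X]] lh_add[OF cc_d[OF X]]
        lh_smult[OF cc_d[OF X]] lm_add[OF cc_lm[OF X]] left_module.smult_closed[OF cc_lm[OF X]])
  {
    assume "f \<in> boundaries (hom_cplx R X ?C) (hom_diff X ?C) (- i)"
    then obtain g where g: "g \<in> carrier (hom_cplx R X ?C m)" "f = hom_diff X ?C m g"
      by (auto simp: boundaries_def m_def)
    have gh: "g (i - 1) \<in> lmod_hom R (obj X (i - 1)) N"
      using g(1) m by (auto simp: hom_cplx_def concentrated_simps dest: spec[of _ "i - 1"])
    let ?g = "if even m then (\<lambda>x\<in>carrier (obj X (i - 1)). \<ominus>\<^bsub>N\<^esub> g (i - 1) x) else g (i - 1)"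
    have g': "?g \<in> lmod_hom R (obj X (i - 1)) N" using gh lmod_hom_uminus[OF N gh cc_lm[OF X]] by simp
    have "f = single X N i (\<lambda>x\<in>carrier (obj X i). ?g (diff X i x))"
      unfolding g(2) df[OF g(1)]
      by (rule arg_cong[where f="single X N i"]) (auto simp: fun_eq_iff restrict_def lh_closed[OF cc_d[OF X]])
    moreover from this have "f i x = ?g (diff X i x)" if "x \<in> carrier (obj X i)" for x
      using that by (simp add: single_def)
    ultimately show "?r f" using single_carrier[OF comp[OF g'] refl] g' by blast
  next
    assume "?r f"
    then obtain g where f: "f \<in> carrier (hom_cplx R X ?C (- i))" and g: "g \<in> lmod_hom R (obj X (i - 1)) N"
      and fg: "\<And>x. x \<in> carrier (obj X i) \<Longrightarrow> f i x = g (diff X i x)" by blast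
    let ?g = "if even m then (\<lambda>x\<in>carrier (obj X (i - 1)). \<ominus>\<^bsub>N\<^esub> g x) else g"
    have g': "?g \<in> lmod_hom R (obj X (i - 1)) N" using g lmod_hom_uminus[OF N g cc_lm[OF X]] by simp
    have s: "single X N (i - 1) ?g \<in> carrier (hom_cplx R X ?C m)"
    proof -
      have "(\<lambda>x\<in>carrier (obj X p). \<zero>\<^bsub>N\<^esub>) = zero_hom (obj X p) (obj ?C (p + m))" for p
        by (simp add: zero_hom_def concentrated_ops)
      then show ?thesis
        using g' zero_hom_lmod[OF cc_lm[OF X] concentrated_left_module[OF N]]
        by (auto simp: hom_cplx_def single_def concentrated_simps(1)[of N 0] m(2)[of "i - 1", simplified])
    qed
    have sv: "single X N (i - 1) h (i - 1) = h" for h by (simp add: single_def)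
    have "f = single X N i (f i)" by (rule hom_concentrated_single(1)[OF f])
    also have "f i = (\<lambda>x\<in>carrier (obj X i). if even m then \<ominus>\<^bsub>N\<^esub> ?g (diff X i x) else ?g (diff X i x))"
      using fg lh_ext[OF hom_concentrated_single(2)[OF f]] lh_closed[OF g] lh_closed[OF cc_d[OF X]]
      by (auto simp: fun_eq_iff restrict_def extensional_def)
    finally have "f = hom_diff X ?C m (single X N (i - 1) ?g)"
      unfolding df[OF s] sv .
    then show "f \<in> boundaries (hom_cplx R X ?C) (hom_diff X ?C) (- i)"
      using s by (auto simp: boundaries_def m_def)
  }
qed

end

section \<open>Cocycles and coboundaries as subgroups\<close>

context
  fixes R :: "('r, 'x) ring_scheme" and X :: "('r, 'a) cplx" and N :: "('r, 'm) module" and i :: int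
  assumes X: "chain_complex R X" and N: "left_module R N"
begin

abbreviation (input) "HX \<equiv> hom_cplx R X (concentrated N) (- i)"

lemma hom_mult_value:
  assumes "x \<in> carrier (obj X i)"
  shows "(f \<otimes>\<^bsub>HX\<^esub> g) i x = f i x \<oplus>\<^bsub>N\<^esub> g i x"
  using assms by (simp add: hom_cplx_def concentrated_ops)

lemma hom_one_value: "x \<in> carrier (obj X i) \<Longrightarrow> \<one>\<^bsub>HX\<^esub> i x = \<zero>\<^bsub>N\<^esub>"
  by (simp add: hom_cplx_def zero_hom_def concentrated_ops)

lemma hom_group: "comm_group HX"
  by (rule hom_cplx_comm_group[OF cc_lm[OF X] concentrated_left_module[OF N]])

lemma hom_inv_value:
  assumes f: "f \<in> carrier HX" and x: "x \<in> carrier (obj X i)"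
  shows "(inv\<^bsub>HX\<^esub> f) i x = \<ominus>\<^bsub>N\<^esub> f i x"
proof -
  interpret G: comm_group HX by (rule hom_group)
  interpret N: abelian_group N by (rule lm_ag[OF N])
  have "(inv\<^bsub>HX\<^esub> f) i x \<oplus>\<^bsub>N\<^esub> f i x = \<zero>\<^bsub>N\<^esub>"
    using hom_mult_value[OF x, of "inv\<^bsub>HX\<^esub> f" f] G.l_inv[OF f] hom_one_value[OF x] by simp
  then show ?thesis
    using lh_closed[OF hom_concentrated_single(2)[OF X N f] x]
      lh_closed[OF hom_concentrated_single(2)[OF X N G.inv_closed[OF f]] x]
    by (intro N.minus_equality[symmetric])
qed

lemma cycles_subgroup: "subgroup (cycles (hom_cplx R X (concentrated N)) (hom_diff X (concentrated N)) (- i)) HX"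
proof -
  interpret G: comm_group HX by (rule hom_group)
  interpret N: abelian_group N by (rule lm_ag[OF N])
  note dx = lh_closed[OF cc_d'[OF X]]
  show ?thesis
    by (rule subgroup.intro)
      (auto simp: hom_cycles[OF X N] hom_mult_value hom_one_value hom_inv_value dx)
qed

lemma boundaries_subset: "boundaries (hom_cplx R X (concentrated N)) (hom_diff X (concentrated N)) (- i) \<subseteq>
    cycles (hom_cplx R X (concentrated N)) (hom_diff X (concentrated N)) (- i)"
  using lh_closed[OF cc_d'[OF X]] cc_dd'[OF X] lh_zero[OF _ cc_ag[OF X] lm_ag[OF N]]
  by (auto simp: hom_cycles[OF X N] hom_boundaries[OF X N])

lemma hom_boundaries_subgroup:
  "subgroup (boundaries (hom_cplx R X (concentrated N)) (hom_diff X (concentrated N)) (- i)) HX"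
proof -
  interpret G: comm_group HX by (rule hom_group)
  interpret N: abelian_group N by (rule lm_ag[OF N])
  note dx = lh_closed[OF cc_d[OF X]]
  show ?thesis
  proof (rule subgroup.intro)
    fix f g assume "f \<in> boundaries (hom_cplx R X (concentrated N)) (hom_diff X (concentrated N)) (- i)"
      "g \<in> boundaries (hom_cplx R X (concentrated N)) (hom_diff X (concentrated N)) (- i)"
    then obtain a b where ab: "f \<in> carrier HX" "g \<in> carrier HX" "a \<in> lmod_hom R (obj X (i - 1)) N" "b \<in> lmod_hom R (obj X (i - 1)) N"
      "\<And>x. x \<in> carrier (obj X i) \<Longrightarrow> f i x = a (diff X i x)" "\<And>x. x \<in> carrier (obj X i) \<Longrightarrow> g i x = b (diff X i x)"
      unfolding hom_boundaries[OF X N] by blast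
    then show "f \<otimes>\<^bsub>HX\<^esub> g \<in> boundaries (hom_cplx R X (concentrated N)) (hom_diff X (concentrated N)) (- i)"
      unfolding hom_boundaries[OF X N]
      by (intro conjI bexI[OF _ lmod_hom_plus[OF N ab(3,4) cc_lm[OF X]]]) (auto simp: hom_mult_value dx)
  next
    show "\<one>\<^bsub>HX\<^esub> \<in> boundaries (hom_cplx R X (concentrated N)) (hom_diff X (concentrated N)) (- i)"
      unfolding hom_boundaries[OF X N]
      by (intro conjI bexI[OF _ zero_hom_lmod[OF cc_lm[OF X] N]]) (auto simp: hom_one_value zero_hom_def dx)
  next
    fix f assume "f \<in> boundaries (hom_cplx R X (concentrated N)) (hom_diff X (concentrated N)) (- i)"
    then obtain a where a: "f \<in> carrier HX" "a \<in> lmod_hom R (obj X (i - 1)) N"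
      "\<And>x. x \<in> carrier (obj X i) \<Longrightarrow> f i x = a (diff X i x)"
      unfolding hom_boundaries[OF X N] by blast
    then show "inv\<^bsub>HX\<^esub> f \<in> boundaries (hom_cplx R X (concentrated N)) (hom_diff X (concentrated N)) (- i)"
      unfolding hom_boundaries[OF X N]
      by (intro conjI bexI[OF _ lmod_hom_uminus[OF N a(2) cc_lm[OF X]]]) (auto simp: hom_inv_value dx)
  qed (auto simp: hom_boundaries[OF X N])
qed

end

lemma hom_cohomology_iso:
  fixes X :: "('r, 'a) cplx" and Y :: "('r, 'b) cplx" and N :: "('r, 'm) module"
  assumes X: "chain_complex R X" and Y: "chain_complex R Y" and N: "left_module R N"
    and \<beta>: "\<beta> \<in> lmod_hom R (obj Y j) (obj X i)"
    and wd1: "\<And>f y. f \<in> lmod_hom R (obj X i) N \<Longrightarrow>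
      (\<And>x. x \<in> carrier (obj X (i + 1)) \<Longrightarrow> f (diff X (i + 1) x) = \<zero>\<^bsub>N\<^esub>) \<Longrightarrow>
      y \<in> carrier (obj Y (j + 1)) \<Longrightarrow> f (\<beta> (diff Y (j + 1) y)) = \<zero>\<^bsub>N\<^esub>"
    and wd2: "\<And>c. c \<in> lmod_hom R (obj X (i - 1)) N \<Longrightarrow>
      \<exists>g\<in>lmod_hom R (obj Y (j - 1)) N. \<forall>y\<in>carrier (obj Y j). c (diff X i (\<beta> y)) = g (diff Y j y)"
    and inj: "\<And>f g. f \<in> lmod_hom R (obj X i) N \<Longrightarrow>
      (\<And>x. x \<in> carrier (obj X (i + 1)) \<Longrightarrow> f (diff X (i + 1) x) = \<zero>\<^bsub>N\<^esub>) \<Longrightarrow>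
      g \<in> lmod_hom R (obj Y (j - 1)) N \<Longrightarrow> (\<And>y. y \<in> carrier (obj Y j) \<Longrightarrow> f (\<beta> y) = g (diff Y j y)) \<Longrightarrow>
      \<exists>c\<in>lmod_hom R (obj X (i - 1)) N. \<forall>x\<in>carrier (obj X i). f x = c (diff X i x)"
    and surj: "\<And>f. f \<in> lmod_hom R (obj Y j) N \<Longrightarrow>
      (\<And>y. y \<in> carrier (obj Y (j + 1)) \<Longrightarrow> f (diff Y (j + 1) y) = \<zero>\<^bsub>N\<^esub>) \<Longrightarrow>
      \<exists>c\<in>lmod_hom R (obj X i) N. \<exists>g\<in>lmod_hom R (obj Y (j - 1)) N.
        (\<forall>x\<in>carrier (obj X (i + 1)). c (diff X (i + 1) x) = \<zero>\<^bsub>N\<^esub>) \<and>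
        (\<forall>y\<in>carrier (obj Y j). f y = c (\<beta> y) \<oplus>\<^bsub>N\<^esub> g (diff Y j y))"
  shows "hom_cohomology R X (concentrated N) i \<cong> hom_cohomology R Y (concentrated N) j"
  unfolding hom_cohomology_def homology_def
proof (rule quotient_iso[where \<psi> = "\<lambda>f. single Y N j (\<lambda>y\<in>carrier (obj Y j). f i (\<beta> y))"])
  let ?G = "hom_cplx R X (concentrated N) (- i)" and ?H = "hom_cplx R Y (concentrated N) (- j)"
  let ?Z = "cycles (hom_cplx R X (concentrated N)) (hom_diff X (concentrated N)) (- i)"
  let ?B = "boundaries (hom_cplx R X (concentrated N)) (hom_diff X (concentrated N)) (- i)"
  let ?Z' = "cycles (hom_cplx R Y (concentrated N)) (hom_diff Y (concentrated N)) (- j)"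
  let ?B' = "boundaries (hom_cplx R Y (concentrated N)) (hom_diff Y (concentrated N)) (- j)"
  let ?\<psi> = "\<lambda>f. single Y N j (\<lambda>y\<in>carrier (obj Y j). f i (\<beta> y))"
  interpret N: abelian_group N by (rule lm_ag[OF N])
  show "comm_group ?G" "comm_group ?H" by (rule hom_group[OF X N] hom_group[OF Y N])+
  show "subgroup ?Z ?G" "subgroup ?Z' ?H" by (rule cycles_subgroup[OF X N] cycles_subgroup[OF Y N])+
  show "subgroup ?B ?G" "subgroup ?B' ?H" by (rule hom_boundaries_subgroup[OF X N] hom_boundaries_subgroup[OF Y N])+
  show "?B \<subseteq> ?Z" "?B' \<subseteq> ?Z'" by (rule boundaries_subset[OF X N] boundaries_subset[OF Y N])+
  have val: "?\<psi> f j y = f i (\<beta> y)" if "y \<in> carrier (obj Y j)" for f y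
    using that by (simp add: single_def)
  have comp: "(\<lambda>y\<in>carrier (obj Y j). f (\<beta> y)) \<in> lmod_hom R (obj Y j) N" if f: "f \<in> lmod_hom R (obj X i) N" for f
    by (rule lmod_homI)
      (auto simp: lh_closed[OF f] lh_add[OF f] lh_smult[OF f] lh_closed[OF \<beta>] lh_add[OF \<beta>] lh_smult[OF \<beta>]
        lm_add[OF cc_lm[OF Y]] left_module.smult_closed[OF cc_lm[OF Y]])
  have \<psi>c: "?\<psi> f \<in> carrier ?H" if "f \<in> carrier ?G" for f
    by (rule single_carrier[OF Y N comp[OF hom_concentrated_single(2)[OF X N that]] refl])
  show \<psi>Z: "?\<psi> f \<in> ?Z'" if "f \<in> ?Z" for f
    using that \<psi>c wd1[OF hom_concentrated_single(2)[OF X N]] lh_closed[OF cc_d'[OF Y]]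
    by (auto simp: hom_cycles[OF X N] hom_cycles[OF Y N] val)
  show "?\<psi> (f \<otimes>\<^bsub>?G\<^esub> g) = ?\<psi> f \<otimes>\<^bsub>?H\<^esub> ?\<psi> g" if "f \<in> ?Z" "g \<in> ?Z" for f g
  proof -
    have fg: "f \<in> carrier ?G" "g \<in> carrier ?G" using that by (auto simp: hom_cycles[OF X N])
    interpret H: comm_group ?H by (rule hom_group[OF Y N])
    have h: "?\<psi> f \<otimes>\<^bsub>?H\<^esub> ?\<psi> g \<in> carrier ?H" using \<psi>c fg by blast
    have "(\<lambda>y\<in>carrier (obj Y j). (f \<otimes>\<^bsub>?G\<^esub> g) i (\<beta> y)) = (?\<psi> f \<otimes>\<^bsub>?H\<^esub> ?\<psi> g) j"
      using lh_ext[OF hom_concentrated_single(2)[OF Y N h]]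
      by (intro extensionalityI[of _ "carrier (obj Y j)"])
        (auto simp: hom_mult_value[OF Y N] hom_mult_value[OF X N] lh_closed[OF \<beta>] val)
    then show ?thesis using hom_concentrated_single(1)[OF Y N h] by simp
  qed
  show "?\<psi> f \<in> ?B' \<longleftrightarrow> f \<in> ?B" if f: "f \<in> ?Z" for f
  proof -
    have fc: "f \<in> carrier ?G" and f0: "\<And>x. x \<in> carrier (obj X (i + 1)) \<Longrightarrow> f i (diff X (i + 1) x) = \<zero>\<^bsub>N\<^esub>"
      using f by (auto simp: hom_cycles[OF X N])
    note fi = hom_concentrated_single(2)[OF X N fc]
    show ?thesis
    proof
      assume "?\<psi> f \<in> ?B'"
      then obtain g where "g \<in> lmod_hom R (obj Y (j - 1)) N" "\<And>y. y \<in> carrier (obj Y j) \<Longrightarrow> f i (\<beta> y) = g (diff Y j y)"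
        unfolding hom_boundaries[OF Y N] by (auto simp: val)
      from inj[OF fi f0 this] show "f \<in> ?B" using fc by (simp add: hom_boundaries[OF X N])
    next
      assume "f \<in> ?B"
      then obtain c where c: "c \<in> lmod_hom R (obj X (i - 1)) N" "\<And>x. x \<in> carrier (obj X i) \<Longrightarrow> f i x = c (diff X i x)"
        unfolding hom_boundaries[OF X N] by blast
      from wd2[OF c(1)] show "?\<psi> f \<in> ?B'"
        using \<psi>c[OF fc] c(2) lh_closed[OF \<beta>] by (simp add: hom_boundaries[OF Y N] val)
    qed
  qed
  show "\<exists>f\<in>?Z. \<exists>b\<in>?B'. h = b \<otimes>\<^bsub>?H\<^esub> ?\<psi> f" if h: "h \<in> ?Z'" for h
  proof -
    interpret H: comm_group ?H by (rule hom_group[OF Y N])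
    have hc: "h \<in> carrier ?H" and h0: "\<And>y. y \<in> carrier (obj Y (j + 1)) \<Longrightarrow> h j (diff Y (j + 1) y) = \<zero>\<^bsub>N\<^esub>"
      using h by (auto simp: hom_cycles[OF Y N])
    from surj[OF hom_concentrated_single(2)[OF Y N hc] h0] obtain c g where
      c: "c \<in> lmod_hom R (obj X i) N" "\<And>x. x \<in> carrier (obj X (i + 1)) \<Longrightarrow> c (diff X (i + 1) x) = \<zero>\<^bsub>N\<^esub>"
      and g: "g \<in> lmod_hom R (obj Y (j - 1)) N" "\<And>y. y \<in> carrier (obj Y j) \<Longrightarrow> h j y = c (\<beta> y) \<oplus>\<^bsub>N\<^esub> g (diff Y j y)" by blast
    let ?f = "single X N i c"
    have fi: "?f i = c" by (simp add: single_def)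
    have f: "?f \<in> carrier ?G" by (rule single_carrier[OF X N c(1) refl])
    then have fZ: "?f \<in> ?Z" using c(2) by (simp add: hom_cycles[OF X N] fi)
    let ?b = "h \<otimes>\<^bsub>?H\<^esub> inv\<^bsub>?H\<^esub> (?\<psi> ?f)"
    have b: "?b \<in> carrier ?H" using hc \<psi>c[OF f] by simp
    have "?b j y = g (diff Y j y)" if y: "y \<in> carrier (obj Y j)" for y
    proof -
      have e: "c (\<beta> y) \<in> carrier N" "g (diff Y j y) \<in> carrier N"
        using y lh_closed[OF c(1)] lh_closed[OF \<beta>] lh_closed[OF g(1)] lh_closed[OF cc_d[OF Y]] by auto
      have "single Y N j (\<lambda>y\<in>carrier (obj Y j). c (\<beta> y)) j y = c (\<beta> y)" using y by (simp add: single_def)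
      then have "?b j y = (c (\<beta> y) \<oplus>\<^bsub>N\<^esub> g (diff Y j y)) \<oplus>\<^bsub>N\<^esub> \<ominus>\<^bsub>N\<^esub> c (\<beta> y)"
        using y \<psi>c[OF f] by (simp add: hom_mult_value[OF Y N] hom_inv_value[OF Y N] val g(2) fi)
      also have "\<dots> = g (diff Y j y)" using e by (simp add: N.a_comm[of "c (\<beta> y)"] N.a_assoc N.r_neg)
      finally show ?thesis .
    qed
    then have "?b \<in> ?B'" using b g(1) by (auto simp: hom_boundaries[OF Y N])
    moreover have "h = ?b \<otimes>\<^bsub>?H\<^esub> ?\<psi> ?f" using hc \<psi>c[OF f] by (simp add: H.m_assoc)
    ultimately show ?thesis using fZ by blast
  qed
qed

section \<open>The mapping cone\<close>

lemma direct_sum_simps: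
  "carrier (direct_sum A B) = carrier A \<times> carrier B" "\<zero>\<^bsub>direct_sum A B\<^esub> = (\<zero>\<^bsub>A\<^esub>, \<zero>\<^bsub>B\<^esub>)"
  "x \<oplus>\<^bsub>direct_sum A B\<^esub> y = (fst x \<oplus>\<^bsub>A\<^esub> fst y, snd x \<oplus>\<^bsub>B\<^esub> snd y)"
  "r \<odot>\<^bsub>direct_sum A B\<^esub> x = (r \<odot>\<^bsub>A\<^esub> fst x, r \<odot>\<^bsub>B\<^esub> snd x)"
  by (simp_all add: direct_sum_def)

lemma direct_sum_left_module:
  assumes A: "left_module R A" and B: "left_module R B"
  shows "left_module R (direct_sum A B)"
proof -
  interpret A: left_module R A by fact
  interpret B: left_module R B by fact
  have "abelian_group (direct_sum A B)"
  proof (rule abelian_groupI)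
    fix x assume "x \<in> carrier (direct_sum A B)"
    then show "\<exists>y\<in>carrier (direct_sum A B). y \<oplus>\<^bsub>direct_sum A B\<^esub> x = \<zero>\<^bsub>direct_sum A B\<^esub>"
      by (intro bexI[of _ "(\<ominus>\<^bsub>A\<^esub> fst x, \<ominus>\<^bsub>B\<^esub> snd x)"]) (auto simp: direct_sum_simps A.M.l_neg B.M.l_neg)
  qed (auto simp: direct_sum_simps A.M.a_ac B.M.a_ac)
  then show ?thesis
    by (intro left_module.intro left_module_axioms.intro A.R.ring_axioms)
      (auto simp: direct_sum_simps A.smult_add_left B.smult_add_left A.smult_add_right B.smult_add_right
        A.smult_mult B.smult_mult)
qed

lemma cone_simps:
  "obj (cone P G u) n = direct_sum (obj G n) (obj P (n - 1))"
  "diff (cone P G u) n = (\<lambda>z\<in>carrier (obj G n) \<times> carrier (obj P (n - 1)).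
    (diff G n (fst z) \<oplus>\<^bsub>obj G (n - 1)\<^esub> u (n - 1) (snd z), \<ominus>\<^bsub>obj P (n - 2)\<^esub> diff P (n - 1) (snd z)))"
  by (auto simp: cone_def direct_sum_simps split_beta)

lemma lmod_hom_uminus_value:
  assumes f: "f \<in> lmod_hom R A B" and AB: "left_module R A" "left_module R B" and a: "a \<in> carrier A"
  shows "f (\<ominus>\<^bsub>A\<^esub> a) = \<ominus>\<^bsub>B\<^esub> f a"
proof -
  interpret A: left_module R A by fact
  interpret B: left_module R B by fact
  have "f (\<ominus>\<^bsub>A\<^esub> a) \<oplus>\<^bsub>B\<^esub> f a = \<zero>\<^bsub>B\<^esub>"
    using lh_add[OF f, of "\<ominus>\<^bsub>A\<^esub> a" a] lh_zero[OF f lm_ag[OF AB(1)] lm_ag[OF AB(2)]] a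
    by (simp add: A.M.l_neg)
  then show ?thesis using lh_closed[OF f] a by (intro B.M.minus_equality[symmetric]) auto
qed

lemma cone_chain_complex:
  assumes P: "chain_complex R P" and G: "chain_complex R G" and u: "u \<in> chain_maps R P G"
  shows "chain_complex R (cone P G u)"
proof -
  have e: "n - 1 - 1 = n - 2" for n :: int by simp
  note c = lh_closed[OF cc_d[OF P], of _ "_ - 1", unfolded e] lh_closed[OF cc_d[OF G]] lh_closed[OF cm_hom[OF u]]
  note lmP = cc_lm[OF P] and lmG = cc_lm[OF G]
  have lm: "left_module R (obj (cone P G u) n)" for n
    unfolding cone_simps by (rule direct_sum_left_module[OF lmG lmP])
  have h: "diff (cone P G u) n \<in> lmod_hom R (obj (cone P G u) n) (obj (cone P G u) (n - 1))" for n
  proof (rule lmod_homI)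
    interpret G1: left_module R "obj G (n - 1)" by (rule lmG)
    interpret P2: left_module R "obj P (n - 2)" by (rule lmP)
    interpret G0: left_module R "obj G n" by (rule lmG)
    interpret P1: left_module R "obj P (n - 1)" by (rule lmP)
    note dP = cc_d[OF P, of "n - 1", unfolded e] and dG = cc_d[OF G, of n] and un = cm_hom[OF u, of "n - 1"]
    note cl = lh_closed[OF dP] lh_closed[OF dG] lh_closed[OF un]
    show "diff (cone P G u) n x \<in> carrier (obj (cone P G u) (n - 1))" if "x \<in> carrier (obj (cone P G u) n)" for x
      using that cl by (auto simp: cone_simps direct_sum_simps)
    show "diff (cone P G u) n (x \<oplus>\<^bsub>obj (cone P G u) n\<^esub> y) =
        diff (cone P G u) n x \<oplus>\<^bsub>obj (cone P G u) (n - 1)\<^esub> diff (cone P G u) n y"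
      if "x \<in> carrier (obj (cone P G u) n)" "y \<in> carrier (obj (cone P G u) n)" for x y
      using that cl by (auto simp: cone_simps direct_sum_simps lh_add[OF dP] lh_add[OF dG] lh_add[OF un]
          G1.M.a_ac P2.M.minus_add)
    show "diff (cone P G u) n (r \<odot>\<^bsub>obj (cone P G u) n\<^esub> x) = r \<odot>\<^bsub>obj (cone P G u) (n - 1)\<^esub> diff (cone P G u) n x"
      if "r \<in> carrier R" "x \<in> carrier (obj (cone P G u) n)" for r x
      using that cl by (auto simp: cone_simps direct_sum_simps lh_smult[OF dP] lh_smult[OF dG] lh_smult[OF un]
          G1.smult_add_right lm_smult_uminus[OF lmP])
    show "diff (cone P G u) n \<in> extensional (carrier (obj (cone P G u) n))"
      by (simp add: cone_simps direct_sum_simps)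
  qed
  have "diff (cone P G u) (n - 1) (diff (cone P G u) n z) = \<zero>\<^bsub>obj (cone P G u) (n - 2)\<^esub>"
    if z: "z \<in> carrier (obj (cone P G u) n)" for n z
  proof -
    interpret G2: left_module R "obj G (n - 2)" by (rule lmG)
    interpret P2: left_module R "obj P (n - 2)" by (rule lmP)
    interpret P3: left_module R "obj P (n - 3)" by (rule lmP)
    interpret G1: left_module R "obj G (n - 1)" by (rule lmG)
    have e3: "n - 2 - 1 = n - 3" "n - 1 - 2 = n - 3" by simp_all
    let ?x = "fst z" and ?y = "snd z"
    have xy: "?x \<in> carrier (obj G n)" "?y \<in> carrier (obj P (n - 1))" using z by (auto simp: cone_simps direct_sum_simps)
    note dP = cc_d[OF P, of "n - 1", unfolded e] and dG = cc_d[OF G, of n] and un = cm_hom[OF u, of "n - 1"]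
    note dP2 = cc_d[OF P, of "n - 2", unfolded e3] and dG1 = cc_d[OF G, of "n - 1", unfolded e] and un2 = cm_hom[OF u, of "n - 2"]
    have a: "diff G n ?x \<in> carrier (obj G (n - 1))" "u (n - 1) ?y \<in> carrier (obj G (n - 1))"
      "diff P (n - 1) ?y \<in> carrier (obj P (n - 2))"
      using xy lh_closed[OF dP] lh_closed[OF dG] lh_closed[OF un] by auto
    have b: "diff G (n - 1) (u (n - 1) ?y) = u (n - 2) (diff P (n - 1) ?y)"
      using cm_comm[OF u xy(2)] by simp
    have c: "u (n - 2) (diff P (n - 1) ?y) \<in> carrier (obj G (n - 2))" using lh_closed[OF un2 a(3)] .
    have d: "diff P (n - 2) (diff P (n - 1) ?y) = \<zero>\<^bsub>obj P (n - 3)\<^esub>" using cc_dd[OF P xy(2)] by (simp add: e)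
    have g: "diff G (n - 1) (diff G n ?x) = \<zero>\<^bsub>obj G (n - 2)\<^esub>" using cc_dd[OF G xy(1)] .
    have n0: "\<ominus>\<^bsub>obj P (n - 3)\<^esub> \<zero>\<^bsub>obj P (n - 3)\<^esub> = \<zero>\<^bsub>obj P (n - 3)\<^esub>"
      by (rule P3.M.minus_equality) auto
    have zz: "z \<in> carrier (obj G n) \<times> carrier (obj P (n - 1))" using z by (simp add: cone_simps direct_sum_simps)
    show ?thesis
      using xy a c zz by (simp add: cone_simps direct_sum_simps e e3 lh_add[OF dG1] b g lmod_hom_uminus_value[OF un2 lmP lmG] lmod_hom_uminus_value[OF dP2 lmP lmP] d n0
          G2.M.r_neg)
  qed
  then show ?thesis using lm h by (simp add: chain_complex_def)
qed

section \<open>Homomorphisms from and to direct sums, by components\<close>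

lemma hm_emb_prj: "F \<in> hm (mobj R A) Y \<Longrightarrow> F (emb A (prj A x)) = F x"
  using hm_src[of F "mobj R A" Y x] by (simp add: mobj_def)

text \<open>The direct sum is a module on \<open>'m \<times> 'm\<close> and has no coordinate in the
  ambient group of \<open>'m\<close>, so its homomorphisms enter the calculus of objects through
  their components.\<close>

lemma direct_sum_hom_components:
  fixes A B N :: "('r, 'm) module"
  assumes A: "left_module R A" and B: "left_module R B" and N: "left_module R N"
    and f: "f \<in> lmod_hom R (direct_sum A B) N"
  obtains F1 F2 where "F1 \<in> hm (mobj R A) (mobj R N)" "F2 \<in> hm (mobj R B) (mobj R N)"
    "\<And>x y. x \<in> carrier A \<Longrightarrow> y \<in> carrier B \<Longrightarrow> emb N (f (x, y)) = F1 (emb A x) + F2 (emb B y)"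
proof -
  interpret A: left_module R A by fact
  interpret B: left_module R B by fact
  note ag = lm_ag[OF A] lm_ag[OF B] lm_ag[OF N]
  let ?f1 = "\<lambda>x\<in>carrier A. f (x, \<zero>\<^bsub>B\<^esub>)" and ?f2 = "\<lambda>y\<in>carrier B. f (\<zero>\<^bsub>A\<^esub>, y)"
  have cl: "f (x, y) \<in> carrier N" if "x \<in> carrier A" "y \<in> carrier B" for x y
    using lh_closed[OF f, of "(x, y)"] that by (simp add: direct_sum_simps)
  have add: "f (x \<oplus>\<^bsub>A\<^esub> x', y \<oplus>\<^bsub>B\<^esub> y') = f (x, y) \<oplus>\<^bsub>N\<^esub> f (x', y')"
    if "x \<in> carrier A" "y \<in> carrier B" "x' \<in> carrier A" "y' \<in> carrier B" for x y x' y'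
    using lh_add[OF f, of "(x, y)" "(x', y')"] that by (simp add: direct_sum_simps)
  have smult: "f (r \<odot>\<^bsub>A\<^esub> x, r \<odot>\<^bsub>B\<^esub> y) = r \<odot>\<^bsub>N\<^esub> f (x, y)"
    if "r \<in> carrier R" "x \<in> carrier A" "y \<in> carrier B" for r x y
    using lh_smult[OF f, of r "(x, y)"] that by (simp add: direct_sum_simps)
  have "?f1 \<in> lmod_hom R A N"
    using add[of _ "\<zero>\<^bsub>B\<^esub>" _ "\<zero>\<^bsub>B\<^esub>"] smult[of _ _ "\<zero>\<^bsub>B\<^esub>"] by (intro lmod_homI) (auto simp: cl lm_smult_zero[OF B])
  moreover have "?f2 \<in> lmod_hom R B N"
    using add[of "\<zero>\<^bsub>A\<^esub>" _ "\<zero>\<^bsub>A\<^esub>"] smult[of _ "\<zero>\<^bsub>A\<^esub>"] by (intro lmod_homI) (auto simp: cl lm_smult_zero[OF A])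
  moreover have "emb N (f (x, y)) = mmap A N ?f1 (emb A x) + mmap B N ?f2 (emb B y)"
    if "x \<in> carrier A" "y \<in> carrier B" for x y
    using that add[of x "\<zero>\<^bsub>B\<^esub>" "\<zero>\<^bsub>A\<^esub>" y] by (simp add: mmap_emb ag emb_add[OF ag(3), symmetric] cl)
  ultimately show ?thesis using that[OF mmap_hm[OF A N] mmap_hm[OF B N]] by blast
qed

lemma direct_sum_hom_exists:
  fixes A B N :: "('r, 'm) module"
  assumes A: "left_module R A" and B: "left_module R B" and N: "left_module R N"
    and F: "F1 \<in> hm (mobj R A) (mobj R N)" "F2 \<in> hm (mobj R B) (mobj R N)"
  obtains f where "f \<in> lmod_hom R (direct_sum A B) N"
    "\<And>x y. x \<in> carrier A \<Longrightarrow> y \<in> carrier B \<Longrightarrow> emb N (f (x, y)) = F1 (emb A x) + F2 (emb B y)"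
proof -
  interpret A: left_module R A by fact
  interpret B: left_module R B by fact
  interpret N: left_module R N by fact
  note ag = lm_ag[OF A] lm_ag[OF B] lm_ag[OF N]
  obtain f1 where f1: "f1 \<in> lmod_hom R A N" "F1 = mmap A N f1" using hm_mmap[OF A N F(1)] .
  obtain f2 where f2: "f2 \<in> lmod_hom R B N" "F2 = mmap B N f2" using hm_mmap[OF B N F(2)] .
  note l = lh_closed[OF f1(1)] lh_closed[OF f2(1)] lh_add[OF f1(1)] lh_add[OF f2(1)]
    lh_smult[OF f1(1)] lh_smult[OF f2(1)]
  let ?f = "\<lambda>z\<in>carrier (direct_sum A B). f1 (fst z) \<oplus>\<^bsub>N\<^esub> f2 (snd z)"
  have "?f \<in> lmod_hom R (direct_sum A B) N"
    by (rule lmod_homI) (auto simp: direct_sum_simps l N.M.a_ac N.smult_add_right)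
  moreover have "emb N (?f (x, y)) = F1 (emb A x) + F2 (emb B y)" if "x \<in> carrier A" "y \<in> carrier B" for x y
    using that by (simp add: direct_sum_simps f1(2) f2(2) mmap_emb ag emb_add l)
  ultimately show ?thesis using that by blast
qed

lemma direct_sum_hom_pair:
  fixes A B X :: "('r, 'm) module"
  assumes A: "left_module R A" and B: "left_module R B" and X: "left_module R X"
    and F: "F1 \<in> hm (mobj R X) (mobj R A)" "F2 \<in> hm (mobj R X) (mobj R B)"
  obtains f where "f \<in> lmod_hom R X (direct_sum A B)"
    "\<And>x. x \<in> carrier X \<Longrightarrow> emb A (fst (f x)) = F1 (emb X x) \<and> emb B (snd (f x)) = F2 (emb X x)"
proof -
  interpret X: left_module R X by fact
  note ag = lm_ag[OF A] lm_ag[OF B] lm_ag[OF X]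
  obtain f1 where f1: "f1 \<in> lmod_hom R X A" "F1 = mmap X A f1" using hm_mmap[OF X A F(1)] .
  obtain f2 where f2: "f2 \<in> lmod_hom R X B" "F2 = mmap X B f2" using hm_mmap[OF X B F(2)] .
  note l = lh_closed[OF f1(1)] lh_closed[OF f2(1)] lh_add[OF f1(1)] lh_add[OF f2(1)]
    lh_smult[OF f1(1)] lh_smult[OF f2(1)]
  let ?f = "\<lambda>x\<in>carrier X. (f1 x, f2 x)"
  have "?f \<in> lmod_hom R X (direct_sum A B)"
    by (rule lmod_homI) (auto simp: direct_sum_simps l)
  moreover have "emb A (fst (?f x)) = F1 (emb X x) \<and> emb B (snd (?f x)) = F2 (emb X x)" if "x \<in> carrier X" for x
    using that by (simp add: f1(2) f2(2) mmap_emb ag)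
  ultimately show ?thesis using that by blast
qed

lemma cone_diff_emb:
  fixes P G :: "('r, 'm) cplx"
  assumes P: "chain_complex R P" and G: "chain_complex R G" and u: "u \<in> chain_maps R P G"
    and x: "x \<in> carrier (obj G i)" and y: "y \<in> carrier (obj P (i - 1))"
  obtains a b where "diff (cone P G u) i (x, y) = (a, b)" "a \<in> carrier (obj G (i - 1))" "b \<in> carrier (obj P (i - 1 - 1))"
    "emb (obj G (i - 1)) a = dm G i (emb (obj G i) x) + cm P G u (i - 1) (emb (obj P (i - 1)) y)"
    "emb (obj P (i - 1 - 1)) b = - dm P (i - 1) (emb (obj P (i - 1)) y)"
proof
  have e: "i - 2 = i - 1 - 1" by simp
  note cl = lh_closed[OF cc_d[OF P] y] lh_closed[OF cc_d[OF G] x] lh_closed[OF cm_hom[OF u] y]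
  let ?a = "diff G i x \<oplus>\<^bsub>obj G (i - 1)\<^esub> u (i - 1) y" and ?b = "\<ominus>\<^bsub>obj P (i - 1 - 1)\<^esub> diff P (i - 1) y"
  show "diff (cone P G u) i (x, y) = (?a, ?b)" using x y unfolding cone_simps e by simp
  show "?a \<in> carrier (obj G (i - 1))" "?b \<in> carrier (obj P (i - 1 - 1))"
    by (intro lm_add[OF cc_lm[OF G]] lm_uminus[OF cc_lm[OF P]] cl)+
  show "emb (obj G (i - 1)) ?a = dm G i (emb (obj G i) x) + cm P G u (i - 1) (emb (obj P (i - 1)) y)"
    "emb (obj P (i - 1 - 1)) ?b = - dm P (i - 1) (emb (obj P (i - 1)) y)"
    unfolding emb_add[OF cc_ag[OF G] cl(2,3)] emb_uminus[OF cc_ag[OF P] cl(1)] dm_def cm_def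
      mmap_emb[OF cc_ag[OF G] x] mmap_emb[OF cc_ag[OF P] y] by simp_all
qed

lemma cone_hom_diff:
  fixes P G :: "('r, 'm) cplx"
  assumes P: "chain_complex R P" and G: "chain_complex R G" and u: "u \<in> chain_maps R P G"
    and F: "F1 \<in> hm (ob R G (i - 1)) B" "F2 \<in> hm (ob R P (i - 1 - 1)) B"
      "\<And>x y. x \<in> carrier (obj G (i - 1)) \<Longrightarrow> y \<in> carrier (obj P (i - 1 - 1)) \<Longrightarrow>
        emb N (f (x, y)) = F1 (emb (obj G (i - 1)) x) + F2 (emb (obj P (i - 1 - 1)) y)"
    and x: "x \<in> carrier (obj G i)" and y: "y \<in> carrier (obj P (i - 1))"
  shows "emb N (f (diff (cone P G u) i (x, y))) = F1 (dm G i (emb (obj G i) x)) +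
    (F1 (cm P G u (i - 1) (emb (obj P (i - 1)) y)) - F2 (dm P (i - 1) (emb (obj P (i - 1)) y)))"
proof -
  obtain a b where ab: "diff (cone P G u) i (x, y) = (a, b)" "a \<in> carrier (obj G (i - 1))" "b \<in> carrier (obj P (i - 1 - 1))"
    "emb (obj G (i - 1)) a = dm G i (emb (obj G i) x) + cm P G u (i - 1) (emb (obj P (i - 1)) y)"
    "emb (obj P (i - 1 - 1)) b = - dm P (i - 1) (emb (obj P (i - 1)) y)"
    using cone_diff_emb[OF P G u x y] .
  show ?thesis unfolding ab(1) F(3)[OF ab(2,3)] ab(4,5) by (simp add: hm_lin[OF F(1)] hm_lin[OF F(2)])
qed

text \<open>Evaluation at \<open>(x, 0)\<close> and at \<open>(0, y)\<close> separates the cocycle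
  condition into its two components; as homomorphisms absorb the idempotents, these may be required
  on the whole ambient group.\<close>

lemma cone_hom_cycle:
  fixes P G :: "('r, 'm) cplx"
  assumes P: "chain_complex R P" and G: "chain_complex R G" and u: "u \<in> chain_maps R P G" and N: "left_module R N"
    and F: "F1 \<in> hm (ob R G i) (mobj R N)" "F2 \<in> hm (ob R P (i - 1)) (mobj R N)"
      "\<And>x y. x \<in> carrier (obj G i) \<Longrightarrow> y \<in> carrier (obj P (i - 1)) \<Longrightarrow>
        emb N (f (x, y)) = F1 (emb (obj G i) x) + F2 (emb (obj P (i - 1)) y)"
    and f: "\<And>z. z \<in> carrier (obj G i) \<times> carrier (obj P (i - 1)) \<Longrightarrow> f z \<in> carrier N"
  shows "(\<forall>z\<in>carrier (obj (cone P G u) (i + 1)). f (diff (cone P G u) (i + 1) z) = \<zero>\<^bsub>N\<^esub>) \<longleftrightarrow>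
    (\<forall>x. F1 (dm G (i + 1) x) = 0) \<and> (\<forall>y. F1 (cm P G u i y) = F2 (dm P i y))"
proof -
  note cG = cpx_ob[OF G] and cP = cpx_ob[OF P]
  let ?\<Delta> = "\<lambda>x y. f (diff (cone P G u) (i + 1) (x, y))"
  have v: "emb N (?\<Delta> x y) = F1 (dm G (i + 1) (emb (obj G (i + 1)) x)) +
      (F1 (cm P G u i (emb (obj P i) y)) - F2 (dm P i (emb (obj P i) y)))"
    if "x \<in> carrier (obj G (i + 1))" "y \<in> carrier (obj P i)" for x y
    using cone_hom_diff[OF P G u, of F1 "i + 1" "mobj R N" F2 N f x y] F that by simp
  have z: "?\<Delta> x y = \<zero>\<^bsub>N\<^esub> \<longleftrightarrow> emb N (?\<Delta> x y) = 0" if xy: "x \<in> carrier (obj G (i + 1))" "y \<in> carrier (obj P i)" for x y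
  proof -
    have "(x, y) \<in> carrier (obj (cone P G u) (i + 1))" using xy by (simp add: cone_simps direct_sum_simps)
    then have "diff (cone P G u) (i + 1) (x, y) \<in> carrier (obj (cone P G u) i)"
      by (rule lh_closed[OF cc_d'[OF cone_chain_complex[OF P G u]]])
    then show ?thesis using emb_eq_zero[OF lm_ag[OF N] f] by (simp add: cone_simps direct_sum_simps)
  qed
  have G0: "emb (obj G (i + 1)) \<zero>\<^bsub>obj G (i + 1)\<^esub> = 0" "emb (obj P i) \<zero>\<^bsub>obj P i\<^esub> = 0"
    by (rule emb_zero cc_ag[OF G] cc_ag[OF P])+
  note zc = lm_zero[OF cc_lm[OF G], of "i + 1"] lm_zero[OF cc_lm[OF P], of i]
  note h0 = hm_zero[OF F(1)] hm_zero[OF F(2)] hm_zero[OF cm_hm[OF P G u]] hm_zero[OF cpx_d[OF cG]] hm_zero[OF cpx_d[OF cP]]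
    hm_zero[OF cpx_d'[OF cG]]
  have "(\<forall>z\<in>carrier (obj (cone P G u) (i + 1)). f (diff (cone P G u) (i + 1) z) = \<zero>\<^bsub>N\<^esub>) \<longleftrightarrow>
      (\<forall>x\<in>carrier (obj G (i + 1)). \<forall>y\<in>carrier (obj P i). emb N (?\<Delta> x y) = 0)"
    using z by (auto simp: cone_simps direct_sum_simps)
  also have "\<dots> \<longleftrightarrow> (\<forall>x\<in>carrier (obj G (i + 1)). F1 (dm G (i + 1) (emb (obj G (i + 1)) x)) = 0) \<and>
      (\<forall>y\<in>carrier (obj P i). F1 (cm P G u i (emb (obj P i) y)) = F2 (dm P i (emb (obj P i) y)))"
  proof (intro iffI conjI ballI; (elim conjE)?)
    assume *: "\<forall>x\<in>carrier (obj G (i + 1)). \<forall>y\<in>carrier (obj P i). emb N (?\<Delta> x y) = 0"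
    show "F1 (dm G (i + 1) (emb (obj G (i + 1)) x)) = 0" if x: "x \<in> carrier (obj G (i + 1))" for x
      using *[rule_format, OF x zc(2)] v[OF x zc(2)] by (simp add: G0 h0)
    show "F1 (cm P G u i (emb (obj P i) y)) = F2 (dm P i (emb (obj P i) y))" if y: "y \<in> carrier (obj P i)" for y
      using *[rule_format, OF zc(1) y] v[OF zc(1) y] by (simp add: G0 h0)
  qed (simp add: v)
  also have "\<dots> \<longleftrightarrow> (\<forall>x. F1 (dm G (i + 1) x) = 0) \<and> (\<forall>y. F1 (cm P G u i y) = F2 (dm P i y))"
  proof -
    have "dm G (i + 1) x = dm G (i + 1) (emb (obj G (i + 1)) (prj (obj G (i + 1)) x))"
      "dm P i y = dm P i (emb (obj P i) (prj (obj P i) y))"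
      "cm P G u i y = cm P G u i (emb (obj P i) (prj (obj P i) y))" for x y
      by (simp_all add: dm_def cm_def mmap_def emb_prj_emb prj_closed cc_ag[OF G] cc_ag[OF P])
    then show ?thesis by (metis prj_closed cc_ag[OF G] cc_ag[OF P])
  qed
  finally show ?thesis .
qed

text \<open>The map in \<open>hom_cohomology_iso\<close> has the components \<open>b1 j\<close> and
  \<open>b2 j\<close>. Coboundaries pull back to coboundaries by the relations in degree
  \<open>j\<close>, which involve \<open>b1 (j - 1)\<close> and \<open>b2 (j - 1)\<close>; their
  existence is what \<open>n + 1 \<le> j\<close> provides.\<close>

theorem (in tate_comparison) cone_cohomology_iso:
  fixes N :: "('r, 'm) module"
  assumes um: "um \<in> chain_maps R P G" and u_eq: "\<And>i. u i = cm P G um i" and N: "left_module R N" and j: "n + 1 \<le> j"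
  shows "hom_cohomology R (cone P G um) (concentrated N) (j + 1) \<cong> hom_cohomology R T (concentrated N) j"
proof -
  note cc' = cc(2,4) and B = obj_ok_mobj[OF N]
  note lm = cc_lm[OF cc(4)] cc_lm[OF cc(2)] cc_lm[OF cc(5)]
  note agN = lm_ag[OF N]
  note hu = cone_hom_diff[OF cc' um, folded u_eq] and hc = cone_hom_cycle[OF cc' um N, folded u_eq]
  have ob: "obj (cone P G um) (j + 1) = direct_sum (obj G (j + 1)) (obj P j)"
    "obj (cone P G um) (j + 1 - 1) = direct_sum (obj G j) (obj P (j - 1))" by (simp_all add: cone_simps)
  have bj: "b1 j \<in> hm (ob R T j) (ob R G (j + 1))" "b2 j \<in> hm (ob R T j) (ob R P j)" using b j by auto
  obtain \<beta> where \<beta>: "\<beta> \<in> lmod_hom R (obj T j) (direct_sum (obj G (j + 1)) (obj P j))"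
    and \<beta>v: "\<And>t. t \<in> carrier (obj T j) \<Longrightarrow> emb (obj G (j + 1)) (fst (\<beta> t)) = b1 j (emb (obj T j) t) \<and>
      emb (obj P j) (snd (\<beta> t)) = b2 j (emb (obj T j) t)"
    using direct_sum_hom_pair[OF lm(1) lm(2) lm(3) bj[unfolded ob_def]] by blast
  have \<beta>c: "\<beta> t \<in> carrier (obj G (j + 1)) \<times> carrier (obj P j)" if "t \<in> carrier (obj T j)" for t
    using lh_closed[OF \<beta> that] by (simp add: direct_sum_simps)
  have F: thesis if f: "f \<in> lmod_hom R (obj (cone P G um) (j + 1)) N"
    and th: "\<And>F1 F2. F1 \<in> hm (ob R G (j + 1)) (mobj R N) \<Longrightarrow> F2 \<in> hm (ob R P j) (mobj R N) \<Longrightarrow>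
      (\<And>x y. x \<in> carrier (obj G (j + 1)) \<Longrightarrow> y \<in> carrier (obj P j) \<Longrightarrow>
        emb N (f (x, y)) = F1 (emb (obj G (j + 1)) x) + F2 (emb (obj P j) y)) \<Longrightarrow>
      (\<And>t. t \<in> carrier (obj T j) \<Longrightarrow> emb N (f (\<beta> t)) = F1 (b1 j (emb (obj T j) t)) + F2 (b2 j (emb (obj T j) t))) \<Longrightarrow>
      ((\<forall>z\<in>carrier (obj (cone P G um) (j + 1 + 1)). f (diff (cone P G um) (j + 1 + 1) z) = \<zero>\<^bsub>N\<^esub>) \<longleftrightarrow>
        (\<forall>x. F1 (dm G (j + 1 + 1) x) = 0) \<and> (\<forall>y. F1 (u (j + 1) y) = F2 (dm P (j + 1) y))) \<Longrightarrow> thesis" for f thesis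
  proof -
    obtain F1 F2 where F: "F1 \<in> hm (ob R G (j + 1)) (mobj R N)" "F2 \<in> hm (ob R P j) (mobj R N)"
      "\<And>x y. x \<in> carrier (obj G (j + 1)) \<Longrightarrow> y \<in> carrier (obj P j) \<Longrightarrow>
        emb N (f (x, y)) = F1 (emb (obj G (j + 1)) x) + F2 (emb (obj P j) y)"
      using direct_sum_hom_components[OF lm(1,2) N f[unfolded ob(1)]] unfolding ob_def by blast
    have fc: "f z \<in> carrier N" if "z \<in> carrier (obj G (j + 1)) \<times> carrier (obj P j)" for z
      using lh_closed[OF f] that by (simp add: ob direct_sum_simps)
    show ?thesis
    proof (rule th[OF F])
      show "emb N (f (\<beta> t)) = F1 (b1 j (emb (obj T j) t)) + F2 (b2 j (emb (obj T j) t))" if t: "t \<in> carrier (obj T j)" for t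
        using F(3)[of "fst (\<beta> t)" "snd (\<beta> t)"] \<beta>v[OF t] \<beta>c[OF t] by (simp add: mem_Times_iff)
    qed (use hc[of F1 "j + 1" F2 f] F fc in auto)
  qed
  have jj: "j + 1 - 1 = j" "j + 1 - 1 - 1 = j - 1" by simp_all
  have c_hom: "emb N (c (diff (cone P G um) (j + 1) (x, y))) = C1 (dm G (j + 1) (emb (obj G (j + 1)) x)) +
      (C1 (u j (emb (obj P j) y)) - C2 (dm P j (emb (obj P j) y)))"
    if "C1 \<in> hm (ob R G j) (mobj R N)" "C2 \<in> hm (ob R P (j - 1)) (mobj R N)"
      "\<And>x y. x \<in> carrier (obj G j) \<Longrightarrow> y \<in> carrier (obj P (j - 1)) \<Longrightarrow>
        emb N (c (x, y)) = C1 (emb (obj G j) x) + C2 (emb (obj P (j - 1)) y)"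
      "x \<in> carrier (obj G (j + 1))" "y \<in> carrier (obj P j)" for c C1 C2 x y
    using hu[of C1 "j + 1" "mobj R N" C2 N c x y, unfolded jj] that by blast
  have dT: "dm T (j + 1) (emb (obj T (j + 1)) t) = emb (obj T j) (diff T (j + 1) t)" if "t \<in> carrier (obj T (j + 1))" for t
    using that by (simp add: dm_def mmap_emb cc_ag[OF cc(5)])
  have dTj: "dm T j (emb (obj T j) t) = emb (obj T (j - 1)) (diff T j t)" if "t \<in> carrier (obj T j)" for t
    using that by (simp add: dm_def mmap_emb cc_ag[OF cc(5)])
  show ?thesis
  proof (rule hom_cohomology_iso[OF cone_chain_complex[OF cc' um] cc(5) N, of \<beta>])
    show "\<beta> \<in> lmod_hom R (obj T j) (obj (cone P G um) (j + 1))" using \<beta> by (simp add: ob)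
  next
    fix f t assume f: "f \<in> lmod_hom R (obj (cone P G um) (j + 1)) N"
      "\<And>x. x \<in> carrier (obj (cone P G um) (j + 1 + 1)) \<Longrightarrow> f (diff (cone P G um) (j + 1 + 1) x) = \<zero>\<^bsub>N\<^esub>"
      and t: "t \<in> carrier (obj T (j + 1))"
    let ?t = "diff T (j + 1) t" and ?e = "emb (obj T (j + 1)) t"
    have tc: "?t \<in> carrier (obj T j)" by (rule lh_closed[OF cc_d'[OF cc(5)] t])
    show "f (\<beta> ?t) = \<zero>\<^bsub>N\<^esub>"
    proof (rule F[OF f(1)])
      fix F1 F2
      assume F: "F1 \<in> hm (ob R G (j + 1)) (mobj R N)" "F2 \<in> hm (ob R P j) (mobj R N)"
        and v: "\<And>t. t \<in> carrier (obj T j) \<Longrightarrow> emb N (f (\<beta> t)) = F1 (b1 j (emb (obj T j) t)) + F2 (b2 j (emb (obj T j) t))"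
        and c: "((\<forall>z\<in>carrier (obj (cone P G um) (j + 1 + 1)). f (diff (cone P G um) (j + 1 + 1) z) = \<zero>\<^bsub>N\<^esub>) \<longleftrightarrow>
          (\<forall>x. F1 (dm G (j + 1 + 1) x) = 0) \<and> (\<forall>y. F1 (u (j + 1) y) = F2 (dm P (j + 1) y)))"
      have c': "F1 (dm G (j + 1 + 1) x) = 0" "F1 (u (j + 1) y) = F2 (dm P (j + 1) y)" for x y using c f(2) by auto
      have "b1 j (dm T (j + 1) ?e) = - (dm G (j + 1 + 1) (b1 (j + 1) ?e) + u (j + 1) (b2 (j + 1) ?e))"
        "b2 j (dm T (j + 1) ?e) = dm P (j + 1) (b2 (j + 1) ?e)"
        using b1d[of "j + 1" ?e] b2d[of "j + 1" ?e] j by simp_all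
      then have "emb N (f (\<beta> ?t)) = 0"
        by (simp only: v[OF tc] dT[OF t, symmetric] hm_lin[OF F(1)] c') simp
      then show ?thesis using emb_eq_zero[OF agN lh_closed[OF f(1)]] \<beta>c[OF tc] by (simp add: ob direct_sum_simps)
    qed
  next
    fix c assume c: "c \<in> lmod_hom R (obj (cone P G um) (j + 1 - 1)) N"
    obtain C1 C2 where C: "C1 \<in> hm (ob R G j) (mobj R N)" "C2 \<in> hm (ob R P (j - 1)) (mobj R N)"
      "\<And>x y. x \<in> carrier (obj G j) \<Longrightarrow> y \<in> carrier (obj P (j - 1)) \<Longrightarrow>
        emb N (c (x, y)) = C1 (emb (obj G j) x) + C2 (emb (obj P (j - 1)) y)"
      using direct_sum_hom_components[OF lm(1,2) N c[unfolded ob(2)]] unfolding ob_def by blast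
    have b': "b1 (j - 1) \<in> hm (ob R T (j - 1)) (ob R G j)" "b2 (j - 1) \<in> hm (ob R T (j - 1)) (ob R P (j - 1))"
      using b[of "j - 1"] j by auto
    \<comment> \<open>The comparison anticommutes with the differentials: \<open>b2\<close> commutes
      with those of \<open>T\<close> and \<open>P\<close>, but the cone uses the negative on
      \<open>P\<close>. Hence the minus sign in the witness.\<close>
    have "(\<lambda>t. - (C1 (b1 (j - 1) t) + C2 (b2 (j - 1) t))) \<in> hm (mobj R (obj T (j - 1))) (mobj R N)"
      unfolding ob_def[symmetric] by (intro hm_uminus hm_plus B hm_comp[OF b'(1) C(1)] hm_comp[OF b'(2) C(2)])
    then obtain g where g: "g \<in> lmod_hom R (obj T (j - 1)) N"
      "(\<lambda>t. - (C1 (b1 (j - 1) t) + C2 (b2 (j - 1) t))) = mmap (obj T (j - 1)) N g"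
      using hm_mmap[OF lm(3) N] by blast
    have "c (diff (cone P G um) (j + 1) (\<beta> t)) = g (diff T j t)" if t: "t \<in> carrier (obj T j)" for t
    proof -
      let ?e = "emb (obj T j) t"
      note tc = lh_closed[OF cc_d[OF cc(5)] t]
      have cl: "c (diff (cone P G um) (j + 1) (\<beta> t)) \<in> carrier N"
        using \<beta>c[OF t] by (intro lh_closed[OF c] lh_closed[OF cc_d[OF cone_chain_complex[OF cc' um]]]) (simp add: ob direct_sum_simps)
      have "emb N (c (diff (cone P G um) (j + 1) (\<beta> t))) =
          C1 (dm G (j + 1) (b1 j ?e)) + (C1 (u j (b2 j ?e)) - C2 (dm P j (b2 j ?e)))"
        using c_hom[OF C, of "fst (\<beta> t)" "snd (\<beta> t)"] \<beta>v[OF t] \<beta>c[OF t] by (simp add: mem_Times_iff)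
      also have "\<dots> = C1 (dm G (j + 1) (b1 j ?e) + u j (b2 j ?e)) - C2 (b2 (j - 1) (dm T j ?e))"
        using b2d[OF j] by (simp add: hm_lin[OF C(1)])
      also have "\<dots> = mmap (obj T (j - 1)) N g (dm T j ?e)"
        unfolding b1d[OF j] fun_cong[OF g(2), symmetric] by (simp add: hm_lin[OF C(1)])
      also have "\<dots> = emb N (g (diff T j t))" using tc by (simp add: dTj t mmap_emb cc_ag[OF cc(5)])
      finally show ?thesis using emb_inj[OF agN cl lh_closed[OF g(1) tc]] by simp
    qed
    then show "\<exists>g\<in>lmod_hom R (obj T (j - 1)) N. \<forall>y\<in>carrier (obj T j). c (diff (cone P G um) (j + 1) (\<beta> y)) = g (diff T j y)"
      using g(1) by blast
  next
    fix f g assume f: "f \<in> lmod_hom R (obj (cone P G um) (j + 1)) N"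
      "\<And>x. x \<in> carrier (obj (cone P G um) (j + 1 + 1)) \<Longrightarrow> f (diff (cone P G um) (j + 1 + 1) x) = \<zero>\<^bsub>N\<^esub>"
      and g: "g \<in> lmod_hom R (obj T (j - 1)) N" "\<And>y. y \<in> carrier (obj T j) \<Longrightarrow> f (\<beta> y) = g (diff T j y)"
    show "\<exists>c\<in>lmod_hom R (obj (cone P G um) (j + 1 - 1)) N.
      \<forall>x\<in>carrier (obj (cone P G um) (j + 1)). f x = c (diff (cone P G um) (j + 1) x)"
    proof (rule F[OF f(1)])
      fix F1 F2
      assume F: "F1 \<in> hm (ob R G (j + 1)) (mobj R N)" "F2 \<in> hm (ob R P j) (mobj R N)"
        "\<And>x y. x \<in> carrier (obj G (j + 1)) \<Longrightarrow> y \<in> carrier (obj P j) \<Longrightarrow>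
          emb N (f (x, y)) = F1 (emb (obj G (j + 1)) x) + F2 (emb (obj P j) y)"
        and v: "\<And>t. t \<in> carrier (obj T j) \<Longrightarrow> emb N (f (\<beta> t)) = F1 (b1 j (emb (obj T j) t)) + F2 (b2 j (emb (obj T j) t))"
        and c: "((\<forall>z\<in>carrier (obj (cone P G um) (j + 1 + 1)). f (diff (cone P G um) (j + 1 + 1) z) = \<zero>\<^bsub>N\<^esub>) \<longleftrightarrow>
          (\<forall>x. F1 (dm G (j + 1 + 1) x) = 0) \<and> (\<forall>y. F1 (u (j + 1) y) = F2 (dm P (j + 1) y)))"
      have c': "F1 (dm G (j + 1 + 1) x) = 0" "F1 (u (j + 1) y) = F2 (dm P (j + 1) y)" for x y using c f(2) by auto
      have g': "mmap (obj T (j - 1)) N g \<in> hm (ob R T (j - 1)) (mobj R N)" unfolding ob_def by (rule mmap_hm[OF lm(3) N g(1)])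
      have "F1 (b1 j t) + F2 (b2 j t) = mmap (obj T (j - 1)) N g (dm T j t)" for t
      proof -
        let ?t = "prj (obj T j) t"
        have tc: "?t \<in> carrier (obj T j)" by (rule prj_closed[OF cc_ag[OF cc(5)]])
        note e = hm_emb_prj[OF bj(1)[unfolded ob_def]] hm_emb_prj[OF bj(2)[unfolded ob_def]]
          hm_emb_prj[OF cpx_d[OF cT, unfolded ob_def]]
        have "F1 (b1 j t) + F2 (b2 j t) = emb N (f (\<beta> ?t))" by (simp add: v[OF tc] e)
        also have "\<dots> = mmap (obj T (j - 1)) N g (dm T j (emb (obj T j) ?t))"
          by (simp add: g(2)[OF tc] dTj[OF tc] mmap_emb cc_ag[OF cc(5)] lh_closed[OF cc_d[OF cc(5)] tc])
        finally show ?thesis by (simp add: e)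
      qed
      from comparison_inj[OF B j F(1,2) g' c' this] obtain C1 C2 where
        C: "C1 \<in> hm (ob R G j) (mobj R N)" "C2 \<in> hm (ob R P (j - 1)) (mobj R N)"
        and FC: "\<And>x. F1 x = C1 (dm G (j + 1) x)" "\<And>y. F2 y = C1 (u j y) - C2 (dm P j y)" by blast
      obtain c where c: "c \<in> lmod_hom R (direct_sum (obj G j) (obj P (j - 1))) N"
        "\<And>x y. x \<in> carrier (obj G j) \<Longrightarrow> y \<in> carrier (obj P (j - 1)) \<Longrightarrow>
          emb N (c (x, y)) = C1 (emb (obj G j) x) + C2 (emb (obj P (j - 1)) y)"
        using direct_sum_hom_exists[OF lm(1,2) N C[unfolded ob_def]] by blast
      have "f z = c (diff (cone P G um) (j + 1) z)" if z: "z \<in> carrier (obj (cone P G um) (j + 1))" for z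
      proof -
        obtain x y where xy: "z = (x, y)" "x \<in> carrier (obj G (j + 1))" "y \<in> carrier (obj P j)"
          using z by (auto simp: ob direct_sum_simps)
        have "c (diff (cone P G um) (j + 1) z) \<in> carrier N"
          by (rule lh_closed[OF c(1)[folded ob(2)]]) (rule lh_closed[OF cc_d[OF cone_chain_complex[OF cc' um]] z])
        moreover have "emb N (f z) = emb N (c (diff (cone P G um) (j + 1) z))"
          using c_hom[OF C c(2) xy(2,3)] F(3)[OF xy(2,3)] FC by (simp only: xy(1))
        ultimately show ?thesis using emb_inj[OF agN lh_closed[OF f(1) z]] by simp
      qed
      then show ?thesis using c(1) unfolding ob(2) by blast
    qed
  next
    fix f assume f: "f \<in> lmod_hom R (obj T j) N" "\<And>y. y \<in> carrier (obj T (j + 1)) \<Longrightarrow> f (diff T (j + 1) y) = \<zero>\<^bsub>N\<^esub>"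
    have f': "mmap (obj T j) N f \<in> hm (ob R T j) (mobj R N)" unfolding ob_def by (rule mmap_hm[OF lm(3) N f(1)])
    have f0: "mmap (obj T j) N f (dm T (j + 1) t) = 0" for t
    proof -
      let ?t = "prj (obj T (j + 1)) t"
      have tc: "?t \<in> carrier (obj T (j + 1))" by (rule prj_closed[OF cc_ag[OF cc(5)]])
      have "dm T (j + 1) t = emb (obj T j) (diff T (j + 1) ?t)" by (simp add: dm_def mmap_def)
      then show ?thesis
        using tc lh_closed[OF cc_d'[OF cc(5)] tc] by (simp add: mmap_emb cc_ag[OF cc(5)] f(2) emb_zero agN)
    qed
    have jn: "n \<le> j" using j by simp
    from comparison_surj[OF B jn f' f0] obtain C1 C2 g' where
      C: "C1 \<in> hm (ob R G (j + 1)) (mobj R N)" "C2 \<in> hm (ob R P j) (mobj R N)" and g': "g' \<in> hm (ob R T (j - 1)) (mobj R N)"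
      and Cc: "\<And>x. C1 (dm G (j + 1 + 1) x) = 0" "\<And>y. C1 (u (j + 1) y) = C2 (dm P (j + 1) y)"
      and fC: "\<And>t. mmap (obj T j) N f t = C1 (b1 j t) + C2 (b2 j t) + g' (dm T j t)" by blast
    obtain g where g: "g \<in> lmod_hom R (obj T (j - 1)) N" "g' = mmap (obj T (j - 1)) N g"
      using hm_mmap[OF lm(3) N g'[unfolded ob_def]] .
    obtain c where c: "c \<in> lmod_hom R (direct_sum (obj G (j + 1)) (obj P j)) N"
      "\<And>x y. x \<in> carrier (obj G (j + 1)) \<Longrightarrow> y \<in> carrier (obj P j) \<Longrightarrow>
        emb N (c (x, y)) = C1 (emb (obj G (j + 1)) x) + C2 (emb (obj P j) y)"
      using direct_sum_hom_exists[OF lm(1,2) N C[unfolded ob_def]] by blast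
    have cN: "c z \<in> carrier N" if "z \<in> carrier (obj G (j + 1)) \<times> carrier (obj P j)" for z
      using lh_closed[OF c(1)] that by (simp add: direct_sum_simps)
    have "\<forall>z\<in>carrier (obj (cone P G um) (j + 1 + 1)). c (diff (cone P G um) (j + 1 + 1) z) = \<zero>\<^bsub>N\<^esub>"
      using hc[of C1 "j + 1" C2 c] C c(2) cN Cc by simp
    moreover have "f t = c (\<beta> t) \<oplus>\<^bsub>N\<^esub> g (diff T j t)" if t: "t \<in> carrier (obj T j)" for t
    proof -
      note tc = lh_closed[OF cc_d[OF cc(5)] t]
      have cl: "c (\<beta> t) \<in> carrier N" "g (diff T j t) \<in> carrier N" using cN[OF \<beta>c[OF t]] lh_closed[OF g(1) tc] by auto
      have "emb N (f t) = C1 (b1 j (emb (obj T j) t)) + C2 (b2 j (emb (obj T j) t)) + g' (dm T j (emb (obj T j) t))"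
        using fC[of "emb (obj T j) t"] t by (simp add: mmap_emb lm_ag[OF lm(3)])
      also have "\<dots> = emb N (c (\<beta> t)) + emb N (g (diff T j t))"
        using c(2)[of "fst (\<beta> t)" "snd (\<beta> t)"] \<beta>v[OF t] \<beta>c[OF t] tc
        by (simp add: mem_Times_iff dTj[OF t] g(2) mmap_emb lm_ag[OF lm(3)])
      finally have "emb N (f t) = emb N (c (\<beta> t) \<oplus>\<^bsub>N\<^esub> g (diff T j t))" unfolding emb_add[OF agN cl] .
      then show ?thesis unfolding emb_inj[OF agN lh_closed[OF f(1) t] lm_add[OF N cl]] .
    qed
    ultimately show "\<exists>c\<in>lmod_hom R (obj (cone P G um) (j + 1)) N. \<exists>g\<in>lmod_hom R (obj T (j - 1)) N.
        (\<forall>x\<in>carrier (obj (cone P G um) (j + 1 + 1)). c (diff (cone P G um) (j + 1 + 1) x) = \<zero>\<^bsub>N\<^esub>) \<and>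
        (\<forall>y\<in>carrier (obj T j). f y = c (\<beta> y) \<oplus>\<^bsub>N\<^esub> g (diff T j y))"
      using c(1) g(1) unfolding ob(1) by blast
  qed
qed

section \<open>The isomorphism\<close>

lemma quasi_iso_low:
  assumes P: "chain_complex R P" and M: "chain_complex R M" and q: "quasi_iso R P M \<pi>" and z: "zero_lmodule (obj M i)"
  shows "boundaries (obj_groups P) (diff P) i = cycles (obj_groups P) (diff P) i"
proof
  show "boundaries (obj_groups P) (diff P) i \<subseteq> cycles (obj_groups P) (diff P) i"
    using lh_closed[OF cc_d'[OF P]] cc_dd'[OF P] by (auto simp: in_boundaries in_cycles)
  show "cycles (obj_groups P) (diff P) i \<subseteq> boundaries (obj_groups P) (diff P) i"
  proof
    fix x assume x: "x \<in> cycles (obj_groups P) (diff P) i"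
    have "\<pi> \<in> chain_maps R P M" using q by (simp add: quasi_iso_def)
    then have "\<pi> i x = \<zero>\<^bsub>obj M i\<^esub>"
      using lh_closed[OF cm_hom, of \<pi> R P M x i] x z by (simp add: zero_lmodule_def in_cycles)
    then have "\<pi> i x \<in> boundaries (obj_groups M) (diff M) i"
      using subgroup.one_closed[OF boundaries_subgroup[OF M, of i]] by simp
    then show "x \<in> boundaries (obj_groups P) (diff P) i" using quasi_iso_inj[OF P M q x] by blast
  qed
qed

text \<open>A cycle \<open>x\<close> in the kernel bounds some \<open>y0\<close> in
  \<open>P\<close>. The image of \<open>y0\<close> is a cycle of \<open>M\<close>, hence homologous
  to the image of a cycle \<open>z\<close>, and lifting the bounding element \<open>m\<close>
  through the surjection corrects \<open>y0 - z\<close> into the kernel.\<close>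

lemma surjective_quasi_iso_kernel_exact:
  fixes P M :: "('r, 'm) cplx"
  assumes P: "chain_complex R P" and M: "chain_complex R M" and q: "quasi_iso R P M \<pi>" and s: "surjective_map P M \<pi>"
    and x: "el (ob R P i) x" "cm P M \<pi> i x = 0" "dm P i x = 0"
  shows "\<exists>y. el (ob R P (i + 1)) y \<and> cm P M \<pi> (i + 1) y = 0 \<and> dm P (i + 1) y = x"
proof -
  have \<pi>: "\<pi> \<in> chain_maps R P M" using q by (simp add: quasi_iso_def)
  note h = cm_hm[OF P M \<pi>] and d = cm_dm[OF P M \<pi>]
  note cP = cpx_ob[OF P] and cM = cpx_ob[OF M]
  have "cm P M \<pi> i x = dm M (i + 1) 0" using x(2) hm_zero[OF cpx_d'[OF cM]] by simp
  from quasi_iso_ob_inj[OF P M q x(1,3) this] obtain y0 where y0: "el (ob R P (i + 1)) y0" "dm P (i + 1) y0 = x" by blast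
  have "dm M (i + 1) (cm P M \<pi> (i + 1) y0) = 0" using d[of "i + 1" y0] y0(2) x(2) by simp
  from quasi_iso_ob_surj[OF P M q hm_el[OF h] this] obtain z m where
    z: "el (ob R P (i + 1)) z" "dm P (i + 1) z = 0" and m: "el (ob R M (i + 1 + 1)) m"
    and zm: "cm P M \<pi> (i + 1) y0 = cm P M \<pi> (i + 1) z + dm M (i + 1 + 1) m" by blast
  obtain m' where m': "cm P M \<pi> (i + 1 + 1) m' = m" using cm_surj[OF P M s m] by blast
  let ?y = "y0 - z - dm P (i + 1 + 1) m'"
  have "el (ob R P (i + 1)) ?y" by (intro el_diff cpx_ok[OF cP] y0 z hm_el[OF cpx_d'[OF cP]])
  moreover have "cm P M \<pi> (i + 1) ?y = 0"
    using d[of "i + 1 + 1" m', unfolded m'] by (simp add: hm_lin[OF h] zm add.commute[of 1])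
  moreover have "dm P (i + 1) ?y = x"
    using cpx_dd'[OF cP, of "i + 1" m'] by (simp add: hm_lin[OF cpx_d'[OF cP]] y0 z)
  ultimately show ?thesis by blast
qed

text \<open>Both maps to \<open>M\<close> have exact kernels. Lift \<open>\<phi> x\<close> to an
  element \<open>r\<close> of \<open>P\<close>; exactness of the kernel of \<open>\<pi>\<close>
  changes \<open>r\<close> to \<open>r - k\<close> with boundary \<open>- y\<close>, and then
  \<open>x - u (r - k)\<close> is a cycle in the kernel of \<open>\<phi>\<close>.\<close>

lemma cone_exact_at:
  fixes P G M :: "('r, 'm) cplx"
  assumes P: "chain_complex R P" and M: "chain_complex R M" and G: "chain_complex R G"
    and q: "quasi_iso R P M \<pi>" and s: "surjective_map P M \<pi>"
    and \<phi>: "\<phi> \<in> chain_maps R G M" and L: "finite_projective_dimension R (ker_cplx G M \<phi>)"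
    and u: "u \<in> chain_maps R P G" and \<phi>u: "\<And>i x. cm G M \<phi> i (cm P G u i x) = cm P M \<pi> i x"
    and x: "el (ob R G i) x" and y: "el (ob R P (i - 1)) y" "dm P (i - 1) y = 0" and xy: "dm G i x + cm P G u (i - 1) y = 0"
  shows "\<exists>x' y'. el (ob R G (i + 1)) x' \<and> el (ob R P i) y' \<and> dm G (i + 1) x' + cm P G u i y' = x \<and> - dm P i y' = y"
proof -
  have \<pi>: "\<pi> \<in> chain_maps R P M" using q by (simp add: quasi_iso_def)
  note h = cm_hm[OF P M \<pi>] cm_hm[OF P G u] cm_hm[OF G M \<phi>]
  note cP = cpx_ob[OF P] and cM = cpx_ob[OF M] and cG = cpx_ob[OF G]
  note l = hm_lin[OF h(1)] hm_lin[OF h(2)] hm_lin[OF h(3)] hm_lin[OF cpx_d[OF cP]] hm_lin[OF cpx_d[OF cG]]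
  obtain r where r: "el (ob R P i) r" "cm P M \<pi> i r = cm G M \<phi> i x"
    using cm_surj[OF P M s hm_el[OF h(3)]] by blast
  let ?z = "y + dm P i r"
  have "cm P M \<pi> (i - 1) y = - cm G M \<phi> (i - 1) (dm G i x)"
    using arg_cong[OF xy, of "cm G M \<phi> (i - 1)"] by (simp add: l \<phi>u eq_neg_iff_add_eq_0 add.commute)
  then have "cm P M \<pi> (i - 1) ?z = 0"
    using cm_dm[OF G M \<phi>, of i x] cm_dm[OF P M \<pi>, of i r] by (simp add: l r(2))
  moreover have "el (ob R P (i - 1)) ?z" by (intro el_add cpx_ok[OF cP] y hm_el[OF cpx_d[OF cP]])
  moreover have "dm P (i - 1) ?z = 0" by (simp add: l y cpx_dd[OF cP])
  ultimately obtain k where k: "el (ob R P i) k" "cm P M \<pi> i k = 0" "dm P i k = ?z"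
    using surjective_quasi_iso_kernel_exact[OF P M q s, of "i - 1" ?z] by auto
  let ?y = "r - k"
  have y': "- dm P i ?y = y" by (simp add: l k)
  have "cm G M \<phi> i (x - cm P G u i ?y) = 0" by (simp add: l \<phi>u k r)
  moreover have "dm G i (x - cm P G u i ?y) = 0"
    using xy cm_dm[OF P G u, of i ?y] y' by (simp add: l k)
  moreover have "el (ob R G i) (x - cm P G u i ?y)" by (intro el_diff cpx_ok[OF cG] x hm_el[OF h(2)])
  ultimately obtain x' where "el (ob R G (i + 1)) x'" "dm G (i + 1) x' = x - cm P G u i ?y"
    using ker_cplx_exact[OF G M \<phi> L] by blast
  moreover have "el (ob R P i) ?y" by (intro el_diff cpx_ok[OF cP] r k)
  ultimately show ?thesis using y' by (intro exI[of _ x'] exI[of _ ?y]) simp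
qed

lemma comp_map_cm:
  fixes P G M :: "('r, 'm) cplx"
  assumes P: "chain_complex R P" and G: "chain_complex R G" and u: "u \<in> chain_maps R P G" and e: "comp_map P \<phi> u = \<pi>"
  shows "cm G M \<phi> i (cm P G u i x) = cm P M \<pi> i x"
proof -
  have "mmap (obj P i) (obj M i) (\<lambda>x. \<phi> i (u i x)) = mmap (obj P i) (obj M i) (\<pi> i)"
    unfolding e[symmetric] by (rule mmap_cong) (auto simp: comp_map_def compose_def cc_ag[OF P])
  then show ?thesis
    by (simp add: cm_def mmap_mmap cc_ag[OF P] cc_ag[OF G] lh_closed[OF cm_hom[OF u]])
qed

theorem proposition12:
  fixes R :: "('r, 'x) ring_scheme"
    and M P G P' T :: "('r, 'm) cplx"
    and N :: "('r, 'm) module"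
    and \<pi> \<phi> u \<pi>' v :: "int \<Rightarrow> 'm \<Rightarrow> 'm"
    and n :: nat and j :: int
  assumes "infinite (UNIV :: 'm set)" and "carrier R \<lesssim> (UNIV :: 'm set)"
    and "gorenstein_ring TYPE('m) R"
    and "chain_complex R M"
    and "\<And>i. i < 0 \<or> int n < i \<Longrightarrow> zero_lmodule (obj M i)"
    and "left_module R N"
    and "generalized_tate_data R M P \<pi> G \<phi> u"
    and "complete_resolution R M T v P' \<pi>'"
    and "int n < j"
  shows "generalized_tate_ext R P G u N j \<cong> tate_ext R T N j"
proof -
  note inf = assms(1) and M = assms(4) and zero = assms(5)
  have dP: "dg_projective R P" and q: "quasi_iso R P M \<pi>" and s: "surjective_map P M \<pi>"
    and gor: "gorenstein_projective R G" and \<phi>: "\<phi> \<in> chain_maps R G M"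
    and L: "finite_projective_dimension R (ker_cplx G M \<phi>)" and u: "u \<in> chain_maps R P G" and eq: "comp_map P \<phi> u = \<pi>"
    using assms(7) by (auto simp: generalized_tate_data_def dg_projective_resolution_def
        special_gorenstein_projective_precover_def gorenstein_projective_precover_def)
  obtain k where dP': "dg_projective R P'" and q': "quasi_iso R P' M \<pi>'" and T: "totally_acyclic R T"
    and v: "v \<in> chain_maps R T P'" and k: "\<And>i. k \<le> i \<Longrightarrow> bij_betw (v i) (carrier (obj T i)) (carrier (obj P' i))"
    using assms(8) by (auto simp: complete_resolution_def dg_projective_resolution_def)
  have P: "chain_complex R P" "\<And>i. projective_lmodule R (obj P i)" using dP by (auto simp: dg_projective_def)
  have P': "chain_complex R P'" "\<And>i. projective_lmodule R (obj P' i)" using dP' by (auto simp: dg_projective_def)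
  have G: "chain_complex R G" using gor by (simp add: gorenstein_projective_def)
  have TC: "chain_complex R T" and Tp: "\<And>i. projective_lmodule R (obj T i)"
    using T by (auto simp: totally_acyclic_def exact_complex_def)
  have \<pi>: "\<pi> \<in> chain_maps R P M" and \<pi>': "\<pi>' \<in> chain_maps R P' M" using q q' by (simp_all add: quasi_iso_def)
  note Gp = gorenstein_precover_facts(1)[OF gor M \<phi> L zero]
  obtain K0 where K0: "\<And>i. i \<le> - 2 \<or> K0 \<le> i \<Longrightarrow> \<exists>h. cycle_section (ob R G) (dm G) i h"
    using gorenstein_precover_facts(2)[OF gor M \<phi> L zero] by blast
  note \<phi>u = comp_map_cm[OF P(1) G u eq, of M]
  have secP: "\<exists>h. cycle_section (ob R P) (dm P) i h" "\<exists>h. cycle_section (ob R P') (dm P') i h" if "i \<le> - 2" for i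
    using dg_projective_section[OF dP that quasi_iso_low[OF P(1) M q zero]]
      dg_projective_section[OF dP' that quasi_iso_low[OF P'(1) M q' zero]] by auto
  obtain Q :: "nat \<Rightarrow> ('r, 'm) cplx" and \<beta> \<epsilon> \<iota> where
    Q': "\<forall>m. projective_cplx R (Q m)"
    "\<forall>m i. \<beta> m i \<in> hm (ob R (Q (Suc m)) i) (ob R (Q m) i)"
    "\<forall>m i x. \<beta> m i (\<beta> (Suc m) i x) = 0"
    "\<forall>m i x. dm (Q m) i (\<beta> m i x) = \<beta> m (i - 1) (dm (Q (Suc m)) i x)"
    "\<forall>m i x. el (ob R (Q (Suc m)) i) x \<longrightarrow> \<beta> m i x = 0 \<longrightarrow> (\<exists>y. \<beta> (Suc m) i y = x)"
    "\<forall>m i (A :: ('r, 'm) module) f. projective_lmodule R A \<longrightarrow> f \<in> hm (ob R (Q (Suc m)) i) (mobj R A) \<longrightarrow>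
      (\<forall>x. f (\<beta> (Suc m) i x) = 0) \<longrightarrow> (\<exists>g\<in>hm (ob R (Q m) i) (mobj R A). \<forall>x. f x = g (\<beta> m i x))"
    "\<forall>i. \<epsilon> i \<in> hm (ob R (Q (Suc 0)) i) (ob R G i)"
    "\<forall>i x. dm G i (\<epsilon> i x) = \<epsilon> (i - 1) (dm (Q (Suc 0)) i x)"
    "\<forall>i x. el (ob R G i) x \<longrightarrow> (\<exists>y. \<epsilon> i y = x)"
    "\<forall>i x. \<epsilon> i x = 0 \<longleftrightarrow> \<beta> 0 i x = 0"
    "\<forall>i. \<iota> i \<in> hm (ob R G i) (ob R (Q 0) i)"
    "\<forall>i x. \<iota> i (\<epsilon> i x) = \<beta> 0 i x"
    using gorenstein_resolution[OF gor] .
  note Q = Q'[rule_format]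
  \<comment> \<open>In degree \<open>- 2\<close> both \<open>G\<close> and, one degree lower,
    \<open>P\<close> have the required sections, and \<open>G\<close> is projective there. The
    resulting exactness of \<open>Hom(C, A)\<close> holds in all degrees from \<open>0\<close> on,
    in particular from \<open>n + 2\<close> on.\<close>
  interpret cs: cone_setup R P G "cm P G u" Q \<beta> \<epsilon> \<iota> "- 2"
    by unfold_locales (fact inf P G Q cm_hm[OF P(1) G u] cm_dm[OF P(1) G u] | rule Q; blast |
      rule cone_exact_at[OF P(1) M G q s \<phi> L u \<phi>u]; assumption | (rule Gp K0 secP; simp))+
  \<comment> \<open>High enough for the splitting of \<open>G\<close> (from \<open>K0\<close>) and
    the bijectivity of \<open>v\<close> (from \<open>k\<close>), and not below \<open>n\<close>, to
    which the descents lead.\<close>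
  let ?K = "max (int n) (max K0 k)"
  interpret c: comparison R M P P' G T "cm P M \<pi>" "cm P' M \<pi>'" "cm P G u" "cm T P' v" "int n" ?K
  proof unfold_locales
    show "\<exists>y. cm P M \<pi> i y = x" if "el (ob R M i) x" for i x using cm_surj[OF P(1) M s that] by blast
    show "\<exists>y. el (ob R P (i + 1)) y \<and> cm P M \<pi> (i + 1) y = 0 \<and> dm P (i + 1) y = x"
      if "el (ob R P i) x" "cm P M \<pi> i x = 0" "dm P i x = 0" for i x
      by (rule surjective_quasi_iso_kernel_exact[OF P(1) M q s that])
    show "x = 0" if "i < 0" "el (ob R M i) x" for i x
      using zero_el[OF cc_lm[OF M] zero, of i x] that by (simp add: ob_def)
    show "\<exists>y. el (ob R T i) y \<and> cm T P' v i y = x" if t: "?K \<le> i" "el (ob R P' i) x" for i x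
    proof -
      obtain a where a: "a \<in> carrier (obj P' i)" "x = emb (obj P' i) a"
        using elE[OF t(2)[unfolded ob_def] cc_ag[OF P'(1)]] .
      then obtain b where "b \<in> carrier (obj T i)" "a = v i b" using k[of i] t(1) by (auto simp: bij_betw_def)
      then show ?thesis using a
        by (intro exI[of _ "emb (obj T i) b"]) (simp add: ob_def cm_def el_emb mmap_emb cc_ag[OF TC])
    qed
    show "x = 0" if t: "?K \<le> i" "el (ob R T i) x" "cm T P' v i x = 0" for i x
    proof -
      obtain a where a: "a \<in> carrier (obj T i)" "x = emb (obj T i) a"
        using elE[OF t(2)[unfolded ob_def] cc_ag[OF TC]] .
      have "v i a = \<zero>\<^bsub>obj P' i\<^esub>"
        using mmap_eq_zeroD[where f="v i", OF cc_ag[OF TC] cc_ag[OF P'(1)] a(1) lh_closed[OF cm_hom[OF v] a(1)]] t(3) a(2)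
        by (simp add: cm_def)
      also have "\<dots> = v i \<zero>\<^bsub>obj T i\<^esub>" by (rule lh_zero[OF cm_hom[OF v] cc_ag[OF TC] cc_ag[OF P'(1)], symmetric])
      finally have "a = \<zero>\<^bsub>obj T i\<^esub>"
        using k[of i] t(1) a(1) lm_zero[OF cc_lm[OF TC]] by (auto simp: bij_betw_def inj_on_def)
      then show ?thesis using a(2) emb_zero[OF cc_ag[OF TC]] by simp
    qed
    show "\<exists>c1\<in>hm (ob R G (i - 1)) (mobj R A). \<exists>c2\<in>hm (ob R P (i - 1 - 1)) (mobj R A).
        (\<forall>x. a1 x = c1 (dm G i x)) \<and> (\<forall>y. a2 y = c1 (cm P G u (i - 1) y) - c2 (dm P (i - 1) y))"
      if "projective_lmodule R A" "int n + 2 \<le> i" "a1 \<in> hm (ob R G i) (mobj R A)" "a2 \<in> hm (ob R P (i - 1)) (mobj R A)"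
        "\<And>x. a1 (dm G (i + 1) x) = 0" "\<And>y. a1 (cm P G u i y) = a2 (dm P i y)"
      for A :: "('r, 'm) module" and a1 a2 i
      using cs.cone_hom_exact[OF that(1,3-6)] that(2) by simp
  qed (fact inf M P P' G TC Tp cm_hm[OF P(1) M \<pi>] cm_dm[OF P(1) M \<pi>] cm_hm[OF P'(1) M \<pi>'] cm_dm[OF P'(1) M \<pi>']
      cm_hm[OF P(1) G u] cm_dm[OF P(1) G u] cm_hm[OF TC P'(1) v] cm_dm[OF TC P'(1) v]
    | rule quasi_iso_ob_inj[OF P'(1) M q'] quasi_iso_ob_surj[OF P'(1) M q'] secP totally_acyclic_hom_exact[OF T]; assumption
    | (rule Gp K0; simp) | simp)+
  obtain w where w: "\<forall>i. w i \<in> hm (ob R P' i) (ob R P i)" "\<forall>i x. dm P i (w i x) = w (i - 1) (dm P' i x)"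
    "\<forall>i x. cm P M \<pi> i (w i x) = cm P' M \<pi>' i x" "\<forall>i x. i < 0 \<longrightarrow> w i x = 0"
    using c.comparison_map .
  note w' = w[rule_format]
  obtain b1 b2 where b: "\<forall>i. int n \<le> i \<longrightarrow> b1 i \<in> hm (ob R T i) (ob R G (i + 1)) \<and> b2 i \<in> hm (ob R T i) (ob R P i)"
    "\<forall>i t. int n + 1 \<le> i \<longrightarrow> dm G (i + 1) (b1 i t) + cm P G u i (b2 i t) = - b1 (i - 1) (dm T i t) \<and>
      dm P i (b2 i t) = b2 (i - 1) (dm T i t)" "\<forall>i t. ?K + 2 \<le> i \<longrightarrow> b2 i t = w i (cm T P' v i t)"
    using c.tate_map[OF w'(1,2)] by blast
  interpret t: tate_comparison R M P P' G T "cm P M \<pi>" "cm P' M \<pi>'" "cm P G u" "cm T P' v" "int n" ?K w b1 b2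
    by unfold_locales (use w b in blast)+
  show ?thesis
    unfolding generalized_tate_ext_def tate_ext_def
    by (rule t.cone_cohomology_iso[OF u refl assms(6)]) (use assms(9) in simp)
qed

end
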